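(* For each choice of scalar field ($\mathbb R$ or $\mathbb C$), there exists an infinite-dimensional separable reflexive Banach space $X$ over that field such that: (i) Every power-bounded operator on $X$ is almost periodic. (ii) Every weakly mixing power-bounded operator on $X$ is stable. (iii) Every power-bounded operator on $X^*$ is almost periodic. (iv) Every weakly mixing power-bounded operator on $X^*$ is stable.
   Context: Operators are bounded linear operators from a Banach space to itself; $X^*$ is the (continuous) dual of $X$. An operator $T$ is power-bounded if $\sup_{n\ge 0}\|T^n\|<\infty$. An operator $T$ on a Banach space $Y$ is almost periodic if for every $y\in Y$ the orbit $\{T^n y\}_{n\ge 0}$ is conditionally compact, i.e. has compact closure in the norm topology. By the mean ergodic theorem, for a power-bounded operator $T$ on a reflexive Banach space $Y$ the limit $Ey:=\lim_{n\to\infty}\frac1n\sum_{k=1}^n T^k y$ exists in norm for every $y\in Y$, and $E$ is a bounded projection onto the fixed space of $T$. Such a $T$ is weakly mixing if $\lim_{n\to\infty}\frac1n\sum_{k=1}^n|\langle y^*,T^k(y-Ey)\rangle|=0$ for every $y\in Y$ and every $y^*\in Y^*$, and it is stable if $\|T^n y-Ey\|\to 0$ for every $y\in Y$. *)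

theory Defs
  imports "HOL-Analysis.Analysis" "HOL-Library.Function_Algebras"
begin

text \<open>
  Since HOL cannot quantify existentially over types, a normed space is given by an explicit
  carrier inside an ambient vector space, with a scalar multiplication over the field
  \<open>'k\<close> (below only \<open>real\<close> or \<open>complex\<close>) and a norm; addition is that of
  the ambient type. Only values on the carrier matter. The ambient type
  \<open>nat \<Rightarrow> 'k\<close> loses no generality for separable Banach spaces: their
  algebraic dimension is at most that of \<open>nat \<Rightarrow> 'k\<close>.
\<close>

record ('k, 'a) nspace =
  carr :: "'a set"
  scal :: "'k \<Rightarrow> 'a \<Rightarrow> 'a"
  nrm :: "'a \<Rightarrow> real"

definition normed_space :: "('k::real_normed_field, 'a::ab_group_add) nspace \<Rightarrow> bool" where
  "normed_space X \<longleftrightarrow>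
     vector_space (scal X) \<and> module.subspace (scal X) (carr X) \<and>
     (\<forall>x\<in>carr X. nrm X x = 0 \<longleftrightarrow> x = 0) \<and>
     (\<forall>c. \<forall>x\<in>carr X. nrm X (scal X c x) = norm c * nrm X x) \<and>
     (\<forall>x\<in>carr X. \<forall>y\<in>carr X. nrm X (x + y) \<le> nrm X x + nrm X y)"

text \<open>The value off the carrier is irrelevant; it is fixed to \<open>0\<close> because the locale
  \<open>Metric_space\<close> asks for nonnegativity and symmetry on the whole type.\<close>

definition ndist :: "('k, 'a::ab_group_add) nspace \<Rightarrow> 'a \<Rightarrow> 'a \<Rightarrow> real" where
  "ndist X x y = (if x \<in> carr X \<and> y \<in> carr X then nrm X (x - y) else 0)"

definition ntop :: "('k, 'a::ab_group_add) nspace \<Rightarrow> 'a topology" where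
  "ntop X = Metric_space.mtopology (carr X) (ndist X)"

definition banach_space :: "('k::real_normed_field, 'a::ab_group_add) nspace \<Rightarrow> bool" where
  "banach_space X \<longleftrightarrow> normed_space X \<and> Metric_space.mcomplete (carr X) (ndist X)"

definition finite_dimensional :: "('k::real_normed_field, 'a::ab_group_add) nspace \<Rightarrow> bool" where
  "finite_dimensional X \<longleftrightarrow>
     (\<exists>B. finite B \<and> B \<subseteq> carr X \<and> module.span (scal X) B = carr X)"

text \<open>Functionals are extended by \<open>0\<close> off the carrier, so that distinct elements of the
  dual are distinct functionals on the carrier and pointwise operations apply.\<close>

definition dual :: "('k::real_normed_field, 'a::ab_group_add) nspace \<Rightarrow> ('k, 'a \<Rightarrow> 'k) nspace" where
  "dual X = \<lparr>
     carr = {f. (\<forall>x\<in>carr X. \<forall>y\<in>carr X. f (x + y) = f x + f y) \<and>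
                (\<forall>c. \<forall>x\<in>carr X. f (scal X c x) = c * f x) \<and>
                (\<exists>C. \<forall>x\<in>carr X. norm (f x) \<le> C * nrm X x) \<and>
                (\<forall>x. x \<notin> carr X \<longrightarrow> f x = 0)},
     scal = (\<lambda>c f x. c * f x),
     nrm = (\<lambda>f. Sup {norm (f x) |x. x \<in> carr X \<and> nrm X x \<le> 1}) \<rparr>"

definition canonical_embedding ::
  "('k::real_normed_field, 'a::ab_group_add) nspace \<Rightarrow> 'a \<Rightarrow> (('a \<Rightarrow> 'k) \<Rightarrow> 'k)" where
  "canonical_embedding X x = (\<lambda>f. if f \<in> carr (dual X) then f x else 0)"

definition reflexive :: "('k::real_normed_field, 'a::ab_group_add) nspace \<Rightarrow> bool" where
  "reflexive X \<longleftrightarrow> canonical_embedding X ` carr X = carr (dual (dual X))"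

definition bounded_operator ::
  "('k::real_normed_field, 'a::ab_group_add) nspace \<Rightarrow> ('a \<Rightarrow> 'a) \<Rightarrow> bool" where
  "bounded_operator X T \<longleftrightarrow>
     (\<forall>x\<in>carr X. T x \<in> carr X) \<and>
     (\<forall>x\<in>carr X. \<forall>y\<in>carr X. T (x + y) = T x + T y) \<and>
     (\<forall>c. \<forall>x\<in>carr X. T (scal X c x) = scal X c (T x)) \<and>
     (\<exists>C. \<forall>x\<in>carr X. nrm X (T x) \<le> C * nrm X x)"

definition operator_norm :: "('k, 'a::ab_group_add) nspace \<Rightarrow> ('a \<Rightarrow> 'a) \<Rightarrow> real" where
  "operator_norm X T = Sup {nrm X (T x) |x. x \<in> carr X \<and> nrm X x \<le> 1}"

definition power_bounded ::
  "('k::real_normed_field, 'a::ab_group_add) nspace \<Rightarrow> ('a \<Rightarrow> 'a) \<Rightarrow> bool" where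
  "power_bounded X T \<longleftrightarrow>
     bounded_operator X T \<and> bdd_above (range (\<lambda>n::nat. operator_norm X (T ^^ n)))"

definition almost_periodic :: "('k, 'a::ab_group_add) nspace \<Rightarrow> ('a \<Rightarrow> 'a) \<Rightarrow> bool" where
  "almost_periodic X T \<longleftrightarrow>
     (\<forall>x\<in>carr X. compactin (ntop X) (ntop X closure_of range (\<lambda>n::nat. (T ^^ n) x)))"

text \<open>The limit is taken in the norm topology; for power-bounded operators on reflexive Banach
  spaces it exists by the mean ergodic theorem, and it is unique.\<close>

definition ergodic_limit ::
  "('k::real_normed_field, 'a::ab_group_add) nspace \<Rightarrow> ('a \<Rightarrow> 'a) \<Rightarrow> 'a \<Rightarrow> 'a" where
  "ergodic_limit X T x =
     (THE z. limitin (ntop X) (\<lambda>n. scal X (1 / of_nat n) (\<Sum>k=1..n. (T ^^ k) x)) z sequentially)"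

definition weakly_mixing ::
  "('k::real_normed_field, 'a::ab_group_add) nspace \<Rightarrow> ('a \<Rightarrow> 'a) \<Rightarrow> bool" where
  "weakly_mixing X T \<longleftrightarrow>
     (\<forall>x\<in>carr X. \<forall>f\<in>carr (dual X).
        (\<lambda>n. 1 / real n * (\<Sum>k=1..n. norm (f ((T ^^ k) (x - ergodic_limit X T x)))))
          \<longlonglongrightarrow> 0)"

definition stable_operator ::
  "('k::real_normed_field, 'a::ab_group_add) nspace \<Rightarrow> ('a \<Rightarrow> 'a) \<Rightarrow> bool" where
  "stable_operator X T \<longleftrightarrow>
     (\<forall>x\<in>carr X. (\<lambda>n. nrm X ((T ^^ n) x - ergodic_limit X T x)) \<longlonglongrightarrow> 0)"

lemma normed_space_nonneg:
  assumes "normed_space X" "x \<in> carr X"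
  shows "0 \<le> nrm X x"
proof -
  interpret vector_space "scal X" using assms(1) by (simp add: normed_space_def)
  have sub: "subspace (carr X)" using assms(1) by (simp add: normed_space_def)
  have m: "scal X (-1) x \<in> carr X" using sub assms(2) by (rule subspace_scale)
  have "nrm X (x + scal X (-1) x) \<le> nrm X x + nrm X (scal X (-1) x)"
    using assms m unfolding normed_space_def by meson
  moreover have "nrm X (scal X (-1) x) = nrm X x"
    using assms by (simp add: normed_space_def del: scale_minus_left)
  moreover have "nrm X (x + scal X (-1) x) = 0"
    using assms(1) subspace_0[OF sub] unfolding normed_space_def by (metis add.right_inverse scale_minus_left scale_one)
  ultimately show ?thesis by linarith
qed

lemma normed_space_Metric_space:
  assumes "normed_space X"
  shows "Metric_space (carr X) (ndist X)"
proof -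
  interpret vector_space "scal X" using assms by (simp add: normed_space_def)
  have sub: "subspace (carr X)" using assms by (simp add: normed_space_def)
  have tri: "nrm X (x + y) \<le> nrm X x + nrm X y" if "x \<in> carr X" "y \<in> carr X" for x y
    using assms that unfolding normed_space_def by meson
  have comm: "nrm X (x - y) = nrm X (y - x)" if "x \<in> carr X" "y \<in> carr X" for x y
  proof -
    have "nrm X (scal X (-1) (x - y)) = nrm X (x - y)"
      using assms subspace_diff[OF sub that]
      by (simp add: normed_space_def del: scale_minus_left)
    then show ?thesis by simp
  qed
  show ?thesis
  proof
    show "0 \<le> ndist X x y" for x y
      using normed_space_nonneg[OF assms] subspace_diff[OF sub] by (simp add: ndist_def)
    show "ndist X x y = ndist X y x" for x y
      using comm by (simp add: ndist_def)
    show "ndist X x y = 0 \<longleftrightarrow> x = y" if "x \<in> carr X" "y \<in> carr X" for x y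
      using assms that subspace_diff[OF sub that] by (simp add: ndist_def normed_space_def)
    show "ndist X x z \<le> ndist X x y + ndist X y z"
      if "x \<in> carr X" "y \<in> carr X" "z \<in> carr X" for x y z
    proof -
      have "nrm X ((x - y) + (y - z)) \<le> nrm X (x - y) + nrm X (y - z)"
        using tri[OF subspace_diff[OF sub that(1,2)] subspace_diff[OF sub that(2,3)]] .
      then show ?thesis using that by (simp add: ndist_def)
    qed
  qed
qed

lemma normed_space_dual:
  fixes X :: "('k::real_normed_field, 'a::ab_group_add) nspace"
  assumes X: "normed_space X"
  shows "normed_space (dual X)"
proof -
  interpret X: vector_space "scal X" using X by (simp add: normed_space_def)
  have sub: "X.subspace (carr X)" using X by (simp add: normed_space_def)
  interpret D: vector_space "scal (dual X)"
    by standard (auto simp: dual_def fun_eq_iff algebra_simps)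
  let ?B = "{x \<in> carr X. nrm X x \<le> 1}"
  have z: "0 \<in> ?B"
  proof -
    have "nrm X 0 = 0" using X X.subspace_0[OF sub] unfolding normed_space_def by blast
    then show ?thesis using X.subspace_0[OF sub] by simp
  qed
  have nrm: "nrm (dual X) f = (SUP x\<in>?B. norm (f x))" for f
    unfolding dual_def by (simp add: image_def) (rule arg_cong[where f = Sup], auto)
  have bound: "\<exists>C. \<forall>x\<in>carr X. norm (f x) \<le> C * nrm X x" if "f \<in> carr (dual X)" for f
    using that by (simp add: dual_def)
  have hom: "f (scal X c x) = c * f x" if "f \<in> carr (dual X)" "x \<in> carr X" for f c x
    using that by (simp add: dual_def)
  have bd: "bdd_above ((\<lambda>x. norm (f x)) ` ?B)" if f: "f \<in> carr (dual X)" for f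
  proof -
    obtain C where C: "\<And>x. x \<in> carr X \<Longrightarrow> norm (f x) \<le> C * nrm X x"
      using bound[OF f] by blast
    have "norm (f x) \<le> max C 0" if x: "x \<in> ?B" for x
    proof -
      have "norm (f x) \<le> C * nrm X x" using C x by simp
      also have "\<dots> \<le> max C 0 * nrm X x"
        using normed_space_nonneg[OF X] x by (intro mult_right_mono) auto
      also have "\<dots> \<le> max C 0 * 1" using x by (intro mult_left_mono) auto
      finally show ?thesis by simp
    qed
    then show ?thesis by (intro bdd_aboveI2)
  qed
  have le: "norm (f x) \<le> nrm (dual X) f" if "f \<in> carr (dual X)" "x \<in> ?B" for f x
    unfolding nrm using that bd by (intro cSUP_upper) auto
  have least: "nrm (dual X) f \<le> c" if "\<And>x. x \<in> ?B \<Longrightarrow> norm (f x) \<le> c" for f c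
    unfolding nrm using that z by (intro cSUP_least) auto
  have f0: "f 0 = 0" if "f \<in> carr (dual X)" for f
  proof -
    have "f (scal X 0 0) = 0 * f 0" using hom[OF that X.subspace_0[OF sub]] .
    then show ?thesis by simp
  qed
  have subD: "D.subspace (carr (dual X))"
  proof (rule D.subspaceI)
    show "0 \<in> carr (dual X)" by (auto simp: dual_def intro: exI[of _ 0])
  next
    fix f g assume fg: "f \<in> carr (dual X)" "g \<in> carr (dual X)"
    then obtain C1 C2 where
      C: "\<And>x. x \<in> carr X \<Longrightarrow> norm (f x) \<le> C1 * nrm X x"
         "\<And>x. x \<in> carr X \<Longrightarrow> norm (g x) \<le> C2 * nrm X x"
      using bound by meson
    have "\<forall>x\<in>carr X. norm (f x + g x) \<le> (C1 + C2) * nrm X x"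
      using add_mono[OF C] by (auto simp: distrib_right intro: order_trans[OF norm_triangle_ineq])
    then have "\<exists>C. \<forall>x\<in>carr X. norm (f x + g x) \<le> C * nrm X x" by blast
    with fg show "f + g \<in> carr (dual X)" by (simp add: dual_def distrib_left ac_simps)
  next
    fix c f assume f: "f \<in> carr (dual X)"
    then obtain C where C: "\<And>x. x \<in> carr X \<Longrightarrow> norm (f x) \<le> C * nrm X x"
      using bound by meson
    have "\<forall>x\<in>carr X. norm (c * f x) \<le> (norm c * C) * nrm X x"
      using C by (simp add: norm_mult mult.assoc mult_left_mono)
    then have "\<exists>C. \<forall>x\<in>carr X. norm (c * f x) \<le> C * nrm X x" by blast
    with f show "scal (dual X) c f \<in> carr (dual X)" by (simp add: dual_def distrib_left ac_simps)
  qed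
  have pos: "nrm (dual X) f = 0 \<longleftrightarrow> f = 0" if f: "f \<in> carr (dual X)" for f
  proof
    assume n0: "nrm (dual X) f = 0"
    have "f x = 0" for x
    proof (cases "x \<in> carr X \<and> x \<noteq> 0")
      case True
      define c :: 'k where "c = of_real (1 / nrm X x)"
      have pos: "nrm X x > 0" using True X normed_space_nonneg[OF X, of x]
        by (auto simp: normed_space_def less_le)
      have "nrm X (scal X c x) = norm c * nrm X x" using True X by (simp add: normed_space_def)
      also have "\<dots> = 1" using pos unfolding c_def norm_of_real by simp
      finally have "scal X c x \<in> ?B" using True X.subspace_scale[OF sub] by simp
      then have "norm (f (scal X c x)) \<le> 0" using le[OF f] n0 by simp
      moreover have "f (scal X c x) = c * f x" using hom[OF f] True by blast
      ultimately show ?thesis using pos by (simp add: c_def)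
    next
      case False
      then show ?thesis using f f0[OF f] by (auto simp: dual_def)
    qed
    then show "f = 0" by (simp add: fun_eq_iff)
  next
    assume "f = 0"
    then show "nrm (dual X) f = 0" using z unfolding nrm by (auto simp: image_constant_conv)
  qed
  have le_scale: "nrm (dual X) (scal (dual X) c f) \<le> norm c * nrm (dual X) f"
    if "f \<in> carr (dual X)" for c f
    using le[OF that] by (intro least) (simp add: dual_def norm_mult mult_left_mono)
  have scale: "nrm (dual X) (scal (dual X) c f) = norm c * nrm (dual X) f"
    if f: "f \<in> carr (dual X)" for c f
  proof (cases "c = 0")
    case True
    then show ?thesis using pos[OF D.subspace_0[OF subD]] by simp
  next
    case False
    have "nrm (dual X) (scal (dual X) (inverse c) (scal (dual X) c f))
        \<le> norm (inverse c) * nrm (dual X) (scal (dual X) c f)"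
      using f by (intro le_scale D.subspace_scale[OF subD])
    moreover have "scal (dual X) (inverse c) (scal (dual X) c f) = f" using False by simp
    ultimately have "nrm (dual X) f \<le> norm (inverse c) * nrm (dual X) (scal (dual X) c f)"
      by simp
    then have "norm c * nrm (dual X) f \<le>
        norm c * (norm (inverse c) * nrm (dual X) (scal (dual X) c f))"
      by (intro mult_left_mono) auto
    also have "\<dots> = nrm (dual X) (scal (dual X) c f)"
      using False by (simp add: nonzero_norm_inverse mult.assoc[symmetric])
    finally have "norm c * nrm (dual X) f \<le> nrm (dual X) (scal (dual X) c f)" .
    then show ?thesis using le_scale[OF f, of c] by simp
  qed
  have tri: "nrm (dual X) (f + g) \<le> nrm (dual X) f + nrm (dual X) g"
    if "f \<in> carr (dual X)" "g \<in> carr (dual X)" for f g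
  proof (rule least)
    fix x assume "x \<in> ?B"
    then have "norm (f x) \<le> nrm (dual X) f" "norm (g x) \<le> nrm (dual X) g"
      using that le by blast+
    then show "norm ((f + g) x) \<le> nrm (dual X) f + nrm (dual X) g"
      using norm_triangle_ineq[of "f x" "g x"] by simp
  qed
  show ?thesis
    unfolding normed_space_def using D.vector_space_axioms subD pos scale tri by blast
qed

end

(* The space is a reflexive, hereditarily indecomposable mixed Tsirelson space with coded special
   functionals. For a power-bounded T and |c| < 1 put q(c) = T^2 - 2 c T + 1, the real quadratic
   factor belonging to the unimodular pair of eigenvalues with real part c; using q(c) instead of
   T - lambda treats both scalar fields at once. If q(c) and q(c') were both not bounded below on any
   tail subspace, there would be block subspaces on which q(c), respectively q(c'), is small, and
   hereditary indecomposability would give nearly equal vectors in them; then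
   q(c') - q(c) = 2 (c - c') T is small on a vector, which is absurd. So all c but one are good,
   and for these q(c) is invertible up to its kernel. The seminorm kap measures how far an orbit is
   from being relatively compact; bounded functionals with respect to kap turn orbits into bounded
   two-sided sequences, whose generating function then extends analytically across the unit circle
   except at 1, -1 and one conjugate pair. By the residue theorem (T^2 - 1) q(c0) annihilates the
   orbit modulo kap, and the mean ergodic theorem for the three factors gives kap = 0: every
   power-bounded operator is almost periodic. By reflexivity an operator on the dual is an adjoint,
   so the inverses of q(c) transfer to the dual. An almost periodic weakly mixing operator is stable
   because finitely many functionals control a totally bounded orbit. *)

theory Submission
  imports Defs "HOL-Complex_Analysis.Complex_Analysis" "HOL-Real_Asymp.Real_Asymp"
begin

section \<open>Dominated functionals and generalised limits\<close>

text \<open>The values c = 1 and c = -1 stay outside the quadratic argument: there q(c) is (T - 1)^2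
  or (T + 1)^2, and the coefficients of its formal inverse grow linearly, so the mean ergodic
  theorem is used for the simple factors T - 1 and T + 1 instead. For |c| < 1 the coefficients stay
  bounded. The quotient by the vectors with \<open>kap\<close> zero is never formed; that T
  preserves \<open>kap\<close> makes T an isometry there, and generalised limits of functionals at
  T^(m+n) y supply the missing negative times n. On the Banach space side, even weights take
  arbitrary block families and give lower estimates, while odd weights accept coded families only. A
  functional of odd weight adds up a coded family with plus signs; once the signs alternate, no
  functional reaches more than a fraction of order 1/m of that value, m being the parameter of the
  odd weight. This gap is the source of hereditary indecomposability. Both fields share one proof
  because functionals need to norm only up to constants: real functionals are complexified at the
  cost of a factor 2, and phases are approximated by powers of one root of unity.\<close>

definition sublinear_on :: "(real \<Rightarrow> 'a::ab_group_add \<Rightarrow> 'a) \<Rightarrow> 'a set \<Rightarrow> ('a \<Rightarrow> real) \<Rightarrow> bool" where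
  "sublinear_on sc S q \<longleftrightarrow> (\<forall>x\<in>S. \<forall>y\<in>S. q (x + y) \<le> q x + q y) \<and> (\<forall>c\<ge>0. \<forall>x\<in>S. q (sc c x) = c * q x)"

text \<open>A linear functional below \<open>q\<close> that agrees with \<open>q\<close> at
  \<open>a\<close> lies below this one, so passing to it forces tightness at \<open>a\<close> while
  staying sublinear. The value 0 off \<open>S\<close> makes functionals equal as functions once they
  agree on \<open>S\<close>, as the minimality argument requires.\<close>

definition shifted :: "(real \<Rightarrow> 'a::ab_group_add \<Rightarrow> 'a) \<Rightarrow> 'a set \<Rightarrow> ('a \<Rightarrow> real) \<Rightarrow> 'a \<Rightarrow> 'a \<Rightarrow> real" where
  "shifted sc S q a x = (if x \<in> S then INF t\<in>{0..}. q (x + sc t a) - t * q a else 0)"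

lemma sublinear_shifted:
  fixes sc :: "real \<Rightarrow> 'a::ab_group_add \<Rightarrow> 'a"
  assumes V: "vector_space sc" and S: "module.subspace sc S" and q: "sublinear_on sc S q" and a: "a \<in> S"
  shows "sublinear_on sc S (shifted sc S q a)"
    and "x \<in> S \<Longrightarrow> t \<ge> 0 \<Longrightarrow> shifted sc S q a x \<le> q (x + sc t a) - t * q a"
proof -
  interpret vector_space sc by fact
  have add: "x + y \<in> S" and sca: "sc c x \<in> S" if "x \<in> S" "y \<in> S" for x y c
    using that S by (auto intro: subspace_add subspace_scale)
  have tri: "q (x + y) \<le> q x + q y" if "x \<in> S" "y \<in> S" for x y using q that by (auto simp: sublinear_on_def)
  have hom: "q (sc c x) = c * q x" if "c \<ge> 0" "x \<in> S" for c x using q that by (auto simp: sublinear_on_def)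
  \<comment> \<open>Subadditivity against -x bounds the values from below, so the \<open>INF\<close>
    is a genuine infimum.\<close>
  have lb: "- q (sc (-1) x) \<le> q (x + sc t a) - t * q a" if "x \<in> S" "t \<ge> 0" for x t
  proof -
    have "q ((x + sc t a) + sc (-1) x) \<le> q (x + sc t a) + q (sc (-1) x)"
      using that a by (intro tri add sca) auto
    moreover have "(x + sc t a) + sc (-1) x = sc t a" by simp
    moreover have "q (sc t a) = t * q a" using hom a that by simp
    ultimately show ?thesis by simp
  qed
  have bd: "bdd_below ((\<lambda>t. q (x + sc t a) - t * q a) ` {0..})" if "x \<in> S" for x
    using lb[OF that] by (intro bdd_belowI2[of _ "- q (sc (-1) x)"]) auto
  show up: "shifted sc S q a x \<le> q (x + sc t a) - t * q a" if "x \<in> S" "t \<ge> 0" for x t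
    unfolding shifted_def using that bd[OF that(1)] by (auto intro: cINF_lower)
  have great: "c \<le> shifted sc S q a x" if "x \<in> S" "\<And>t. t \<ge> 0 \<Longrightarrow> c \<le> q (x + sc t a) - t * q a" for x c
    unfolding shifted_def using that by (auto intro!: cINF_greatest)
  show "sublinear_on sc S (shifted sc S q a)"
    unfolding sublinear_on_def
  proof (intro conjI ballI allI impI)
    fix x y assume xy: "x \<in> S" "y \<in> S"
    have *: "shifted sc S q a (x + y) \<le> (q (x + sc s a) - s * q a) + (q (y + sc t a) - t * q a)" if "s \<ge> 0" "t \<ge> 0" for s t
    proof -
      have "shifted sc S q a (x + y) \<le> q ((x + y) + sc (s + t) a) - (s + t) * q a" using up that xy add by auto
      also have "(x + y) + sc (s + t) a = (x + sc s a) + (y + sc t a)" by (simp add: scale_left_distrib)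
      also have "q \<dots> \<le> q (x + sc s a) + q (y + sc t a)" using xy a by (intro tri add sca) auto
      finally show ?thesis by (simp add: algebra_simps)
    qed
    have "shifted sc S q a (x + y) - (q (y + sc t a) - t * q a) \<le> shifted sc S q a x" if "t \<ge> 0" for t
      using *[OF _ that] xy by (intro great) (auto simp: algebra_simps)
    then have "shifted sc S q a (x + y) - shifted sc S q a x \<le> shifted sc S q a y"
      using xy by (intro great) (auto simp: algebra_simps)
    then show "shifted sc S q a (x + y) \<le> shifted sc S q a x + shifted sc S q a y" by simp
  next
    fix c :: real and x assume c: "c \<ge> 0" and x: "x \<in> S"
    have le: "shifted sc S q a (sc c x) \<le> c * shifted sc S q a x" if c: "c > 0" and x: "x \<in> S" for c x
    proof -
      have "shifted sc S q a (sc c x) / c \<le> shifted sc S q a x"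
      proof (rule great[OF x])
        fix t :: real assume t: "t \<ge> 0"
        have "shifted sc S q a (sc c x) \<le> q (sc c x + sc (c * t) a) - (c * t) * q a" using up[of "sc c x" "c * t"] c t x sca by auto
        also have "sc c x + sc (c * t) a = sc c (x + sc t a)" by (simp add: scale_right_distrib)
        also have "q \<dots> = c * q (x + sc t a)" using c x a by (intro hom add sca) auto
        finally show "shifted sc S q a (sc c x) / c \<le> q (x + sc t a) - t * q a"
          unfolding pos_divide_le_eq[OF c] by (simp add: algebra_simps)
      qed
      then show ?thesis using c by (simp add: divide_le_eq mult.commute)
    qed
    show "shifted sc S q a (sc c x) = c * shifted sc S q a x"
    proof (cases "c = 0")
      case True
      have 0: "0 \<in> S" using S by (rule subspace_0)
      have q0: "q 0 = 0" using hom[of 0 0] 0 by simp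
      have "shifted sc S q a 0 = 0"
      proof (rule antisym)
        show "shifted sc S q a 0 \<le> 0" using up[OF 0, of 0] q0 by simp
        show "0 \<le> shifted sc S q a 0" using hom a by (intro great[OF 0]) simp
      qed
      then show ?thesis using True by simp
    next
      case False
      then have c: "c > 0" using c by simp
      have "shifted sc S q a (sc (1 / c) (sc c x)) \<le> 1 / c * shifted sc S q a (sc c x)"
        using le[of "1 / c" "sc c x"] c x sca by auto
      then have "c * shifted sc S q a x \<le> shifted sc S q a (sc c x)" using c by (simp add: field_simps)
      then show ?thesis using le[OF c x] by simp
    qed
  qed
qed

text \<open>A minimal sublinear functional below \<open>p\<close> equals all its shifts, which forces additivity.\<close>

lemma hahn_banach_seminorm:
  fixes sc :: "real \<Rightarrow> 'a::ab_group_add \<Rightarrow> 'a"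
  assumes V: "vector_space sc" and S: "module.subspace sc S"
    and p: "\<And>x y. x \<in> S \<Longrightarrow> y \<in> S \<Longrightarrow> p (x + y) \<le> p x + p y" "\<And>c x. x \<in> S \<Longrightarrow> p (sc c x) = \<bar>c\<bar> * p x"
    and y: "y \<in> S"
  shows "\<exists>\<phi>. (\<forall>x\<in>S. \<forall>z\<in>S. \<phi> (x + z) = \<phi> x + \<phi> z) \<and> (\<forall>c. \<forall>x\<in>S. \<phi> (sc c x) = c * \<phi> x)
    \<and> (\<forall>x\<in>S. \<bar>\<phi> x\<bar> \<le> p x) \<and> \<phi> y = p y"
proof -
  interpret vector_space sc by fact
  have add: "x + y \<in> S" and sca: "sc c x \<in> S" if "x \<in> S" "y \<in> S" for x y c
    using that S by (auto intro: subspace_add subspace_scale)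
  have 0: "0 \<in> S" using S by (rule subspace_0)
  have sp: "sublinear_on sc S p" using p by (auto simp: sublinear_on_def)
  \<comment> \<open>Starting Zorn below the shift along \<open>y\<close> builds the normalisation
    in: the minimal functional satisfies m(-y) <= -p(y), which gives m(y) = p(y) at the end.\<close>
  define py where "py = shifted sc S p y"
  have spy: "sublinear_on sc S py" unfolding py_def by (rule sublinear_shifted(1)[OF V S sp y])
  have py_p: "py x \<le> p x" if "x \<in> S" for x using sublinear_shifted(2)[OF V S sp y that, of 0] by (simp add: py_def)
  have py_y: "py (sc (-1) y) \<le> - p y"
  proof -
    have "p 0 = 0" using p(2)[OF 0, of 0] by simp
    then show ?thesis using sublinear_shifted(2)[OF V S sp y sca[OF y y], of 1 "-1"] by (simp add: py_def)
  qed
  define A where "A = {q. sublinear_on sc S q \<and> (\<forall>x\<in>S. q x \<le> py x) \<and> (\<forall>x. x \<notin> S \<longrightarrow> q x = 0)}"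
  define P where "P a u \<longleftrightarrow> (\<forall>x. u x \<le> (a x :: real))" for a u :: "'a \<Rightarrow> real"
  have pyA: "py \<in> A" using spy by (auto simp: A_def py_def shifted_def)
  have lower: "- py (sc (-1) x) \<le> q x" if "q \<in> A" "x \<in> S" for q x
  proof -
    have sq: "sublinear_on sc S q" using that by (simp add: A_def)
    have "q (sc 0 0) = 0 * q 0" using sq 0 unfolding sublinear_on_def by (metis order_refl)
    then have "q 0 = 0" by simp
    moreover have "q (x + sc (-1) x) \<le> q x + q (sc (-1) x)"
      using sq that(2) sca[OF that(2) that(2), of "-1"] unfolding sublinear_on_def by blast
    moreover have "q (sc (-1) x) \<le> py (sc (-1) x)" using that sca unfolding A_def by blast
    ultimately show ?thesis by simp
  qed
  have "\<exists>m\<in>A. \<forall>a\<in>A. P m a \<longrightarrow> a = m"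
  proof (rule predicate_Zorn)
    show "partial_order_on A (relation_of P A)"
      by (rule partial_order_on_relation_ofI) (auto simp: P_def fun_eq_iff intro: order_trans order_antisym)
  next
    fix C assume C: "C \<in> Chains (relation_of P A)"
    then have CA: "C \<subseteq> A" and tot: "\<And>a b. a \<in> C \<Longrightarrow> b \<in> C \<Longrightarrow> P a b \<or> P b a"
      by (auto simp: Chains_def relation_of_def)
    show "\<exists>u\<in>A. \<forall>a\<in>C. P a u"
    proof (cases "C = {}")
      case True
      then show ?thesis using pyA by auto
    next
      case False
      define u where "u x = (if x \<in> S then INF q\<in>C. q x else 0)" for x
      have bd: "bdd_below ((\<lambda>q. q x) ` C)" if "x \<in> S" for x
        using lower[OF _ that] CA by (intro bdd_belowI2[of _ "- py (sc (-1) x)"]) auto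
      have ule: "u x \<le> q x" if "q \<in> C" "x \<in> S" for q x
        unfolding u_def using that bd[OF that(2)] by (auto intro: cINF_lower)
      have ugr: "c \<le> u x" if "x \<in> S" "\<And>q. q \<in> C \<Longrightarrow> c \<le> q x" for x c
        unfolding u_def using that False by (auto intro!: cINF_greatest)
      have sC: "sublinear_on sc S q" if "q \<in> C" for q using that CA by (auto simp: A_def)
      have "sublinear_on sc S u"
        unfolding sublinear_on_def
      proof (intro conjI ballI allI impI)
        fix x z assume xz: "x \<in> S" "z \<in> S"
        \<comment> \<open>Of two members of a chain one lies below the other; the smaller one bounds
          both terms, so the infimum of a chain is again subadditive.\<close>
        have *: "u (x + z) \<le> q x + r z" if qr: "q \<in> C" "r \<in> C" for q r
        proof -
          obtain s where s: "s \<in> C" "s x \<le> q x" "s z \<le> r z"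
            using tot[OF qr] qr by (auto simp: P_def)
          have "u (x + z) \<le> s (x + z)" using ule s xz add by auto
          also have "\<dots> \<le> s x + s z" using sC[OF s(1)] xz by (auto simp: sublinear_on_def)
          finally show ?thesis using s by simp
        qed
        have "u (x + z) - r z \<le> u x" if "r \<in> C" for r
          using * that xz by (intro ugr) (auto simp: algebra_simps)
        then have "u (x + z) - u x \<le> u z" using xz by (intro ugr) (auto simp: algebra_simps)
        then show "u (x + z) \<le> u x + u z" by simp
      next
        fix c :: real and x assume c: "c \<ge> 0" and x: "x \<in> S"
        have hC: "q (sc c x) = c * q x" if "q \<in> C" for q using sC[OF that] c x by (auto simp: sublinear_on_def)
        show "u (sc c x) = c * u x"
        proof (rule antisym)
          show "c * u x \<le> u (sc c x)"
          proof (rule ugr)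
            show "sc c x \<in> S" using sca x by blast
            fix q assume q: "q \<in> C"
            show "c * u x \<le> q (sc c x)" unfolding hC[OF q] using ule[OF q x] c by (rule mult_left_mono)
          qed
          show "u (sc c x) \<le> c * u x"
          proof (cases "c = 0")
            case True
            obtain q where "q \<in> C" using False by blast
            then show ?thesis using ule[of q "sc c x"] hC[of q] True x sca 0 by auto
          next
            case False
            then have c: "c > 0" using c by simp
            have "u (sc c x) / c \<le> u x"
            proof (rule ugr[OF x])
              fix q assume "q \<in> C"
              then show "u (sc c x) / c \<le> q x" using ule[of q "sc c x"] hC x sca c by (auto simp: divide_le_eq mult.commute)
            qed
            then show ?thesis using c by (simp add: divide_le_eq mult.commute)
          qed
        qed
      qed
      moreover have "u x \<le> py x" if "x \<in> S" for x
      proof -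
        obtain q where q: "q \<in> C" using False by blast
        then have "q x \<le> py x" using CA that by (auto simp: A_def)
        then show ?thesis using ule[OF q that] by simp
      qed
      ultimately have "u \<in> A" by (auto simp: A_def u_def)
      moreover have "P a u" if "a \<in> C" for a
        using ule[OF that] CA that by (auto simp: P_def A_def u_def)
      ultimately show ?thesis by blast
    qed
  qed
  then obtain m where m: "m \<in> A" and min: "\<And>a. a \<in> A \<Longrightarrow> P m a \<Longrightarrow> a = m" by blast
  have sm: "sublinear_on sc S m" using m by (simp add: A_def)
  \<comment> \<open>The shift along \<open>a\<close> belongs to \<open>A\<close> and lies below
    \<open>m\<close>, hence equals \<open>m\<close>; its defining inequality at t = 1 is
    superadditivity.\<close>
  have super: "m x + m a \<le> m (x + a)" if x: "x \<in> S" and a: "a \<in> S" for x a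
  proof -
    have le: "shifted sc S m a z \<le> m z" if "z \<in> S" for z using sublinear_shifted(2)[OF V S sm a that, of 0] by simp
    have "shifted sc S m a \<in> A"
      unfolding A_def using sublinear_shifted(1)[OF V S sm a] le m
      by (auto simp: A_def shifted_def[of sc S m a] intro: order_trans)
    moreover have "P m (shifted sc S m a)" using le m by (auto simp: P_def A_def shifted_def)
    ultimately have "shifted sc S m a = m" by (rule min)
    then show ?thesis using sublinear_shifted(2)[OF V S sm a x, of 1] by simp
  qed
  have madd: "m (x + z) = m x + m z" if "x \<in> S" "z \<in> S" for x z
    using super[OF that] sm that by (auto simp: sublinear_on_def intro: antisym)
  have m0: "m 0 = 0" using madd[OF 0 0] by simp
  have mneg: "m (sc (-1) x) = - m x" if "x \<in> S" for x
    using madd[OF that sca[OF that that], of "-1"] m0 by simp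
  have mhom: "m (sc c x) = c * m x" if "x \<in> S" for c x
  proof (cases "c \<ge> 0")
    case True
    then show ?thesis using sm that by (auto simp: sublinear_on_def)
  next
    case False
    then have "m (sc (- c) x) = (- c) * m x" using sm that unfolding sublinear_on_def by (meson neg_0_le_iff_le nle_le)
    moreover have "m (sc (-1) (sc (- c) x)) = - m (sc (- c) x)" by (rule mneg[OF sca[OF that that]])
    moreover have "sc (-1) (sc (- c) x) = sc c x" by simp
    ultimately show ?thesis by (metis mult_minus_left minus_minus)
  qed
  have mp: "m x \<le> p x" if "x \<in> S" for x using m that py_p[OF that] by (auto simp: A_def intro: order_trans)
  have "\<bar>m x\<bar> \<le> p x" if "x \<in> S" for x
    using mp[OF that] mp[OF sca[OF that that], of "-1"] mneg[OF that] p(2)[OF that, of "-1"] by simp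
  moreover have "m y = p y"
  proof -
    have "m (sc (-1) y) \<le> py (sc (-1) y)" using m sca[OF y y] unfolding A_def by blast
    then have "- m y \<le> - p y" using py_y mneg[OF y] by simp
    then show ?thesis using mp[OF y] by simp
  qed
  ultimately show ?thesis using madd mhom by blast
qed

section \<open>Generalised limits of bounded sequences\<close>

definition eventual_bound :: "(nat \<Rightarrow> real) \<Rightarrow> real" where
  "eventual_bound s = Inf {M. \<forall>\<^sub>F n in sequentially. \<bar>s n\<bar> \<le> M}"

text \<open>The infimum in \<open>eventual_bound\<close> is limsup |s n|. Working with eventual
  bounds makes finitely many terms irrelevant, which is how index shifts are absorbed later.\<close>

lemma eventual_bound:
  assumes "Bseq s"
  shows "(\<forall>\<^sub>F n in sequentially. \<bar>s n\<bar> \<le> M) \<Longrightarrow> eventual_bound s \<le> M"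
    and "e > 0 \<Longrightarrow> \<forall>\<^sub>F n in sequentially. \<bar>s n\<bar> \<le> eventual_bound s + e"
    and "eventual_bound s \<ge> 0"
proof -
  let ?A = "{M. \<forall>\<^sub>F n in sequentially. \<bar>s n\<bar> \<le> M}"
  have pos: "M \<ge> 0" if "M \<in> ?A" for M
  proof -
    have "\<exists>n. \<bar>s n\<bar> \<le> M" using that eventually_happens[of "\<lambda>n. \<bar>s n\<bar> \<le> M" sequentially] by auto
    then show ?thesis by (auto intro: order_trans[OF abs_ge_zero])
  qed
  then have bd: "bdd_below ?A" by (rule bdd_belowI)
  obtain K where "\<And>n. norm (s n) \<le> K" using assms by (auto simp: Bseq_def)
  then have ne: "K \<in> ?A" by auto
  show "(\<forall>\<^sub>F n in sequentially. \<bar>s n\<bar> \<le> M) \<Longrightarrow> eventual_bound s \<le> M"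
    unfolding eventual_bound_def using bd by (intro cInf_lower) auto
  show "eventual_bound s \<ge> 0" unfolding eventual_bound_def using pos ne by (intro cInf_greatest) auto
  assume "e > 0"
  then have "Inf ?A < eventual_bound s + e" by (simp add: eventual_bound_def)
  then obtain M where "M \<in> ?A" "M < eventual_bound s + e" using cInf_lessD[of ?A] ne by blast
  then show "\<forall>\<^sub>F n in sequentially. \<bar>s n\<bar> \<le> eventual_bound s + e"
    by (auto elim: eventually_mono)
qed

definition is_glim :: "((nat \<Rightarrow> real) \<Rightarrow> real) \<Rightarrow> bool" where
  "is_glim L \<longleftrightarrow> (\<forall>s r. Bseq s \<longrightarrow> Bseq r \<longrightarrow> L (\<lambda>n. s n + r n) = L s + L r) \<and> (\<forall>c s. Bseq s \<longrightarrow> L (\<lambda>n. c * s n) = c * L s)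
    \<and> (\<forall>s M. Bseq s \<longrightarrow> (\<forall>\<^sub>F n in sequentially. \<bar>s n\<bar> \<le> M) \<longrightarrow> \<bar>L s\<bar> \<le> M) \<and> L (\<lambda>n. 1) = 1"

lemma Bseq_plus: assumes "Bseq s" "Bseq r" shows "Bseq (\<lambda>n. s n + r n :: 'a::real_normed_vector)"
proof -
  obtain K J where K: "\<And>n. norm (s n) \<le> K" and J: "\<And>n. norm (r n) \<le> J" using assms by (auto simp: Bseq_def)
  have "norm (s n + r n) \<le> K + J" for n using norm_triangle_ineq[of "s n" "r n"] K[of n] J[of n] by linarith
  then show ?thesis by (rule BseqI')
qed

lemma Bseq_times: assumes "Bseq s" shows "Bseq (\<lambda>n. c * s n :: 'a::real_normed_algebra)"
proof -
  obtain K where K: "\<And>n. norm (s n) \<le> K" using assms by (auto simp: Bseq_def)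
  have "norm (c * s n) \<le> norm c * K" for n
    by (rule order_trans[OF norm_mult_ineq mult_left_mono[OF K]]) simp
  then show ?thesis by (rule BseqI')
qed

text \<open>Hahn-Banach for the seminorm limsup |s n| on the bounded sequences, normed at the
  constant sequence 1.\<close>

lemma glim_exists: "\<exists>L. is_glim L"
proof -
  let ?S = "{s :: nat \<Rightarrow> real. Bseq s}"
  let ?sc = "\<lambda>c (s :: nat \<Rightarrow> real) n. c * s n"
  interpret V: vector_space ?sc by standard (auto simp: fun_eq_iff algebra_simps)
  have S: "V.subspace ?S"
    by (rule V.subspaceI) (auto simp: plus_fun_def zero_fun_def intro: Bseq_plus Bseq_times)
  have one: "(\<lambda>n. 1) \<in> ?S" by simp
  have tri: "eventual_bound (s + r) \<le> eventual_bound s + eventual_bound r" if "s \<in> ?S" "r \<in> ?S" for s r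
  proof (rule field_le_epsilon)
    fix e :: real assume e: "e > 0"
    have B: "Bseq s" "Bseq r" "Bseq (s + r)" using that Bseq_plus[of s r] by (auto simp: plus_fun_def)
    have "\<forall>\<^sub>F n in sequentially. \<bar>(s + r) n\<bar> \<le> eventual_bound s + eventual_bound r + e"
    proof (rule eventually_elim2)
      show "\<forall>\<^sub>F n in sequentially. \<bar>s n\<bar> \<le> eventual_bound s + e / 2" "\<forall>\<^sub>F n in sequentially. \<bar>r n\<bar> \<le> eventual_bound r + e / 2"
        using eventual_bound(2)[OF B(1)] eventual_bound(2)[OF B(2)] e by auto
      fix n assume "\<bar>s n\<bar> \<le> eventual_bound s + e / 2" "\<bar>r n\<bar> \<le> eventual_bound r + e / 2"
      then show "\<bar>(s + r) n\<bar> \<le> eventual_bound s + eventual_bound r + e" by simp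
    qed
    then show "eventual_bound (s + r) \<le> eventual_bound s + eventual_bound r + e" by (rule eventual_bound(1)[OF B(3)])
  qed
  have le: "eventual_bound (?sc c s) \<le> \<bar>c\<bar> * eventual_bound s" if "s \<in> ?S" for c s
  proof (rule field_le_epsilon)
    fix e :: real assume e: "e > 0"
    have B: "Bseq s" "Bseq (?sc c s)" using that Bseq_times[of s c] by auto
    have "\<forall>\<^sub>F n in sequentially. \<bar>s n\<bar> \<le> eventual_bound s + e / (\<bar>c\<bar> + 1)"
      using eventual_bound(2)[OF B(1)] e by simp
    then have "\<forall>\<^sub>F n in sequentially. \<bar>?sc c s n\<bar> \<le> \<bar>c\<bar> * eventual_bound s + e"
    proof (rule eventually_mono)
      fix n assume "\<bar>s n\<bar> \<le> eventual_bound s + e / (\<bar>c\<bar> + 1)"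
      then have "\<bar>c\<bar> * \<bar>s n\<bar> \<le> \<bar>c\<bar> * (eventual_bound s + e / (\<bar>c\<bar> + 1))" by (intro mult_left_mono) auto
      also have "\<bar>c\<bar> * (e / (\<bar>c\<bar> + 1)) \<le> e" using e by (simp add: field_simps)
      then have "\<bar>c\<bar> * (eventual_bound s + e / (\<bar>c\<bar> + 1)) \<le> \<bar>c\<bar> * eventual_bound s + e" by (simp add: distrib_left)
      finally show "\<bar>?sc c s n\<bar> \<le> \<bar>c\<bar> * eventual_bound s + e" by (simp add: abs_mult)
    qed
    then show "eventual_bound (?sc c s) \<le> \<bar>c\<bar> * eventual_bound s + e" by (rule eventual_bound(1)[OF B(2)])
  qed
  have hom: "eventual_bound (?sc c s) = \<bar>c\<bar> * eventual_bound s" if s: "s \<in> ?S" for c s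
  proof (cases "c = 0")
    case True
    have "Bseq (?sc c s)" using s Bseq_times[of s c] by auto
    then show ?thesis using le[OF s, of c] eventual_bound(3)[of "?sc c s"] True by simp
  next
    case False
    have "eventual_bound (?sc (1 / c) (?sc c s)) \<le> \<bar>1 / c\<bar> * eventual_bound (?sc c s)"
      using s Bseq_times[of s c] by (intro le) auto
    then have "eventual_bound s \<le> eventual_bound (?sc c s) / \<bar>c\<bar>" using False by simp
    then have "\<bar>c\<bar> * eventual_bound s \<le> eventual_bound (?sc c s)" using False by (simp add: field_simps)
    then show ?thesis using le[OF s, of c] by simp
  qed
  have e1: "eventual_bound (\<lambda>n. 1) = 1"
  proof (rule antisym)
    show "eventual_bound (\<lambda>n. 1) \<le> 1" by (rule eventual_bound(1)) auto
    show "1 \<le> eventual_bound (\<lambda>n. 1)"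
    proof (rule field_le_epsilon)
      fix e :: real assume "e > 0"
      then show "1 \<le> eventual_bound (\<lambda>n. 1) + e" using eventual_bound(2)[of "\<lambda>n. 1" e] by simp
    qed
  qed
  obtain L where L: "\<forall>x\<in>?S. \<forall>z\<in>?S. L (x + z) = L x + L z" "\<forall>c. \<forall>x\<in>?S. L (?sc c x) = c * L x"
    "\<forall>x\<in>?S. \<bar>L x\<bar> \<le> eventual_bound x" "L (\<lambda>n. 1) = eventual_bound (\<lambda>n. 1)"
    using hahn_banach_seminorm[OF V.vector_space_axioms S tri hom one] by blast
  have "is_glim L"
    unfolding is_glim_def
  proof (intro conjI allI impI)
    show "L (\<lambda>n. s n + r n) = L s + L r" if "Bseq s" "Bseq r" for s r using L(1) that by (auto simp: plus_fun_def)
    show "L (\<lambda>n. c * s n) = c * L s" if "Bseq s" for c s using L(2) that by auto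
    show "\<bar>L s\<bar> \<le> M" if "Bseq s" "\<forall>\<^sub>F n in sequentially. \<bar>s n\<bar> \<le> M" for s M
      using L(3) eventual_bound(1)[OF that] that(1) by force
    show "L (\<lambda>n. 1) = 1" using L(4) e1 by simp
  qed
  then show ?thesis by blast
qed

text \<open>A Banach limit, without shift invariance: additive, homogeneous and bounded by \<open>limsup |s|\<close>, but
  only on bounded sequences.\<close>

definition glim :: "(nat \<Rightarrow> real) \<Rightarrow> real" where
  "glim = (SOME L. is_glim L)"

lemma glim: "is_glim glim"
  using someI_ex[OF glim_exists] by (simp only: glim_def)

lemma glim_add: "Bseq s \<Longrightarrow> Bseq r \<Longrightarrow> glim (\<lambda>n. s n + r n) = glim s + glim r"
  and glim_scale: "Bseq s \<Longrightarrow> glim (\<lambda>n. c * s n) = c * glim s"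
  and glim_bound: "Bseq s \<Longrightarrow> \<forall>\<^sub>F n in sequentially. \<bar>s n\<bar> \<le> M \<Longrightarrow> \<bar>glim s\<bar> \<le> M"
  using glim unfolding is_glim_def by blast+

lemma glim_const: "glim (\<lambda>n. c) = c"
  using glim_scale[of "\<lambda>n. 1" c] glim by (simp add: is_glim_def)

lemma glim_cong:
  assumes "Bseq s" "\<forall>\<^sub>F n in sequentially. s n = r n" "Bseq r" shows "glim s = glim r"
proof -
  have B: "Bseq (\<lambda>n. -1 * r n)" "Bseq (\<lambda>n. s n + -1 * r n)" using assms Bseq_times Bseq_plus by blast+
  have "\<bar>glim (\<lambda>n. s n + -1 * r n)\<bar> \<le> 0"
    using assms(2) by (intro glim_bound[OF B(2)]) (auto elim: eventually_mono)
  then show ?thesis using glim_add[OF assms(1) B(1)] glim_scale[OF assms(3), of "-1"] by simp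
qed

lemma glim_tendsto_0: assumes "s \<longlonglongrightarrow> 0" shows "glim s = 0"
proof -
  have B: "Bseq s" using assms by (meson convergentI convergent_imp_Bseq)
  have "\<bar>glim s\<bar> \<le> e" if "e > 0" for e
    using tendstoD[OF assms that] by (intro glim_bound[OF B]) (auto elim: eventually_mono)
  from this[of "\<bar>glim s\<bar> / 2"] show ?thesis by auto
qed

text \<open>Taken in each real coordinate, so that one definition serves both fields.\<close>

definition glimk :: "(nat \<Rightarrow> 'k::euclidean_space) \<Rightarrow> 'k" where
  "glimk s = (\<Sum>b\<in>Basis. glim (\<lambda>n. s n \<bullet> b) *\<^sub>R b)"

lemma Bseq_inner: "Bseq s \<Longrightarrow> Bseq (\<lambda>n. s n \<bullet> (b :: 'k::euclidean_space))"
proof -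
  assume "Bseq s"
  then obtain K where K: "\<And>n. norm (s n) \<le> K" by (auto simp: Bseq_def)
  have "norm (s n \<bullet> b) \<le> K * norm b" for n
    using Cauchy_Schwarz_ineq2[of "s n" b] mult_right_mono[OF K[of n], of "norm b"] by simp
  then show ?thesis by (rule BseqI')
qed

lemma glim_sum: "finite A \<Longrightarrow> (\<And>i. i \<in> A \<Longrightarrow> Bseq (s i)) \<Longrightarrow> glim (\<lambda>n. \<Sum>i\<in>A. s i n) = (\<Sum>i\<in>A. glim (s i)) \<and> Bseq (\<lambda>n. \<Sum>i\<in>A. s i n)"
proof (induction A rule: finite_induct)
  case empty
  then show ?case using glim_const[of 0] by simp
next
  case (insert i A)
  then show ?case using glim_add[of "s i" "\<lambda>n. \<Sum>i\<in>A. s i n"] Bseq_plus[of "s i" "\<lambda>n. \<Sum>i\<in>A. s i n"] by simp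
qed

text \<open>Expanding in \<open>Basis\<close> reduces a real-linear map to finitely many scalar
  limits. This is what makes \<open>glimk\<close> commute with multiplication by field elements,
  which mixes the coordinates.\<close>

lemma glimk_linear:
  fixes h :: "'k::euclidean_space \<Rightarrow> 'k"
  assumes "linear h" "Bseq s"
  shows "glimk (\<lambda>n. h (s n)) = h (glimk s)"
proof -
  have "glim (\<lambda>n. h (s n) \<bullet> b) = (\<Sum>b'\<in>Basis. glim (\<lambda>n. s n \<bullet> b') * (h b' \<bullet> b))" for b
  proof -
    have "h (s n) \<bullet> b = (\<Sum>b'\<in>Basis. (h b' \<bullet> b) * (s n \<bullet> b'))" for n
    proof -
      have "h (s n) = h (\<Sum>b'\<in>Basis. (s n \<bullet> b') *\<^sub>R b')" by (simp add: euclidean_representation)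
      also have "\<dots> = (\<Sum>b'\<in>Basis. (s n \<bullet> b') *\<^sub>R h b')"
        using assms(1) by (simp add: linear_sum linear_scale)
      finally show ?thesis by (simp add: inner_sum_left mult.commute)
    qed
    then have "glim (\<lambda>n. h (s n) \<bullet> b) = glim (\<lambda>n. \<Sum>b'\<in>Basis. (h b' \<bullet> b) * (s n \<bullet> b'))" by simp
    also have "\<dots> = (\<Sum>b'\<in>Basis. glim (\<lambda>n. (h b' \<bullet> b) * (s n \<bullet> b')))"
      using Bseq_times[OF Bseq_inner[OF assms(2)]] by (subst glim_sum) auto
    also have "\<dots> = (\<Sum>b'\<in>Basis. glim (\<lambda>n. s n \<bullet> b') * (h b' \<bullet> b))"
      using glim_scale[OF Bseq_inner[OF assms(2)]] by (simp add: mult.commute)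
    finally show ?thesis .
  qed
  moreover have "h (glimk s) \<bullet> b = (\<Sum>b'\<in>Basis. glim (\<lambda>n. s n \<bullet> b') * (h b' \<bullet> b))" for b
    unfolding glimk_def using assms(1) by (simp add: linear_sum linear_scale inner_sum_left)
  moreover have "glimk (\<lambda>n. h (s n)) \<bullet> b = glim (\<lambda>n. h (s n) \<bullet> b)" if "b \<in> Basis" for b
    unfolding glimk_def using that by (rule inner_sum_left_Basis)
  ultimately have "glimk (\<lambda>n. h (s n)) \<bullet> b = h (glimk s) \<bullet> b" if "b \<in> Basis" for b using that by presburger
  then show ?thesis by (rule euclidean_eqI)
qed

lemma glimk_mult: "Bseq s \<Longrightarrow> glimk (\<lambda>n. c * s n) = c * glimk (s :: nat \<Rightarrow> 'k::{real_normed_field, euclidean_space})"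
  by (rule glimk_linear) (auto intro: linearI simp: algebra_simps)

lemma glimk_add: assumes "Bseq s" "Bseq r" shows "glimk (\<lambda>n. s n + r n) = glimk s + glimk r"
  using glim_add[OF assms[THEN Bseq_inner]] by (simp add: glimk_def inner_add_left scaleR_left_distrib sum.distrib)

lemma glimk_const: "glimk (\<lambda>n. c) = c"
  by (simp add: glimk_def glim_const euclidean_representation)

text \<open>The dimension enters because the coordinates are bounded one by one and added; for an
  element of the bidual any finite bound is good enough.\<close>

lemma glimk_bound:
  assumes "\<And>n. norm (s n) \<le> M" shows "norm (glimk (s :: nat \<Rightarrow> 'k::euclidean_space)) \<le> real DIM('k) * M"
proof -
  have B: "Bseq s" using assms by (rule BseqI')
  have "norm (glimk s) \<le> (\<Sum>b\<in>(Basis::'k set). norm (glim (\<lambda>n. s n \<bullet> b) *\<^sub>R b))" unfolding glimk_def by (rule norm_sum)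
  also have "\<dots> \<le> (\<Sum>b\<in>(Basis::'k set). M)"
  proof (rule sum_mono)
    fix b :: 'k assume b: "b \<in> Basis"
    have "\<bar>glim (\<lambda>n. s n \<bullet> b)\<bar> \<le> M"
      using order_trans[OF Basis_le_norm[OF b] assms] by (intro glim_bound[OF Bseq_inner[OF B]]) auto
    then show "norm (glim (\<lambda>n. s n \<bullet> b) *\<^sub>R b) \<le> M" using b by simp
  qed
  finally show ?thesis by simp
qed

lemma glimk_tendsto_0: assumes "s \<longlonglongrightarrow> 0" shows "glimk s = 0"
proof -
  have "(\<lambda>n. s n \<bullet> b) \<longlonglongrightarrow> 0" for b using tendsto_inner[OF assms tendsto_const[of b]] by simp
  then show ?thesis by (simp add: glimk_def glim_tendsto_0)
qed

section \<open>A Tauberian theorem for bounded two-sided sequences\<close>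

text \<open>The operator E - a for the translation E. A real quadratic E^2 - 2 c E + 1 with |c| < 1
  factors into two of these, at a conjugate unimodular pair.\<close>

definition shift :: "complex \<Rightarrow> (int \<Rightarrow> complex) \<Rightarrow> int \<Rightarrow> complex" where
  "shift a s = (\<lambda>n. s (n + 1) - a * s n)"

text \<open>\<open>two_sided s\<close> is \<open>\<Sum>n\<ge>0. s n / z^(n+1)\<close> outside the unit disc and
  \<open>- \<Sum>m\<ge>0. s (-m-1) z^m\<close> inside; formally the two differ by
  the full series \<open>\<Sum>n. s n / z^(n+1)\<close>.\<close>

definition outer_part :: "(int \<Rightarrow> complex) \<Rightarrow> complex \<Rightarrow> complex" where
  "outer_part s w = (\<Sum>n. s (int n) * w ^ n)"

definition inner_part :: "(int \<Rightarrow> complex) \<Rightarrow> complex \<Rightarrow> complex" where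
  "inner_part s z = - (\<Sum>m. s (- int m - 1) * z ^ m)"

definition two_sided :: "(int \<Rightarrow> complex) \<Rightarrow> complex \<Rightarrow> complex" where
  "two_sided s z = (if norm z > 1 then outer_part s (1 / z) / z else inner_part s z)"

lemma bounded_power_series:
  fixes a :: "nat \<Rightarrow> complex"
  assumes "\<And>n. norm (a n) \<le> M" "norm w < 1"
  shows "summable (\<lambda>n. a n * w ^ n)" "norm (\<Sum>n. a n * w ^ n) \<le> M / (1 - norm w)"
proof -
  have g: "summable (\<lambda>n. M * norm w ^ n)" using assms(2) by (intro summable_mult summable_geometric) simp
  have le: "norm (a n * w ^ n) \<le> M * norm w ^ n" for n
    unfolding norm_mult norm_power using assms(1) by (intro mult_right_mono) auto
  show "summable (\<lambda>n. a n * w ^ n)" by (rule summable_comparison_test'[OF g]) (rule le)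
  have "norm (\<Sum>n. a n * w ^ n) \<le> (\<Sum>n. M * norm w ^ n)" by (rule norm_suminf_le[OF le g])
  also have "\<dots> = M * (1 / (1 - norm w))" using assms(2) by (simp add: suminf_mult suminf_geometric)
  finally show "norm (\<Sum>n. a n * w ^ n) \<le> M / (1 - norm w)" by simp
qed

text \<open>This growth rate at the circle is the Tauberian input. Combined with
  \<open>residue_zero_of_growth\<close> it leaves at most a simple pole at each isolated singularity
  on the circle.\<close>

lemma two_sided_bound:
  assumes "\<And>n. norm (s n) \<le> M" "norm z \<noteq> 1"
  shows "norm (two_sided s z) \<le> M / \<bar>norm z - 1\<bar>"
proof (cases "norm z > 1")
  case True
  then have w: "norm (1 / z) < 1" by (simp add: norm_divide divide_less_eq)
  have "norm (outer_part s (1 / z)) \<le> M / (1 - norm (1 / z))"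
    unfolding outer_part_def using assms(1) w by (intro bounded_power_series) auto
  then have "norm (outer_part s (1 / z) / z) \<le> M / (1 - norm (1 / z)) / norm z"
    unfolding norm_divide[of _ z] by (rule divide_right_mono) simp
  also have "\<dots> = M / (norm z - 1)"
  proof -
    have "z \<noteq> 0" using True by auto
    then show ?thesis using True by (simp add: norm_divide field_simps)
  qed
  finally show ?thesis using True by (simp add: two_sided_def)
next
  case False
  then show ?thesis using bounded_power_series(2)[of "\<lambda>m. s (- int m - 1)" M z] assms by (simp add: two_sided_def inner_part_def)
qed

text \<open>Shifting a power series by one index splits off one term, and the signs in the inner
  part are chosen so that the same identity results inside and outside the disc. Factors z - a can
  therefore be traded for shifts of the sequence, up to a constant.\<close>

lemma two_sided_shift:
  assumes "\<And>n. norm (s n) \<le> M" "norm z \<noteq> 1"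
  shows "two_sided (shift a s) z = (z - a) * two_sided s z - s 0"
proof (cases "norm z > 1")
  case True
  define w where "w = 1 / z"
  have w: "norm w < 1" "w \<noteq> 0" "z \<noteq> 0" using True by (auto simp: w_def norm_divide divide_less_eq)
  have s1: "summable (\<lambda>n. s (int n) * w ^ n)" using bounded_power_series(1)[of "\<lambda>n. s (int n)" M w] assms(1) w by blast
  have s2: "summable (\<lambda>n. s (int n + 1) * w ^ n)" using bounded_power_series(1)[of "\<lambda>n. s (int n + 1)"] assms(1) w by blast
  have "outer_part s w = s 0 + (\<Sum>n. s (int (Suc n)) * w ^ Suc n)" unfolding outer_part_def using suminf_split_head[OF s1] by simp
  also have "(\<Sum>n. s (int (Suc n)) * w ^ Suc n) = (\<Sum>n. w * (s (int n + 1) * w ^ n))" by (simp add: algebra_simps)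
  also have "\<dots> = w * (\<Sum>n. s (int n + 1) * w ^ n)" using s2 by (rule suminf_mult)
  finally have 1: "(\<Sum>n. s (int n + 1) * w ^ n) = z * (outer_part s w - s 0)" using w by (simp add: w_def)
  have "outer_part (shift a s) w = (\<Sum>n. s (int n + 1) * w ^ n - a * (s (int n) * w ^ n))"
    by (simp add: outer_part_def shift_def algebra_simps)
  also have "\<dots> = (\<Sum>n. s (int n + 1) * w ^ n) - a * outer_part s w"
    unfolding outer_part_def using s1 s2 by (simp add: suminf_diff[symmetric] suminf_mult summable_mult)
  finally have "outer_part (shift a s) w = z * (outer_part s w - s 0) - a * outer_part s w" using 1 by simp
  then show ?thesis using True w by (simp add: two_sided_def w_def[symmetric] field_simps)
next
  case False
  then have z: "norm z < 1" using assms by simp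
  have s1: "summable (\<lambda>m. s (- int m - 1) * z ^ m)" using bounded_power_series(1)[of "\<lambda>m. s (- int m - 1)"] assms(1) z by blast
  have s2: "summable (\<lambda>m. s (- int m) * z ^ m)" using bounded_power_series(1)[of "\<lambda>m. s (- int m)"] assms(1) z by blast
  have "(\<Sum>m. s (- int m) * z ^ m) = s 0 + (\<Sum>m. s (- int (Suc m)) * z ^ Suc m)" using suminf_split_head[OF s2] by simp
  also have "(\<Sum>m. s (- int (Suc m)) * z ^ Suc m) = (\<Sum>m. z * (s (- int m - 1) * z ^ m))"
  proof (rule suminf_cong)
    fix m
    have e: "- int (Suc m) = - int m - 1" by simp
    show "s (- int (Suc m)) * z ^ Suc m = z * (s (- int m - 1) * z ^ m)" unfolding e by (simp only: power_Suc mult_ac)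
  qed
  also have "\<dots> = z * (\<Sum>m. s (- int m - 1) * z ^ m)" using s1 by (rule suminf_mult)
  finally have 1: "(\<Sum>m. s (- int m) * z ^ m) = s 0 - z * inner_part s z" by (simp add: inner_part_def)
  have "inner_part (shift a s) z = - (\<Sum>m. s (- int m) * z ^ m - a * (s (- int m - 1) * z ^ m))"
    by (simp add: inner_part_def shift_def algebra_simps)
  also have "\<dots> = - (\<Sum>m. s (- int m) * z ^ m) - a * inner_part s z"
    unfolding inner_part_def using s1 s2 by (simp add: suminf_diff[symmetric] suminf_mult summable_mult)
  finally show ?thesis using False 1 by (simp add: two_sided_def algebra_simps)
qed

lemma shift_bound: "(\<And>n. norm (s n) \<le> M) \<Longrightarrow> norm a \<le> 1 \<Longrightarrow> norm (shift a s n) \<le> 2 * M"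
proof -
  assume s: "\<And>n. norm (s n) \<le> M" and a: "norm a \<le> 1"
  have M: "M \<ge> 0" using s[of 0] norm_ge_zero order_trans by blast
  have "norm (a * s n) \<le> 1 * M" unfolding norm_mult using a s M by (intro mult_mono) auto
  then show ?thesis unfolding shift_def using norm_triangle_ineq4[of "s (n + 1)" "a * s n"] s[of "n + 1"] by linarith
qed

lemma two_sided_holomorphic:
  assumes "\<And>n. norm (s n) \<le> M"
  shows "two_sided s holomorphic_on {z. norm z > 1}" "two_sided s holomorphic_on {z. norm z < 1}"
proof -
  have P: "(\<lambda>w. \<Sum>n. a n * w ^ n) holomorphic_on ball 0 1" if "\<And>n. norm (a n) \<le> M" for a
  proof (rule power_series_holomorphic)
    fix w :: complex assume "w \<in> ball 0 1"
    then show "(\<lambda>n. a n * (w - 0) ^ n) sums (\<Sum>n. a n * w ^ n)"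
      using bounded_power_series(1)[OF that, of w] by (simp add: summable_sums)
  qed
  have "(outer_part s \<circ> (\<lambda>z. 1 / z)) holomorphic_on {z. norm z > 1}"
  proof (rule holomorphic_on_compose_gen)
    show "(\<lambda>z. 1 / z) holomorphic_on {z :: complex. norm z > 1}" by (intro holomorphic_intros) auto
    show "outer_part s holomorphic_on ball 0 1" unfolding outer_part_def using assms by (intro P)
    show "(\<lambda>z. 1 / z) ` {z :: complex. norm z > 1} \<subseteq> ball 0 1" by (auto simp: norm_divide divide_less_eq)
  qed
  then have "(\<lambda>z. outer_part s (1 / z) / z) holomorphic_on {z. norm z > 1}"
    unfolding o_def by (intro holomorphic_intros) auto
  then show "two_sided s holomorphic_on {z. norm z > 1}"
    by (rule holomorphic_transform) (auto simp: two_sided_def)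
  have "inner_part s holomorphic_on ball 0 1" unfolding inner_part_def using assms by (intro holomorphic_intros P)
  then have "inner_part s holomorphic_on {z. norm z < 1}" by (simp add: ball_def)
  then show "two_sided s holomorphic_on {z. norm z < 1}"
    by (rule holomorphic_transform) (auto simp: two_sided_def)
qed

text \<open>Along a chain of preimages under \<open>shift \<mu>\<close> the identity
  \<open>two_sided_shift\<close> can be iterated; it expands the function in powers of z - \<mu>
  with coefficients - \<gamma> (k+1) 0 and remainder (z - \<mu>)^k times the function of the k-th
  preimage. Geometric growth of the preimages makes the remainder vanish within radius 1/K, on both
  sides of the circle alike.\<close>

lemma two_sided_local_extension:
  assumes g: "\<And>k. \<gamma> k = shift \<mu> (\<gamma> (Suc k))" and b: "\<And>k n. norm (\<gamma> k n) \<le> M * K ^ k" and K: "K > 0"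
  shows "\<exists>L. L holomorphic_on ball \<mu> (1 / K) \<and> (\<forall>z\<in>ball \<mu> (1 / K). norm z \<noteq> 1 \<longrightarrow> two_sided (\<gamma> 0) z = L z)"
proof (intro exI conjI ballI impI)
  let ?L = "\<lambda>z. \<Sum>i. (- \<gamma> (Suc i) 0) * (z - \<mu>) ^ i"
  have small: "norm (K * (z - \<mu>)) < 1" if "z \<in> ball \<mu> (1 / K)" for z
  proof -
    have "norm (K * (z - \<mu>)) = K * norm (z - \<mu>)" using K by (simp only: norm_mult norm_of_real abs_of_pos)
    also have "\<dots> < 1" using that K by (simp add: dist_norm norm_minus_commute field_simps)
    finally show ?thesis .
  qed
  have summ: "(\<lambda>i. (- \<gamma> (Suc i) 0) * (z - \<mu>) ^ i) sums ?L z" if z: "z \<in> ball \<mu> (1 / K)" for z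
  proof (rule summable_sums)
    have g: "summable (\<lambda>i. M * K * norm (K * (z - \<mu>)) ^ i)"
      using small[OF z] by (intro summable_mult summable_geometric) simp
    show "summable (\<lambda>i. (- \<gamma> (Suc i) 0) * (z - \<mu>) ^ i)"
    proof (rule summable_comparison_test'[OF g])
      fix i :: nat
      have "norm ((- \<gamma> (Suc i) 0) * (z - \<mu>) ^ i) \<le> (M * K ^ Suc i) * norm (z - \<mu>) ^ i"
        unfolding norm_mult norm_power norm_minus_cancel by (rule mult_right_mono[OF b]) simp
      also have "\<dots> = M * K * norm (K * (z - \<mu>)) ^ i"
        using K by (simp add: norm_mult power_mult_distrib)
      finally show "norm ((- \<gamma> (Suc i) 0) * (z - \<mu>) ^ i) \<le> M * K * norm (K * (z - \<mu>)) ^ i" .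
    qed
  qed
  show "?L holomorphic_on ball \<mu> (1 / K)" by (rule power_series_holomorphic[OF summ])
  fix z assume z: "z \<in> ball \<mu> (1 / K)" "norm z \<noteq> 1"
  have ex: "two_sided (\<gamma> 0) z = (\<Sum>i<k. (- \<gamma> (Suc i) 0) * (z - \<mu>) ^ i) + (z - \<mu>) ^ k * two_sided (\<gamma> k) z" for k
  proof (induction k)
    case (Suc k)
    have "two_sided (\<gamma> k) z = (z - \<mu>) * two_sided (\<gamma> (Suc k)) z - \<gamma> (Suc k) 0"
      by (subst g) (rule two_sided_shift[OF b z(2)])
    then have "(z - \<mu>) ^ k * two_sided (\<gamma> k) z = (z - \<mu>) ^ Suc k * two_sided (\<gamma> (Suc k)) z + (- \<gamma> (Suc k) 0) * (z - \<mu>) ^ k"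
      by (simp only:) (simp add: algebra_simps)
    then show ?case using Suc by simp
  qed simp
  have "(\<lambda>k. (z - \<mu>) ^ k * two_sided (\<gamma> k) z) \<longlonglongrightarrow> 0"
  proof (rule Lim_null_comparison)
    show "\<forall>\<^sub>F k in sequentially. norm ((z - \<mu>) ^ k * two_sided (\<gamma> k) z) \<le> M / \<bar>norm z - 1\<bar> * norm (K * (z - \<mu>)) ^ k"
    proof (rule always_eventually, rule allI)
      fix k
      have "norm ((z - \<mu>) ^ k * two_sided (\<gamma> k) z) \<le> norm (z - \<mu>) ^ k * (M * K ^ k / \<bar>norm z - 1\<bar>)"
        unfolding norm_mult norm_power using two_sided_bound[OF b z(2)] by (intro mult_left_mono) auto
      also have "\<dots> = M / \<bar>norm z - 1\<bar> * norm (K * (z - \<mu>)) ^ k"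
        using K by (simp add: norm_mult power_mult_distrib)
      finally show "norm ((z - \<mu>) ^ k * two_sided (\<gamma> k) z) \<le> M / \<bar>norm z - 1\<bar> * norm (K * (z - \<mu>)) ^ k" .
    qed
    show "(\<lambda>k. M / \<bar>norm z - 1\<bar> * norm (K * (z - \<mu>)) ^ k) \<longlonglongrightarrow> 0"
      using small[OF z(1)] by (intro tendsto_mult_right_zero LIMSEQ_power_zero) simp
  qed
  then have "(\<lambda>k. two_sided (\<gamma> 0) z - (z - \<mu>) ^ k * two_sided (\<gamma> k) z) \<longlonglongrightarrow> two_sided (\<gamma> 0) z - 0" by (intro tendsto_intros)
  moreover have "two_sided (\<gamma> 0) z - (z - \<mu>) ^ k * two_sided (\<gamma> k) z = (\<Sum>i<k. (- \<gamma> (Suc i) 0) * (z - \<mu>) ^ i)" for k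
    using ex[of k] by simp
  ultimately have "(\<lambda>i. (- \<gamma> (Suc i) 0) * (z - \<mu>) ^ i) sums two_sided (\<gamma> 0) z" by (simp add: sums_def)
  then show "two_sided (\<gamma> 0) z = ?L z" using summ[OF z(1)] by (rule sums_unique2)
qed

lemma holomorphic_across_circle:
  assumes h: "G holomorphic_on {z. norm z > 1}" "G holomorphic_on {z. norm z < 1}" and E: "finite E"
    and loc: "\<And>\<mu>. norm \<mu> = 1 \<Longrightarrow> \<mu> \<notin> E \<Longrightarrow> \<exists>\<rho>>0. \<exists>L. L holomorphic_on ball \<mu> \<rho> \<and> (\<forall>z\<in>ball \<mu> \<rho>. norm z \<noteq> 1 \<longrightarrow> G z = L z)"
  shows "\<exists>H. H holomorphic_on (- E) \<and> (\<forall>z. norm z \<noteq> 1 \<longrightarrow> H z = G z)"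
proof -
  let ?C = "{w :: complex. norm w \<noteq> 1}"
  \<comment> \<open>Circle values are limits from off the circle. A local extension is continuous
    and hence agrees with these limits, so all local extensions glue together.\<close>
  define H where "H z = (if norm z = 1 then Lim (at z within ?C) G else G z)" for z
  \<comment> \<open>Points on the ray through \<nu> just outside the circle show that the limit is
    taken along a nontrivial filter and is unique.\<close>
  have isl: "at \<nu> within ?C \<noteq> bot" if "norm \<nu> = 1" for \<nu> :: complex
  proof -
    have "\<nu> islimpt ?C"
    proof (rule islimptI)
      fix T assume T: "\<nu> \<in> T" "open T"
      then obtain e where e: "e > 0" "ball \<nu> e \<subseteq> T" using openE by blast
      define w where "w = of_real (1 + e / 2) * \<nu>"
      have "norm w = 1 + e / 2" using that e unfolding w_def norm_mult norm_of_real by simp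
      moreover have "w - \<nu> = of_real (e / 2) * \<nu>" by (simp add: w_def algebra_simps)
      then have "norm (w - \<nu>) = e / 2" using that e by (simp only: norm_mult norm_of_real)
      then have "w \<in> ball \<nu> e" using e by (simp add: dist_norm norm_minus_commute)
      ultimately show "\<exists>y\<in>?C. y \<in> T \<and> y \<noteq> \<nu>" using e that by (intro bexI[of _ w]) auto
    qed
    then show ?thesis by (simp add: trivial_limit_within)
  qed
  have HL: "H z = L z" if L: "L holomorphic_on ball \<mu> \<rho>" "\<forall>z\<in>ball \<mu> \<rho>. norm z \<noteq> 1 \<longrightarrow> G z = L z" and z: "z \<in> ball \<mu> \<rho>" for L \<mu> \<rho> z
  proof (cases "norm z = 1")
    case True
    have "continuous_on (ball \<mu> \<rho>) L" using L(1) by (rule holomorphic_on_imp_continuous_on)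
    then have "isCont L z" using z by (simp add: continuous_on_eq_continuous_at)
    then have "(L \<longlongrightarrow> L z) (at z within ?C)" by (auto simp: isCont_def intro: tendsto_within_subset)
    moreover have "\<forall>\<^sub>F w in at z within ?C. L w = G w"
      unfolding eventually_at_topological using z L(2) by (intro exI[of _ "ball \<mu> \<rho>"]) auto
    ultimately have "(G \<longlongrightarrow> L z) (at z within ?C)" by (rule Lim_transform_eventually)
    then show ?thesis using tendsto_Lim[OF isl[OF True]] True by (simp add: H_def)
  next
    case False
    then show ?thesis using L z by (simp add: H_def)
  qed
  have "H holomorphic_on (- E)"
  proof -
    have "\<exists>f'. (H has_field_derivative f') (at z)" if z: "z \<in> - E" for z
    proof -
      have *: "\<exists>f'. (H has_field_derivative f') (at z)" if S: "open S" "z \<in> S" "F holomorphic_on S" "\<And>w. w \<in> S \<Longrightarrow> F w = H w" for F S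
      proof -
        obtain f' where f': "(F has_field_derivative f') (at z)" using S by (auto simp: holomorphic_on_open)
        show ?thesis by (rule exI, rule has_field_derivative_transform_within_open[OF f' S(1,2)]) (use S(4) in auto)
      qed
      consider "norm z > 1" | "norm z < 1" | "norm z = 1" by linarith
      then show ?thesis
      proof cases
        case 1
        show ?thesis by (rule *[OF _ _ h(1)]) (use 1 in \<open>auto simp: H_def intro!: open_Collect_less continuous_intros\<close>)
      next
        case 2
        show ?thesis by (rule *[OF _ _ h(2)]) (use 2 in \<open>auto simp: H_def intro!: open_Collect_less continuous_intros\<close>)
      next
        case 3
        have "z \<notin> E" using z by simp
        from loc[OF 3 this] obtain \<rho> L where L: "\<rho> > 0" "L holomorphic_on ball z \<rho>" "\<forall>w\<in>ball z \<rho>. norm w \<noteq> 1 \<longrightarrow> G w = L w" by blast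
        show ?thesis by (rule *[OF _ _ L(2)]) (use L HL[OF L(2,3)] in auto)
      qed
    qed
    then show ?thesis using E by (subst holomorphic_on_open) (auto simp: finite_imp_closed open_Compl)
  qed
  then show ?thesis by (auto simp: H_def)
qed

text \<open>On \<open>\<bar>\<zeta>\<bar> = r\<close> the polynomial \<open>cnj \<xi> \<zeta>\<^sup>2 + r\<^sup>2 \<zeta> + \<xi> r\<^sup>2\<close> equals \<open>\<zeta> (\<bar>\<xi> + \<zeta>\<bar>\<^sup>2 - 1)\<close>, so it
  absorbs the singularity allowed by the growth bound.\<close>

lemma residue_zero_of_growth:
  assumes lam: "norm \<xi> = 1" and rho: "0 < \<rho>" "\<rho> \<le> 1" and H: "H holomorphic_on (ball \<xi> \<rho> - {\<xi>})"
    and gr: "\<And>z. norm z \<noteq> 1 \<Longrightarrow> norm (H z) \<le> M / \<bar>norm z - 1\<bar>" and h: "h holomorphic_on UNIV"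
  shows "residue (\<lambda>z. (z - \<xi>) * h z * H z) \<xi> = 0"
proof -
  \<comment> \<open>The three Laurent terms that arise when the polynomial is divided by \<zeta> and
    multiplied by \<open>h\<close> and \<open>H\<close>. They are kept apart because their
    coefficients carry different powers of \<open>r\<close>.\<close>
  define f1 where "f1 z = (z - \<xi>) * h z * H z" for z
  define f0 where "f0 z = h z * H z" for z
  define fm where "fm z = h z * H z / (z - \<xi>)" for z
  let ?S = "ball \<xi> \<rho>"
  have hS: "h holomorphic_on (?S - {\<xi>})" using h by (rule holomorphic_on_subset) auto
  have hol: "f1 holomorphic_on (?S - {\<xi>})" "f0 holomorphic_on (?S - {\<xi>})" "fm holomorphic_on (?S - {\<xi>})"
    unfolding f1_def f0_def fm_def using H hS by (auto intro!: holomorphic_intros)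
  have M: "M \<ge> 0" using gr[of 0] by (auto intro: order_trans[OF norm_ge_zero])
  have "compact (h ` cball \<xi> 1)"
    using h by (intro compact_continuous_image holomorphic_on_imp_continuous_on[OF holomorphic_on_subset]) auto
  then obtain B where "\<forall>y\<in>h ` cball \<xi> 1. norm y \<le> B" using compact_imp_bounded bounded_iff by blast
  then have B: "\<And>z. z \<in> cball \<xi> 1 \<Longrightarrow> norm (h z) \<le> B" by blast
  have B0: "B \<ge> 0" using B[of \<xi>] by (auto intro: order_trans[OF norm_ge_zero])
  have bound: "norm (residue f1 \<xi>) \<le> B * (M * 3) * r + r\<^sup>2 * norm (residue f0 \<xi>) + r\<^sup>2 * norm (residue fm \<xi>)" if r: "0 < r" "r < \<rho>" for r
  proof -
    have cb: "cball \<xi> r \<subseteq> ?S" using r by auto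
    have I: "(f has_contour_integral 2 * pi * \<i> * residue f \<xi>) (circlepath \<xi> r)" if "f holomorphic_on (?S - {\<xi>})" for f
      using base_residue[OF open_ball _ r(1) that cb] rho by simp
    let ?f = "\<lambda>z. cnj \<xi> * f1 z + r\<^sup>2 * f0 z + \<xi> * r\<^sup>2 * fm z"
    have "(?f has_contour_integral (cnj \<xi> * (2 * pi * \<i> * residue f1 \<xi>) + r\<^sup>2 * (2 * pi * \<i> * residue f0 \<xi>) + \<xi> * r\<^sup>2 * (2 * pi * \<i> * residue fm \<xi>))) (circlepath \<xi> r)"
      by (intro has_contour_integral_add has_contour_integral_lmul I hol)
    then have "norm (cnj \<xi> * (2 * pi * \<i> * residue f1 \<xi>) + r\<^sup>2 * (2 * pi * \<i> * residue f0 \<xi>) + \<xi> * r\<^sup>2 * (2 * pi * \<i> * residue fm \<xi>)) \<le> (B * (M * 3)) * (2 * pi * r)"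
    proof (rule has_contour_integral_bound_circlepath)
      show "0 \<le> B * (M * 3)" using B0 M by simp
      show "0 < r" by fact
      fix z assume z: "norm (z - \<xi>) = r"
      define \<zeta> where "\<zeta> = z - \<xi>"
      have nz: "norm \<zeta> = r" using z by (simp add: \<zeta>_def)
      then have z0: "\<zeta> \<noteq> 0" using r by auto
      have zz: "\<zeta> * cnj \<zeta> = (of_real r)\<^sup>2" using complex_norm_square[of \<zeta>] nz by simp
      have ll: "\<xi> * cnj \<xi> = 1" using complex_norm_square[of \<xi>] lam by simp
      have nz2: "of_real ((norm z)\<^sup>2) = z * cnj z" by (rule complex_norm_square)
      have key: "?f z = h z * H z * of_real ((norm z)\<^sup>2 - 1)"
      proof -
        have "z = \<xi> + \<zeta>" by (simp add: \<zeta>_def)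
        then have "z * cnj z - 1 = cnj \<xi> * \<zeta> + \<zeta> * cnj \<zeta> + \<xi> * cnj \<zeta>" using ll by (simp add: algebra_simps)
        also have "\<xi> * cnj \<zeta> = \<xi> * (of_real r)\<^sup>2 / \<zeta>" using zz z0 by (simp add: field_simps)
        finally have "of_real ((norm z)\<^sup>2 - 1) = cnj \<xi> * \<zeta> + (of_real r)\<^sup>2 + \<xi> * (of_real r)\<^sup>2 / \<zeta>"
          using nz2 zz by simp
        moreover have "?f z = h z * H z * (cnj \<xi> * \<zeta> + (of_real r)\<^sup>2 + \<xi> * (of_real r)\<^sup>2 / \<zeta>)"
          unfolding f1_def f0_def fm_def \<zeta>_def[symmetric] by (simp add: algebra_simps)
        ultimately show ?thesis by simp
      qed
      have "norm (h z) \<le> B" using B[of z] z r rho by (simp add: dist_norm norm_minus_commute)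
      \<comment> \<open>On the unit circle the factor vanishes, whatever value \<open>H\<close> has
        there. Off it, |z|^2 - 1 splits, and |z| + 1 <= 3 because |z| <= 1 + r < 2.\<close>
      moreover have "norm (H z * of_real ((norm z)\<^sup>2 - 1)) \<le> M * 3"
      proof (cases "norm z = 1")
        case True
        then show ?thesis using M by simp
      next
        case False
        have "\<bar>(norm z)\<^sup>2 - 1\<bar> = \<bar>norm z - 1\<bar> * (norm z + 1)"
        proof -
          have "(norm z)\<^sup>2 - 1 = (norm z - 1) * (norm z + 1)" by (simp add: power2_eq_square algebra_simps)
          then have "\<bar>(norm z)\<^sup>2 - 1\<bar> = \<bar>norm z - 1\<bar> * \<bar>norm z + 1\<bar>" by (simp only: abs_mult)
          also have "\<bar>norm z + 1\<bar> = norm z + 1" by (rule abs_of_nonneg) simp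
          finally show ?thesis .
        qed
        then have "norm (H z * of_real ((norm z)\<^sup>2 - 1)) \<le> M / \<bar>norm z - 1\<bar> * (\<bar>norm z - 1\<bar> * (norm z + 1))"
          unfolding norm_mult norm_of_real using gr[OF False] M by (intro mult_mono) auto
        also have "\<dots> = M * (norm z + 1)" using False by simp
        also have "\<dots> \<le> M * 3"
          using M norm_triangle_ineq[of \<xi> "z - \<xi>"] lam z r rho by (intro mult_left_mono) auto
        finally show ?thesis .
      qed
      moreover have "norm (?f z) = norm (h z) * norm (H z * of_real ((norm z)\<^sup>2 - 1))"
        unfolding key by (simp only: norm_mult mult.assoc)
      ultimately show "norm (?f z) \<le> B * (M * 3)" using B0 by (simp only:) (intro mult_mono; simp)
    qed
    moreover have "cnj \<xi> * (2 * pi * \<i> * residue f1 \<xi>) + r\<^sup>2 * (2 * pi * \<i> * residue f0 \<xi>) + \<xi> * r\<^sup>2 * (2 * pi * \<i> * residue fm \<xi>) =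
       (2 * pi * \<i>) * (cnj \<xi> * residue f1 \<xi> + r\<^sup>2 * residue f0 \<xi> + \<xi> * r\<^sup>2 * residue fm \<xi>)"
      by (simp add: algebra_simps)
    ultimately have "norm ((2 * pi * \<i>) * (cnj \<xi> * residue f1 \<xi> + r\<^sup>2 * residue f0 \<xi> + \<xi> * r\<^sup>2 * residue fm \<xi>)) \<le> (B * (M * 3)) * (2 * pi * r)"
      by (simp only:)
    moreover have "norm (2 * pi * \<i>) = 2 * pi" by (simp add: norm_mult)
    moreover have "(B * (M * 3)) * (2 * pi * r) = (2 * pi) * (B * (M * 3) * r)" by simp
    ultimately have "(2 * pi) * norm (cnj \<xi> * residue f1 \<xi> + r\<^sup>2 * residue f0 \<xi> + \<xi> * r\<^sup>2 * residue fm \<xi>) \<le> (2 * pi) * (B * (M * 3) * r)"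
      by (simp only: norm_mult[of "2 * pi * \<i>"])
    then have "norm (cnj \<xi> * residue f1 \<xi> + r\<^sup>2 * residue f0 \<xi> + \<xi> * r\<^sup>2 * residue fm \<xi>) \<le> B * (M * 3) * r"
      by (rule mult_left_le_imp_le) simp
    moreover have "norm (cnj \<xi> * residue f1 \<xi>) \<le> norm (cnj \<xi> * residue f1 \<xi> + r\<^sup>2 * residue f0 \<xi> + \<xi> * r\<^sup>2 * residue fm \<xi>) + norm (r\<^sup>2 * residue f0 \<xi>) + norm (\<xi> * r\<^sup>2 * residue fm \<xi>)"
      using norm_triangle_ineq4[of "cnj \<xi> * residue f1 \<xi> + r\<^sup>2 * residue f0 \<xi> + \<xi> * r\<^sup>2 * residue fm \<xi>" "r\<^sup>2 * residue f0 \<xi> + \<xi> * r\<^sup>2 * residue fm \<xi>"]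
        norm_triangle_ineq[of "r\<^sup>2 * residue f0 \<xi>" "\<xi> * r\<^sup>2 * residue fm \<xi>"] by (simp add: add.assoc)
    ultimately show ?thesis using lam by (simp add: norm_mult norm_power)
  qed
  \<comment> \<open>The residues do not depend on the radius, so the radius may tend to 0 and the
    right-hand side with it.\<close>
  have "((\<lambda>r. B * (M * 3) * r + r\<^sup>2 * norm (residue f0 \<xi>) + r\<^sup>2 * norm (residue fm \<xi>)) \<longlongrightarrow> B * (M * 3) * 0 + 0\<^sup>2 * norm (residue f0 \<xi>) + 0\<^sup>2 * norm (residue fm \<xi>)) (at_right 0)"
    by (intro tendsto_intros)
  then have "norm (residue f1 \<xi>) \<le> B * (M * 3) * 0 + 0\<^sup>2 * norm (residue f0 \<xi>) + 0\<^sup>2 * norm (residue fm \<xi>)"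
  proof (rule tendsto_lowerbound)
    show "\<forall>\<^sub>F r in at_right 0. norm (residue f1 \<xi>) \<le> B * (M * 3) * r + r\<^sup>2 * norm (residue f0 \<xi>) + r\<^sup>2 * norm (residue fm \<xi>)"
      unfolding eventually_at_right_field using bound rho by (intro exI[of _ \<rho>]) auto
  qed simp
  then show ?thesis by (simp add: f1_def[abs_def])
qed

lemma shift_pow_commute: "(shift a ^^ k) (shift b s) = shift b ((shift a ^^ k) s)"
proof (induction k)
  case (Suc k)
  have "shift a (shift b s) = shift b (shift a s)" for s by (auto simp: shift_def fun_eq_iff algebra_simps)
  then show ?case using Suc by simp
qed simp

lemma shift_pow_bound: "(\<And>n. norm (s n) \<le> M) \<Longrightarrow> norm a \<le> 1 \<Longrightarrow> norm ((shift a ^^ k) s n) \<le> 2 ^ k * M"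
proof (induction k arbitrary: n)
  case (Suc k)
  then show ?case using shift_bound[of "(shift a ^^ k) s" "2 ^ k * M" a] by (simp add: mult.assoc)
qed simp

text \<open>The conclusion is (E^2 - 1)(E^2 - 2 c0 E + 1) b = 0 at time 0, with E the translation.
  Only circle points with real part 1, -1 or c0 can be singular for the generating function; there
  the quartic kills the residues. So the contour integral of the transformed function over a large
  circle vanishes, and that integral is 2 pi i times the value sought.\<close>

theorem two_sided_tauberian:
  fixes b :: "int \<Rightarrow> real"
  assumes b: "\<And>n. \<bar>b n\<bar> \<le> M" and c0: "\<bar>c0\<bar> < 1"
    and reg: "\<And>c. \<bar>c\<bar> < 1 \<Longrightarrow> c \<noteq> c0 \<Longrightarrow> \<exists>D \<beta>. \<beta> (0::nat) = b \<and> (\<forall>k n. \<beta> k n = \<beta> (Suc k) (n + 2) - 2 * c * \<beta> (Suc k) (n + 1) + \<beta> (Suc k) n)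
       \<and> (\<forall>k n. \<bar>\<beta> k n\<bar> \<le> M * D ^ k) \<and> D > 0"
  shows "b 4 - 2 * c0 * b 3 + 2 * c0 * b 1 - b 0 = 0"
proof -
  define s where "s n = complex_of_real (b n)" for n
  have sM: "norm (s n) \<le> M" for n using b by (simp add: s_def)
  have M0: "M \<ge> 0" using b[of 0] by simp
  define \<xi> where "\<xi> = Complex c0 (sqrt (1 - c0\<^sup>2))"
  have c02: "c0\<^sup>2 \<le> 1" using c0 by (simp add: abs_square_le_1)
  have nxi: "norm \<xi> = 1" using c02 by (simp add: \<xi>_def cmod_def)
  have xi1: "\<xi> * cnj \<xi> = 1" "\<xi> + cnj \<xi> = 2 * of_real c0"
    using complex_norm_square[of \<xi>] nxi by (simp_all add: \<xi>_def complex_eq_iff)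
  define E where "E = {1, -1, \<xi>, cnj \<xi>}"
  have loc: "\<exists>\<rho>>0. \<exists>L. L holomorphic_on ball \<mu> \<rho> \<and> (\<forall>z\<in>ball \<mu> \<rho>. norm z \<noteq> 1 \<longrightarrow> two_sided s z = L z)" if mu: "norm \<mu> = 1" "\<mu> \<notin> E" for \<mu>
  proof -
    have mu2: "(Re \<mu>)\<^sup>2 + (Im \<mu>)\<^sup>2 = 1" using mu(1) by (simp add: cmod_def)
    have "\<bar>Re \<mu>\<bar> \<noteq> 1"
    proof
      assume "\<bar>Re \<mu>\<bar> = 1"
      then have "(Re \<mu>)\<^sup>2 = 1" by (simp add: abs_square_eq_1)
      then have "Im \<mu> = 0" using mu2 by simp
      then show False using mu(2) \<open>\<bar>Re \<mu>\<bar> = 1\<close> by (auto simp: E_def complex_eq_iff abs_if split: if_splits)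
    qed
    then have c: "\<bar>Re \<mu>\<bar> < 1" using abs_Re_le_cmod[of \<mu>] mu(1) by linarith
    have "Re \<mu> \<noteq> c0"
    proof
      assume *: "Re \<mu> = c0"
      then have "(Im \<mu>)\<^sup>2 = (sqrt (1 - c0\<^sup>2))\<^sup>2" using mu2 c02 by simp
      then have "Im \<mu> = sqrt (1 - c0\<^sup>2) \<or> Im \<mu> = - sqrt (1 - c0\<^sup>2)" by (simp only: power2_eq_iff)
      then show False using mu(2) * by (auto simp: E_def \<xi>_def complex_eq_iff)
    qed
    from reg[OF c this] obtain D \<beta> where B: "\<beta> 0 = b" "\<And>k n. \<beta> k n = \<beta> (Suc k) (n + 2) - 2 * Re \<mu> * \<beta> (Suc k) (n + 1) + \<beta> (Suc k) n"
       "\<And>k n. \<bar>\<beta> k n\<bar> \<le> M * D ^ k" "D > 0" by blast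
    \<comment> \<open>\<open>\<beta>\<close> is a chain of preimages under the quadratic. Applying
      the conjugate factor k times to its k-th member leaves a chain of preimages under the single
      factor \<open>shift \<mu>\<close>; the cost 2^k is absorbed in the rate 2 D.\<close>
    define \<gamma> where "\<gamma> k = (shift (cnj \<mu>) ^^ k) (\<lambda>n. complex_of_real (\<beta> k n))" for k
    have m1: "\<mu> * cnj \<mu> = 1" using complex_norm_square[of \<mu>] mu by simp
    have "shift \<mu> (shift (cnj \<mu>) (\<lambda>n. complex_of_real (\<beta> (Suc k) n))) = (\<lambda>n. complex_of_real (\<beta> k n))" for k
    proof
      fix n
      have "shift \<mu> (shift (cnj \<mu>) (\<lambda>n. complex_of_real (\<beta> (Suc k) n))) n =
          of_real (\<beta> (Suc k) (n + 2)) - (\<mu> + cnj \<mu>) * of_real (\<beta> (Suc k) (n + 1)) + (\<mu> * cnj \<mu>) * of_real (\<beta> (Suc k) n)"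
        by (simp add: shift_def algebra_simps)
      also have "\<dots> = of_real (\<beta> k n)" unfolding m1 B(2)[of k n] complex_add_cnj by simp
      finally show "shift \<mu> (shift (cnj \<mu>) (\<lambda>n. complex_of_real (\<beta> (Suc k) n))) n = of_real (\<beta> k n)" .
    qed
    then have "\<gamma> k = (shift (cnj \<mu>) ^^ k) (shift \<mu> (shift (cnj \<mu>) (\<lambda>n. complex_of_real (\<beta> (Suc k) n))))" for k
      unfolding \<gamma>_def by simp
    then have "\<gamma> k = shift \<mu> (\<gamma> (Suc k))" for k
      unfolding shift_pow_commute \<gamma>_def[of "Suc k"] funpow_Suc_right o_def by simp
    moreover have "norm (\<gamma> k n) \<le> M * (2 * D) ^ k" for k n
    proof -
      have "norm (\<gamma> k n) \<le> 2 ^ k * (M * D ^ k)" unfolding \<gamma>_def using B(3) mu(1) by (intro shift_pow_bound) auto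
      then show ?thesis by (simp add: power_mult_distrib mult_ac)
    qed
    moreover have "\<gamma> 0 = s" by (auto simp: \<gamma>_def B(1) s_def)
    ultimately have "\<exists>L. L holomorphic_on ball \<mu> (1 / (2 * D)) \<and> (\<forall>z\<in>ball \<mu> (1 / (2 * D)). norm z \<noteq> 1 \<longrightarrow> two_sided s z = L z)"
      using two_sided_local_extension[of \<gamma> \<mu> M "2 * D"] B(4) by (metis mult_pos_pos zero_less_numeral)
    moreover have "1 / (2 * D) > 0" using B(4) by simp
    ultimately show ?thesis by blast
  qed
  obtain H where H: "H holomorphic_on (- E)" "\<And>z. norm z \<noteq> 1 \<Longrightarrow> H z = two_sided s z"
    using holomorphic_across_circle[of "two_sided s" E, OF two_sided_holomorphic[of s M, OF sM] _ loc] by (auto simp: E_def)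
  have nE: "norm p = 1" if "p \<in> E" for p using that nxi by (auto simp: E_def)
  have fE: "finite E" by (simp add: E_def)
  define \<Psi> where "\<Psi> z = (z - 1) * ((z + 1) * ((z - \<xi>) * (z - cnj \<xi>)))" for z
  have res0: "residue (\<lambda>z. \<Psi> z * H z) p = 0" if p: "p \<in> E" for p
  proof -
    obtain h where h: "h holomorphic_on UNIV" "\<Psi> = (\<lambda>z. (z - p) * h z)"
    proof -
      consider "p = 1" | "p = -1" | "p = \<xi>" | "p = cnj \<xi>" using p by (auto simp: E_def)
      then show thesis
      proof cases
        case 1
        show ?thesis by (rule that[of "\<lambda>z. (z + 1) * ((z - \<xi>) * (z - cnj \<xi>))"]) (auto simp: \<Psi>_def 1 fun_eq_iff intro!: holomorphic_intros)
      next
        case 2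
        show ?thesis by (rule that[of "\<lambda>z. (z - 1) * ((z - \<xi>) * (z - cnj \<xi>))"]) (auto simp: \<Psi>_def 2 fun_eq_iff intro!: holomorphic_intros)
      next
        case 3
        show ?thesis by (rule that[of "\<lambda>z. (z - 1) * ((z + 1) * (z - cnj \<xi>))"]) (auto simp: \<Psi>_def 3 fun_eq_iff intro!: holomorphic_intros)
      next
        case 4
        show ?thesis by (rule that[of "\<lambda>z. (z - 1) * ((z + 1) * (z - \<xi>))"]) (auto simp: \<Psi>_def 4 fun_eq_iff intro!: holomorphic_intros)
      qed
    qed
    have "open (- (E - {p}))" using fE by (intro open_Compl finite_imp_closed) auto
    then obtain \<rho> where r: "\<rho> > 0" "ball p \<rho> \<subseteq> - (E - {p})" by (rule openE[where x=p]) auto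
    have "residue (\<lambda>z. (z - p) * h z * H z) p = 0"
    proof (rule residue_zero_of_growth[where \<rho> = "min \<rho> 1" and M = M])
      show "norm p = 1" by (rule nE[OF p])
      show "0 < min \<rho> 1" "min \<rho> 1 \<le> 1" using r by auto
      show "H holomorphic_on ball p (min \<rho> 1) - {p}" using H(1) r by (rule_tac holomorphic_on_subset) auto
      show "h holomorphic_on UNIV" by (rule h(1))
      show "norm (H z) \<le> M / \<bar>norm z - 1\<bar>" if "norm z \<noteq> 1" for z
        using two_sided_bound[OF sM that] H(2)[OF that] by simp
    qed
    then show ?thesis using h(2) by (simp add: mult.assoc)
  qed
  define d where "d = shift 1 (shift (-1) (shift \<xi> (shift (cnj \<xi>) s)))"
  have d0: "d 0 = of_real (b 4 - 2 * c0 * b 3 + 2 * c0 * b 1 - b 0)"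
  proof -
    have "shift \<xi> (shift (cnj \<xi>) s) n = s (n + 2) - (\<xi> + cnj \<xi>) * s (n + 1) + (\<xi> * cnj \<xi>) * s n" for n
      by (simp add: shift_def algebra_simps)
    then have 1: "shift \<xi> (shift (cnj \<xi>) s) = (\<lambda>n. s (n + 2) - 2 * of_real c0 * s (n + 1) + s n)" unfolding xi1 mult_1 by (rule ext)
    show ?thesis unfolding d_def 1 by (simp add: shift_def s_def algebra_simps)
  qed
  have dM: "norm (d n) \<le> 16 * M" for n
  proof -
    have 1: "norm (shift (cnj \<xi>) s n) \<le> 2 * M" for n by (rule shift_bound[OF sM]) (simp add: nxi)
    have 2: "norm (shift \<xi> (shift (cnj \<xi>) s) n) \<le> 2 * (2 * M)" for n by (rule shift_bound[OF 1]) (simp add: nxi)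
    have 3: "norm (shift (-1) (shift \<xi> (shift (cnj \<xi>) s)) n) \<le> 2 * (2 * (2 * M))" for n by (rule shift_bound[OF 2]) simp
    have "norm (d n) \<le> 2 * (2 * (2 * (2 * M)))" unfolding d_def by (rule shift_bound[OF 3]) simp
    then show ?thesis by simp
  qed
  obtain P where P: "P holomorphic_on UNIV" "\<And>z. norm z \<noteq> 1 \<Longrightarrow> two_sided d z = \<Psi> z * two_sided s z - P z"
  proof -
    let ?s1 = "shift (cnj \<xi>) s" and ?s2 = "shift \<xi> (shift (cnj \<xi>) s)" and ?s3 = "shift (-1) (shift \<xi> (shift (cnj \<xi>) s))"
    have m1: "norm (?s1 n) \<le> 2 * M" for n by (rule shift_bound[OF sM]) (simp add: nxi)
    have m2: "norm (?s2 n) \<le> 2 * (2 * M)" for n by (rule shift_bound[OF m1]) (simp add: nxi)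
    have m3: "norm (?s3 n) \<le> 2 * (2 * (2 * M))" for n by (rule shift_bound[OF m2]) simp
    let ?P = "\<lambda>z. (z - 1) * ((z + 1) * ((z - \<xi>) * s 0 + ?s1 0) + ?s2 0) + ?s3 0"
    show thesis
    proof (rule that[of ?P])
      show "?P holomorphic_on UNIV" by (intro holomorphic_intros)
      fix z :: complex assume z: "norm z \<noteq> 1"
      show "two_sided d z = \<Psi> z * two_sided s z - ?P z"
        unfolding d_def two_sided_shift[OF m3 z] two_sided_shift[OF m2 z] two_sided_shift[OF m1 z] two_sided_shift[OF sM z] \<Psi>_def by (simp add: algebra_simps)
    qed
  qed
  \<comment> \<open>The integral of \<Psi> H vanishes by the residues and that of P by Cauchy, hence
    so does the integral of \<open>two_sided d\<close>. Subtracting d 0 / z leaves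
    \<open>two_sided (shift 0 d) z / z\<close>, where \<open>shift 0\<close> just drops the leading
    term; this is small enough for its integral to vanish as \<open>R\<close> grows.\<close>
  have small: "2 * pi * norm (d 0) \<le> (16 * M / (R * (R - 1))) * (2 * pi * R)" if R: "R > 1" for R
  proof -
    let ?g = "circlepath 0 R"
    have out: "norm z > 1" if "z \<in> path_image ?g" for z using that R by auto
    have "contour_integral ?g (\<lambda>z. \<Psi> z * H z) = 2 * pi * \<i> * (\<Sum>p\<in>E. winding_number ?g p * residue (\<lambda>z. \<Psi> z * H z) p)"
    proof (rule Residue_theorem[of UNIV])
      show "(\<lambda>z. \<Psi> z * H z) holomorphic_on UNIV - E"
        unfolding \<Psi>_def using H(1) by (auto intro!: holomorphic_intros simp: Compl_eq_Diff_UNIV)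
      show "path_image ?g \<subseteq> UNIV - E" using out nE by force
    qed (use fE in auto)
    also have "\<dots> = 0" using res0 by simp
    finally have I1: "contour_integral ?g (\<lambda>z. \<Psi> z * H z) = 0" .
    have ci1: "(\<lambda>z. \<Psi> z * H z) contour_integrable_on ?g"
    proof (rule contour_integrable_holomorphic_simple[of _ "- E"])
      show "(\<lambda>z. \<Psi> z * H z) holomorphic_on - E" unfolding \<Psi>_def using H(1) by (auto intro!: holomorphic_intros)
      show "open (- E)" using fE by (intro open_Compl finite_imp_closed)
      show "path_image ?g \<subseteq> - E" using out nE by force
    qed simp
    have hP: "(P has_contour_integral 0) ?g"
      using Cauchy_theorem_convex_simple[of P UNIV ?g] P(1) by auto
    have "((\<lambda>z. \<Psi> z * H z - P z) has_contour_integral 0 - 0) ?g"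
      using has_contour_integral_integral[OF ci1] I1 hP by (intro has_contour_integral_diff) auto
    then have Id: "(two_sided d has_contour_integral 0 - 0) ?g"
    proof (rule has_contour_integral_eq)
      fix z assume "z \<in> path_image ?g"
      then have "norm z \<noteq> 1" using out by force
      then show "\<Psi> z * H z - P z = two_sided d z" using P(2) H(2) by simp
    qed
    have "((\<lambda>z. d 0 / (z - 0)) has_contour_integral 2 * pi * \<i> * d 0) ?g"
      using Cauchy_integral_circlepath_simple[of "\<lambda>_. d 0" 0 R 0] R by simp
    then have "((\<lambda>z. two_sided d z - d 0 / (z - 0)) has_contour_integral 0 - 0 - 2 * pi * \<i> * d 0) ?g"
      by (rule has_contour_integral_diff[OF Id])
    then have "norm (0 - 0 - 2 * pi * \<i> * d 0) \<le> (16 * M / (R * (R - 1))) * (2 * pi * R)"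
    proof (rule has_contour_integral_bound_circlepath)
      show "0 \<le> 16 * M / (R * (R - 1))" "0 < R" using M0 R by auto
      fix z :: complex assume "norm (z - 0) = R"
      then have z: "norm z = R" "norm z \<noteq> 1" "z \<noteq> 0" using R by auto
      have "two_sided d z - d 0 / (z - 0) = two_sided (shift 0 d) z / z" using z unfolding two_sided_shift[OF dM z(2)] by (simp add: field_simps)
      moreover have "norm (two_sided (shift 0 d) z) \<le> 16 * M / \<bar>norm z - 1\<bar>"
        using dM z by (intro two_sided_bound) (auto simp: shift_def)
      ultimately have "norm (two_sided d z - d 0 / (z - 0)) \<le> 16 * M / \<bar>norm z - 1\<bar> / norm z"
        by (simp only: norm_divide divide_right_mono norm_ge_zero)
      then show "norm (two_sided d z - d 0 / (z - 0)) \<le> 16 * M / (R * (R - 1))" using z R by (simp add: mult.commute)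
    qed
    then show ?thesis by (simp add: norm_mult)
  qed
  have "((\<lambda>R. (16 * M / (R * (R - 1))) * (2 * pi * R)) \<longlongrightarrow> 0) at_top" by real_asymp
  then have "2 * pi * norm (d 0) \<le> 0"
    by (rule tendsto_lowerbound) (use small in \<open>auto intro: eventually_mono[OF eventually_gt_at_top[of 1]]\<close>)
  then have "norm (d 0) = 0" using pi_gt_zero by (auto simp: mult_le_0_iff not_le simp del: pi_gt_zero)
  then show ?thesis unfolding d0 by (simp only: norm_eq_zero of_real_eq_0_iff)
qed

section \<open>Power-bounded operators on reflexive spaces\<close>

text \<open>The scalar \<open>\<omega>\<close> is \<open>-1\<close> for the reals and \<open>\<i>\<close> for the complex numbers.\<close>

locale scalar_field =
  fixes \<omega> :: "'k::{real_normed_field, euclidean_space}"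
  assumes span: "\<exists>a b. z = of_real a + of_real b * \<omega>"
    and dichotomy: "\<omega> = -1 \<or> (\<omega> * \<omega> = -1 \<and> (1::'k) \<bullet> \<omega> = 0)"
begin

lemma norm_omega_1: "norm \<omega> = 1"
  using dichotomy
proof
  assume "\<omega> * \<omega> = -1 \<and> (1::'k) \<bullet> \<omega> = 0"
  then have "norm \<omega> * norm \<omega> = 1" by (metis norm_minus_cancel norm_mult norm_one)
  then show ?thesis by (metis abs_norm_cancel power2_eq_square real_sqrt_abs real_sqrt_one)
qed simp

end

section \<open>Normed spaces given by a carrier, separation and the mean ergodic theorem\<close>

locale normed_ctx = scalar_field \<omega> for \<omega> :: "'k::{real_normed_field, euclidean_space}" +
  fixes Y :: "('k, 'a::ab_group_add) nspace"
  assumes ns: "normed_space Y"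
begin

abbreviation "C \<equiv> carr Y"
abbreviation "N \<equiv> nrm Y"
abbreviation "sc \<equiv> scal Y"

sublocale V: vector_space sc using ns by (simp add: normed_space_def)

lemma sub: "V.subspace C" using ns by (simp add: normed_space_def)

lemma zero_in [simp]: "0 \<in> C" using sub by (rule V.subspace_0)
lemma add_in [simp]: "x \<in> C \<Longrightarrow> y \<in> C \<Longrightarrow> x + y \<in> C" using sub by (rule V.subspace_add)
lemma sc_in [simp]: "x \<in> C \<Longrightarrow> sc c x \<in> C" using sub by (rule V.subspace_scale)
lemma diff_in [simp]: "x \<in> C \<Longrightarrow> y \<in> C \<Longrightarrow> x - y \<in> C" using sub by (rule V.subspace_diff)
lemma neg_in [simp]: "x \<in> C \<Longrightarrow> - x \<in> C" using sub by (rule V.subspace_neg)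
lemma sum_in: "(\<And>i. i \<in> A \<Longrightarrow> f i \<in> C) \<Longrightarrow> sum f A \<in> C" using sub by (rule V.subspace_sum)

lemma N_nonneg [simp]: "x \<in> C \<Longrightarrow> 0 \<le> N x" using normed_space_nonneg[OF ns] .
lemma N_eq0: "x \<in> C \<Longrightarrow> N x = 0 \<longleftrightarrow> x = 0" using ns by (simp add: normed_space_def)
lemma N_0 [simp]: "N 0 = 0" using N_eq0[of 0] by simp
lemma N_sc: "x \<in> C \<Longrightarrow> N (sc c x) = norm c * N x" using ns by (simp add: normed_space_def)
lemma N_tri: "x \<in> C \<Longrightarrow> y \<in> C \<Longrightarrow> N (x + y) \<le> N x + N y" using ns unfolding normed_space_def by meson
lemma N_neg: "x \<in> C \<Longrightarrow> N (- x) = N x" using N_sc[of x "-1"] by simp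
lemma N_comm: "x \<in> C \<Longrightarrow> y \<in> C \<Longrightarrow> N (x - y) = N (y - x)" using N_neg[of "x - y"] by simp
lemma N_tri_minus: "x \<in> C \<Longrightarrow> y \<in> C \<Longrightarrow> N (x - y) \<le> N x + N y" using N_tri[of x "- y"] N_neg[of y] by simp
lemma N_tri3: "x \<in> C \<Longrightarrow> y \<in> C \<Longrightarrow> z \<in> C \<Longrightarrow> N (x - z) \<le> N (x - y) + N (y - z)"
  using N_tri[of "x - y" "y - z"] by simp
lemma N_sum: "finite A \<Longrightarrow> (\<And>i. i \<in> A \<Longrightarrow> f i \<in> C) \<Longrightarrow> N (sum f A) \<le> (\<Sum>i\<in>A. N (f i))"
proof (induction A rule: finite_induct)
  case (insert i A)
  have "N (sum f (insert i A)) \<le> N (f i) + N (sum f A)" using insert by (simp add: N_tri sum_in)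
  also have "\<dots> \<le> N (f i) + (\<Sum>i\<in>A. N (f i))" using insert by simp
  finally show ?case using insert by simp
qed simp

text \<open>Restriction of scalars to the reals: the Hahn-Banach lemma and the quadratic factor are
  real, so both fields can share them.\<close>

definition "rscale \<equiv> \<lambda>r. sc (of_real r)"

lemma rscale_vector_space: "vector_space rscale"
  by standard (auto simp: rscale_def V.scale_right_distrib V.scale_left_distrib)
lemma rscale_sub: "module.subspace rscale C"
proof -
  interpret R: vector_space rscale by (rule rscale_vector_space)
  show ?thesis by (rule R.subspaceI) (auto simp: rscale_def)
qed
lemma rscale_in [simp]: "x \<in> C \<Longrightarrow> rscale r x \<in> C" by (simp add: rscale_def)
lemma N_rs: "x \<in> C \<Longrightarrow> N (rscale r x) = \<bar>r\<bar> * N x" by (simp add: rscale_def N_sc)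
lemma rscale_add: "rscale r (x + y) = rscale r x + rscale r y" by (simp add: rscale_def V.scale_right_distrib)
lemma rscale_add2: "rscale (r + s) x = rscale r x + rscale s x" by (simp add: rscale_def V.scale_left_distrib)
lemma rscale_diff: "rscale r (x - y) = rscale r x - rscale r y" by (simp add: rscale_def V.scale_right_diff_distrib)
lemma rscale_diff2: "rscale (r - s) x = rscale r x - rscale s x" by (simp add: rscale_def V.scale_left_diff_distrib)
lemma rscale_rs [simp]: "rscale r (rscale s x) = rscale (r * s) x" by (simp add: rscale_def)
lemma rscale_1 [simp]: "rscale 1 x = x" by (simp add: rscale_def)
lemma rscale_0 [simp]: "rscale 0 x = 0" by (simp add: rscale_def)
lemma rscale_zero [simp]: "rscale r 0 = 0" by (simp add: rscale_def)
lemma rscale_neg: "rscale (- r) x = - rscale r x" by (simp add: rscale_def V.scale_minus_left)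

lemma dualD:
  assumes "f \<in> carr (dual Y)"
  shows "x \<in> C \<Longrightarrow> y \<in> C \<Longrightarrow> f (x + y) = f x + f y" "x \<in> C \<Longrightarrow> f (sc c x) = c * f x"
    "x \<notin> C \<Longrightarrow> f x = 0" "\<exists>B\<ge>0. \<forall>x\<in>C. norm (f x) \<le> B * N x"
proof -
  show "x \<in> C \<Longrightarrow> y \<in> C \<Longrightarrow> f (x + y) = f x + f y" "x \<in> C \<Longrightarrow> f (sc c x) = c * f x" "x \<notin> C \<Longrightarrow> f x = 0"
    using assms by (auto simp: dual_def)
  obtain B where "\<forall>x\<in>C. norm (f x) \<le> B * N x" using assms by (auto simp: dual_def)
  then have "\<forall>x\<in>C. norm (f x) \<le> max B 0 * N x"
    by (meson N_nonneg max.cobounded1 mult_right_mono order_trans)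
  then show "\<exists>B\<ge>0. \<forall>x\<in>C. norm (f x) \<le> B * N x" by (intro exI[of _ "max B 0"]) auto
qed

lemma dual_diff: "f \<in> carr (dual Y) \<Longrightarrow> x \<in> C \<Longrightarrow> y \<in> C \<Longrightarrow> f (x - y) = f x - f y"
  using dualD(1)[of f x "sc (-1) y"] dualD(2)[of f y "-1"] by simp

lemma dualI:
  assumes "\<And>x y. x \<in> C \<Longrightarrow> y \<in> C \<Longrightarrow> f (x + y) = f x + f y" "\<And>c x. x \<in> C \<Longrightarrow> f (sc c x) = c * f x"
    "\<And>x. x \<in> C \<Longrightarrow> norm (f x) \<le> B * N x" "\<And>x. x \<notin> C \<Longrightarrow> f x = 0"
  shows "f \<in> carr (dual Y)"
  using assms by (auto simp: dual_def intro!: exI[of _ B])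

lemma dual_norm_le: assumes "f \<in> carr (dual Y)" "x \<in> C" shows "norm (f x) \<le> nrm (dual Y) f * N x"
proof (cases "x = 0")
  case True
  then show ?thesis using dualD(2)[OF assms(1) zero_in, of 0] by simp
next
  case False
  then have Nx: "N x > 0" using N_eq0[OF assms(2)] N_nonneg[OF assms(2)] by linarith
  obtain B where B: "B \<ge> 0" "\<And>x. x \<in> C \<Longrightarrow> norm (f x) \<le> B * N x" using dualD(4)[OF assms(1)] by blast
  let ?S = "{norm (f x) |x. x \<in> C \<and> N x \<le> 1}"
  have bd: "bdd_above ?S"
    using B mult_left_mono[of _ 1 B] by (intro bdd_aboveI[of _ B]) (auto intro: order_trans)
  define y where "y = rscale (1 / N x) x"
  have "y \<in> C" "N y \<le> 1" using assms Nx by (auto simp: y_def N_rs)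
  then have "norm (f y) \<le> Sup ?S" using bd by (intro cSup_upper) auto
  also have "Sup ?S = nrm (dual Y) f" by (simp add: dual_def)
  finally have "norm (f y) \<le> nrm (dual Y) f" .
  moreover have "norm (f y) = norm (f x) / N x"
    unfolding y_def rscale_def dualD(2)[OF assms] using Nx by (simp add: norm_mult norm_divide)
  ultimately show ?thesis using Nx by (simp add: field_simps)
qed

lemma dual_norm_least: assumes "\<And>x. x \<in> C \<Longrightarrow> norm (f x) \<le> B * N x" "B \<ge> 0" shows "nrm (dual Y) f \<le> B"
proof -
  have "Sup {norm (f x) |x. x \<in> C \<and> N x \<le> 1} \<le> B"
  proof (rule cSup_least)
    show "{norm (f x) |x. x \<in> C \<and> N x \<le> 1} \<noteq> {}" using zero_in N_0 by (metis (mono_tags, lifting) empty_Collect_eq zero_le_one)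
    fix r assume "r \<in> {norm (f x) |x. x \<in> C \<and> N x \<le> 1}"
    then obtain x where "r = norm (f x)" "x \<in> C" "N x \<le> 1" by blast
    then show "r \<le> B" using assms(1)[of x] mult_left_mono[of "N x" 1 B] assms(2) by auto
  qed
  then show ?thesis by (simp add: dual_def)
qed

text \<open>The dominating seminorm is the distance to \<open>M\<close>: zero on \<open>M\<close>,
  at least \<open>d\<close> at \<open>y\<close>. Over the complex numbers the real functional \<phi>
  is turned into \<phi>(x) - \<omega> \<phi>(\<omega> x); the crude bound for the two terms is the
  origin of the factor 2 in all later duality arguments.\<close>

lemma separation:
  assumes M: "V.subspace M" "M \<subseteq> C" and y: "y \<in> C" and d: "\<And>m. m \<in> M \<Longrightarrow> d \<le> N (y - m)" "d \<ge> 0"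
  shows "\<exists>f\<in>carr (dual Y). (\<forall>m\<in>M. f m = 0) \<and> (\<forall>x\<in>C. norm (f x) \<le> 2 * N x) \<and> norm (f y) \<ge> d"
proof -
  have M0: "0 \<in> M" using M(1) by (rule V.subspace_0)
  define p where "p x = (INF m\<in>M. N (x - m))" for x
  have bd: "bdd_below ((\<lambda>m. N (x - m)) ` M)" if "x \<in> C" for x using M that by (intro bdd_belowI2[of _ 0]) auto
  have ple: "p x \<le> N (x - m)" if "x \<in> C" "m \<in> M" for x m unfolding p_def using that bd by (intro cINF_lower) auto
  have pge: "c \<le> p x" if "\<And>m. m \<in> M \<Longrightarrow> c \<le> N (x - m)" for c x unfolding p_def using that M0 by (intro cINF_greatest) auto
  have ptri: "p (x + z) \<le> p x + p z" if "x \<in> C" "z \<in> C" for x z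
  proof -
    have *: "p (x + z) \<le> N (x - m) + N (z - k)" if "m \<in> M" "k \<in> M" for m k
    proof -
      have mk: "m + k \<in> M" "m \<in> C" "k \<in> C" using that M V.subspace_add by auto
      have "p (x + z) \<le> N ((x + z) - (m + k))" using ple mk \<open>x \<in> C\<close> \<open>z \<in> C\<close> by auto
      also have "(x + z) - (m + k) = (x - m) + (z - k)" by simp
      also have "N \<dots> \<le> N (x - m) + N (z - k)" using mk \<open>x \<in> C\<close> \<open>z \<in> C\<close> by (intro N_tri) auto
      finally show ?thesis .
    qed
    have "p (x + z) - N (z - k) \<le> p x" if "k \<in> M" for k using *[OF _ that] by (intro pge) (simp add: algebra_simps)
    then have "p (x + z) - p x \<le> p z" by (intro pge) (simp add: algebra_simps)
    then show ?thesis by simp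
  qed
  have ple2: "p (rscale c x) \<le> \<bar>c\<bar> * p x" if "x \<in> C" "c \<noteq> 0" for c x
  proof -
    have "p (rscale c x) / \<bar>c\<bar> \<le> p x"
    proof (rule pge)
      fix m assume m: "m \<in> M"
      then have "rscale c m \<in> M" unfolding rscale_def using M(1) by (rule_tac V.subspace_scale)
      then have "p (rscale c x) \<le> N (rscale c x - rscale c m)" using ple that by auto
      also have "\<dots> = \<bar>c\<bar> * N (x - m)" unfolding rscale_diff[symmetric] using M m that by (intro N_rs) auto
      finally show "p (rscale c x) / \<bar>c\<bar> \<le> N (x - m)" using that by (simp add: field_simps)
    qed
    then show ?thesis using that by (simp add: field_simps)
  qed
  have phom: "p (rscale c x) = \<bar>c\<bar> * p x" if x: "x \<in> C" for c x
  proof (cases "c = 0")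
    case True
    have "p 0 \<le> 0" using ple[of 0 0] M0 by simp
    moreover have "0 \<le> p 0" using M by (intro pge) (auto simp: N_neg)
    ultimately show ?thesis using True by simp
  next
    case False
    have "p (rscale (1 / c) (rscale c x)) \<le> \<bar>1 / c\<bar> * p (rscale c x)" using x False by (intro ple2) auto
    then have "\<bar>c\<bar> * p x \<le> p (rscale c x)" using False by (simp add: field_simps)
    then show ?thesis using ple2[OF x False] by simp
  qed
  obtain \<phi> where \<phi>: "\<forall>x\<in>C. \<forall>z\<in>C. \<phi> (x + z) = \<phi> x + \<phi> z" "\<forall>c. \<forall>x\<in>C. \<phi> (rscale c x) = c * \<phi> x" "\<forall>x\<in>C. \<bar>\<phi> x\<bar> \<le> p x" "\<phi> y = p y"
    using hahn_banach_seminorm[OF rscale_vector_space rscale_sub, of p y] ptri phom y by blast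
  have pN: "p x \<le> N x" if "x \<in> C" for x using ple[OF that M0] by simp
  have \<phi>N: "\<bar>\<phi> x\<bar> \<le> N x" if "x \<in> C" for x using \<phi>(3) pN that by force
  have \<phi>M: "\<phi> m = 0" if "m \<in> M" for m
  proof -
    have "p m \<le> 0" using ple[of m m] that M by auto
    then show ?thesis using \<phi>(3) that M by force
  qed
  have py: "d \<le> \<phi> y" using \<phi>(4) pge[OF d(1)] by simp
  from dichotomy show ?thesis
  proof
    assume om: "\<omega> = -1"
    have real: "\<exists>r. c = of_real r" for c :: 'k
    proof -
      obtain a b where "c = of_real a + of_real b * \<omega>" using span by blast
      then have "c = of_real (a - b)" by (simp add: om)
      then show ?thesis by blast
    qed
    define f where "f x = (if x \<in> C then of_real (\<phi> x) else 0 :: 'k)" for x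
    have hom: "f (sc c x) = c * f x" if "x \<in> C" for c x
    proof -
      obtain r where "c = of_real r" using real by blast
      then show ?thesis using \<phi>(2) that by (simp add: f_def rscale_def)
    qed
    have "f \<in> carr (dual Y)"
      by (rule dualI[where B = 1]) (use hom \<phi>(1) \<phi>N in \<open>auto simp: f_def\<close>)
    moreover have "norm (f x) \<le> 2 * N x" if "x \<in> C" for x using \<phi>N[OF that] that by (auto simp: f_def intro: order_trans[of _ "N x"])
    moreover have "norm (f y) \<ge> d" using py y by (simp add: f_def)
    moreover have "f m = 0" if "m \<in> M" for m using \<phi>M[OF that] by (simp add: f_def)
    ultimately show ?thesis by blast
  next
    assume om: "\<omega> * \<omega> = -1 \<and> (1::'k) \<bullet> \<omega> = 0"
    define f where "f x = (if x \<in> C then of_real (\<phi> x) - \<omega> * of_real (\<phi> (sc \<omega> x)) else 0 :: 'k)" for x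
    have add: "f (x + z) = f x + f z" if "x \<in> C" "z \<in> C" for x z
      using that \<phi>(1) by (simp add: f_def V.scale_right_distrib algebra_simps)
    have homr: "f (rscale r x) = of_real r * f x" if "x \<in> C" for r x
    proof -
      have "sc \<omega> (rscale r x) = rscale r (sc \<omega> x)" by (simp add: rscale_def mult.commute)
      then show ?thesis using that \<phi>(2) by (simp add: f_def algebra_simps)
    qed
    have homw: "f (sc \<omega> x) = \<omega> * f x" if "x \<in> C" for x
    proof -
      have "sc \<omega> (sc \<omega> x) = rscale (-1) x" using om by (simp add: rscale_def)
      then have "f (sc \<omega> x) = of_real (\<phi> (sc \<omega> x)) + \<omega> * of_real (\<phi> x)" using that \<phi>(2) by (simp add: f_def)
      moreover have "\<omega> * f x = \<omega> * of_real (\<phi> x) - (\<omega> * \<omega>) * of_real (\<phi> (sc \<omega> x))" using that by (simp add: f_def algebra_simps)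
      ultimately show ?thesis using om by simp
    qed
    have hom: "f (sc c x) = c * f x" if "x \<in> C" for c x
    proof -
      obtain a b where c: "c = of_real a + of_real b * \<omega>" using span by blast
      have "sc c x = rscale a x + rscale b (sc \<omega> x)" by (simp add: c rscale_def V.scale_left_distrib)
      then show ?thesis using that add homr homw by (simp add: c algebra_simps)
    qed
    have bound: "norm (f x) \<le> 2 * N x" if "x \<in> C" for x
    proof -
      have "norm (f x) \<le> \<bar>\<phi> x\<bar> + \<bar>\<phi> (sc \<omega> x)\<bar>"
        using that norm_triangle_ineq4[of "of_real (\<phi> x)" "\<omega> * of_real (\<phi> (sc \<omega> x)) :: 'k"] by (simp add: f_def norm_mult norm_omega_1)
      also have "\<dots> \<le> N x + N (sc \<omega> x)" using that by (intro add_mono \<phi>N) auto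
      finally show ?thesis using that by (simp add: N_sc norm_omega_1)
    qed
    have "f \<in> carr (dual Y)" by (rule dualI[where B = 2]) (use add hom bound in \<open>auto simp: f_def\<close>)
    \<comment> \<open>Orthogonality of 1 and \<omega> makes \<phi> the real part of
      \<open>f\<close>, so nothing is lost at \<open>y\<close>.\<close>
    moreover have "norm (f y) \<ge> d"
    proof -
      have "f y \<bullet> 1 = \<phi> y * (1 \<bullet> (1::'k)) - \<phi> (sc \<omega> y) * (\<omega> \<bullet> 1)"
        using y by (simp add: f_def inner_diff_left of_real_def)
      also have "\<dots> = \<phi> y" using om by (simp add: inner_commute dot_square_norm)
      finally have "\<phi> y = f y \<bullet> 1" by simp
      also have "\<dots> \<le> norm (f y) * norm (1::'k)" by (rule norm_cauchy_schwarz)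
      finally show ?thesis using py by simp
    qed
    moreover have "f m = 0" if "m \<in> M" for m
      using \<phi>M that V.subspace_scale[OF M(1) that] by (simp add: f_def)
    ultimately show ?thesis using bound by blast
  qed
qed

lemma norming_functional: "y \<in> C \<Longrightarrow> \<exists>f\<in>carr (dual Y). (\<forall>x\<in>C. norm (f x) \<le> 2 * N x) \<and> norm (f y) \<ge> N y"
  using separation[of "{0}" y "N y"] V.subspace_single_0 by auto

lemma convergent_of_Cauchy:
  assumes B: "banach_space Y" and s: "\<And>n. s n \<in> C" and c: "\<And>e. e > 0 \<Longrightarrow> \<exists>M. \<forall>m\<ge>M. \<forall>n\<ge>M. N (s m - s n) < e"
  shows "\<exists>l\<in>C. (\<lambda>n. N (s n - l)) \<longlonglongrightarrow> 0"
proof -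
  interpret M: Metric_space C "ndist Y" by (rule normed_space_Metric_space[OF ns])
  have "M.MCauchy s"
    unfolding M.MCauchy_def using s c by (auto simp: ndist_def)
  then obtain l where "limitin M.mtopology s l sequentially" using B by (auto simp: banach_space_def M.mcomplete_def)
  then have l: "l \<in> C" "(\<lambda>n. ndist Y (s n) l) \<longlonglongrightarrow> 0" by (auto simp: M.limitin_metric_dist_null)
  moreover have "ndist Y (s n) l = N (s n - l)" for n using s l by (simp add: ndist_def)
  ultimately show ?thesis by auto
qed

text \<open>The \<open>w n\<close> are approximate solutions of V w = x with bounded defects x - V
  (w n). The Cesaro means of the defects stay bounded, and V sends them to 0 in norm because the
  summed images are bounded. A weak limit \<open>g\<close> of the means therefore lies in the
  kernel, and x - g is a weak limit of elements of the range. In this form the argument covers T -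
  1, T + 1 and the quadratic factor.\<close>

lemma mean_ergodic_abstract:
  fixes w :: "nat \<Rightarrow> 'a"
  assumes R: "reflexive Y" and V: "\<And>x. x \<in> C \<Longrightarrow> V x \<in> C" "\<And>x y. x \<in> C \<Longrightarrow> y \<in> C \<Longrightarrow> V (x + y) = V x + V y"
    "\<And>c x. x \<in> C \<Longrightarrow> V (sc c x) = sc c (V x)" "\<And>x. x \<in> C \<Longrightarrow> N (V x) \<le> L * N x"
    and x: "x \<in> C" and w: "\<And>n. w n \<in> C" and B: "\<And>n. N (x - V (w n)) \<le> B" and B': "\<And>n. N (\<Sum>i<n. V (x - V (w i))) \<le> B'"
  shows "\<exists>g\<in>C. V g = 0 \<and> (\<forall>e>0. \<exists>v\<in>C. N (x - g - V v) < e)"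
proof -
  have Vsum: "V (\<Sum>i\<in>A. f i) = (\<Sum>i\<in>A. V (f i))" if "finite A" "\<And>i. i \<in> A \<Longrightarrow> f i \<in> C" for A and f :: "nat \<Rightarrow> 'a"
    using that
  proof (induction A rule: finite_induct)
    case empty
    then show ?case using V(3)[OF zero_in, of 0] by simp
  next
    case (insert i A)
    then show ?case using V(2) by (simp add: sum_in)
  qed
  have Vdiff: "V (x - y) = V x - V y" if "x \<in> C" "y \<in> C" for x y
    using V(2)[of x "sc (-1) y"] V(3)[of y "-1"] that by simp
  have Vrs: "V (rscale r x) = rscale r (V x)" if "x \<in> C" for r x using V(3) that by (simp add: rscale_def)
  define a where "a n = rscale (1 / real (Suc n)) (\<Sum>i<Suc n. x - V (w i))" for n
  define u where "u n = rscale (1 / real (Suc n)) (\<Sum>i<Suc n. w i)" for n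
  have aC: "a n \<in> C" for n unfolding a_def using x w V(1) by (intro rscale_in sum_in) auto
  have uC: "u n \<in> C" for n unfolding u_def using w by (intro rscale_in sum_in) auto
  have xa: "x - a n = V (u n)" for n
  proof -
    have "V (u n) = rscale (1 / real (Suc n)) (\<Sum>i<Suc n. V (w i))" unfolding u_def using w by (simp add: Vrs sum_in Vsum del: sum.lessThan_Suc)
    moreover have "a n = rscale (1 / real (Suc n)) ((\<Sum>i<Suc n. x) - (\<Sum>i<Suc n. V (w i)))" by (simp only: a_def sum_subtractf)
    moreover have "rscale (1 / real (Suc n)) (\<Sum>i<Suc n. x) = x"
    proof -
      have "(\<Sum>i<m. x) = rscale (real m) x" for m by (induction m) (auto simp: rscale_add2 add.commute)
      then have "rscale (1 / real (Suc n)) (\<Sum>i<Suc n. x) = rscale (1 / real (Suc n)) (rscale (real (Suc n)) x)" by (simp only:)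
      then show ?thesis by simp
    qed
    ultimately show ?thesis by (simp add: rscale_diff del: sum.lessThan_Suc)
  qed
  have Na: "N (a n) \<le> B" for n
  proof -
    have "(\<Sum>i<Suc n. x - V (w i)) \<in> C" using x w V(1) by (intro sum_in) auto
    then have "N (a n) = 1 / real (Suc n) * N (\<Sum>i<Suc n. x - V (w i))" unfolding a_def by (subst N_rs) auto
    also have "\<dots> \<le> 1 / real (Suc n) * (\<Sum>i<Suc n. N (x - V (w i)))" using x w V(1) by (intro mult_left_mono N_sum) auto
    also have "\<dots> \<le> 1 / real (Suc n) * (\<Sum>i<Suc n. B)" using B by (intro mult_left_mono sum_mono) auto
    also have "\<dots> = B" by simp
    finally show ?thesis .
  qed
  have Va: "N (V (a n)) \<le> B' / real (Suc n)" for n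
  proof -
    have "V (a n) = rscale (1 / real (Suc n)) (\<Sum>i<Suc n. V (x - V (w i)))" unfolding a_def using x w V(1) by (simp add: Vrs sum_in Vsum del: sum.lessThan_Suc)
    then have "N (V (a n)) = 1 / real (Suc n) * N (\<Sum>i<Suc n. V (x - V (w i)))" using x w V(1) by (simp add: N_rs sum_in del: sum.lessThan_Suc)
    also have "\<dots> \<le> 1 / real (Suc n) * B'" using B'[of "Suc n"] by (intro mult_left_mono) auto
    finally show ?thesis by simp
  qed
  have B0: "B \<ge> 0" using B[of 0] x w V(1) by (meson N_nonneg diff_in order_trans)
  have fa: "norm (f (a n)) \<le> nrm (dual Y) f * B" if "f \<in> carr (dual Y)" for f n
  proof -
    have "0 \<le> nrm (dual Y) f" using normed_space_nonneg[OF normed_space_dual[OF ns] that] .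
    then show ?thesis using dual_norm_le[OF that aC[of n]] Na[of n] by (meson mult_left_mono order_trans)
  qed
  have Bs: "Bseq (\<lambda>n. f (a n))" if "f \<in> carr (dual Y)" for f using fa[OF that] by (rule BseqI')
  \<comment> \<open>The generalised limit of the functional values is an element of the bidual;
    reflexivity turns it into the vector \<open>g\<close>, in place of a weakly convergent
    subsequence.\<close>
  define \<Phi> where "\<Phi> f = (if f \<in> carr (dual Y) then glimk (\<lambda>n. f (a n)) else 0)" for f
  interpret D: normed_ctx \<omega> "dual Y" by unfold_locales (rule normed_space_dual[OF ns])
  have "\<Phi> \<in> carr (dual (dual Y))"
  proof (rule D.dualI)
    show "\<Phi> (f + g) = \<Phi> f + \<Phi> g" if "f \<in> carr (dual Y)" "g \<in> carr (dual Y)" for f g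
      using that glimk_add[OF Bs[OF that(1)] Bs[OF that(2)]] by (simp add: \<Phi>_def)
    show "\<Phi> (scal (dual Y) c f) = c * \<Phi> f" if "f \<in> carr (dual Y)" for c f
      using that glimk_mult[OF Bs[OF that], of c] D.sc_in[OF that, of c] by (simp add: \<Phi>_def dual_def)
    show "norm (\<Phi> f) \<le> (real DIM('k) * B) * nrm (dual Y) f" if "f \<in> carr (dual Y)" for f
      using glimk_bound[of "\<lambda>n. f (a n)", OF fa[OF that]] that by (simp add: \<Phi>_def mult_ac)
  qed (simp add: \<Phi>_def)
  then obtain g where g: "g \<in> C" "canonical_embedding Y g = \<Phi>" using R unfolding reflexive_def by force
  have fg: "f g = glimk (\<lambda>n. f (a n))" if "f \<in> carr (dual Y)" for f
    using fun_cong[OF g(2), of f] that by (simp add: canonical_embedding_def \<Phi>_def)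
  have fVg: "f (V g) = 0" if f: "f \<in> carr (dual Y)" for f
  proof -
    define h where "h z = (if z \<in> C then f (V z) else 0)" for z
    obtain K where K: "K \<ge> 0" "\<forall>x\<in>C. norm (f x) \<le> K * N x" using dualD(4)[OF f] by blast
    have h: "h \<in> carr (dual Y)"
    proof (rule dualI)
      show "norm (h z) \<le> (K * L) * N z" if "z \<in> C" for z
      proof -
        have "norm (h z) \<le> K * N (V z)" using K V(1) that by (simp add: h_def)
        also have "\<dots> \<le> K * (L * N z)" using K V(4) that by (intro mult_left_mono) auto
        finally show ?thesis by simp
      qed
    qed (use V(1-3) dualD[OF f] in \<open>auto simp: h_def\<close>)
    have "(\<lambda>n. h (a n)) \<longlonglongrightarrow> 0"
    proof (rule Lim_null_comparison)
      show "\<forall>\<^sub>F n in sequentially. norm (h (a n)) \<le> nrm (dual Y) f * (B' / real (Suc n))"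
      proof (rule always_eventually, rule allI)
        fix n
        have "norm (h (a n)) \<le> nrm (dual Y) f * N (V (a n))" using dual_norm_le[OF f V(1)[OF aC]] aC by (simp add: h_def)
        also have "\<dots> \<le> nrm (dual Y) f * (B' / real (Suc n))" using D.N_nonneg[OF f] Va by (intro mult_left_mono) auto
        finally show "norm (h (a n)) \<le> nrm (dual Y) f * (B' / real (Suc n))" .
      qed
      show "(\<lambda>n. nrm (dual Y) f * (B' / real (Suc n))) \<longlonglongrightarrow> 0"
        by (intro tendsto_mult_right_zero LIMSEQ_Suc[OF lim_const_over_n])
    qed
    then have "h g = 0" unfolding fg[OF h] by (rule glimk_tendsto_0)
    then show ?thesis using g by (simp add: h_def)
  qed
  have "V g = 0"
  proof -
    obtain f where f: "f \<in> carr (dual Y)" "norm (f (V g)) \<ge> N (V g)" using norming_functional[OF V(1)[OF g(1)]] by blast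
    have "N (V g) \<le> 0" using f(2) fVg[OF f(1)] by simp
    then show ?thesis using N_eq0[OF V(1)[OF g(1)]] N_nonneg[OF V(1)[OF g(1)]] by simp
  qed
  \<comment> \<open>If x - g had positive distance from the range, a functional vanishing on the
    range would detect it. But such a functional has the same value at x and at all means, hence at
    g.\<close>
  moreover have "\<exists>v\<in>C. N (x - g - V v) < e" if e: "e > 0" for e
  proof (rule ccontr)
    assume "\<not> (\<exists>v\<in>C. N (x - g - V v) < e)"
    then have far: "e \<le> N (x - g - m)" if "m \<in> V ` C" for m using that by (auto simp: not_less)
    have "V.subspace (V ` C)"
    proof (rule V.subspaceI)
      have "V 0 = 0" using V(3)[OF zero_in, of 0] by simp
      then show "0 \<in> V ` C" by (metis imageI zero_in)
      show "x + y \<in> V ` C" if "x \<in> V ` C" "y \<in> V ` C" for x y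
        using that V(2) add_in by (metis (no_types, lifting) imageE imageI)
      show "sc c x \<in> V ` C" if "x \<in> V ` C" for c x
        using that V(3) sc_in by (metis (no_types, lifting) imageE imageI)
    qed
    then obtain f where f: "f \<in> carr (dual Y)" "\<forall>m\<in>V ` C. f m = 0" "norm (f (x - g)) \<ge> e"
      using separation[of "V ` C" "x - g" e] far x g V(1) e by force
    have "f x + (- 1) * f (a n) = 0" for n
      using dual_diff[OF f(1) x aC[of n]] f(2) uC[of n] by (simp add: xa)
    then have "glimk (\<lambda>n. f x + (-1) * f (a n)) = 0" using glimk_const[of "0::'k"] by simp
    moreover have "glimk (\<lambda>n. f x + (-1) * f (a n)) = f x + (-1) * f g"
      using glimk_add[of "\<lambda>n. f x" "\<lambda>n. (-1) * f (a n)"] Bseq_times[OF Bs[OF f(1)], of "-1"] glimk_mult[OF Bs[OF f(1)], of "-1"] fg[OF f(1)] glimk_const[of "f x"] by simp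
    ultimately have "f (x - g) = 0" using dual_diff[OF f(1) x g(1)] by simp
    then show False using f(3) e by simp
  qed
  ultimately show ?thesis using g by blast
qed

end

section \<open>Noncompactness of the orbits of a power-bounded operator\<close>

locale power_bounded_op = normed_ctx \<omega> Y
  for \<omega> :: "'k::{real_normed_field, euclidean_space}" and Y :: "('k, 'a::ab_group_add) nspace" +
  fixes T :: "'a \<Rightarrow> 'a" and K :: real
  assumes T_in [simp]: "x \<in> C \<Longrightarrow> T x \<in> C"
    and T_add: "x \<in> C \<Longrightarrow> y \<in> C \<Longrightarrow> T (x + y) = T x + T y"
    and T_sc: "x \<in> C \<Longrightarrow> T (sc c x) = sc c (T x)"
    and T_pow: "x \<in> C \<Longrightarrow> N ((T ^^ n) x) \<le> K * N x"
    and K1: "K \<ge> 1"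
begin

lemma Tn_in [simp]: "x \<in> C \<Longrightarrow> (T ^^ n) x \<in> C"
  by (induction n) auto
lemma Tn_add: "x \<in> C \<Longrightarrow> y \<in> C \<Longrightarrow> (T ^^ n) (x + y) = (T ^^ n) x + (T ^^ n) y"
  by (induction n) (auto simp: T_add)
lemma Tn_sc: "x \<in> C \<Longrightarrow> (T ^^ n) (sc c x) = sc c ((T ^^ n) x)"
  by (induction n) (auto simp: T_sc)
lemma Tn_rs: "x \<in> C \<Longrightarrow> (T ^^ n) (rscale c x) = rscale c ((T ^^ n) x)"
  by (simp add: rscale_def Tn_sc)
lemma T_rs: "x \<in> C \<Longrightarrow> T (rscale c x) = rscale c (T x)"
  by (simp add: rscale_def T_sc)
lemma Tn_diff: "x \<in> C \<Longrightarrow> y \<in> C \<Longrightarrow> (T ^^ n) (x - y) = (T ^^ n) x - (T ^^ n) y"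
  using Tn_add[of x "rscale (-1) y" n] Tn_rs[of y n "-1"] by (simp add: rscale_neg)
lemma T_diff: "x \<in> C \<Longrightarrow> y \<in> C \<Longrightarrow> T (x - y) = T x - T y"
  using Tn_diff[of x y 1] by simp
lemma T_0 [simp]: "T 0 = 0"
  using T_diff[of 0 0] by simp
lemma Tn_0 [simp]: "(T ^^ n) 0 = 0"
  by (induction n) auto
lemma T_norm: "x \<in> C \<Longrightarrow> N (T x) \<le> K * N x"
  using T_pow[of x 1] by simp
lemma T_Tn: "T ((T ^^ n) x) = (T ^^ n) (T x)"
  by (simp add: funpow_swap1)

definition covered :: "real \<Rightarrow> 'a \<Rightarrow> bool" where
  "covered e y \<longleftrightarrow> (\<exists>F. finite F \<and> F \<subseteq> C \<and> (\<forall>n. \<exists>a\<in>F. N ((T ^^ n) y - a) \<le> e))"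

text \<open>The Kuratowski-type measure of noncompactness of the orbit of \<open>y\<close>.\<close>

definition kap :: "'a \<Rightarrow> real" where
  "kap y = Inf {e. covered e y}"

lemma covered_nonneg: "y \<in> C \<Longrightarrow> covered e y \<Longrightarrow> e \<ge> 0"
  unfolding covered_def by (meson N_nonneg Tn_in diff_in order_trans subsetD)

lemma covered_norm: "y \<in> C \<Longrightarrow> covered (K * N y) y"
  unfolding covered_def by (intro exI[of _ "{0}"]) (auto simp: T_pow)

lemma covered_mono: "covered e y \<Longrightarrow> e \<le> e' \<Longrightarrow> covered e' y"
  unfolding covered_def by (meson order_trans)

lemma kap_le: "y \<in> C \<Longrightarrow> covered e y \<Longrightarrow> kap y \<le> e"
  unfolding kap_def using covered_nonneg by (intro cInf_lower bdd_belowI[of _ 0]) auto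

lemma kap_nonneg: "y \<in> C \<Longrightarrow> 0 \<le> kap y"
  unfolding kap_def using covered_nonneg covered_norm by (intro cInf_greatest) auto

lemma kap_cover: assumes "y \<in> C" "e > kap y" shows "covered e y"
proof -
  have "{e. covered e y} \<noteq> {}" using covered_norm[OF assms(1)] by blast
  then obtain e' where "covered e' y" "e' < e" using cInf_lessD[of "{e. covered e y}" e] assms by (auto simp: kap_def)
  then show ?thesis using covered_mono by (meson less_imp_le)
qed

lemma kap_norm: "y \<in> C \<Longrightarrow> kap y \<le> K * N y"
  using kap_le covered_norm by blast

lemma kap_add: assumes x: "x \<in> C" and y: "y \<in> C" shows "kap (x + y) \<le> kap x + kap y"
proof (rule field_le_epsilon)
  fix e :: real assume e: "e > 0"
  obtain F where F: "finite F" "F \<subseteq> C" "\<And>n. \<exists>a\<in>F. N ((T ^^ n) x - a) \<le> kap x + e / 2"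
    using kap_cover[OF x, of "kap x + e / 2"] e by (auto simp: covered_def)
  obtain G where G: "finite G" "G \<subseteq> C" "\<And>n. \<exists>a\<in>G. N ((T ^^ n) y - a) \<le> kap y + e / 2"
    using kap_cover[OF y, of "kap y + e / 2"] e by (auto simp: covered_def)
  have "covered (kap x + kap y + e) (x + y)"
    unfolding covered_def
  proof (intro exI conjI allI)
    show "finite ((\<lambda>(a, b). a + b) ` (F \<times> G))" using F G by auto
    show "(\<lambda>(a, b). a + b) ` (F \<times> G) \<subseteq> C" using F(2) G(2) by (auto intro!: add_in)
    fix n
    obtain a b where ab: "a \<in> F" "N ((T ^^ n) x - a) \<le> kap x + e / 2" "b \<in> G" "N ((T ^^ n) y - b) \<le> kap y + e / 2" using F(3) G(3) by blast
    have in_C: "a \<in> C" "b \<in> C" using ab F G by auto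
    have "(T ^^ n) (x + y) - (a + b) = ((T ^^ n) x - a) + ((T ^^ n) y - b)" using x y by (simp add: Tn_add)
    also have "N \<dots> \<le> N ((T ^^ n) x - a) + N ((T ^^ n) y - b)" using x y in_C by (intro N_tri) auto
    finally have "N ((T ^^ n) (x + y) - (a + b)) \<le> kap x + kap y + e" using ab by simp
    then show "\<exists>a\<in>(\<lambda>(a, b). a + b) ` (F \<times> G). N ((T ^^ n) (x + y) - a) \<le> kap x + kap y + e" using ab by force
  qed
  then show "kap (x + y) \<le> kap x + kap y + e" using x y by (intro kap_le) auto
qed

text \<open>A commuting Lipschitz map carries a finite net for the orbit of \<open>y\<close> to one
  for the orbit of \<open>A y\<close>. The division by L + 1 in the proof takes care of L =
  0.\<close>

lemma kap_commuting:
  assumes A: "\<And>x. x \<in> C \<Longrightarrow> A x \<in> C" "\<And>x y. x \<in> C \<Longrightarrow> y \<in> C \<Longrightarrow> N (A x - A y) \<le> L * N (x - y)" "\<And>x. x \<in> C \<Longrightarrow> T (A x) = A (T x)"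
    and L: "L \<ge> 0" and y: "y \<in> C"
  shows "kap (A y) \<le> L * kap y"
proof -
  have AT: "(T ^^ n) (A y) = A ((T ^^ n) y)" for n using y by (induction n) (auto simp: A)
  have le: "kap (A y) \<le> L * (kap y + e)" if e: "e > 0" for e
  proof -
    obtain F where F: "finite F" "F \<subseteq> C" "\<And>n. \<exists>a\<in>F. N ((T ^^ n) y - a) \<le> kap y + e"
      using kap_cover[OF y, of "kap y + e"] e by (auto simp: covered_def)
    have "covered (L * (kap y + e)) (A y)"
      unfolding covered_def
    proof (intro exI conjI allI)
      show "finite (A ` F)" "A ` F \<subseteq> C" using F A(1) by auto
      fix n
      obtain a where a: "a \<in> F" "N ((T ^^ n) y - a) \<le> kap y + e" using F(3) by blast
      have "N ((T ^^ n) (A y) - A a) \<le> L * N ((T ^^ n) y - a)" unfolding AT using a F y by (intro A(2)) auto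
      also have "\<dots> \<le> L * (kap y + e)" using a L by (intro mult_left_mono) auto
      finally show "\<exists>a\<in>A ` F. N ((T ^^ n) (A y) - a) \<le> L * (kap y + e)" using a by blast
    qed
    then show ?thesis using A(1) y by (intro kap_le) auto
  qed
  show ?thesis
  proof (rule field_le_epsilon)
    fix e :: real assume e: "e > 0"
    have "kap (A y) \<le> L * (kap y + e / (L + 1))" using e L by (intro le) auto
    also have "\<dots> = L * kap y + L / (L + 1) * e" by (simp add: algebra_simps)
    also have "L / (L + 1) * e \<le> 1 * e" using e L by (intro mult_right_mono) (auto simp: divide_le_eq)
    finally show "kap (A y) \<le> L * kap y + e" by simp
  qed
qed

lemma kap_rs: assumes y: "y \<in> C" shows "kap (rscale r y) = \<bar>r\<bar> * kap y"
proof -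
  have le: "kap (rscale r y) \<le> \<bar>r\<bar> * kap y" if "y \<in> C" for r y
    using that by (intro kap_commuting) (auto simp: rscale_diff[symmetric] N_rs T_rs)
  show ?thesis
  proof (cases "r = 0")
    case True
    have "kap 0 \<le> 0" using kap_norm[of 0] by simp
    then show ?thesis using True kap_nonneg[of 0] by simp
  next
    case False
    have "kap (rscale (1 / r) (rscale r y)) \<le> \<bar>1 / r\<bar> * kap (rscale r y)" using y by (intro le) auto
    then have "\<bar>r\<bar> * kap y \<le> kap (rscale r y)" using False by (simp add: field_simps)
    then show ?thesis using le[OF y, of r] by simp
  qed
qed

text \<open>Dropping or adding one orbit point does not change whether finitely many balls of a
  given radius cover the orbit. This invariance is what lets functionals bounded by
  \<open>kap\<close> follow the orbit backwards in time.\<close>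

lemma kap_T: assumes y: "y \<in> C" shows "kap (T y) = kap y"
proof (rule antisym)
  have "covered e (T y)" if "covered e y" for e
    using that unfolding covered_def by (metis funpow_swap1 funpow_Suc_right o_apply)
  then have "kap (T y) \<le> e" if "covered e y" for e using kap_le[of "T y" e] y that by auto
  then show "kap (T y) \<le> kap y"
    unfolding kap_def[of y] using covered_norm[OF y] by (intro cInf_greatest) auto
  have "covered e y" if c: "covered e (T y)" for e
  proof -
    obtain F where F: "finite F" "F \<subseteq> C" "\<And>n. \<exists>a\<in>F. N ((T ^^ n) (T y) - a) \<le> e" using c by (auto simp: covered_def)
    show ?thesis
      unfolding covered_def
    proof (intro exI conjI allI)
      show "finite (insert y F)" "insert y F \<subseteq> C" using F y by auto
      fix n
      show "\<exists>a\<in>insert y F. N ((T ^^ n) y - a) \<le> e"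
      proof (cases n)
        case 0
        have "e \<ge> 0" using covered_nonneg[OF _ c] y by simp
        then show ?thesis using 0 by simp
      next
        case (Suc m)
        then show ?thesis using F(3)[of m] by (auto simp: T_Tn)
      qed
    qed
  qed
  then have "kap y \<le> e" if "covered e (T y)" for e using kap_le[OF y] that by auto
  then show "kap y \<le> kap (T y)"
    unfolding kap_def[of "T y"] using covered_norm[of "T y"] y by (intro cInf_greatest) auto
qed

lemma kap_Tn: "y \<in> C \<Longrightarrow> kap ((T ^^ n) y) = kap y"
  by (induction n) (auto simp: kap_T)

definition qop :: "real \<Rightarrow> 'a \<Rightarrow> 'a" where
  "qop c x = T (T x) - rscale (2 * c) (T x) + x"

text \<open>Time n is read relative to a base point m that goes to infinity, which gives a meaning
  to negative n. \<open>nat\<close> truncates only for m < -n, finitely many indices that the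
  generalised limit ignores.\<close>

definition orbit_functional :: "(nat \<Rightarrow> 'a \<Rightarrow> real) \<Rightarrow> 'a \<Rightarrow> int \<Rightarrow> real" where
  "orbit_functional \<phi> y n = glim (\<lambda>m. \<phi> m ((T ^^ nat (int m + n)) y))"

text \<open>Modulo vectors with \<open>kap\<close> zero, \<open>Q\<close> is a right inverse of the
  quadratic factor, so its powers at \<open>y\<close> produce the chain of preimages, of geometric
  growth, that the Tauberian theorem asks for. The functionals are bounded by \<open>kap\<close>, so
  the errors disappear exactly in the limit sequences.\<close>

lemma kap_regular_imp:
  assumes c0: "\<bar>c0\<bar> < 1"
    and reg: "\<And>c. \<bar>c\<bar> < 1 \<Longrightarrow> c \<noteq> c0 \<Longrightarrow> \<exists>Q D. \<forall>y\<in>C. Q y \<in> C \<and> kap (Q y) \<le> D * kap y \<and> kap (qop c (Q y) - y) = 0"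
    and y: "y \<in> C"
  shows "kap ((T ^^ 4) y - rscale (2 * c0) ((T ^^ 3) y) + rscale (2 * c0) (T y) - y) = 0"
proof -
  define w where "w = (T ^^ 4) y - rscale (2 * c0) ((T ^^ 3) y) + rscale (2 * c0) (T y) - y"
  have w: "w \<in> C" using y by (simp add: w_def)
  \<comment> \<open>The functional with index m norms T^m w. Since \<open>kap\<close> of T^m w does
    not depend on m, the sequence attached to \<open>w\<close> has the value \<open>kap w\<close> at
    time 0.\<close>
  have "\<exists>\<phi>. (\<forall>x\<in>C. \<forall>z\<in>C. \<phi> (x + z) = \<phi> x + \<phi> z) \<and> (\<forall>c. \<forall>x\<in>C. \<phi> (rscale c x) = c * \<phi> x) \<and> (\<forall>x\<in>C. \<bar>\<phi> x\<bar> \<le> kap x) \<and> \<phi> ((T ^^ m) w) = kap ((T ^^ m) w)" for m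
    using w by (intro hahn_banach_seminorm[OF rscale_vector_space rscale_sub]) (auto simp: kap_add kap_rs)
  then obtain \<phi> where \<phi>: "\<And>m x z. x \<in> C \<Longrightarrow> z \<in> C \<Longrightarrow> \<phi> m (x + z) = \<phi> m x + \<phi> m z" "\<And>m c x. x \<in> C \<Longrightarrow> \<phi> m (rscale c x) = c * \<phi> m x"
    "\<And>m x. x \<in> C \<Longrightarrow> \<bar>\<phi> m x\<bar> \<le> kap x" "\<And>m. \<phi> m ((T ^^ m) w) = kap ((T ^^ m) w)" by metis
  let ?b = "orbit_functional \<phi>"
  have bd: "\<bar>\<phi> m ((T ^^ k) x)\<bar> \<le> kap x" if "x \<in> C" for m k x using \<phi>(3)[of "(T ^^ k) x" m] that by (simp add: kap_Tn)
  have Bs: "Bseq (\<lambda>m. \<phi> m ((T ^^ nat (int m + n)) x))" if "x \<in> C" for n x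
    using bd[OF that] by (intro BseqI') auto
  have b_le: "\<bar>?b x n\<bar> \<le> kap x" if "x \<in> C" for x n
    unfolding orbit_functional_def using bd[OF that] by (intro glim_bound[OF Bs[OF that]]) auto
  have b_add: "?b (x + z) n = ?b x n + ?b z n" if "x \<in> C" "z \<in> C" for x z n
    unfolding orbit_functional_def using that glim_add[OF Bs[OF that(1)] Bs[OF that(2)]] by (simp add: Tn_add \<phi>(1))
  have b_rs: "?b (rscale r x) n = r * ?b x n" if "x \<in> C" for x r n
    unfolding orbit_functional_def using that glim_scale[OF Bs[OF that]] by (simp add: Tn_rs \<phi>(2))
  have b_diff: "?b (x - z) n = ?b x n - ?b z n" if "x \<in> C" "z \<in> C" for x z n
    using b_add[of x "rscale (-1) z" n] b_rs[of z "-1" n] that by (simp add: rscale_neg)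
  have b_T: "?b (T x) n = ?b x (n + 1)" if x: "x \<in> C" for x n
    unfolding orbit_functional_def
  proof (rule glim_cong)
    show "Bseq (\<lambda>m. \<phi> m ((T ^^ nat (int m + n)) (T x)))" using x by (intro Bs) auto
    show "Bseq (\<lambda>m. \<phi> m ((T ^^ nat (int m + (n + 1))) x))" using x by (intro Bs) auto
    show "\<forall>\<^sub>F m in sequentially. \<phi> m ((T ^^ nat (int m + n)) (T x)) = \<phi> m ((T ^^ nat (int m + (n + 1))) x)"
      using eventually_ge_at_top[of "nat (- n)"]
    proof eventually_elim
      case (elim m)
      then have "nat (int m + (n + 1)) = Suc (nat (int m + n))" by linarith
      then show ?case by (simp add: T_Tn)
    qed
  qed
  have b_Tn: "?b ((T ^^ k) x) n = ?b x (n + int k)" if "x \<in> C" for x k n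
    using that by (induction k arbitrary: n) (auto simp: b_T add_ac)
  have b_w: "?b w 0 = kap w"
    unfolding orbit_functional_def using \<phi>(4) w by (simp add: kap_Tn glim_const)
  have "?b y 4 - 2 * c0 * ?b y 3 + 2 * c0 * ?b y 1 - ?b y 0 = 0"
  proof (rule two_sided_tauberian[OF b_le[OF y] c0])
    fix c :: real assume c: "\<bar>c\<bar> < 1" "c \<noteq> c0"
    obtain Q D where Q: "\<And>y. y \<in> C \<Longrightarrow> Q y \<in> C" "\<And>y. y \<in> C \<Longrightarrow> kap (Q y) \<le> D * kap y" "\<And>y. y \<in> C \<Longrightarrow> kap (qop c (Q y) - y) = 0"
      using reg[OF c] by blast
    define \<beta> where "\<beta> k = ?b ((Q ^^ k) y)" for k
    have Qk: "(Q ^^ k) y \<in> C" for k using y Q(1) by (induction k) auto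
    show "\<exists>D \<beta>. \<beta> (0::nat) = ?b y \<and> (\<forall>k n. \<beta> k n = \<beta> (Suc k) (n + 2) - 2 * c * \<beta> (Suc k) (n + 1) + \<beta> (Suc k) n)
       \<and> (\<forall>k n. \<bar>\<beta> k n\<bar> \<le> kap y * D ^ k) \<and> D > 0"
    proof (intro exI conjI allI)
      show "\<beta> 0 = ?b y" by (simp add: \<beta>_def)
      show "max D 1 > 0" by simp
      fix k n
      let ?x = "(Q ^^ k) y"
      have x: "?x \<in> C" "Q ?x \<in> C" using Qk Q(1) by auto
      have qx: "qop c (Q ?x) \<in> C" using x by (simp add: qop_def)
      have "\<bar>?b (qop c (Q ?x) - ?x) n\<bar> \<le> 0" using b_le[of "qop c (Q ?x) - ?x" n] Q(3)[OF x(1)] qx x by simp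
      then have "?b ?x n = ?b (qop c (Q ?x)) n" using b_diff[OF qx x(1), of n] by simp
      also have "\<dots> = ?b (Q ?x) (n + 2) - 2 * c * ?b (Q ?x) (n + 1) + ?b (Q ?x) n"
        unfolding qop_def using x by (simp add: b_add b_diff b_rs b_T add_ac)
      finally show "\<beta> k n = \<beta> (Suc k) (n + 2) - 2 * c * \<beta> (Suc k) (n + 1) + \<beta> (Suc k) n" by (simp add: \<beta>_def)
      have "kap ((Q ^^ k) y) \<le> kap y * max D 1 ^ k"
      proof (induction k)
        case (Suc k)
        have "kap ((Q ^^ Suc k) y) \<le> D * kap ((Q ^^ k) y)" using Q(2)[OF Qk] by simp
        also have "\<dots> \<le> max D 1 * kap ((Q ^^ k) y)" using kap_nonneg[OF Qk] by (intro mult_right_mono) auto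
        also have "\<dots> \<le> max D 1 * (kap y * max D 1 ^ k)" using Suc by (intro mult_left_mono) auto
        finally show ?case by (simp add: mult_ac)
      qed simp
      then show "\<bar>\<beta> k n\<bar> \<le> kap y * max D 1 ^ k" unfolding \<beta>_def using b_le[OF Qk] by (meson order_trans)
    qed
  qed
  moreover have "?b w 0 = ?b y 4 - 2 * c0 * ?b y 3 + 2 * c0 * ?b y 1 - ?b y 0"
    unfolding w_def using y by (simp only: b_add b_diff b_rs b_Tn b_T Tn_in rscale_in diff_in add_in T_in) simp
  ultimately show ?thesis using b_w by (simp add: w_def)
qed

text \<open>The mean ergodic splitting into the kernel of \<open>V\<close> and the closure of its
  range, in elementwise form.\<close>

definition ergodic_for :: "('a \<Rightarrow> 'a) \<Rightarrow> bool" where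
  "ergodic_for V \<longleftrightarrow> (\<forall>x\<in>C. \<exists>g\<in>C. V g = 0 \<and> (\<forall>e>0. \<exists>v\<in>C. N (x - g - V v) < e))"

text \<open>\<open>w M\<close> is a partial sum of the formal inverse of T - s, where 1/s = s. Its
  defect is s^M T^M x, so power boundedness gives both bounds of the abstract theorem, the second
  one by telescoping.\<close>

lemma ergodic_sign:
  assumes R: "reflexive Y" and s: "s = 1 \<or> s = -1"
  shows "ergodic_for (\<lambda>x. T x - rscale s x)"
  unfolding ergodic_for_def
proof
  fix x assume x: "x \<in> C"
  let ?V = "\<lambda>x. T x - rscale s x"
  have ss: "s * s = 1" "\<bar>s\<bar> = 1" "\<bar>s ^ n\<bar> = 1" for n using s by (auto simp: power_abs)
  define w where "w M = (\<Sum>n<M. rscale (- (s ^ Suc n)) ((T ^^ n) x))" for M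
  have wC: "w M \<in> C" for M unfolding w_def using x by (intro sum_in) auto
  have xV: "x - ?V (w M) = rscale (s ^ M) ((T ^^ M) x)" for M
  proof (induction M)
    case (Suc M)
    have *: "w (Suc M) = w M + rscale (- (s ^ Suc M)) ((T ^^ M) x)" by (simp add: w_def)
    have "?V (w (Suc M)) = ?V (w M) + ?V (rscale (- (s ^ Suc M)) ((T ^^ M) x))" unfolding * using wC x by (simp add: T_add rscale_add)
    also have "?V (rscale (- (s ^ Suc M)) ((T ^^ M) x)) = rscale (s ^ M) ((T ^^ M) x) - rscale (s ^ Suc M) ((T ^^ Suc M) x)"
      using x ss(1) by (simp add: T_rs mult.assoc[symmetric]) (simp add: rscale_neg)
    finally have "?V (w (Suc M)) = ?V (w M) + (rscale (s ^ M) ((T ^^ M) x) - rscale (s ^ Suc M) ((T ^^ Suc M) x))" .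
    then have "x - ?V (w (Suc M)) = (x - ?V (w M)) - (rscale (s ^ M) ((T ^^ M) x) - rscale (s ^ Suc M) ((T ^^ Suc M) x))"
      by (simp only: diff_diff_eq)
    then show ?case unfolding Suc by simp
  qed (simp add: w_def)
  have sB: "N (\<Sum>i<n. ?V (x - ?V (w i))) \<le> 2 * K * N x" for n
  proof -
    have "(\<Sum>i<n. ?V (x - ?V (w i))) = rscale (s ^ Suc n) ((T ^^ n) x) - rscale s x"
    proof (induction n)
      case (Suc n)
      have "s * s ^ n = s ^ n * s" by simp
      have "rscale (s ^ n) (T ((T ^^ n) x)) = rscale (s ^ Suc (Suc n)) ((T ^^ Suc n) x)" using ss(1) by (simp add: mult.assoc[symmetric])
      then show ?case using Suc x unfolding xV by (simp add: T_rs)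
    qed simp
    also have "N \<dots> \<le> N (rscale (s ^ Suc n) ((T ^^ n) x)) + N (rscale s x)" using x by (intro N_tri_minus) auto
    also have "\<dots> = N ((T ^^ n) x) + N x" using x ss by (simp add: N_rs abs_mult)
    also have "\<dots> \<le> K * N x + K * N x" using x T_pow K1 mult_right_mono[OF K1 N_nonneg[OF x]] by (intro add_mono) auto
    finally show ?thesis by simp
  qed
  show "\<exists>g\<in>C. ?V g = 0 \<and> (\<forall>e>0. \<exists>v\<in>C. N (x - g - ?V v) < e)"
  proof (rule mean_ergodic_abstract[OF R _ _ _ _ x wC, where V = ?V and L = "K + 1" and B = "K * N x" and B' = "2 * K * N x"])
    show "?V z \<in> C" if "z \<in> C" for z using that by simp
    show "?V (z + y) = ?V z + ?V y" if "z \<in> C" "y \<in> C" for z y using that by (simp add: T_add rscale_add)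
    show "?V (sc c z) = sc c (?V z)" if "z \<in> C" for c z using that by (simp add: T_sc rscale_def V.scale_right_diff_distrib mult.commute)
    show "N (?V z) \<le> (K + 1) * N z" if "z \<in> C" for z
      using N_tri_minus[of "T z" "rscale s z"] T_norm[OF that] N_rs[OF that, of s] ss that by (simp add: distrib_right)
    show "N (\<Sum>i<n. ?V (x - ?V (w i))) \<le> 2 * K * N x" for n by (rule sB)
    show "N (x - ?V (w n)) \<le> K * N x" for n unfolding xV using x T_pow ss by (simp add: N_rs)
  qed
qed

text \<open>The values \<open>U\<^bsub>n-1\<^esub>(c)\<close> of the Chebyshev polynomials of the second kind: the coefficients of the formal
  inverse of \<open>1 - 2 c T + T^2\<close>.\<close>

definition chev :: "real \<Rightarrow> nat \<Rightarrow> real" where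
  "chev c n = sin (real n * arccos c) / sin (arccos c)"

text \<open>With c = cos t and 0 < t < pi, the recurrence is the addition theorem and sin t > 0
  gives the uniform bound.\<close>

lemma chev_simps: assumes "\<bar>c\<bar> < 1"
  shows "chev c 0 = 0" "chev c (Suc 0) = 1" "chev c (Suc (Suc n)) = 2 * c * chev c (Suc n) - chev c n"
    and "\<bar>chev c n\<bar> \<le> 1 / sin (arccos c)" "sin (arccos c) > 0"
proof -
  have s: "sin (arccos c) > 0"
    using assms arccos_lt_bounded[of c] by (intro sin_gt_zero) auto
  then show "sin (arccos c) > 0" .
  show "chev c 0 = 0" "chev c (Suc 0) = 1" using s by (auto simp: chev_def)
  have cc: "cos (arccos c) = c" using assms by simp
  let ?t = "arccos c"
  have "real (Suc (Suc n)) * ?t = real (Suc n) * ?t + ?t" "real n * ?t = real (Suc n) * ?t - ?t" by (simp_all add: algebra_simps)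
  moreover have *: "a * c + b = 2 * c * a - (a * c - b)" for a b :: real by simp
  ultimately have "sin (real (Suc (Suc n)) * ?t) = 2 * c * sin (real (Suc n) * ?t) - sin (real n * ?t)"
    by (simp only: sin_add sin_diff cc)
  then show "chev c (Suc (Suc n)) = 2 * c * chev c (Suc n) - chev c n" by (simp add: chev_def diff_divide_distrib)
  show "\<bar>chev c n\<bar> \<le> 1 / sin (arccos c)"
    unfolding chev_def abs_divide using s by (intro frac_le) auto
qed

lemma qop_in [simp]: "x \<in> C \<Longrightarrow> qop c x \<in> C" by (simp add: qop_def)
lemma qop_add: "x \<in> C \<Longrightarrow> y \<in> C \<Longrightarrow> qop c (x + y) = qop c x + qop c y" by (simp add: qop_def T_add rscale_add)
lemma qop_sc: "x \<in> C \<Longrightarrow> qop c (sc a x) = sc a (qop c x)"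
  by (simp add: qop_def T_sc rscale_def V.scale_right_diff_distrib V.scale_right_distrib mult.commute)
lemma qop_rs: "x \<in> C \<Longrightarrow> qop c (rscale a x) = rscale a (qop c x)" by (simp add: rscale_def qop_sc)
lemma qop_T: "x \<in> C \<Longrightarrow> qop c (T x) = T (qop c x)" by (simp add: qop_def T_add T_diff T_rs)
lemma qop_diff: "x \<in> C \<Longrightarrow> y \<in> C \<Longrightarrow> qop c (x - y) = qop c x - qop c y"
  using qop_add[of x "rscale (-1) y" c] qop_rs[of y c "-1"] by (simp add: rscale_neg)
lemma qop_0 [simp]: "qop c 0 = 0" by (simp add: qop_def)
lemma qop_norm: "x \<in> C \<Longrightarrow> N (qop c x) \<le> (K + 2 * \<bar>c\<bar> * K + 1) * N x"
proof -
  assume x: "x \<in> C"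
  have "N (qop c x) \<le> N (T (T x) - rscale (2 * c) (T x)) + N x" unfolding qop_def using x by (intro N_tri) auto
  also have "\<dots> \<le> N (T (T x)) + N (rscale (2 * c) (T x)) + N x" using x N_tri_minus[of "T (T x)" "rscale (2 * c) (T x)"] by simp
  also have "\<dots> \<le> K * N x + 2 * \<bar>c\<bar> * (K * N x) + N x"
    using x T_pow[of x 2] T_norm[of x] by (intro add_mono) (auto simp: N_rs numeral_2_eq_2 abs_mult intro!: mult_left_mono)
  finally show ?thesis by (simp add: algebra_simps)
qed

text \<open>Cutting the formal inverse of the quadratic after M terms leaves only two terms, with
  coefficients \<open>chev c (Suc M)\<close> and \<open>chev c M\<close>, bounded because |c| <
  1.\<close>

lemma ergodic_qop:
  assumes R: "reflexive Y" and c: "\<bar>c\<bar> < 1"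
  shows "ergodic_for (qop c)"
  unfolding ergodic_for_def
proof
  fix x assume x: "x \<in> C"
  let ?u = "chev c"
  define w where "w M = (\<Sum>n<M. rscale (?u (Suc n)) ((T ^^ n) x))" for M
  have wC: "w M \<in> C" for M unfolding w_def using x by (intro sum_in) auto
  have xV: "x - qop c (w M) = rscale (?u (Suc M)) ((T ^^ M) x) - rscale (?u M) ((T ^^ Suc M) x)" for M
  proof (induction M)
    case 0
    then show ?case using chev_simps[OF c] by (simp add: w_def)
  next
    case (Suc M)
    let ?t = "\<lambda>n. (T ^^ n) x"
    have *: "w (Suc M) = w M + rscale (?u (Suc M)) (?t M)" by (simp add: w_def)
    have "qop c (w (Suc M)) = qop c (w M) + (rscale (?u (Suc M)) (?t (Suc (Suc M))) - rscale (2 * c * ?u (Suc M)) (?t (Suc M)) + rscale (?u (Suc M)) (?t M))"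
      unfolding * using wC x by (simp add: qop_add qop_rs) (simp add: qop_def rscale_add rscale_diff mult_ac)
    then have "x - qop c (w (Suc M)) = (x - qop c (w M)) - (rscale (?u (Suc M)) (?t (Suc (Suc M))) - rscale (2 * c * ?u (Suc M)) (?t (Suc M)) + rscale (?u (Suc M)) (?t M))"
      by (simp add: algebra_simps)
    also have "\<dots> = (rscale (2 * c * ?u (Suc M)) (?t (Suc M)) - rscale (?u M) (?t (Suc M))) - rscale (?u (Suc M)) (?t (Suc (Suc M)))"
      unfolding Suc by (simp add: algebra_simps)
    finally show ?case unfolding chev_simps(3)[OF c] rscale_diff2 .
  qed
  define B where "B = 1 / sin (arccos c)"
  have B: "\<bar>?u n\<bar> \<le> B" "B \<ge> 0" for n using chev_simps(4,5)[OF c] by (auto simp: B_def)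
  have g: "N (x - qop c (w M)) \<le> 2 * B * (K * N x)" for M
  proof -
    have "N (x - qop c (w M)) \<le> N (rscale (?u (Suc M)) ((T ^^ M) x)) + N (rscale (?u M) ((T ^^ Suc M) x))" unfolding xV using x by (intro N_tri_minus) auto
    also have "\<dots> \<le> B * (K * N x) + B * (K * N x)"
      unfolding N_rs[OF Tn_in[OF x]] using B T_pow[OF x] x by (intro add_mono mult_mono) (auto simp del: funpow.simps)
    finally show ?thesis by simp
  qed
  have qw: "N (qop c (w M)) \<le> N x + 2 * B * (K * N x)" for M
    using g[of M] N_tri_minus[of x "x - qop c (w M)"] x wC by simp
  have "N (\<Sum>i<n. qop c (x - qop c (w i))) \<le> (N x + 2 * B * (K * N x)) + K * (N x + 2 * B * (K * N x))" for n
  proof -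
    \<comment> \<open>The sum telescopes to \<open>qop c\<close> of two partial sums, which is
      already bounded independently of n. For n = 0 the truncated n - 1 is harmless, as
      \<open>w 0\<close> is 0.\<close>
    have "(\<Sum>i<n. qop c (x - qop c (w i))) = qop c (w n) - T (T (qop c (w (n - 1))))"
    proof (cases n)
      case 0
      then show ?thesis by (simp add: w_def)
    next
      case (Suc m)
      have "(\<Sum>i<Suc m. qop c (x - qop c (w i))) = qop c (w (Suc m)) - T (T (qop c (w m)))"
      proof (induction m)
        case 0
        then show ?case using chev_simps[OF c] x by (simp add: w_def)
      next
        case (Suc m)
        let ?t = "\<lambda>n. (T ^^ n) x"
        have 1: "w (Suc (Suc m)) = w (Suc m) + rscale (?u (Suc (Suc m))) (?t (Suc m))" "w (Suc m) = w m + rscale (?u (Suc m)) (?t m)" by (simp_all add: w_def)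
        have "qop c (x - qop c (w (Suc m))) = rscale (?u (Suc (Suc m))) (qop c (?t (Suc m))) - rscale (?u (Suc m)) (qop c (?t (Suc (Suc m))))"
          unfolding xV using x by (simp add: qop_diff qop_rs del: funpow.simps)
        moreover have "qop c (w (Suc (Suc m))) = qop c (w (Suc m)) + rscale (?u (Suc (Suc m))) (qop c (?t (Suc m)))"
          unfolding 1(1) using x wC by (simp add: qop_add qop_rs del: funpow.simps)
        moreover have "T (T (qop c (w (Suc m)))) = T (T (qop c (w m))) + rscale (?u (Suc m)) (qop c (?t (Suc (Suc m))))"
          unfolding 1(2) using x wC by (simp add: qop_add qop_rs T_add T_rs qop_T)
        moreover have "(\<Sum>i<Suc (Suc m). qop c (x - qop c (w i))) = (\<Sum>i<Suc m. qop c (x - qop c (w i))) + qop c (x - qop c (w (Suc m)))"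
          by (rule sum.lessThan_Suc)
        ultimately show ?case unfolding Suc.IH by (simp del: sum.lessThan_Suc funpow.simps)
      qed
      then show ?thesis using Suc by simp
    qed
    also have "N \<dots> \<le> N (qop c (w n)) + N (T (T (qop c (w (n - 1)))))" using wC by (intro N_tri_minus) auto
    also have "\<dots> \<le> (N x + 2 * B * (K * N x)) + K * (N x + 2 * B * (K * N x))"
      using qw[of n] T_pow[of "qop c (w (n - 1))" 2] wC mult_left_mono[OF qw[of "n - 1"], of K] K1
      by (intro add_mono) (auto simp: numeral_2_eq_2 intro: order_trans)
    finally show ?thesis .
  qed
  then show "\<exists>g\<in>C. qop c g = 0 \<and> (\<forall>e>0. \<exists>v\<in>C. N (x - g - qop c v) < e)"
    by (intro mean_ergodic_abstract[OF R _ _ _ qop_norm x wC g]) (auto simp: qop_add qop_sc)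
qed


text \<open>A bounded set of coefficient pairs has finite nets of any mesh, and the map to
  combinations of \<open>u\<close> and \<open>v\<close> is Lipschitz.\<close>

lemma kap_two_dim:
  assumes u: "u \<in> C" "v \<in> C" and y: "y \<in> C"
    and B: "\<And>n. \<exists>a b. \<bar>a\<bar> \<le> B \<and> \<bar>b\<bar> \<le> B \<and> (T ^^ n) y = rscale a u + rscale b v"
  shows "kap y = 0"
proof -
  have "kap y \<le> 0 + e" if e: "e > 0" for e
  proof -
    define d where "d = e / (N u + N v + 1)"
    have pos: "N u + N v + 1 > 0" using N_nonneg u by (meson add_nonneg_pos add_nonneg_nonneg zero_less_one)
    have d: "d > 0" using e pos by (simp add: d_def)
    have "\<exists>G. finite G \<and> cball 0 B \<subseteq> (\<Union>x\<in>G. ball (x::real) d)"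
      using compact_cball[of "0::real" B] d unfolding compact_eq_totally_bounded by blast
    then obtain G where G: "finite G" "cball 0 B \<subseteq> (\<Union>x\<in>G. ball (x::real) d)" by blast
    have near: "\<exists>r\<in>G. \<bar>a - r\<bar> \<le> d" if "\<bar>a\<bar> \<le> B" for a
    proof -
      have "a \<in> cball 0 B" using that by simp
      then obtain r where "r \<in> G" "a \<in> ball r d" using G(2) by blast
      then show ?thesis by (intro bexI[of _ r]) (auto simp: dist_real_def)
    qed
    have "covered e y"
      unfolding covered_def
    proof (intro exI conjI allI)
      let ?F = "(\<lambda>(r, t). rscale r u + rscale t v) ` (G \<times> G)"
      show "finite ?F" "?F \<subseteq> C" using G(1) u by (auto intro!: add_in)
      fix n
      obtain a b where ab: "\<bar>a\<bar> \<le> B" "\<bar>b\<bar> \<le> B" "(T ^^ n) y = rscale a u + rscale b v" using B by blast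
      obtain r t where rt: "r \<in> G" "t \<in> G" "\<bar>a - r\<bar> \<le> d" "\<bar>b - t\<bar> \<le> d" using near ab by meson
      have "N ((T ^^ n) y - (rscale r u + rscale t v)) = N (rscale (a - r) u + rscale (b - t) v)" by (simp add: ab rscale_diff2 algebra_simps)
      also have "\<dots> \<le> N (rscale (a - r) u) + N (rscale (b - t) v)" using u by (intro N_tri) auto
      also have "\<dots> \<le> d * N u + d * N v" using u rt by (intro add_mono) (auto simp: N_rs intro!: mult_right_mono)
      also have "\<dots> \<le> d * (N u + N v + 1)" using d by (simp add: algebra_simps)
      also have "\<dots> = e" using pos by (simp add: d_def)
      finally show "\<exists>a\<in>?F. N ((T ^^ n) y - a) \<le> e" using rt by force
    qed
    then show ?thesis using kap_le[OF y] by simp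
  qed
  then have "kap y \<le> 0" by (rule field_le_epsilon)
  then show ?thesis using kap_nonneg[OF y] by simp
qed

lemma kap_eigenvector:
  assumes s: "s = 1 \<or> s = -1" and g: "g \<in> C" and eq: "T g - rscale s g = 0"
  shows "kap g = 0"
proof (rule kap_two_dim[OF g zero_in g, of 1])
  fix n
  have "\<bar>s ^ n\<bar> = 1" using s by (auto simp: power_abs)
  moreover have "(T ^^ n) g = rscale (s ^ n) g"
    using g eq by (induction n) (auto simp: T_rs mult.commute)
  ultimately show "\<exists>a b. \<bar>a\<bar> \<le> 1 \<and> \<bar>b\<bar> \<le> 1 \<and> (T ^^ n) g = rscale a g + rscale b 0"
    by (intro exI[of _ "s ^ n"] exI[of _ 0]) auto
qed

text \<open>On the kernel T obeys a two-term recurrence, so the orbit of T g consists of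
  combinations of T g and g with coefficients \<open>chev\<close>. Passing from g to T g costs
  nothing by \<open>kap_T\<close>.\<close>

lemma kap_qop_kernel:
  assumes c: "\<bar>c\<bar> < 1" and g: "g \<in> C" and eq: "qop c g = 0"
  shows "kap g = 0"
proof -
  have TT: "T (T g) = rscale (2 * c) (T g) - g" using eq by (simp add: qop_def algebra_simps)
  have "kap (T g) = 0"
  proof (rule kap_two_dim[of "T g" g _ "1 / sin (arccos c)"])
    fix n
    have "(T ^^ n) (T g) = rscale (chev c (Suc n)) (T g) - rscale (chev c n) g"
    proof (induction n)
      case 0
      then show ?case using chev_simps[OF c] by simp
    next
      case (Suc n)
      have "(T ^^ Suc n) (T g) = T ((T ^^ n) (T g))" by simp
      also have "\<dots> = rscale (chev c (Suc n)) (T (T g)) - rscale (chev c n) (T g)" unfolding Suc using g by (simp add: T_diff T_rs)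
      finally show ?case unfolding TT chev_simps(3)[OF c] by (simp add: rscale_diff rscale_diff2 mult_ac)
    qed
    then show "\<exists>a b. \<bar>a\<bar> \<le> 1 / sin (arccos c) \<and> \<bar>b\<bar> \<le> 1 / sin (arccos c) \<and> (T ^^ n) (T g) = rscale a (T g) + rscale b g"
      using chev_simps(4)[OF c] by (intro exI[of _ "chev c (Suc n)"] exI[of _ "- chev c n"]) (auto simp: rscale_neg)
  qed (use g in auto)
  then show ?thesis using kap_T[OF g] by simp
qed

text \<open>Write x = g + V v + small. The kernel part has \<open>kap\<close> zero by the assumption
  on \<open>V\<close>, the range part by the assumption on W V, and the rest is controlled by the
  norm. This cancels one factor at a time from a product that annihilates all orbits modulo
  \<open>kap\<close>.\<close>

lemma kap_strip:
  assumes V: "ergodic_for V" "\<And>x. x \<in> C \<Longrightarrow> V x \<in> C" "\<And>g. g \<in> C \<Longrightarrow> V g = 0 \<Longrightarrow> kap g = 0"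
    and W: "\<And>x. x \<in> C \<Longrightarrow> W x \<in> C" "\<And>x y. x \<in> C \<Longrightarrow> y \<in> C \<Longrightarrow> W (x - y) = W x - W y"
      "\<And>x. x \<in> C \<Longrightarrow> N (W x) \<le> L * N x" "\<And>x. x \<in> C \<Longrightarrow> T (W x) = W (T x)" "L \<ge> 0"
    and 0: "\<And>y. y \<in> C \<Longrightarrow> kap (W (V y)) = 0" and x: "x \<in> C"
  shows "kap (W x) = 0"
proof -
  obtain g where g: "g \<in> C" "V g = 0" "\<And>e. e > 0 \<Longrightarrow> \<exists>v\<in>C. N (x - g - V v) < e"
    using V(1) x unfolding ergodic_for_def by blast
  have Wg: "kap (W g) \<le> 0"
  proof -
    have "N (W a - W b) \<le> L * N (a - b)" if "a \<in> C" "b \<in> C" for a b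
      using W(3)[of "a - b"] W(2)[OF that] that by simp
    then have "kap (W g) \<le> L * kap g" using W(1,4,5) g(1) by (intro kap_commuting) auto
    then show ?thesis using V(3)[OF g(1,2)] by simp
  qed
  have KL: "K * L \<ge> 0" using K1 W(5) by simp
  have le: "kap (W x) \<le> K * L * e" if e: "e > 0" for e
  proof -
    obtain v where v: "v \<in> C" "N (x - g - V v) < e" using g(3)[OF e] by blast
    have in_C: "W x - W g \<in> C" "W (V v) \<in> C" "x - g - V v \<in> C" using x g v V(2) W(1) by auto
    have "W x = W g + (W (V v) + W (x - g - V v))" using x g(1) v(1) V(2) by (simp add: W(2))
    then have "kap (W x) \<le> kap (W g) + kap (W (V v) + W (x - g - V v))"
      using kap_add[of "W g" "W (V v) + W (x - g - V v)"] g W(1) in_C by auto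
    also have "\<dots> \<le> kap (W g) + (kap (W (V v)) + kap (W (x - g - V v)))"
      using kap_add[of "W (V v)" "W (x - g - V v)"] W(1) in_C by auto
    also have "\<dots> \<le> kap (W (x - g - V v))" using Wg 0[OF v(1)] by simp
    also have "\<dots> \<le> K * N (W (x - g - V v))" using W(1) in_C by (intro kap_norm) auto
    also have "\<dots> \<le> K * (L * N (x - g - V v))" using W(3) in_C K1 by (intro mult_left_mono) auto
    also have "\<dots> \<le> K * L * e" using KL v by (simp add: mult.assoc[symmetric] mult_left_mono)
    finally show ?thesis .
  qed
  have "kap (W x) \<le> 0 + e" if e: "e > 0" for e
  proof -
    have "kap (W x) \<le> K * L * (e / (K * L + 1))" using e KL by (intro le) auto
    also have "\<dots> = (K * L / (K * L + 1)) * e" by simp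
    also have "\<dots> \<le> 1 * e" using e KL by (intro mult_right_mono) (auto simp: divide_le_eq)
    finally show ?thesis by simp
  qed
  then have "kap (W x) \<le> 0" by (rule field_le_epsilon)
  then show ?thesis using kap_nonneg[of "W x"] W(1) x by simp
qed

lemma kap_eq_0:
  assumes R: "reflexive Y" and c0: "\<bar>c0\<bar> < 1"
    and reg: "\<And>c. \<bar>c\<bar> < 1 \<Longrightarrow> c \<noteq> c0 \<Longrightarrow> \<exists>Q D. \<forall>y\<in>C. Q y \<in> C \<and> kap (Q y) \<le> D * kap y \<and> kap (qop c (Q y) - y) = 0"
    and y: "y \<in> C"
  shows "kap y = 0"
proof -
  define V where "V s x = T x - rscale s x" for s x
  have V_in: "V s x \<in> C" if "x \<in> C" for s x using that by (simp add: V_def)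
  have V_diff: "V s (x - z) = V s x - V s z" if "x \<in> C" "z \<in> C" for s x z
    using that by (simp add: V_def T_diff rscale_diff)
  have V_norm: "N (V s x) \<le> (K + \<bar>s\<bar>) * N x" if "x \<in> C" for s x
    using N_tri_minus[of "T x" "rscale s x"] T_norm[OF that] N_rs[OF that, of s] that by (simp add: V_def distrib_right)
  have V_T: "T (V s x) = V s (T x)" if "x \<in> C" for s x using that by (simp add: V_def T_diff T_rs)
  have V_erg: "ergodic_for (V s)" if "s = 1 \<or> s = -1" for s using ergodic_sign[OF R that] by (simp add: V_def[abs_def])
  have V_ker: "kap g = 0" if "s = 1 \<or> s = -1" "g \<in> C" "V s g = 0" for s g
    using kap_eigenvector[OF that(1,2)] that(3) by (simp add: V_def)
  \<comment> \<open>Multiplied out, (T - 1)(T + 1) q(c0) is the quartic of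
    \<open>kap_regular_imp\<close>. The factors are then stripped starting with the one applied
    first.\<close>
  have 3: "kap (V 1 (V (-1) (qop c0 x))) = 0" if x: "x \<in> C" for x
  proof -
    have "V 1 (V (-1) (qop c0 x)) = (T ^^ 4) x - rscale (2 * c0) ((T ^^ 3) x) + rscale (2 * c0) (T x) - x"
      using x by (simp add: V_def qop_def T_add T_diff T_rs rscale_add rscale_diff rscale_neg eval_nat_numeral)
    then show ?thesis using kap_regular_imp[OF c0 reg x] by simp
  qed
  have 2: "kap (V 1 (V (-1) x)) = 0" if x: "x \<in> C" for x
  proof (rule kap_strip[of "qop c0" "\<lambda>x. V 1 (V (-1) x)" "(K + 1) * (K + 1)"])
    show "N (V 1 (V (- 1) x)) \<le> (K + 1) * (K + 1) * N x" if "x \<in> C" for x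
    proof -
      have "N (V 1 (V (- 1) x)) \<le> (K + 1) * N (V (-1) x)" using V_norm[OF V_in[OF that], of 1] by simp
      also have "\<dots> \<le> (K + 1) * ((K + 1) * N x)" using V_norm[OF that, of "-1"] K1 by (intro mult_left_mono) auto
      finally show ?thesis by simp
    qed
  qed (use ergodic_qop[OF R c0] kap_qop_kernel[OF c0] 3 x K1 in \<open>auto simp: V_in V_diff V_T\<close>)
  have 1: "kap (V 1 x) = 0" if x: "x \<in> C" for x
    by (rule kap_strip[of "V (-1)" "V 1" "K + 1"])
      (use V_erg[of "-1"] V_ker[of "-1"] V_norm[of _ 1] 2 x K1 in \<open>auto simp: V_in V_diff V_T\<close>)
  show ?thesis
    using kap_strip[of "V 1" "\<lambda>x. x" 1 y] V_erg[of 1] V_ker[of 1] 1 y by (auto simp: V_in)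
qed

lemma kap_0_almost_periodic:
  assumes B: "banach_space Y" and 0: "\<And>y. y \<in> C \<Longrightarrow> kap y = 0"
  shows "almost_periodic Y T"
  unfolding almost_periodic_def ntop_def
proof
  fix x assume x: "x \<in> C"
  interpret M: Metric_space C "ndist Y" by (rule normed_space_Metric_space[OF ns])
  let ?S = "range (\<lambda>n. (T ^^ n) x)"
  have "M.mtotally_bounded ?S"
    unfolding M.mtotally_bounded_def
  proof (intro allI impI)
    fix e :: real assume e: "e > 0"
    obtain F where F: "finite F" "F \<subseteq> C" "\<And>n. \<exists>a\<in>F. N ((T ^^ n) x - a) \<le> e / 3"
      using kap_cover[OF x, of "e / 3"] 0[OF x] e by (auto simp: covered_def)
    \<comment> \<open>Total boundedness asks for centres in the orbit itself, so each centre is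
      replaced by an orbit point near it, and the radius e/3 becomes at most 2e/3. A centre without
      such a point gets an arbitrary orbit point.\<close>
    define r where "r a = (T ^^ (SOME n. N ((T ^^ n) x - a) \<le> e / 3)) x" for a
    show "\<exists>G. finite G \<and> G \<subseteq> ?S \<and> ?S \<subseteq> (\<Union>z\<in>G. M.mball z e)"
    proof (intro exI conjI subsetI)
      show "finite (r ` F)" using F by simp
      show "z \<in> ?S" if "z \<in> r ` F" for z using that by (auto simp: r_def)
      fix z assume "z \<in> ?S"
      then obtain n where z: "z = (T ^^ n) x" by auto
      obtain a where a: "a \<in> F" "N ((T ^^ n) x - a) \<le> e / 3" using F(3) by blast
      have ra: "N (r a - a) \<le> e / 3" "r a \<in> C" "a \<in> C" unfolding r_def using someI[of "\<lambda>n. N ((T ^^ n) x - a) \<le> e / 3", OF a(2)] x a F by auto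
      have "N (r a - z) \<le> N (r a - a) + N (a - z)" using ra x z by (intro N_tri3) auto
      also have "N (a - z) = N (z - a)" using ra x z by (intro N_comm) auto
      finally have "N (r a - z) < e" using ra a e z by simp
      then have "z \<in> M.mball (r a) e" using ra x z by (simp add: ndist_def)
      then show "z \<in> (\<Union>z\<in>r ` F. M.mball z e)" using a by blast
    qed
  qed
  then show "compactin M.mtopology (M.mtopology closure_of ?S)"
    using M.mtotally_bounded_eq_compact_closure_of B by (auto simp: banach_space_def)
qed

text \<open>The averages fix the kernel part of the splitting, are O(1/n) on T v - v by telescoping,
  and are uniformly bounded on the rest. The convergence proved here is what gives the
  \<open>THE\<close> in \<open>ergodic_limit\<close> its meaning.\<close>

lemma ergodic_limit_eq:
  assumes R: "reflexive Y" and x: "x \<in> C"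
  shows "ergodic_limit Y T x \<in> C" "T (ergodic_limit Y T x) = ergodic_limit Y T x"
proof -
  interpret M: Metric_space C "ndist Y" by (rule normed_space_Metric_space[OF ns])
  obtain g where g: "g \<in> C" "T g - rscale 1 g = 0" "\<And>e. e > 0 \<Longrightarrow> \<exists>v\<in>C. N (x - g - (T v - rscale 1 v)) < e"
    using ergodic_sign[OF R, of 1] x unfolding ergodic_for_def by blast
  then have Tg: "(T ^^ n) g = g" for n by (induction n) auto
  define A where "A n x = rscale (1 / real n) (\<Sum>k=1..n. (T ^^ k) x)" for n x
  have A_in: "A n x \<in> C" if "x \<in> C" for n x unfolding A_def using that by (intro rscale_in sum_in) auto
  have A_add: "A n (x + z) = A n x + A n z" if "x \<in> C" "z \<in> C" for n x z
    using that by (simp add: A_def Tn_add sum.distrib rscale_add)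
  have A_g: "A n g = g" if "n > 0" for n
  proof -
    have "(\<Sum>k=1..m. g) = rscale (real m) g" for m by (induction m) (auto simp: rscale_add2 add.commute)
    then show ?thesis using that by (simp add: A_def Tg)
  qed
  have A_norm: "N (A n z) \<le> K * N z" if "z \<in> C" for n z
  proof (cases "n = 0")
    case True
    then show ?thesis using that K1 by (simp add: A_def)
  next
    case False
    have "N (A n z) = 1 / real n * N (\<Sum>k=1..n. (T ^^ k) z)" unfolding A_def using that by (subst N_rs) (auto intro!: sum_in)
    also have "\<dots> \<le> 1 / real n * (\<Sum>k=1..n. N ((T ^^ k) z))" using that by (intro mult_left_mono N_sum) auto
    also have "\<dots> \<le> 1 / real n * (\<Sum>k=1..n. K * N z)" using that by (intro mult_left_mono sum_mono T_pow) auto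
    finally show ?thesis using False by simp
  qed
  have A_tel: "N (A n (T v - v)) \<le> 2 * K * N v / real n" if v: "v \<in> C" for n v
  proof -
    have "(\<Sum>k=1..n. (T ^^ k) (T v - v)) = (T ^^ n) (T v) - T v"
      using v by (induction n) (auto simp: Tn_diff T_Tn)
    then have "N (A n (T v - v)) = 1 / real n * N ((T ^^ n) (T v) - T v)" unfolding A_def using v by (simp add: N_rs)
    also have "N ((T ^^ n) (T v) - T v) \<le> N ((T ^^ Suc n) v) + N ((T ^^ 1) v)"
      using v N_tri_minus[of "(T ^^ n) (T v)" "T v"] by (simp add: T_Tn)
    also have "\<dots> \<le> 2 * K * N v" using T_pow[OF v, of "Suc n"] T_pow[OF v, of 1] by linarith
    finally show ?thesis by (simp add: mult_left_mono divide_right_mono)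
  qed
  have lim: "(\<lambda>n. N (A n x - g)) \<longlonglongrightarrow> 0"
  proof (rule LIMSEQ_I)
    fix e :: real assume e: "e > 0"
    have K0: "K > 0" using K1 by simp
    obtain v where v: "v \<in> C" "N (x - g - (T v - v)) < e / (2 * K)" using g(3)[of "e / (2 * K)"] e K0 by auto
    obtain n0 where n0: "2 * K * N v / real n < e / 2" if "n \<ge> n0" for n
    proof -
      have "(\<lambda>n. 2 * K * N v / real n) \<longlonglongrightarrow> 0" by (rule lim_const_over_n)
      then have "\<forall>\<^sub>F n in sequentially. 2 * K * N v / real n < e / 2" using e by (intro order_tendstoD) auto
      then show ?thesis using that by (auto simp: eventually_sequentially)
    qed
    have "norm (N (A n x - g) - 0) < e" if n: "n \<ge> max n0 1" for n
    proof -
      let ?r = "x - g - (T v - v)"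
      have in_C: "?r \<in> C" "T v - v \<in> C" using x g(1) v(1) by auto
      have "A n (g + ((T v - v) + ?r)) = A n g + (A n (T v - v) + A n ?r)"
        using in_C g(1) A_add by (metis add_in)
      then have "A n x - g = A n (T v - v) + A n ?r" using A_g[of n] n by simp
      then have "N (A n x - g) \<le> N (A n (T v - v)) + N (A n ?r)" using in_C A_in N_tri by metis
      also have "\<dots> \<le> 2 * K * N v / real n + K * N ?r" using A_tel[OF v(1)] A_norm[OF in_C(1)] by (intro add_mono)
      also have "\<dots> < e / 2 + e / 2" using n0[of n] n v(2) K0 by (intro add_strict_mono) (auto simp: field_simps)
      finally show ?thesis using A_in[OF x] g(1) by simp
    qed
    then show "\<exists>n0. \<forall>n\<ge>n0. norm (N (A n x - g) - 0) < e" by blast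
  qed
  have "limitin M.mtopology (\<lambda>n. scal Y (1 / of_nat n) (\<Sum>k=1..n. (T ^^ k) x)) g sequentially"
  proof -
    have "scal Y (1 / of_nat n) (\<Sum>k=1..n. (T ^^ k) x) = A n x" for n by (simp add: A_def rscale_def)
    moreover have "ndist Y (A n x) g = N (A n x - g)" for n using A_in[OF x] g(1) by (simp add: ndist_def)
    ultimately show ?thesis using lim g(1) A_in[OF x] by (simp add: M.limitin_metric_dist_null)
  qed
  then have "ergodic_limit Y T x = g"
    unfolding ergodic_limit_def ntop_def
    by (intro the_equality M.limitin_metric_unique[of _ _ sequentially g]) (assumption | rule sequentially_bot)+
  then show "ergodic_limit Y T x \<in> C" "T (ergodic_limit Y T x) = ergodic_limit Y T x" using g by auto
qed

lemma kap_0_stable: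
  assumes R: "reflexive Y" and 0: "\<And>y. y \<in> C \<Longrightarrow> kap y = 0" and wm: "weakly_mixing Y T"
  shows "stable_operator Y T"
  unfolding stable_operator_def
proof
  fix x assume x: "x \<in> C"
  define g where "g = ergodic_limit Y T x"
  have g: "g \<in> C" "T g = g" using ergodic_limit_eq[OF R x] by (auto simp: g_def)
  have Tg: "(T ^^ n) g = g" for n using g by (induction n) auto
  let ?z = "x - g"
  have z: "?z \<in> C" using x g by simp
  have mix: "(\<lambda>n. 1 / real n * (\<Sum>k=1..n. norm (f ((T ^^ k) ?z)))) \<longlonglongrightarrow> 0" if "f \<in> carr (dual Y)" for f
    using wm x that by (auto simp: weakly_mixing_def g_def)
  have "(\<lambda>n. N ((T ^^ n) x - g)) \<longlonglongrightarrow> 0"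
  proof (rule LIMSEQ_I)
    fix r :: real assume r: "r > 0"
    \<comment> \<open>It suffices to find one orbit point of size at most 4 e, since all later ones
      are then at most 4 K e = r/2.\<close>
    define e where "e = r / (8 * K)"
    have e: "e > 0" using r K1 by (simp add: e_def)
    obtain F where F: "finite F" "F \<subseteq> C" "\<And>n. \<exists>a\<in>F. N ((T ^^ n) ?z - a) \<le> e"
      using kap_cover[OF z, of e] 0[OF z] e by (auto simp: covered_def)
    have "\<forall>a\<in>F. \<exists>f\<in>carr (dual Y). (\<forall>x\<in>C. norm (f x) \<le> 2 * N x) \<and> norm (f a) \<ge> N a"
      using norming_functional F by blast
    then obtain f where f: "\<And>a. a \<in> F \<Longrightarrow> f a \<in> carr (dual Y)" "\<And>a x. a \<in> F \<Longrightarrow> x \<in> C \<Longrightarrow> norm (f a x) \<le> 2 * N x"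
      "\<And>a. a \<in> F \<Longrightarrow> norm (f a a) \<ge> N a" by metis
    define h where "h k = (\<Sum>a\<in>F. norm (f a ((T ^^ k) ?z)))" for k
    have "(\<lambda>n. \<Sum>a\<in>F. 1 / real n * (\<Sum>k=1..n. norm (f a ((T ^^ k) ?z)))) \<longlonglongrightarrow> (\<Sum>a\<in>F. 0)"
      by (intro tendsto_sum mix f)
    moreover have "(\<Sum>a\<in>F. 1 / real n * (\<Sum>k=1..n. norm (f a ((T ^^ k) ?z)))) = 1 / real n * (\<Sum>k=1..n. h k)" for n
      unfolding h_def by (subst sum_distrib_left[symmetric]) (subst sum.swap, rule refl)
    ultimately have "(\<lambda>n. 1 / real n * (\<Sum>k=1..n. h k)) \<longlonglongrightarrow> 0" by simp
    then have "\<forall>\<^sub>F n in sequentially. 1 / real n * (\<Sum>k=1..n. h k) < e" using e by (intro order_tendstoD)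
    then have "\<forall>\<^sub>F n in sequentially. 1 / real n * (\<Sum>k=1..n. h k) < e \<and> n \<ge> 1"
      using eventually_ge_at_top[of 1] by eventually_elim auto
    then obtain n where n: "n \<ge> 1" "1 / real n * (\<Sum>k=1..n. h k) < e"
      by (metis (no_types, lifting) eventually_happens' sequentially_bot)
    \<comment> \<open>Adding the functionals before averaging yields one time k at which all
      functionals of the net are small simultaneously.\<close>
    have "\<exists>k. h k < e"
    proof (rule ccontr)
      assume "\<not> (\<exists>k. h k < e)"
      then have "(\<Sum>k=1..n. e) \<le> (\<Sum>k=1..n. h k)" by (intro sum_mono) (auto simp: not_less)
      then show False using n by (simp add: field_simps)
    qed
    then obtain k where k: "h k < e" by blast
    obtain a where a: "a \<in> F" "N ((T ^^ k) ?z - a) \<le> e" using F(3) by blast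
    then have aC: "a \<in> C" using F by blast
    have tz: "(T ^^ k) ?z \<in> C" using z by simp
    have "norm (f a ((T ^^ k) ?z)) \<le> h k" unfolding h_def using F(1) a(1) by (intro member_le_sum) auto
    moreover have "norm (f a a) \<le> norm (f a ((T ^^ k) ?z)) + norm (f a ((T ^^ k) ?z - a))"
      unfolding dual_diff[OF f(1)[OF a(1)] tz aC]
      using norm_triangle_ineq4[of "f a ((T ^^ k) ?z)" "f a ((T ^^ k) ?z) - f a a"] by simp
    moreover have "norm (f a ((T ^^ k) ?z - a)) \<le> 2 * N ((T ^^ k) ?z - a)" using f(2) a(1) tz aC by simp
    ultimately have "N a \<le> 3 * e" using f(3)[OF a(1)] a(2) k by linarith
    moreover have "N ((T ^^ k) ?z) \<le> N ((T ^^ k) ?z - a) + N a" using N_tri[of "(T ^^ k) ?z - a" a] tz aC by simp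
    ultimately have small: "N ((T ^^ k) ?z) \<le> 4 * e" using a(2) by linarith
    have "norm (N ((T ^^ n) x - g) - 0) < r" if "n \<ge> k" for n
    proof -
      have "(T ^^ n) x - g = (T ^^ (n - k)) ((T ^^ k) ?z)"
        using that x g Tg by (simp add: Tn_diff funpow_add[symmetric] flip: o_apply[of "T ^^ (n - k)" "T ^^ k"])
      then have "N ((T ^^ n) x - g) \<le> K * N ((T ^^ k) ?z)" using T_pow[OF tz] by metis
      also have "\<dots> \<le> K * (4 * e)" using small K1 by (intro mult_left_mono) auto
      also have "\<dots> = r / 2" using K1 by (simp add: e_def)
      finally show ?thesis using r x g by simp
    qed
    then show "\<exists>n0. \<forall>n\<ge>n0. norm (N ((T ^^ n) x - g) - 0) < r" by blast
  qed
  then show "(\<lambda>n. N ((T ^^ n) x - ergodic_limit Y T x)) \<longlonglongrightarrow> 0" by (simp add: g_def)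
qed

end

section \<open>Reduction to regularity at all parameters but one\<close>

context normed_ctx
begin

lemma bounded_operator_pow:
  assumes "bounded_operator Y T" shows "bounded_operator Y (T ^^ n)"
proof (induction n)
  case 0
  then show ?case unfolding bounded_operator_def by (auto intro: exI[of _ 1])
next
  case (Suc n)
  obtain B where B: "\<And>x. x \<in> C \<Longrightarrow> N (T x) \<le> B * N x" using assms unfolding bounded_operator_def by blast
  obtain D where D: "\<And>x. x \<in> C \<Longrightarrow> N ((T ^^ n) x) \<le> D * N x" using Suc unfolding bounded_operator_def by blast
  have "N ((T ^^ Suc n) x) \<le> (max B 0 * D) * N x" if x: "x \<in> C" for x
  proof -
    have xn: "(T ^^ n) x \<in> C" using Suc x by (auto simp: bounded_operator_def)
    have "N ((T ^^ Suc n) x) \<le> B * N ((T ^^ n) x)" using B[OF xn] by simp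
    also have "\<dots> \<le> max B 0 * N ((T ^^ n) x)" using xn by (intro mult_right_mono) auto
    also have "\<dots> \<le> max B 0 * (D * N x)" using D[OF x] by (intro mult_left_mono) auto
    finally show ?thesis by simp
  qed
  then show ?case using Suc assms by (auto simp: bounded_operator_def)
qed

lemma operator_norm_bound:
  assumes A: "bounded_operator Y A" and x: "x \<in> C" shows "N (A x) \<le> operator_norm Y A * N x"
proof (cases "x = 0")
  case True
  obtain B where "N (A x) \<le> B * N x" using A x by (auto simp: bounded_operator_def)
  then show ?thesis using True by simp
next
  case False
  then have Nx: "N x > 0" using N_eq0[OF x] N_nonneg[OF x] by linarith
  obtain B where B: "\<And>x. x \<in> C \<Longrightarrow> N (A x) \<le> B * N x" using A unfolding bounded_operator_def by blast
  have Ain: "A z \<in> C" if "z \<in> C" for z using A that by (simp add: bounded_operator_def)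
  have Asc: "A (sc c z) = sc c (A z)" if "z \<in> C" for c z using A that by (simp add: bounded_operator_def)
  let ?S = "{N (A x) |x. x \<in> C \<and> N x \<le> 1}"
  have bd: "bdd_above ?S"
  proof (rule bdd_aboveI[of _ "max B 0"])
    fix r assume "r \<in> ?S"
    then obtain z where z: "r = N (A z)" "z \<in> C" "N z \<le> 1" by blast
    have "N (A z) \<le> B * N z" using B z by simp
    also have "\<dots> \<le> max B 0 * N z" using z by (intro mult_right_mono) auto
    also have "\<dots> \<le> max B 0" using z mult_left_mono[of "N z" 1 "max B 0"] by simp
    finally show "r \<le> max B 0" using z by simp
  qed
  define y where "y = rscale (1 / N x) x"
  have y: "y \<in> C" "N y \<le> 1" using x Nx by (auto simp: y_def N_rs)
  then have "N (A y) \<le> operator_norm Y A" unfolding operator_norm_def using bd by (intro cSup_upper) auto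
  moreover have "N (A y) = N (A x) / N x"
    unfolding y_def rscale_def Asc[OF x] using N_rs[OF Ain[OF x], of "1 / N x"] Nx by (simp add: rscale_def)
  ultimately show ?thesis using Nx by (simp add: field_simps)
qed

lemma power_bounded_op_of_power_bounded:
  assumes "power_bounded Y T" shows "\<exists>K. power_bounded_op \<omega> Y T K"
proof -
  have T: "bounded_operator Y T" using assms by (simp add: power_bounded_def)
  obtain M where M: "\<And>n. operator_norm Y (T ^^ n) \<le> M" using assms by (auto simp: power_bounded_def bdd_above_def)
  have "N ((T ^^ n) x) \<le> max M 1 * N x" if x: "x \<in> C" for n x
  proof -
    have "N ((T ^^ n) x) \<le> operator_norm Y (T ^^ n) * N x" using operator_norm_bound[OF bounded_operator_pow[OF T] x] .
    also have "\<dots> \<le> max M 1 * N x" using M[of n] x by (intro mult_right_mono) auto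
    finally show ?thesis .
  qed
  then have "power_bounded_op \<omega> Y T (max M 1)"
    using T by unfold_locales (auto simp: bounded_operator_def)
  then show ?thesis by blast
qed

text \<open>With \<open>V = qop c\<close> the condition reads \<open>V = V Q V\<close>, so \<open>1 - V Q\<close> maps into the kernel of \<open>V\<close>.\<close>

definition regular_at :: "('a \<Rightarrow> 'a) \<Rightarrow> real \<Rightarrow> bool" where
  "regular_at T c \<longleftrightarrow> (\<exists>Q L. (\<forall>x\<in>C. Q x \<in> C \<and> N (Q x) \<le> L * N x \<and> T (Q x) = Q (T x)
       \<and> power_bounded_op.qop Y T c (x - power_bounded_op.qop Y T c (Q x)) = 0)
     \<and> (\<forall>x\<in>C. \<forall>y\<in>C. Q (x + y) = Q x + Q y) \<and> (\<forall>a. \<forall>x\<in>C. Q (sc a x) = sc a (Q x)))"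

lemma regular_power_bounded:
  assumes R: "reflexive Y" and B: "banach_space Y" and T: "power_bounded Y T"
    and reg: "\<And>K. power_bounded_op \<omega> Y T K \<Longrightarrow> \<exists>c0. \<bar>c0\<bar> < 1 \<and> (\<forall>c. \<bar>c\<bar> < 1 \<longrightarrow> c \<noteq> c0 \<longrightarrow> regular_at T c)"
  shows "almost_periodic Y T" "weakly_mixing Y T \<Longrightarrow> stable_operator Y T"
proof -
  obtain K where K: "power_bounded_op \<omega> Y T K" using power_bounded_op_of_power_bounded[OF T] by blast
  interpret P: power_bounded_op \<omega> Y T K by (rule K)
  obtain c0 where c0: "\<bar>c0\<bar> < 1" and c: "\<And>c. \<bar>c\<bar> < 1 \<Longrightarrow> c \<noteq> c0 \<Longrightarrow> regular_at T c"
    using reg[OF K] by blast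
  have "P.kap y = 0" if "y \<in> C" for y
  proof (rule P.kap_eq_0[OF R c0 _ that])
    fix c :: real assume c1: "\<bar>c\<bar> < 1" "c \<noteq> c0"
    obtain Q L where Q: "\<And>x. x \<in> C \<Longrightarrow> Q x \<in> C" "\<And>x. x \<in> C \<Longrightarrow> N (Q x) \<le> L * N x"
      "\<And>x. x \<in> C \<Longrightarrow> T (Q x) = Q (T x)" "\<And>x. x \<in> C \<Longrightarrow> P.qop c (x - P.qop c (Q x)) = 0"
      "\<And>x y. x \<in> C \<Longrightarrow> y \<in> C \<Longrightarrow> Q (x + y) = Q x + Q y" "\<And>a x. x \<in> C \<Longrightarrow> Q (sc a x) = sc a (Q x)"
      using c[OF c1] unfolding regular_at_def by blast
    have Qdiff: "Q (x - z) = Q x - Q z" if "x \<in> C" "z \<in> C" for x z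
      using Q(5)[of x "sc (-1) z"] Q(6)[of z "-1"] that by simp
    have "P.kap (Q y) \<le> max L 0 * P.kap y" if y: "y \<in> C" for y
    proof (rule P.kap_commuting)
      show "N (Q x - Q z) \<le> max L 0 * N (x - z)" if "x \<in> C" "z \<in> C" for x z
      proof -
        have "N (Q (x - z)) \<le> L * N (x - z)" using Q(2) that by simp
        also have "\<dots> \<le> max L 0 * N (x - z)" using that by (intro mult_right_mono) auto
        finally show ?thesis using Qdiff[OF that] by simp
      qed
    qed (use Q y in auto)
    \<comment> \<open>The defect lies in the kernel of the quadratic factor, hence has
      \<open>kap\<close> zero.\<close>
    moreover have "P.kap (P.qop c (Q y) - y) = 0" if y: "y \<in> C" for y
    proof -
      have "P.kap (rscale (-1) (y - P.qop c (Q y))) = 0"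
        using P.kap_qop_kernel[OF c1(1) _ Q(4)[OF y]] P.kap_rs[of "y - P.qop c (Q y)"] Q(1)[OF y] y by simp
      then show ?thesis by (simp add: rscale_neg)
    qed
    ultimately show "\<exists>Q D. \<forall>y\<in>C. Q y \<in> C \<and> P.kap (Q y) \<le> D * P.kap y \<and> P.kap (P.qop c (Q y) - y) = 0"
      using Q(1) by blast
  qed
  then show "almost_periodic Y T" "weakly_mixing Y T \<Longrightarrow> stable_operator Y T"
    using P.kap_0_almost_periodic[OF B] P.kap_0_stable[OF R] by blast+
qed

end

section \<open>A mixed Tsirelson norm with coded special functionals\<close>

text \<open>\<open>mm j\<close> and \<open>nn j\<close> are the parameters \<open>m\<^sub>j\<close>, \<open>n\<^sub>j\<close> of the norm. The factor \<open>split_bound\<close> in \<open>nn\<close> is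
  what the constant in \<open>recursive_estimate\<close> becomes after \<open>r\<close> rounds.\<close>

fun split_bound :: "nat \<Rightarrow> nat \<Rightarrow> nat" where
  "split_bound v 0 = 8"
| "split_bound v (Suc r) = v * (split_bound v r + 2)"

text \<open>\<open>mm\<close> exceeds the square of every earlier \<open>nn\<close>, so a functional
  of larger weight is negligible even when summed over the square of the number of blocks. The cube
  of \<open>mm\<close> times \<open>split_bound\<close> after mm^2 + 1 rounds keeps the constant
  left by unfolding below nn / mm^2; mm^2 halvings make the proportional part equally small.\<close>

primrec mn_seq :: "nat \<Rightarrow> nat \<times> nat" where
  "mn_seq 0 = (2, 2)"
| "mn_seq (Suc j) = (let n = snd (mn_seq j); m = 4 * n ^ 2 in (m, m ^ 3 * split_bound n (m ^ 2 + 1)))"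

definition mm :: "nat \<Rightarrow> nat" where "mm j = fst (mn_seq j)"
definition nn :: "nat \<Rightarrow> nat" where "nn j = snd (mn_seq j)"

lemma mm_Suc: "mm (Suc j) = 4 * nn j ^ 2"
  by (simp add: mm_def nn_def Let_def)

lemma nn_Suc: "nn (Suc j) = mm (Suc j) ^ 3 * split_bound (nn j) (mm (Suc j) ^ 2 + 1)"
  by (simp add: mm_def nn_def Let_def)

lemma split_bound_ge: "v \<ge> 1 \<Longrightarrow> split_bound v r \<ge> 8"
proof (induction r)
  case (Suc r)
  then have "8 \<le> 1 * (split_bound v r + 2)" by simp
  also have "\<dots> \<le> v * (split_bound v r + 2)" using Suc by (intro mult_right_mono) auto
  finally show ?case by simp
qed auto

lemma split_bound_ge_power: "v \<ge> 1 \<Longrightarrow> split_bound v r \<ge> v ^ r"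
proof (induction r)
  case (Suc r)
  then have "v * v ^ r \<le> v * (split_bound v r + 2)" by (intro mult_left_mono) auto
  then show ?case by simp
qed auto

lemma split_bound_Suc_ge: "v \<ge> 1 \<Longrightarrow> split_bound v r \<le> split_bound v (Suc r)"
proof -
  assume "v \<ge> 1"
  then have "1 * (split_bound v r + 2) \<le> v * (split_bound v r + 2)" by (intro mult_right_mono) auto
  then show ?thesis by simp
qed

lemma mm_nn_ge: "mm j \<ge> 2 \<and> nn j \<ge> 2"
proof (induction j)
  case 0
  then show ?case by (simp add: mm_def nn_def)
next
  case (Suc j)
  have "2 \<le> nn j ^ 2" using Suc by (metis order_trans self_le_power one_le_numeral pos2)
  then have m: "mm (Suc j) \<ge> 2" unfolding mm_Suc by linarith
  have "2 \<le> mm (Suc j) ^ 3" using m by (metis order_trans self_le_power one_le_numeral zero_less_numeral)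
  moreover have "1 \<le> split_bound (nn j) (mm (Suc j) ^ 2 + 1)"
    using split_bound_ge[of "nn j"] Suc by (meson order_trans one_le_numeral)
  ultimately have "2 * 1 \<le> nn (Suc j)" unfolding nn_Suc by (intro mult_mono) auto
  then show ?case using m by simp
qed

lemmas mm_ge = mm_nn_ge[THEN conjunct1] and nn_ge = mm_nn_ge[THEN conjunct2]

lemma nn_sq_le_mm: "i < j \<Longrightarrow> 4 * nn i ^ 2 \<le> mm j \<and> mm i < mm j \<and> nn i < nn j \<and> nn i < mm j"
proof (induction j)
  case (Suc j)
  have a: "nn j \<le> nn j ^ 2" using nn_ge[of j] by (intro self_le_power) auto
  have b: "mm (Suc j) \<le> mm (Suc j) ^ 3" using mm_ge[of "Suc j"] by (intro self_le_power) auto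
  have c: "mm (Suc j) ^ 3 * 1 \<le> nn (Suc j)"
    unfolding nn_Suc using split_bound_ge[of "nn j" "mm (Suc j) ^ 2 + 1"] nn_ge[of j] by (intro mult_left_mono) auto
  have d: "nn j < mm (Suc j)" unfolding mm_Suc using a nn_ge[of j] by linarith
  have e: "nn j < nn (Suc j)" using b c d by linarith
  have f: "mm j \<le> nn j"
  proof (cases j)
    case 0
    then show ?thesis by (simp add: mm_def nn_def)
  next
    case (Suc k)
    have b: "mm (Suc k) \<le> mm (Suc k) ^ 3" using mm_ge[of "Suc k"] by (intro self_le_power) auto
    have c: "mm (Suc k) ^ 3 * 1 \<le> nn (Suc k)"
      unfolding nn_Suc using split_bound_ge[of "nn k" "mm (Suc k) ^ 2 + 1"] nn_ge[of k] by (intro mult_left_mono) auto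
    show ?thesis using b c Suc by simp
  qed
  show ?case
  proof (cases "i = j")
    case True
    then show ?thesis using d e f mm_Suc by auto
  next
    case False
    then have "i < j" using Suc by simp
    then show ?thesis using Suc.IH d e f by linarith
  qed
qed simp

lemma mm_mono: "i \<le> j \<Longrightarrow> mm i \<le> mm j"
  using nn_sq_le_mm[of i j] by (cases "i = j") auto
lemma nn_mono: "i \<le> j \<Longrightarrow> nn i \<le> nn j"
  using nn_sq_le_mm[of i j] by (cases "i = j") auto
lemma mm_gt: "mm j > j"
proof (induction j)
  case (Suc j)
  then show ?case using nn_sq_le_mm[of j "Suc j"] by simp
qed (use mm_ge[of 0] in auto)

text \<open>A tree codes a norming functional. \<open>Leaf e i\<close> is \<open>\<omega>^e\<close> times the \<open>i\<close>-th coordinate; \<open>Node e a b j ts\<close> is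
  \<open>\<omega>^e / m\<^sub>j\<close> times the sum of the functionals \<open>ts\<close>, restricted to the interval \<open>[a, b)\<close>. For odd \<open>j\<close> the
  list \<open>ts\<close> must be special: each weight is the code of the preceding functionals. Weights \<open>0\<close> mod \<open>4\<close>
  start a special sequence, codes are \<open>2\<close> mod \<open>4\<close>.\<close>

datatype tree = Leaf nat nat | Node nat nat nat nat "tree list"

instance tree :: countable by countable_datatype

fun weight :: "tree \<Rightarrow> nat" where
  "weight (Leaf e i) = 0"
| "weight (Node e a b j ts) = j"

fun supp :: "tree \<Rightarrow> nat set" where
  "supp (Leaf e i) = {i}"
| "supp (Node e a b j ts) = (\<Union>t\<in>set ts. supp t) \<inter> {a..<b}"

text \<open>Putting \<open>j\<close> into the code forces the code above \<open>j\<close>. Since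
  \<open>to_nat\<close> is injective on lists of trees, a code determines all predecessors.\<close>

definition coding :: "nat \<Rightarrow> tree list \<Rightarrow> nat" where
  "coding j ts = 4 * prod_encode (to_nat ts, j) + 2"

definition special :: "nat \<Rightarrow> tree list \<Rightarrow> bool" where
  "special j ts \<longleftrightarrow> (\<forall>i<length ts. if i = 0 then weight (ts ! 0) mod 4 = 0 \<and> weight (ts ! 0) > j else weight (ts ! i) = coding j (take i ts))"

definition successive :: "tree list \<Rightarrow> bool" where
  "successive = sorted_wrt (\<lambda>s t. \<forall>i\<in>supp s. \<forall>j\<in>supp t. i < j)"

text \<open>Weight 0 is left to the leaves, so a weight of at least 1 singles out the nodes.
  Restricting the coding condition to odd weights keeps even weights available for lower estimates
  on arbitrary blocks.\<close>

fun valid :: "tree \<Rightarrow> bool" where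
  "valid (Leaf e i) = True"
| "valid (Node e a b j ts) = (j \<ge> 1 \<and> (\<forall>t\<in>set ts. valid t) \<and> successive ts \<and> length ts \<le> nn j \<and> (odd j \<longrightarrow> special j ts))"

text \<open>A leaf outside the window becomes the zero functional, coded as an empty node of even
  weight 2. For nodes only the interval shrinks, so the children, and with them the coding, stay
  intact.\<close>

fun restrict_tree :: "nat \<Rightarrow> nat \<Rightarrow> tree \<Rightarrow> tree" where
  "restrict_tree c d (Leaf e i) = (if c \<le> i \<and> i < d then Leaf e i else Node 0 0 0 2 [])"
| "restrict_tree c d (Node e a b j ts) = Node e (max a c) (min b d) j ts"

fun rotate_tree :: "nat \<Rightarrow> tree \<Rightarrow> tree" where
  "rotate_tree k (Leaf e i) = Leaf (k + e) i"
| "rotate_tree k (Node e a b j ts) = Node (k + e) a b j ts"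

lemma coding_inj: "coding j ts = coding j us \<Longrightarrow> ts = us"
  by (simp add: coding_def)
lemma coding_gt: "coding j ts > j"
  using le_prod_encode_2[of j "to_nat ts"] by (simp add: coding_def)
lemma coding_even: "even (coding j ts)" "coding j ts mod 4 = 2"
proof -
  have "(4 * n + 2) mod 4 = (2::nat)" for n by presburger
  then show "coding j ts mod 4 = 2" by (simp only: coding_def)
qed (auto simp: coding_def)

lemma special_weight: assumes "special j ts" "i < length ts" shows "weight (ts ! i) > j" "even (weight (ts ! i))"
proof -
  have a: "weight (ts ! 0) mod 4 = 0 \<Longrightarrow> even (weight (ts ! 0))" by presburger
  show "weight (ts ! i) > j" "even (weight (ts ! i))"
    using assms a coding_gt coding_even by (auto simp: special_def split: if_splits)
qed

lemma valid_restrict_tree [simp]: "valid t \<Longrightarrow> valid (restrict_tree c d t)"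
  by (cases t) (auto simp: successive_def)
lemma valid_rotate_tree [simp]: "valid t \<Longrightarrow> valid (rotate_tree k t)"
  by (cases t) auto
lemma weight_rotate_tree [simp]: "weight (rotate_tree k t) = weight t"
  by (cases t) auto
lemma supp_rotate_tree [simp]: "supp (rotate_tree k t) = supp t"
  by (cases t) auto
lemma supp_restrict_tree: "supp (restrict_tree c d t) = supp t \<inter> {c..<d}"
  by (cases t) auto
lemma finite_supp [simp]: "finite (supp t)"
  by (induction t) auto
lemma successive_restrict_tree: "successive ts \<Longrightarrow> successive (map (restrict_tree c d) ts)"
  by (auto simp: successive_def sorted_wrt_map supp_restrict_tree elim!: sorted_wrt_mono_rel[rotated])

section \<open>Norming functionals and their estimates on sums of blocks\<close>

definition window :: "nat \<Rightarrow> nat \<Rightarrow> (nat \<Rightarrow> 'k::zero) \<Rightarrow> nat \<Rightarrow> 'k" where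
  "window a b x = (\<lambda>i. if a \<le> i \<and> i < b then x i else 0)"

definition block_sum :: "(nat \<Rightarrow> nat \<Rightarrow> 'k::comm_monoid_add) \<Rightarrow> nat \<Rightarrow> nat \<Rightarrow> nat \<Rightarrow> 'k" where
  "block_sum x a b = (\<lambda>i. \<Sum>k=a..<b. x k i)"

definition blocks :: "(nat \<Rightarrow> nat) \<Rightarrow> (nat \<Rightarrow> nat \<Rightarrow> 'k::zero) \<Rightarrow> bool" where
  "blocks l x \<longleftrightarrow> mono l \<and> (\<forall>k i. x k i \<noteq> 0 \<longrightarrow> l k \<le> i \<and> i < l (Suc k))"

text \<open>Powers of \<open>\<omega>\<close> serve as approximate phases, so that countably many trees suffice for the coding.\<close>

locale phase_field =
  fixes \<omega> :: "'k::{real_normed_field, euclidean_space}"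
  assumes omega4: "\<omega> ^ 4 = 1"
    and phase: "\<exists>e. norm (\<omega> ^ e * z - of_real (norm z)) \<le> 4 / 5 * norm z"
begin

lemma norm_omega [simp]: "norm \<omega> = 1"
proof -
  have "norm \<omega> ^ 4 = 1" using omega4 by (metis norm_one norm_power)
  then show ?thesis by (metis norm_ge_zero power_eq_1_iff zero_neq_numeral abs_of_nonneg real_norm_def)
qed

lemma norm_omega_power [simp]: "norm (\<omega> ^ e) = 1"
  by (simp add: norm_power)

fun act :: "tree \<Rightarrow> (nat \<Rightarrow> 'k) \<Rightarrow> 'k" where
  "act (Leaf e i) x = \<omega> ^ e * x i"
| "act (Node e a b j ts) x = \<omega> ^ e * of_real (1 / real (mm j)) * (\<Sum>t\<leftarrow>ts. act t (window a b x))"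

lemma act_add: "act t (\<lambda>i. x i + y i) = act t x + act t y"
proof (induction t arbitrary: x y)
  case (Node e a b j ts)
  have "window a b (\<lambda>i. x i + y i) = (\<lambda>i. window a b x i + window a b y i)" by (auto simp: window_def)
  then have "(\<Sum>t\<leftarrow>ts. act t (window a b (\<lambda>i. x i + y i))) = (\<Sum>t\<leftarrow>ts. act t (window a b x) + act t (window a b y))"
    using Node by (intro arg_cong[where f=sum_list] map_cong) auto
  then show ?case by (simp add: sum_list_addf distrib_left)
qed (simp add: distrib_left)

lemma act_scale: "act t (\<lambda>i. c * x i) = c * act t x"
proof (induction t arbitrary: x)
  case (Node e a b j ts)
  have "window a b (\<lambda>i. c * x i) = (\<lambda>i. c * window a b x i)" by (auto simp: window_def)
  then have "(\<Sum>t\<leftarrow>ts. act t (window a b (\<lambda>i. c * x i))) = (\<Sum>t\<leftarrow>ts. c * act t (window a b x))"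
    using Node by (intro arg_cong[where f=sum_list] map_cong) auto
  then show ?case by (simp add: sum_list_const_mult)
qed simp

lemma act_zero [simp]: "act t (\<lambda>i. 0) = 0"
  using act_scale[of t 0 "\<lambda>i. 0"] by simp

lemma act_minus: "act t (\<lambda>i. x i - y i) = act t x - act t y"
  using act_add[of t x "\<lambda>i. -1 * y i"] act_scale[of t "-1" y] by simp

lemma act_sum: "finite A \<Longrightarrow> act t (\<lambda>i. \<Sum>k\<in>A. x k i) = (\<Sum>k\<in>A. act t (x k))"
  by (induction A rule: finite_induct) (auto simp: act_add)

lemma act_block_sum: "act t (block_sum x a b) = (\<Sum>k=a..<b. act t (x k))"
  by (simp add: block_sum_def act_sum)

lemma act_cong: "(\<And>i. i \<in> supp t \<Longrightarrow> x i = y i) \<Longrightarrow> act t x = act t y"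
proof (induction t arbitrary: x y)
  case (Node e a b j ts)
  have "act t (window a b x) = act t (window a b y)" if "t \<in> set ts" for t
    using that Node.prems by (intro Node.IH) (auto simp: window_def)
  then have "map (\<lambda>t. act t (window a b x)) ts = map (\<lambda>t. act t (window a b y)) ts" by auto
  then show ?case by (simp only: act.simps)
qed simp

lemma act_eq_0: "(\<And>i. i \<in> supp t \<Longrightarrow> x i = 0) \<Longrightarrow> act t x = 0"
  using act_cong[of t x "\<lambda>i. 0"] by simp

lemma act_restrict_tree: "act (restrict_tree c d t) x = act t (window c d x)"
proof (cases t)
  case (Node e a b j ts)
  have "window (max a c) (min b d) x = window a b (window c d x)" by (auto simp: window_def)
  then show ?thesis using Node by simp
qed (auto simp: window_def)

lemma act_rotate_tree: "act (rotate_tree k t) x = \<omega> ^ k * act t x"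
  by (cases t) (auto simp: power_add)

text \<open>Disjointness of the supports at each node keeps the sum below the l1 norm, and the
  factor 1/mm j survives at the root. The second bound is how heavy functionals become small on a
  fixed vector.\<close>

lemma norm_act_l1:
  assumes "valid t" "finite A" "\<And>i. i \<notin> A \<Longrightarrow> x i = 0"
  shows "norm (act t x) \<le> (\<Sum>i\<in>A \<inter> supp t. norm (x i))"
    and "weight t = j \<Longrightarrow> j \<ge> 1 \<Longrightarrow> norm (act t x) \<le> (\<Sum>i\<in>A \<inter> supp t. norm (x i)) / real (mm j)"
proof -
  have L: "norm (\<Sum>t\<leftarrow>ts. act t x) \<le> (\<Sum>i\<in>A \<inter> (\<Union>t\<in>set ts. supp t). norm (x i))"
    if "successive ts" "\<And>t. t \<in> set ts \<Longrightarrow> norm (act t x) \<le> (\<Sum>i\<in>A \<inter> supp t. norm (x i))" for ts x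
    using that
  proof (induction ts)
    case (Cons t ts)
    have d: "(A \<inter> supp t) \<inter> (A \<inter> (\<Union>t\<in>set ts. supp t)) = {}"
      using Cons.prems(1) by (fastforce simp: successive_def)
    have "norm (\<Sum>t\<leftarrow>t # ts. act t x) \<le> norm (act t x) + norm (\<Sum>t\<leftarrow>ts. act t x)"
      by (simp add: norm_triangle_ineq)
    also have "\<dots> \<le> (\<Sum>i\<in>A \<inter> supp t. norm (x i)) + (\<Sum>i\<in>A \<inter> (\<Union>t\<in>set ts. supp t). norm (x i))"
      using Cons by (intro add_mono) (auto simp: successive_def)
    also have "\<dots> = (\<Sum>i\<in>(A \<inter> supp t) \<union> (A \<inter> (\<Union>t\<in>set ts. supp t)). norm (x i))"
      using d assms(2) by (intro sum.union_disjoint[symmetric]) auto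
    also have "(A \<inter> supp t) \<union> (A \<inter> (\<Union>t\<in>set ts. supp t)) = A \<inter> (\<Union>t\<in>set (t # ts). supp t)" by auto
    finally show ?case .
  qed simp
  have M: "norm (act (Node e a b j ts) x) \<le> (\<Sum>i\<in>A \<inter> supp (Node e a b j ts). norm (x i)) / real (mm j)"
    if "valid (Node e a b j ts)" "\<And>i. i \<notin> A \<Longrightarrow> x i = 0"
      "\<And>t x. t \<in> set ts \<Longrightarrow> (\<And>i. i \<notin> A \<Longrightarrow> x i = 0) \<Longrightarrow> norm (act t x) \<le> (\<Sum>i\<in>A \<inter> supp t. norm (x i))"
    for e a b j ts x
  proof -
    have z: "\<And>i. i \<notin> A \<Longrightarrow> window a b x i = 0" using that(2) by (auto simp: window_def)
    have "norm (act (Node e a b j ts) x) = norm (\<Sum>t\<leftarrow>ts. act t (window a b x)) / real (mm j)"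
      by (simp add: norm_mult norm_divide)
    also have "\<dots> \<le> (\<Sum>i\<in>A \<inter> (\<Union>t\<in>set ts. supp t). norm (window a b x i)) / real (mm j)"
      using that z by (intro divide_right_mono L) auto
    also have "(\<Sum>i\<in>A \<inter> (\<Union>t\<in>set ts. supp t). norm (window a b x i)) = (\<Sum>i\<in>A \<inter> supp (Node e a b j ts). norm (x i))"
      using assms(2) by (intro sum.mono_neutral_cong_right) (auto simp: window_def)
    finally show ?thesis .
  qed
  have one: "norm (act t x) \<le> (\<Sum>i\<in>A \<inter> supp t. norm (x i))" if "valid t" "\<And>i. i \<notin> A \<Longrightarrow> x i = 0" for t x
    using that
  proof (induction t arbitrary: x)
    case (Leaf e i)
    then show ?case by (cases "i \<in> A") (auto simp: norm_mult)
  next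
    case (Node e a b j ts)
    have "norm (act (Node e a b j ts) x) \<le> (\<Sum>i\<in>A \<inter> supp (Node e a b j ts). norm (x i)) / real (mm j)"
      using Node by (intro M) auto
    also have "\<dots> \<le> (\<Sum>i\<in>A \<inter> supp (Node e a b j ts). norm (x i)) / 1"
      using mm_ge[of j] by (intro divide_left_mono sum_nonneg) auto
    finally show ?case by simp
  qed
  show "norm (act t x) \<le> (\<Sum>i\<in>A \<inter> supp t. norm (x i))" using one assms by auto
  show "norm (act t x) \<le> (\<Sum>i\<in>A \<inter> supp t. norm (x i)) / real (mm j)" if "weight t = j" "j \<ge> 1"
  proof (cases t)
    case (Leaf e i)
    then show ?thesis using that by simp
  next
    case (Node e a b j' ts)
    then have "j' = j" using that by simp
    then show ?thesis using M[of e a b j ts x] one assms Node by auto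
  qed
qed

text \<open>At each border between a tree and its successors, the two sides can share only the block
  that straddles the border. Counting that block twice costs one extra \<tau> per tree.\<close>

lemma list_estimate:
  assumes x: "blocks l x" and ts: "successive ts"
    and H: "\<And>t a b. t \<in> set ts \<Longrightarrow> a \<le> b \<Longrightarrow> b \<le> N \<Longrightarrow> norm (act t (block_sum x a b)) \<le> D * (Q + real (b - a) * \<tau>)"
    and D: "D \<ge> 0" "\<tau> \<ge> 0" and ab: "a \<le> b" "b \<le> N"
  shows "norm (\<Sum>t\<leftarrow>ts. act t (block_sum x a b)) \<le> D * (real (length ts) * (Q + \<tau>) + real (b - a) * \<tau>)"
  using ts H ab
proof (induction ts arbitrary: a b)
  case Nil
  then show ?case using D by simp
next
  case (Cons t ts)
  \<comment> \<open>The border: the first index after the support of \<open>t\<close>, or 0 if the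
    support is empty.\<close>
  define c where "c = (if supp t = {} then 0 else Suc (Max (supp t)))"
  have c1: "i < c" if "i \<in> supp t" for i
    using that by (auto simp: c_def less_Suc_eq_le)
  have c2: "c \<le> i" if "i \<in> supp s" "s \<in> set ts" for i s
  proof (cases "supp t = {}")
    case False
    then have "Max (supp t) \<in> supp t" by simp
    then show ?thesis using Cons.prems(1) that False by (auto simp: c_def successive_def Suc_le_eq)
  qed (simp add: c_def)
  have ml: "mono l" using x by (simp add: blocks_def)
  \<comment> \<open>The first block reaching beyond the border, or \<open>b\<close> if there is
    none. It is handed to both sides.\<close>
  define e where "e = (LEAST e. e \<ge> b \<or> l (Suc e) > c)"
  have e1: "e \<ge> b \<or> l (Suc e) > c" unfolding e_def by (rule LeastI[of _ b]) auto
  have e2: "l (Suc k) \<le> c" if "k < e" for k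
    using not_less_Least[OF that[unfolded e_def]] by auto
  have e3: "e \<le> b" unfolding e_def by (rule Least_le) auto
  define b' where "b' = max a (min b (Suc e))"
  define a' where "a' = max a e"
  have tx: "act t (x k) = 0" if "k \<ge> Suc e" "k < b" for k
  proof (rule act_eq_0)
    fix i assume "i \<in> supp t"
    then have "i < c" by (rule c1)
    moreover have "c < l k" using e1 that monoD[OF ml that(1)] by auto
    ultimately show "x k i = 0" using x by (meson blocks_def leD less_trans)
  qed
  have sx: "act s (x k) = 0" if "k < e" "s \<in> set ts" for k s
  proof (rule act_eq_0)
    fix i assume "i \<in> supp s"
    then have "c \<le> i" using c2 that by blast
    then show "x k i = 0" using e2[OF that(1)] x by (meson blocks_def leD order_trans)
  qed
  have 1: "act t (block_sum x a b) = act t (block_sum x a b')"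
    unfolding act_block_sum b'_def using tx Cons.prems(3) by (intro sum.mono_neutral_right) auto
  have 2: "map (\<lambda>s. act s (block_sum x a b)) ts = map (\<lambda>s. act s (block_sum x a' b)) ts"
    unfolding act_block_sum a'_def using sx by (intro map_cong refl sum.mono_neutral_right) auto
  have b': "a \<le> b'" "b' \<le> b" using Cons.prems by (auto simp: b'_def)
  have a': "a \<le> a'" "a' \<le> b" using Cons.prems e3 by (auto simp: a'_def)
  have len: "real (b' - a) + real (b - a') \<le> real (b - a) + 1"
    using Cons.prems e3 unfolding b'_def a'_def by (auto simp: max_def min_def)
  have "norm (\<Sum>s\<leftarrow>t # ts. act s (block_sum x a b)) \<le> norm (act t (block_sum x a b)) + norm (\<Sum>s\<leftarrow>ts. act s (block_sum x a b))"
    by (simp add: norm_triangle_ineq)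
  also have "\<dots> = norm (act t (block_sum x a b')) + norm (\<Sum>s\<leftarrow>ts. act s (block_sum x a' b))"
    by (simp only: 1 2)
  also have "\<dots> \<le> D * (Q + real (b' - a) * \<tau>) + D * (real (length ts) * (Q + \<tau>) + real (b - a') * \<tau>)"
    using Cons.prems b' a' by (intro add_mono Cons.IH Cons.prems(2)) (auto simp: successive_def)
  also have "\<dots> = D * (Q + real (length ts) * (Q + \<tau>) + (real (b' - a) + real (b - a')) * \<tau>)"
    by (simp add: algebra_simps)
  also have "\<dots> \<le> D * (Q + real (length ts) * (Q + \<tau>) + (real (b - a) + 1) * \<tau>)"
    using D len by (intro mult_left_mono add_left_mono mult_right_mono) auto
  also have "\<dots> = D * (real (length (t # ts)) * (Q + \<tau>) + real (b - a) * \<tau>)"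
    by (simp add: algebra_simps)
  finally show ?case .
qed

text \<open>The interval of the node is pushed into its children, which stay valid and successive
  under restriction, so that \<open>list_estimate\<close> applies to them.\<close>

lemma act_Node_estimate:
  assumes x: "blocks l x" and t: "valid (Node e c d j ts)"
    and H: "\<And>t a b. valid t \<Longrightarrow> a \<le> b \<Longrightarrow> b \<le> N \<Longrightarrow> norm (act t (block_sum x a b)) \<le> D * (Q + real (b - a) * \<tau>)"
    and D: "D \<ge> 0" "\<tau> \<ge> 0" "Q \<ge> 0" and ab: "a \<le> b" "b \<le> N"
  shows "norm (act (Node e c d j ts) (block_sum x a b)) \<le> D * (real (nn j) * (Q + \<tau>) + real (b - a) * \<tau>) / real (mm j)"
proof -
  have "norm (act (Node e c d j ts) (block_sum x a b)) = norm (\<Sum>t\<leftarrow>map (restrict_tree c d) ts. act t (block_sum x a b)) / real (mm j)"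
    by (simp add: norm_mult norm_divide act_restrict_tree o_def)
  also have "\<dots> \<le> (D * (real (length (map (restrict_tree c d) ts)) * (Q + \<tau>) + real (b - a) * \<tau>)) / real (mm j)"
    using t by (intro divide_right_mono list_estimate[where N=N]) (use x H D ab successive_restrict_tree in auto)
  also have "\<dots> \<le> (D * (real (nn j) * (Q + \<tau>) + real (b - a) * \<tau>)) / real (mm j)"
    using t D by (intro divide_right_mono mult_left_mono add_right_mono mult_right_mono) auto
  finally show ?thesis .
qed

text \<open>Blocks occupy disjoint intervals, so a single coordinate meets at most one of
  them.\<close>

lemma act_Leaf_estimate:
  assumes x: "blocks l x" and D: "\<And>k. k < b \<Longrightarrow> norm (act (Leaf e i) (x k)) \<le> D" "D \<ge> 0"
  shows "norm (act (Leaf e i) (block_sum x a b)) \<le> D"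
proof (cases "\<exists>k\<in>{a..<b}. x k i \<noteq> 0")
  case False
  then have "\<And>k. k \<in> {a..<b} \<Longrightarrow> act (Leaf e i) (x k) = 0" by auto
  then have "act (Leaf e i) (block_sum x a b) = 0"
    unfolding act_block_sum by (rule sum.neutral[OF ballI]) auto
  then show ?thesis using D(2) by (simp only: norm_zero)
next
  case True
  then obtain k where k: "k \<in> {a..<b}" "x k i \<noteq> 0" by blast
  have ml: "mono l" using x by (simp add: blocks_def)
  have "x k' i = 0" if "k' \<noteq> k" for k'
  proof (rule ccontr)
    assume "x k' i \<noteq> 0"
    then have *: "l k' \<le> i" "i < l (Suc k')" "l k \<le> i" "i < l (Suc k)" using x k by (auto simp: blocks_def)
    show False
    proof (cases "k' < k")
      case True
      then have "l (Suc k') \<le> l k" using monoD[OF ml, of "Suc k'" k] by simp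
      then show ?thesis using * by simp
    next
      case False
      then have "l (Suc k) \<le> l k'" using monoD[OF ml, of "Suc k" k'] that by simp
      then show ?thesis using * by simp
    qed
  qed
  then have "act (Leaf e i) (block_sum x a b) = (\<Sum>k'\<in>{k}. act (Leaf e i) (x k'))"
    unfolding act_block_sum using k by (intro sum.mono_neutral_right) auto
  then show ?thesis using D(1)[of k] k by (simp del: act.simps)
qed

text \<open>A functional of weight below \<open>p\<close> is unfolded one level at a time; each level halves the part of the bound that
  is proportional to the number of blocks.\<close>

lemma recursive_estimate:
  assumes x: "blocks l x" and D: "\<And>t k. valid t \<Longrightarrow> k < N \<Longrightarrow> norm (act t (x k)) \<le> D" "D \<ge> 0"
    and p: "p \<ge> 1" and th: "0 \<le> \<theta>" "\<theta> \<le> 1"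
    and big: "\<And>t a b. valid t \<Longrightarrow> weight t \<ge> p \<Longrightarrow> a \<le> b \<Longrightarrow> b \<le> N \<Longrightarrow> norm (act t (block_sum x a b)) \<le> D * (8 + real (b - a) * \<theta>)"
    and ab: "a \<le> b" "b \<le> N" and t: "valid t"
  shows "norm (act t (block_sum x a b)) \<le> D * (real (split_bound (nn (p - 1)) r) + real (b - a) * (\<theta> + (1/2) ^ r))"
    and "weight t = j \<Longrightarrow> 1 \<le> j \<Longrightarrow> j < p \<Longrightarrow> norm (act t (block_sum x a b)) \<le> D * (real (split_bound (nn (p - 1)) (Suc r)) + real (b - a) * (\<theta> + (1/2) ^ r) / real (mm j))"
proof -
  let ?v = "nn (p - 1)"
  have v: "?v \<ge> 1" using nn_ge[of "p - 1"] by simp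
  \<comment> \<open>One level of unfolding: at most nn (p - 1) children, each contributing the
    previous constant plus at most 2. This is the recursion of \<open>split_bound\<close>.\<close>
  have small: "norm (act t (block_sum x a b)) \<le> D * (real (split_bound ?v (Suc r)) + real (b - a) * (\<theta> + (1/2) ^ r) / real (mm j))"
    if IH: "\<And>t a b. valid t \<Longrightarrow> a \<le> b \<Longrightarrow> b \<le> N \<Longrightarrow> norm (act t (block_sum x a b)) \<le> D * (real (split_bound ?v r) + real (b - a) * (\<theta> + (1/2) ^ r))"
      and t: "valid t" "weight t = j" "1 \<le> j" "j < p" "a \<le> b" "b \<le> N" for t a b r j
  proof -
    obtain e c d ts where T: "t = Node e c d j ts" using t by (cases t) auto
    have tau: "0 \<le> \<theta> + (1/2::real) ^ r" "\<theta> + (1/2::real) ^ r \<le> 2"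
      using th power_le_one[of "1/2::real" r] by auto
    have "norm (act t (block_sum x a b)) \<le> D * (real (nn j) * (real (split_bound ?v r) + (\<theta> + (1/2) ^ r)) + real (b - a) * (\<theta> + (1/2) ^ r)) / real (mm j)"
      unfolding T using t T by (intro act_Node_estimate[OF x]) (use D IH tau in auto)
    also have "\<dots> = D * (real (nn j) * (real (split_bound ?v r) + (\<theta> + (1/2) ^ r)) / real (mm j) + real (b - a) * (\<theta> + (1/2) ^ r) / real (mm j))"
      by (simp only: add_divide_distrib distrib_left times_divide_eq_right)
    also have "\<dots> \<le> D * (real (split_bound ?v (Suc r)) + real (b - a) * (\<theta> + (1/2) ^ r) / real (mm j))"
    proof (intro mult_left_mono add_right_mono D)
      have "real (nn j) * (real (split_bound ?v r) + (\<theta> + (1/2) ^ r)) / real (mm j) \<le> real (nn j) * (real (split_bound ?v r) + (\<theta> + (1/2) ^ r)) / 1"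
        using mm_ge[of j] tau by (intro divide_left_mono) auto
      also have "\<dots> \<le> real ?v * (real (split_bound ?v r) + 2)"
        using tau nn_mono[of j "p - 1"] t by (auto intro!: mult_mono)
      finally show "real (nn j) * (real (split_bound ?v r) + (\<theta> + (1/2) ^ r)) / real (mm j) \<le> real (split_bound ?v (Suc r))"
        by (simp add: algebra_simps)
    qed
    finally show ?thesis .
  qed
  have main: "norm (act t (block_sum x a b)) \<le> D * (real (split_bound ?v r) + real (b - a) * (\<theta> + (1/2) ^ r))"
    if "valid t" "a \<le> b" "b \<le> N" for t a b r
    using that
  proof (induction r arbitrary: t a b)
    case 0
    have "norm (act t (block_sum x a b)) \<le> (\<Sum>k=a..<b. norm (act t (x k)))" unfolding act_block_sum by (rule norm_sum)
    also have "\<dots> \<le> (\<Sum>k=a..<b. D)" using 0 D by (intro sum_mono) auto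
    also have "\<dots> = D * (0 + real (b - a) * 1)" by simp
    also have "\<dots> \<le> D * (real (split_bound ?v 0) + real (b - a) * (\<theta> + (1/2) ^ 0))"
      using D th by (intro mult_left_mono add_mono) auto
    finally show ?case .
  next
    case (Suc r)
    have sb: "1 \<le> real (split_bound ?v (Suc r))" "8 \<le> real (split_bound ?v (Suc r))"
      using split_bound_ge[OF v, of "Suc r"] by linarith+
    have nn: "0 \<le> real (b - a) * (\<theta> + (1/2) ^ Suc r)" using th by simp
    consider "weight t = 0" | "1 \<le> weight t" "weight t < p" | "p \<le> weight t" by linarith
    then show ?case
    proof cases
      case 1
      then obtain e i where T: "t = Leaf e i" using Suc.prems by (cases t) auto
      have "norm (act t (block_sum x a b)) \<le> D" unfolding T using Suc.prems
        by (intro act_Leaf_estimate[OF x] D) auto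
      also have "\<dots> \<le> D * (real (split_bound ?v (Suc r)) + real (b - a) * (\<theta> + (1/2) ^ Suc r))"
      proof -
        have "D * 1 \<le> D * (real (split_bound ?v (Suc r)) + real (b - a) * (\<theta> + (1/2) ^ Suc r))"
          using D(2) sb nn by (intro mult_left_mono) linarith+
        then show ?thesis by simp
      qed
      finally show ?thesis .
    next
      case 2
      have "norm (act t (block_sum x a b)) \<le> D * (real (split_bound ?v (Suc r)) + real (b - a) * (\<theta> + (1/2) ^ r) / real (mm (weight t)))"
        using 2 Suc by (intro small) auto
      also have "\<dots> \<le> D * (real (split_bound ?v (Suc r)) + real (b - a) * (\<theta> + (1/2) ^ Suc r))"
      proof (intro mult_left_mono add_left_mono D)
        \<comment> \<open>Since \<open>mm\<close> is at least 2, one level halves the coefficient,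
          and the half that would be gained on \<theta> is given away.\<close>
        have "(\<theta> + (1/2) ^ r) / real (mm (weight t)) \<le> (\<theta> + (1/2) ^ r) / 2"
          using mm_ge[of "weight t"] th by (intro divide_left_mono) auto
        also have "\<dots> \<le> \<theta> + (1/2) ^ Suc r" using th by (simp add: field_simps)
        finally have "real (b - a) * ((\<theta> + (1/2) ^ r) / real (mm (weight t))) \<le> real (b - a) * (\<theta> + (1/2) ^ Suc r)"
          by (intro mult_left_mono) auto
        then show "real (b - a) * (\<theta> + (1/2) ^ r) / real (mm (weight t)) \<le> real (b - a) * (\<theta> + (1/2) ^ Suc r)" by simp
      qed
      finally show ?thesis .
    next
      case 3
      have "norm (act t (block_sum x a b)) \<le> D * (8 + real (b - a) * \<theta>)" using 3 Suc.prems by (intro big) auto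
      also have "\<dots> \<le> D * (real (split_bound ?v (Suc r)) + real (b - a) * (\<theta> + (1/2) ^ Suc r))"
        using D sb by (intro mult_left_mono add_mono) auto
      finally show ?thesis .
    qed
  qed
  show "norm (act t (block_sum x a b)) \<le> D * (real (split_bound ?v r) + real (b - a) * (\<theta> + (1/2) ^ r))"
    using main t ab by auto
  show "norm (act t (block_sum x a b)) \<le> D * (real (split_bound ?v (Suc r)) + real (b - a) * (\<theta> + (1/2) ^ r) / real (mm j))"
    if "weight t = j" "1 \<le> j" "j < p"
    using small[OF main t that ab] by auto
qed


text \<open>\<open>nm\<close> is junk off \<open>X0\<close>. The space is boundedly complete, so \<open>X0\<close> is also the completion of the finitely
  supported sequences.\<close>

definition X0 :: "(nat \<Rightarrow> 'k) set" where
  "X0 = {x. bdd_above ((\<lambda>t. norm (act t x)) ` {t. valid t})}"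

definition nm :: "(nat \<Rightarrow> 'k) \<Rightarrow> real" where
  "nm x = (SUP t\<in>{t. valid t}. norm (act t x))"

section \<open>The norm and its first properties\<close>

lemma nn_gt: "nn j > j"
proof (induction j)
  case (Suc j)
  then show ?case using nn_sq_le_mm[of j "Suc j"] by simp
qed (use nn_ge[of 0] in auto)

lemma valid_Leaf_ex: "Leaf 0 0 \<in> {t. valid t}" by simp

lemma act_le_nm: "x \<in> X0 \<Longrightarrow> valid t \<Longrightarrow> norm (act t x) \<le> nm x"
  unfolding nm_def X0_def by (rule cSUP_upper) auto

lemma nm_le: "(\<And>t. valid t \<Longrightarrow> norm (act t x) \<le> c) \<Longrightarrow> nm x \<le> c"
  unfolding nm_def by (rule cSUP_least) (use valid_Leaf_ex in blast)+

lemma X0_I: "(\<And>t. valid t \<Longrightarrow> norm (act t x) \<le> c) \<Longrightarrow> x \<in> X0"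
  unfolding X0_def by (auto intro!: bdd_aboveI2)

lemma nm_nonneg: "x \<in> X0 \<Longrightarrow> 0 \<le> nm x"
  using act_le_nm[of x "Leaf 0 0"] by (auto intro: order_trans[OF norm_ge_zero])

lemma coord_le_nm: "x \<in> X0 \<Longrightarrow> norm (x i) \<le> nm x"
  using act_le_nm[of x "Leaf 0 i"] by simp

lemma fin_X0: assumes "\<And>i. i \<ge> N \<Longrightarrow> x i = 0" shows "x \<in> X0"
proof (rule X0_I)
  fix t assume "valid t"
  then have "norm (act t x) \<le> (\<Sum>i\<in>{..<N} \<inter> supp t. norm (x i))" by (rule norm_act_l1) (use assms in auto)
  also have "\<dots> \<le> (\<Sum>i<N. norm (x i))" by (rule sum_mono2) auto
  finally show "norm (act t x) \<le> (\<Sum>i<N. norm (x i))" .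
qed

lemma X0_add: "x \<in> X0 \<Longrightarrow> y \<in> X0 \<Longrightarrow> (\<lambda>i. x i + y i) \<in> X0"
  and nm_add: "x \<in> X0 \<Longrightarrow> y \<in> X0 \<Longrightarrow> nm (\<lambda>i. x i + y i) \<le> nm x + nm y"
proof -
  assume xy: "x \<in> X0" "y \<in> X0"
  have *: "norm (act t (\<lambda>i. x i + y i)) \<le> nm x + nm y" if "valid t" for t
    unfolding act_add using norm_triangle_ineq[of "act t x" "act t y"] act_le_nm[OF xy(1) that] act_le_nm[OF xy(2) that] by linarith
  show "(\<lambda>i. x i + y i) \<in> X0" using * by (rule X0_I)
  show "nm (\<lambda>i. x i + y i) \<le> nm x + nm y" using * by (rule nm_le)
qed

lemma X0_scale: "x \<in> X0 \<Longrightarrow> (\<lambda>i. c * x i) \<in> X0"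
  and nm_scale: "x \<in> X0 \<Longrightarrow> nm (\<lambda>i. c * x i) = norm c * nm x"
proof -
  have *: "norm (act t (\<lambda>i. c * x i)) \<le> norm c * nm x" if "valid t" "x \<in> X0" for t c x
    unfolding act_scale norm_mult using act_le_nm[OF that(2,1)] by (intro mult_left_mono) auto
  have in0: "(\<lambda>i. c * x i) \<in> X0" if "x \<in> X0" for c x using * that by (intro X0_I) auto
  have le: "nm (\<lambda>i. c * x i) \<le> norm c * nm x" if "x \<in> X0" for c x using * that by (intro nm_le) auto
  assume x: "x \<in> X0"
  show "(\<lambda>i. c * x i) \<in> X0" using in0 x .
  show "nm (\<lambda>i. c * x i) = norm c * nm x"
  proof (cases "c = 0")
    case True
    then show ?thesis using le[OF x, of c] nm_nonneg[OF in0[OF x, of c]] by simp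
  next
    case False
    have "nm x \<le> norm (inverse c) * nm (\<lambda>i. c * x i)"
      using le[OF in0[OF x, of c], of "inverse c"] False by (simp add: mult.assoc[symmetric])
    then have "norm c * nm x \<le> norm c * (norm (inverse c) * nm (\<lambda>i. c * x i))" by (intro mult_left_mono) auto
    also have "\<dots> = nm (\<lambda>i. c * x i)" using False by (simp add: mult.assoc[symmetric] norm_mult[symmetric] del: norm_inverse)
    finally have "norm c * nm x \<le> nm (\<lambda>i. c * x i)" .
    then show ?thesis using le[OF x, of c] by simp
  qed
qed

lemma X0_window: "x \<in> X0 \<Longrightarrow> window a b x \<in> X0"
  and nm_window: "x \<in> X0 \<Longrightarrow> nm (window a b x) \<le> nm x"
proof -
  assume x: "x \<in> X0"
  have *: "norm (act t (window a b x)) \<le> nm x" if "valid t" for t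
    using act_le_nm[OF x valid_restrict_tree[OF that]] by (simp add: act_restrict_tree[symmetric])
  show "window a b x \<in> X0" using * by (rule X0_I)
  show "nm (window a b x) \<le> nm x" using * by (rule nm_le)
qed

lemma norming_tree:
  assumes "x \<in> X0" "nm x > c" shows "\<exists>t. valid t \<and> norm (act t x) > c"
  using assms nm_le[of x c] by (meson not_le)

lemma nm_eq_0: "x \<in> X0 \<Longrightarrow> nm x = 0 \<longleftrightarrow> x = (\<lambda>i. 0)"
proof
  assume "x \<in> X0" "nm x = 0"
  then show "x = (\<lambda>i. 0)" using coord_le_nm[of x] by (intro ext) (metis norm_le_zero_iff)
next
  assume "x = (\<lambda>i. 0)"
  then have "nm x \<le> 0" by (intro nm_le) auto
  moreover assume "x \<in> X0"
  ultimately show "nm x = 0" using nm_nonneg[of x] by simp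
qed

text \<open>A node of weight j cuts N consecutive blocks into at most N + nn j pieces. Once nn j <=
  N these are at most 2 N pieces of size C, to be divided by mm j and by N.\<close>

lemma avg_estimate:
  assumes y: "blocks l y" and C: "\<And>t k. valid t \<Longrightarrow> norm (act t (y k)) \<le> C" "C \<ge> 0" and N: "N \<ge> 1"
    and t: "valid t"
  shows "norm (act t (\<lambda>i. of_real (1 / real N) * block_sum y a (a + N) i)) \<le> C"
    and "1 \<le> weight t \<Longrightarrow> nn (weight t) \<le> N \<Longrightarrow> norm (act t (\<lambda>i. of_real (1 / real N) * block_sum y a (a + N) i)) \<le> 2 * C / real (mm (weight t))"
proof -
  have triv: "norm (act t (block_sum y a b)) \<le> C * (0 + real (b - a) * 1)" if "valid t" for t a b
  proof -
    have "norm (act t (block_sum y a b)) \<le> (\<Sum>k=a..<b. norm (act t (y k)))" unfolding act_block_sum by (rule norm_sum)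
    also have "\<dots> \<le> (\<Sum>k=a..<b. C)" using that C by (intro sum_mono) auto
    finally show ?thesis by (simp add: mult.commute)
  qed
  have e: "norm (act t (\<lambda>i. of_real (1 / real N) * block_sum y a (a + N) i)) = norm (act t (block_sum y a (a + N))) / real N"
    unfolding act_scale by (simp add: norm_mult norm_divide)
  show "norm (act t (\<lambda>i. of_real (1 / real N) * block_sum y a (a + N) i)) \<le> C"
    unfolding e using triv[OF t, of a "a + N"] N by (simp add: field_simps)
  assume j: "1 \<le> weight t" "nn (weight t) \<le> N"
  then obtain e' c d j' ts where T: "t = Node e' c d j' ts" by (cases t) auto
  have w: "weight t = j'" by (simp add: T)
  have "norm (act t (block_sum y a (a + N))) \<le> C * (real (nn (weight t)) * (0 + 1) + real (a + N - a) * 1) / real (mm (weight t))"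
    unfolding w unfolding T by (rule act_Node_estimate[OF y t[unfolded T] triv]) (use C in auto)
  also have "\<dots> \<le> C * (2 * real N) / real (mm (weight t))"
    using j C by (intro divide_right_mono mult_left_mono) auto
  finally have "norm (act t (block_sum y a (a + N))) / real N \<le> C * (2 * real N) / real (mm (weight t)) / real N"
    by (rule divide_right_mono) simp
  then show "norm (act t (\<lambda>i. of_real (1 / real N) * block_sum y a (a + N) i)) \<le> 2 * C / real (mm (weight t))"
    unfolding e using N by (simp add: mult.commute)
qed

section \<open>Rapidly increasing sequences and long averages\<close>

lemma nn_decomp: "j \<ge> 1 \<Longrightarrow> real (nn j) = real (mm j) ^ 3 * real (split_bound (nn (j - 1)) (Suc ((mm j)\<^sup>2)))"
  using nn_Suc[of "j - 1"] by (simp add: numeral_3_eq_3 del: split_bound.simps)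

text \<open>The reason for unfolding mm^2 times.\<close>

lemma half_power_le: "(1/2::real) ^ ((mm j)\<^sup>2) \<le> 1 / (real (mm j))\<^sup>2"
proof -
  have "real ((mm j)\<^sup>2) < 2 ^ ((mm j)\<^sup>2)" using of_nat_less_two_power[of "(mm j)\<^sup>2"] by simp
  then have "1 / 2 ^ ((mm j)\<^sup>2) \<le> 1 / real ((mm j)\<^sup>2)"
    using mm_ge[of j] by (intro divide_left_mono) auto
  then show ?thesis by (simp add: power_divide)
qed

text \<open>A functional of weight at least j is too heavy for the early vectors and too light for
  the late ones; only one index in between can contribute a full C. That is the large-weight
  hypothesis of \<open>recursive_estimate\<close> with \<theta> = 1/mm j, run for mm^2 rounds. The
  gain 1/mm (weight t) for lighter functionals comes from the root level of the unfolding.\<close>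

lemma ris_estimate:
  assumes x: "blocks l x" and C: "C \<ge> 0" and j: "1 \<le> j" "j \<le> js 0" and js: "strict_mono js"
    and 1: "\<And>t k. valid t \<Longrightarrow> norm (act t (x k)) \<le> C"
    and 2: "\<And>t k. valid t \<Longrightarrow> 1 \<le> weight t \<Longrightarrow> weight t \<le> js k \<Longrightarrow> norm (act t (x k)) \<le> C / real (mm (weight t))"
    and 3: "\<And>t k. valid t \<Longrightarrow> weight t \<ge> js (Suc k) \<Longrightarrow> norm (act t (x k)) \<le> C / real (nn j)"
    and t: "valid t"
  shows "norm (act t (block_sum x 0 (nn j))) \<le> 3 * C * real (nn j) / real (mm j)"
    and "1 \<le> weight t \<Longrightarrow> weight t < j \<Longrightarrow> norm (act t (block_sum x 0 (nn j))) \<le> 3 * C * real (nn j) / (real (mm j) * real (mm (weight t)))"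
    and "weight t > j \<Longrightarrow> norm (act t (block_sum x 0 (nn j))) \<le> 3 * C"
proof -
  have m: "real (mm j) \<ge> 2" "real (nn j) \<ge> 2" using mm_ge[of j] nn_ge[of j] by linarith+
  have big: "norm (act t (block_sum x a b)) \<le> C * (2 + real (b - a) / real (mm (weight t)))"
    if "valid t" "weight t \<ge> j" "a \<le> b" "b \<le> nn j" for t a b
  proof -
    \<comment> \<open>The index k with js k <= weight t < js (k + 1), or 0 if the weight lies below
      js 0.\<close>
    define k0 where "k0 = (LEAST k. weight t < js (Suc k))"
    have ex: "\<exists>k. weight t < js (Suc k)"
      using strict_mono_imp_increasing[OF js, of "Suc (weight t)"] by (intro exI[of _ "weight t"]) linarith
    have k0: "weight t < js (Suc k0)" unfolding k0_def using ex by (rule LeastI_ex)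
    have m0: "0 \<le> C / real (mm (weight t))" "0 \<le> C / real (nn j)" using C by auto
    have each: "norm (act t (x k)) \<le> C / real (mm (weight t)) + C / real (nn j) + (if k = k0 then C else 0)" for k
    proof -
      consider "k < k0" | "k = k0" | "k > k0" by linarith
      then show ?thesis
      proof cases
        case 1
        then have "weight t \<ge> js (Suc k)" using not_less_Least[of k "\<lambda>k. weight t < js (Suc k)"] k0_def by auto
        then show ?thesis using 3[OF that(1), of k] m0 1 by simp
      next
        case 2
        then show ?thesis using 1[OF that(1), of k] m0 by simp
      next
        case 3
        then have "js (Suc k0) \<le> js k" using js by (simp add: strict_mono_less_eq Suc_le_eq)
        then have "weight t \<le> js k" using k0 by simp
        then show ?thesis using 2[OF that(1) _, of k] m0 3 j that by simp
      qed
    qed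
    have "norm (act t (block_sum x a b)) \<le> (\<Sum>k=a..<b. norm (act t (x k)))" unfolding act_block_sum by (rule norm_sum)
    also have "\<dots> \<le> (\<Sum>k=a..<b. C / real (mm (weight t)) + C / real (nn j) + (if k = k0 then C else 0))"
      by (intro sum_mono each)
    also have "\<dots> = real (b - a) * (C / real (mm (weight t))) + real (b - a) * (C / real (nn j)) + (if k0 \<in> {a..<b} then C else 0)"
      by (simp add: sum.distrib sum.delta distrib_left)
    also have "\<dots> \<le> real (b - a) * (C / real (mm (weight t))) + real (nn j) * (C / real (nn j)) + C"
      using that C m0 by (intro add_mono mult_right_mono) auto
    also have "\<dots> = C * (2 + real (b - a) / real (mm (weight t)))" using m by (simp add: algebra_simps)
    finally show ?thesis .
  qed
  have big': "norm (act t (block_sum x a b)) \<le> C * (8 + real (b - a) * (1 / real (mm j)))"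
    if "valid t" "weight t \<ge> j" "a \<le> b" "b \<le> nn j" for t a b
  proof -
    have "norm (act t (block_sum x a b)) \<le> C * (2 + real (b - a) / real (mm (weight t)))" using big that by blast
    also have "\<dots> \<le> C * (8 + real (b - a) * (1 / real (mm j)))"
      using C mm_mono[OF that(2)] m by (intro mult_left_mono add_mono) (auto intro!: divide_left_mono)
    finally show ?thesis .
  qed
  define sb where "sb = real (split_bound (nn (j - 1)) (Suc ((mm j)\<^sup>2)))"
  have sb0: "sb \<ge> 0" by (simp add: sb_def)
  have N: "real (nn j) = real (mm j) ^ 3 * sb" using nn_decomp[OF j(1)] by (simp add: sb_def)
  have sbm: "sb \<le> real (nn j) / (real (mm j))\<^sup>2"
  proof -
    have "real (nn j) / (real (mm j))\<^sup>2 = real (mm j) * sb" unfolding N using m by (simp add: power2_eq_square power3_eq_cube)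
    moreover have "1 * sb \<le> real (mm j) * sb" using m sb0 by (intro mult_right_mono) auto
    ultimately show ?thesis by simp
  qed
  have sbm': "sb \<le> real (nn j) / real (mm j)"
  proof -
    have "real (nn j) / (real (mm j))\<^sup>2 \<le> real (nn j) / real (mm j)"
      using m by (intro divide_left_mono) (auto simp: power2_eq_square)
    then show ?thesis using sbm by simp
  qed
  have hp: "(1/2::real) ^ ((mm j)\<^sup>2) \<le> 1 / real (mm j)"
  proof -
    have "1 / (real (mm j))\<^sup>2 \<le> 1 / real (mm j)" using m by (intro divide_left_mono) (auto simp: power2_eq_square)
    then show ?thesis using half_power_le[of j] by linarith
  qed
  have th: "0 \<le> 1 / real (mm j)" "1 / real (mm j) \<le> 1" using m by auto
  have sbs: "real (split_bound (nn (j - 1)) ((mm j)\<^sup>2)) \<le> sb"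
    unfolding sb_def using split_bound_Suc_ge[of "nn (j - 1)"] nn_ge[of "j - 1"] by (simp del: split_bound.simps)
  have "norm (act t (block_sum x 0 (nn j))) \<le> C * (real (split_bound (nn (j - 1)) ((mm j)\<^sup>2)) + real (nn j - 0) * (1 / real (mm j) + (1/2) ^ ((mm j)\<^sup>2)))"
    by (rule recursive_estimate(1)[OF x, of "nn j" C j "1 / real (mm j)"]) (use 1 C j th big' t in auto)
  also have "\<dots> \<le> C * (real (nn j) / real (mm j) + real (nn j) * (1 / real (mm j) + 1 / real (mm j)))"
  proof -
    have "real (nn j) * (1 / real (mm j) + (1/2) ^ ((mm j)\<^sup>2)) \<le> real (nn j) * (1 / real (mm j) + 1 / real (mm j))"
      by (rule mult_left_mono[OF add_left_mono[OF hp]]) simp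
    then show ?thesis using C sbs sbm' by (intro mult_left_mono add_mono) auto
  qed
  also have "\<dots> = 3 * C * real (nn j) / real (mm j)" by (simp add: field_simps)
  finally show "norm (act t (block_sum x 0 (nn j))) \<le> 3 * C * real (nn j) / real (mm j)" .
  show "norm (act t (block_sum x 0 (nn j))) \<le> 3 * C" if "weight t > j"
  proof -
    have "nn j \<le> mm (weight t)" using nn_sq_le_mm[OF that] by simp
    then have le1: "real (nn j) / real (mm (weight t)) \<le> 1" using m by (simp add: divide_le_eq)
    have "norm (act t (block_sum x 0 (nn j))) \<le> C * (2 + real (nn j - 0) / real (mm (weight t)))" using that by (intro big[OF t]) auto
    also have "\<dots> \<le> C * 3" using C le1 by (intro mult_left_mono) auto
    finally show ?thesis by simp
  qed
  show "norm (act t (block_sum x 0 (nn j))) \<le> 3 * C * real (nn j) / (real (mm j) * real (mm (weight t)))" if w: "1 \<le> weight t" "weight t < j"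
  proof -
    let ?w = "real (mm (weight t))"
    have mw: "?w \<ge> 2" "?w \<le> real (mm j)" using mm_ge[of "weight t"] mm_mono[of "weight t" j] w by linarith+
    have "norm (act t (block_sum x 0 (nn j))) \<le> C * (real (split_bound (nn (j - 1)) (Suc ((mm j)\<^sup>2))) + real (nn j - 0) * (1 / real (mm j) + (1/2) ^ ((mm j)\<^sup>2)) / ?w)"
      by (rule recursive_estimate(2)[OF x, of "nn j" C j "1 / real (mm j)"]) (use 1 C j th big' t w in auto)
    also have "\<dots> \<le> C * (real (nn j) / (real (mm j))\<^sup>2 + real (nn j) * (1 / real (mm j) + 1 / real (mm j)) / ?w)"
    proof -
      have "real (nn j - 0) * (1 / real (mm j) + (1/2) ^ ((mm j)\<^sup>2)) \<le> real (nn j) * (1 / real (mm j) + 1 / real (mm j))"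
        unfolding diff_zero by (rule mult_left_mono[OF add_left_mono[OF hp]]) simp
      then show ?thesis using C sbm[unfolded sb_def] mw by (intro mult_left_mono add_mono divide_right_mono) auto
    qed
    also have "\<dots> \<le> C * (real (nn j) / (real (mm j) * ?w) + real (nn j) * (1 / real (mm j) + 1 / real (mm j)) / ?w)"
      using C mw m by (intro mult_left_mono add_mono divide_left_mono) (auto simp: power2_eq_square)
    also have "\<dots> = 3 * C * real (nn j) / (real (mm j) * ?w)" using m mw by (simp add: field_simps)
    finally show ?thesis .
  qed
qed

text \<open>A finitely supported vector has finite l1 norm, and a node of weight J divides by mm J >
  J.\<close>

lemma weight_decay:
  assumes "\<And>i. x i \<noteq> 0 \<Longrightarrow> i < e" "\<delta> > 0"
  shows "\<exists>J>J0. \<forall>t. valid t \<and> weight t \<ge> J \<longrightarrow> norm (act t x) \<le> \<delta>"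
proof -
  define L where "L = (\<Sum>i<e. norm (x i))"
  have L0: "L \<ge> 0" by (auto simp: L_def intro: sum_nonneg)
  obtain J where J: "real J \<ge> L / \<delta>" "J > J0" "J \<ge> 1"
  proof -
    obtain n where "real n \<ge> L / \<delta>" using real_arch_simple by blast
    then show ?thesis by (intro that[of "max n (Suc J0)"]) (auto simp: max_def)
  qed
  have z: "x i = 0" if "i \<notin> {..<e}" for i using assms(1)[of i] that by auto
  have "norm (act t x) \<le> \<delta>" if "valid t" "weight t \<ge> J" for t
  proof -
    have "norm (act t x) \<le> (\<Sum>i\<in>{..<e} \<inter> supp t. norm (x i)) / real (mm (weight t))"
      by (rule norm_act_l1(2)) (use that J z in auto)
    also have "\<dots> \<le> L / real (mm (weight t))" unfolding L_def by (intro divide_right_mono sum_mono2) auto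
    also have "\<dots> \<le> \<delta>"
    proof -
      have "real J \<le> real (mm (weight t))" using mm_gt[of "weight t"] that by linarith
      then have "L / \<delta> \<le> real (mm (weight t))" using J by linarith
      then show ?thesis using assms(2) mm_ge[of "weight t"] by (simp add: field_simps)
    qed
    finally show ?thesis .
  qed
  then show ?thesis using J by blast
qed

text \<open>A set \<open>supplies\<close> the ingredients of a rapidly increasing sequence: arbitrarily far out it contains vectors that behave
  like long averages.\<close>

definition supplies :: "real \<Rightarrow> (nat \<Rightarrow> 'k) set \<Rightarrow> bool" where
  "supplies C W \<longleftrightarrow> (\<forall>s N. \<exists>x e. s \<le> e \<and> x \<in> W \<and> (\<forall>i. x i \<noteq> 0 \<longrightarrow> s \<le> i \<and> i < e) \<and> (\<forall>t. valid t \<longrightarrow> norm (act t x) \<le> C)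
     \<and> (\<forall>t. valid t \<and> 1 \<le> weight t \<and> nn (weight t) \<le> N \<longrightarrow> norm (act t x) \<le> C / real (mm (weight t))))"

text \<open>Each vector is an average long enough for all weights up to js k. Then js (k + 1) is
  taken so large that functionals of that weight or more are negligible on the vector, and this
  number sets the length of the next average.\<close>

lemma ris_exists:
  assumes sup: "supplies C W" and C: "C > 0" and j: "j \<ge> 1"
  shows "\<exists>l x js. blocks l x \<and> l 0 = s \<and> (\<forall>k. x k \<in> W) \<and> strict_mono js \<and> j \<le> js 0
    \<and> (\<forall>t k. valid t \<longrightarrow> norm (act t (x k)) \<le> C)
    \<and> (\<forall>t k. valid t \<longrightarrow> 1 \<le> weight t \<longrightarrow> weight t \<le> js k \<longrightarrow> norm (act t (x k)) \<le> C / real (mm (weight t)))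
    \<and> (\<forall>t k. valid t \<longrightarrow> weight t \<ge> js (Suc k) \<longrightarrow> norm (act t (x k)) \<le> C / real (nn j))"
proof -
  \<comment> \<open>A state of the construction: start, vector, end, and the weight threshold
    \<open>J\<close>.\<close>
  define P where "P = (\<lambda>(s, x, e, J). s \<le> e \<and> x \<in> W \<and> (\<forall>i. x i \<noteq> 0 \<longrightarrow> s \<le> i \<and> i < e) \<and> (\<forall>t. valid t \<longrightarrow> norm (act t x) \<le> C)
     \<and> (\<forall>t. valid t \<and> 1 \<le> weight t \<and> nn (weight t) \<le> nn J \<longrightarrow> norm (act t x) \<le> C / real (mm (weight t))))"
  define R where "R = (\<lambda>(s::nat, x, e::nat, J::nat) (s', x' :: nat \<Rightarrow> 'k, e' :: nat, J'). s' = e \<and> J < J' \<and> (\<forall>t. valid t \<and> weight t \<ge> J' \<longrightarrow> norm (act t x) \<le> C / real (nn j)))"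
  have supP: "\<exists>x e. P (s, x, e, J)" for s J
    using sup unfolding supplies_def P_def by (auto dest!: spec[of _ s] spec[of _ "nn J"])
  have "\<exists>f. \<forall>n. (P (f n) \<and> (n = 0 \<longrightarrow> fst (f n) = s \<and> snd (snd (snd (f n))) = j)) \<and> R (f n) (f (Suc n))"
  proof (rule dependent_nat_choice)
    show "\<exists>z. P z \<and> ((0::nat) = 0 \<longrightarrow> fst z = s \<and> snd (snd (snd z)) = j)" using supP[of s j] by auto
  next
    fix z :: "nat \<times> (nat \<Rightarrow> 'k) \<times> nat \<times> nat" and n :: nat
    assume z: "P z \<and> (n = 0 \<longrightarrow> fst z = s \<and> snd (snd (snd z)) = j)"
    obtain s0 x e J where Z: "z = (s0, x, e, J)" by (cases z) auto
    have "\<And>i. x i \<noteq> 0 \<Longrightarrow> i < e" using z Z by (auto simp: P_def)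
    then obtain J' where J': "J' > J" "\<forall>t. valid t \<and> weight t \<ge> J' \<longrightarrow> norm (act t x) \<le> C / real (nn j)"
      using weight_decay[of x e "C / real (nn j)" J] C nn_ge[of j] by auto
    obtain x' e' where "P (e, x', e', J')" using supP by blast
    then show "\<exists>z'. (P z' \<and> (Suc n = 0 \<longrightarrow> fst z' = s \<and> snd (snd (snd z')) = j)) \<and> R z z'"
      using J' Z by (intro exI[of _ "(e, x', e', J')"]) (auto simp: R_def)
  qed
  then obtain f where f: "\<And>n. P (f n)" "\<And>n. R (f n) (f (Suc n))" "fst (f 0) = s" "snd (snd (snd (f 0))) = j" by blast
  define l where "l n = fst (f n)" for n
  define x where "x n = fst (snd (f n))" for n
  define js where "js n = snd (snd (snd (f n)))" for n
  have e: "f n = (l n, x n, l (Suc n), js n)" for n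
    using f(2)[of n] by (auto simp: l_def x_def js_def R_def split: prod.splits)
  have Pn: "l n \<le> l (Suc n)" "x n \<in> W" "\<forall>i. x n i \<noteq> 0 \<longrightarrow> l n \<le> i \<and> i < l (Suc n)" "\<forall>t. valid t \<longrightarrow> norm (act t (x n)) \<le> C"
     "\<forall>t. valid t \<and> 1 \<le> weight t \<and> nn (weight t) \<le> nn (js n) \<longrightarrow> norm (act t (x n)) \<le> C / real (mm (weight t))" for n
    using f(1)[of n] unfolding e P_def by auto
  have Rn: "js n < js (Suc n)" "\<forall>t. valid t \<and> weight t \<ge> js (Suc n) \<longrightarrow> norm (act t (x n)) \<le> C / real (nn j)" for n
    using f(2)[of n] unfolding e R_def by auto
  show ?thesis
  proof (intro exI conjI)
    show "blocks l x" using Pn by (auto simp: blocks_def incseq_SucI)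
    show "l 0 = s" using f by (simp add: l_def)
    show "strict_mono js" using Rn by (simp add: strict_mono_Suc_iff)
    show "j \<le> js 0" using f by (simp add: js_def)
    show "\<forall>t k. valid t \<longrightarrow> 1 \<le> weight t \<longrightarrow> weight t \<le> js k \<longrightarrow> norm (act t (x k)) \<le> C / real (mm (weight t))"
      using Pn(5) nn_mono by blast
  qed (use Pn Rn in auto)
qed

text \<open>For even weights any successive list may be combined, so every block contributes its own
  norming functional, turned by an approximate phase. The phase error of 4/5 leaves one fifth of the
  sum.\<close>

lemma even_lower_estimate:
  assumes x: "blocks l x" and tt: "\<And>k. valid (tt k)" and j: "even j" "j \<ge> 1" and d: "d \<le> nn j"
  shows "\<exists>t. valid t \<and> weight t = j \<and> supp t \<subseteq> {l a..<l (a + d)} \<and>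
    norm (act t (block_sum x a (a + d))) \<ge> (\<Sum>k=a..<a+d. norm (act (tt k) (x k))) / (5 * real (mm j))"
proof -
  have "\<forall>k. \<exists>e. norm (\<omega> ^ e * act (tt k) (x k) - of_real (norm (act (tt k) (x k)))) \<le> 4 / 5 * norm (act (tt k) (x k))"
    using phase by blast
  from choice[OF this] obtain e where e: "\<And>k. norm (\<omega> ^ e k * act (tt k) (x k) - of_real (norm (act (tt k) (x k)))) \<le> 4 / 5 * norm (act (tt k) (x k))"
    by blast
  \<comment> \<open>Restriction to its own interval keeps each functional from seeing the
    neighbouring blocks.\<close>
  define g where "g k = rotate_tree (e k) (restrict_tree (l k) (l (Suc k)) (tt k))" for k
  have ml: "mono l" using x by (simp add: blocks_def)
  have sptg: "supp (g k) \<subseteq> {l k..<l (Suc k)}" for k by (auto simp: g_def supp_restrict_tree)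
  define t where "t = Node 0 0 (l (a + d)) j (map g [a..<a + d])"
  have coding: "successive (map g [a..<a + d])"
    unfolding successive_def sorted_wrt_map
  proof (rule sorted_wrt_mono_rel[OF _ sorted_wrt_upt], intro ballI)
    fix p q i i' assume "p < (q::nat)" "i \<in> supp (g p)" "i' \<in> supp (g q)"
    then show "i < i'" using sptg[of p] sptg[of q] monoD[OF ml, of "Suc p" q] by fastforce
  qed
  have v: "valid t" using j tt d coding by (auto simp: t_def g_def)
  have ag: "act (g k) (window 0 (l (a + d)) (block_sum x a (a + d))) = \<omega> ^ e k * act (tt k) (x k)" if k: "k \<in> {a..<a + d}" for k
  proof -
    have "act (g k) (window 0 (l (a + d)) (block_sum x a (a + d))) = \<omega> ^ e k * act (tt k) (window (l k) (l (Suc k)) (window 0 (l (a + d)) (block_sum x a (a + d))))"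
      by (simp add: g_def act_rotate_tree act_restrict_tree)
    also have "window (l k) (l (Suc k)) (window 0 (l (a + d)) (block_sum x a (a + d))) = x k"
    proof
      fix i
      show "window (l k) (l (Suc k)) (window 0 (l (a + d)) (block_sum x a (a + d))) i = x k i"
      proof (cases "l k \<le> i \<and> i < l (Suc k)")
        case True
        have "l (Suc k) \<le> l (a + d)" using k by (intro monoD[OF ml]) auto
        moreover have "x k' i = 0" if "k' \<noteq> k" for k'
        proof (cases "k' < k")
          case True2: True
          then have "l (Suc k') \<le> l k" by (intro monoD[OF ml]) auto
          then show ?thesis using x True by (meson blocks_def leD less_le_trans)
        next
          case False
          then have "l (Suc k) \<le> l k'" using that by (intro monoD[OF ml]) auto
          then show ?thesis using x True by (meson blocks_def leD less_le_trans)
        qed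
        then have "block_sum x a (a + d) i = (\<Sum>k'\<in>{k}. x k' i)"
          unfolding block_sum_def using k by (intro sum.mono_neutral_right) auto
        ultimately show ?thesis using True by (simp add: window_def)
      next
        case False
        then have "x k i = 0" using x unfolding blocks_def by blast
        then show ?thesis using False by (auto simp: window_def)
      qed
    qed
    finally show ?thesis .
  qed
  have "act t (block_sum x a (a + d)) = of_real (1 / real (mm j)) * (\<Sum>k=a..<a+d. act (g k) (window 0 (l (a + d)) (block_sum x a (a + d))))"
    by (simp add: t_def o_def interv_sum_list_conv_sum_set_nat)
  also have "(\<Sum>k=a..<a+d. act (g k) (window 0 (l (a + d)) (block_sum x a (a + d)))) = (\<Sum>k=a..<a+d. \<omega> ^ e k * act (tt k) (x k))"
    by (intro sum.cong refl ag)
  finally have at: "norm (act t (block_sum x a (a + d))) = norm (\<Sum>k=a..<a+d. \<omega> ^ e k * act (tt k) (x k)) / real (mm j)"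
    by (simp add: norm_mult norm_divide)
  let ?S = "\<Sum>k=a..<a+d. norm (act (tt k) (x k))"
  have "norm ((\<Sum>k=a..<a+d. \<omega> ^ e k * act (tt k) (x k)) - of_real ?S) \<le> 4 / 5 * ?S"
  proof -
    have "norm ((\<Sum>k=a..<a+d. \<omega> ^ e k * act (tt k) (x k)) - of_real ?S) = norm (\<Sum>k=a..<a+d. \<omega> ^ e k * act (tt k) (x k) - of_real (norm (act (tt k) (x k))))"
      by (simp add: sum_subtractf)
    also have "\<dots> \<le> (\<Sum>k=a..<a+d. 4 / 5 * norm (act (tt k) (x k)))" using e by (intro sum_norm_le) auto
    finally show ?thesis by (simp add: sum_distrib_left)
  qed
  moreover have "norm (of_real ?S :: 'k) = ?S" unfolding norm_of_real by (intro abs_of_nonneg sum_nonneg) auto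
  ultimately have "norm (\<Sum>k=a..<a+d. \<omega> ^ e k * act (tt k) (x k)) \<ge> ?S / 5"
    using norm_triangle_ineq2[of "of_real ?S :: 'k" "\<Sum>k=a..<a+d. \<omega> ^ e k * act (tt k) (x k)"] norm_minus_commute[of "of_real ?S :: 'k" "\<Sum>k=a..<a+d. \<omega> ^ e k * act (tt k) (x k)"] by linarith
  then have "norm (act t (block_sum x a (a + d))) \<ge> ?S / 5 / real (mm j)"
    unfolding at by (intro divide_right_mono) auto
  moreover have "supp t \<subseteq> {l a..<l (a + d)}"
  proof
    fix i assume "i \<in> supp t"
    then obtain k where k: "k \<in> {a..<a + d}" "i \<in> supp (g k)" "i < l (a + d)" by (auto simp: t_def)
    then show "i \<in> {l a..<l (a + d)}" using sptg[of k] monoD[OF ml, of a k] by fastforce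
  qed
  ultimately show ?thesis using v by (intro exI[of _ t]) (auto simp: t_def)
qed

lemma sum_group:
  fixes a b K M :: nat and f :: "nat \<Rightarrow> 'c::comm_monoid_add"
  shows "a \<le> b \<Longrightarrow> (\<Sum>i=a..<b. \<Sum>k=K + i * M..<K + (i + 1) * M. f k) = (\<Sum>k=K + a * M..<K + b * M. f k)"
proof (induction b rule: dec_induct)
  case (step b)
  have "(\<Sum>k=K + a * M..<K + b * M. f k) + (\<Sum>k=K + b * M..<K + (b + 1) * M. f k) = (\<Sum>k=K + a * M..<K + (b + 1) * M. f k)"
    using step by (intro sum.atLeastLessThan_concat) auto
  then show ?case using step by simp
qed simp

definition lin_closed :: "(nat \<Rightarrow> 'k) set \<Rightarrow> bool" where
  "lin_closed W \<longleftrightarrow> (\<lambda>i. 0) \<in> W \<and> (\<forall>x\<in>W. \<forall>y\<in>W. (\<lambda>i. x i + y i) \<in> W) \<and> (\<forall>c. \<forall>x\<in>W. (\<lambda>i. c * x i) \<in> W)"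

lemma lin_closed_add: "lin_closed W \<Longrightarrow> x \<in> W \<Longrightarrow> y \<in> W \<Longrightarrow> (\<lambda>i. x i + y i) \<in> W"
  and lin_closed_scale: "lin_closed W \<Longrightarrow> x \<in> W \<Longrightarrow> (\<lambda>i. c * x i) \<in> W"
  by (auto simp: lin_closed_def)

lemma lin_closed_block_sum: assumes W: "lin_closed W" "\<And>k. y k \<in> W" shows "block_sum y a b \<in> W"
proof -
  have "(\<lambda>i. \<Sum>k\<in>A. y k i) \<in> W" if "finite A" for A
    using that
  proof (induction A rule: finite_induct)
    case empty
    then show ?case using W by (simp add: lin_closed_def)
  next
    case (insert k A)
    then show ?case using W unfolding lin_closed_def by simp
  qed
  then show ?thesis by (simp add: block_sum_def)
qed

text \<open>If the averages of \<open>N\<close> blocks shrank by a factor \<open>1/2\<close> at each of many levels, the norm would fall below the lower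
  estimate for even weights.\<close>

lemma ell1_average:
  assumes y: "blocks l y" and W: "lin_closed W" "\<And>k. y k \<in> W" and up: "\<And>t k. valid t \<Longrightarrow> norm (act t (y k)) \<le> 1"
    and lo: "\<And>k. valid (tt k) \<and> norm (act (tt k) (y k)) \<ge> 1/2" and N: "N \<ge> 1"
  shows "\<exists>x e. l K \<le> e \<and> x \<in> W \<and> (\<exists>t. valid t \<and> norm (act t x) \<ge> 1/2) \<and> (\<forall>i. x i \<noteq> 0 \<longrightarrow> l K \<le> i \<and> i < e) \<and> (\<forall>t. valid t \<longrightarrow> norm (act t x) \<le> 4)
     \<and> (\<forall>t. valid t \<and> 1 \<le> weight t \<and> nn (weight t) \<le> N \<longrightarrow> norm (act t x) \<le> 4 / real (mm (weight t)))"
proof -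
  have ml: "mono l" using y by (simp add: blocks_def)
  define v where "v s i = block_sum y (K + i * N ^ s) (K + (i + 1) * N ^ s)" for s i
  \<comment> \<open>Sums of N^s blocks measured against (N/2)^s, that is, a loss of 1/2 at every
    level. As \<open>B 0\<close> holds, either some step from s to s + 1 fails or the loss persists
    for all s.\<close>
  define B where "B s \<longleftrightarrow> (\<forall>i t. valid t \<longrightarrow> norm (act t (v s i)) \<le> (real N / 2) ^ s)" for s
  have B0: "B 0" using up by (auto simp: B_def v_def act_block_sum)
  have "\<exists>s. B s \<and> \<not> B (Suc s)"
  proof (rule ccontr)
    assume "\<not> (\<exists>s. B s \<and> \<not> B (Suc s))"
    then have all: "B s" for s using B0 by (induction s) auto
    \<comment> \<open>Even, and with N <= nn (q - 1); then for s = mm q squared, N^s blocks still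
      fit into one functional of weight q. Their sum has norm at least N^s / (10 mm q), above
      (N/2)^s because 2^s > 10 mm q.\<close>
    define q where "q = 2 * (N + 1)"
    have q: "even q" "q \<ge> 1" by (auto simp: q_def)
    define s where "s = (mm q)\<^sup>2"
    have m16: "mm q \<ge> 16"
    proof -
      have "mm 1 = 16" by (simp add: mm_def)
      then show ?thesis using mm_mono[OF q(2)] by simp
    qed
    have Nq: "N \<le> nn (q - 1)" using nn_gt[of "q - 1"] by (auto simp: q_def)
    have "N ^ s \<le> nn (q - 1) ^ s" using Nq by (rule power_mono) auto
    also have "\<dots> \<le> split_bound (nn (q - 1)) s" using nn_ge[of "q - 1"] by (intro split_bound_ge_power) auto
    also have "\<dots> \<le> split_bound (nn (q - 1)) (Suc s)" using nn_ge[of "q - 1"] by (intro split_bound_Suc_ge) auto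
    also have "\<dots> \<le> mm q ^ 3 * split_bound (nn (q - 1)) (Suc s)" using mm_ge[of q] by simp
    also have "\<dots> = nn q" using nn_Suc[of "q - 1"] q unfolding s_def by (simp del: split_bound.simps)
    finally have Ns: "N ^ s \<le> nn q" .
    obtain t where t: "valid t" "norm (act t (block_sum y K (K + N ^ s))) \<ge> (\<Sum>k=K..<K + N ^ s. norm (act (tt k) (y k))) / (5 * real (mm q))"
      using even_lower_estimate[OF y, of tt q "N ^ s" K] lo q Ns by blast
    have "(\<Sum>k=K..<K + N ^ s. (1/2::real)) \<le> (\<Sum>k=K..<K + N ^ s. norm (act (tt k) (y k)))" using lo by (intro sum_mono) auto
    then have "real (N ^ s) / 2 / (5 * real (mm q)) \<le> norm (act t (block_sum y K (K + N ^ s)))"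
      using t(2) by (intro order_trans[OF divide_right_mono t(2)]) auto
    also have "block_sum y K (K + N ^ s) = v s 0" by (simp add: v_def)
    also have "norm (act t (v s 0)) \<le> (real N / 2) ^ s" using all[of s] t by (auto simp: B_def)
    finally have "real (N ^ s) / 2 / (5 * real (mm q)) \<le> real (N ^ s) / 2 ^ s" by (simp add: power_divide)
    moreover have "real (N ^ s) > 0" using N by simp
    moreover have "real (N ^ s) / 2 / (5 * real (mm q)) = real (N ^ s) * (1 / (10 * real (mm q)))" "real (N ^ s) / 2 ^ s = real (N ^ s) * (1 / 2 ^ s)"
      by simp_all
    ultimately have "(1::real) / (10 * real (mm q)) \<le> 1 / 2 ^ s"
      by (metis mult_le_cancel_left_pos)
    then have "(2::real) ^ s \<le> 10 * real (mm q)" using m16 by (simp add: field_simps)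
    moreover have "(2::real) ^ s > 10 * real (mm q)"
    proof -
      have "s \<ge> mm q + 4"
      proof -
        have "mm q * 16 \<le> mm q * mm q" using m16 by (intro mult_left_mono) auto
        then show ?thesis using m16 unfolding s_def power2_eq_square by linarith
      qed
      then have "(2::real) ^ (mm q + 4) \<le> 2 ^ s" by (intro power_increasing) auto
      moreover have "real (mm q) < 2 ^ mm q" using of_nat_less_two_power[of "mm q"] by simp
      moreover have "(2::real) ^ (mm q + 4) = 16 * 2 ^ mm q" by (simp add: power_add)
      ultimately show ?thesis using m16 by linarith
    qed
    ultimately show False by simp
  qed
  then obtain s where s: "B s" "\<not> B (Suc s)" by blast
  then obtain i t0 where t0: "valid t0" "norm (act t0 (v (Suc s) i)) > (real N / 2) ^ Suc s" by (auto simp: B_def not_le)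
  \<comment> \<open>Normalisation: sums of N^s blocks get norm at most 2, while the average of the N
    of them that break the bound keeps norm at least 1. The constant 4 of the conclusion is twice
    this 2.\<close>
  define c where "c = 2 * (2 / real N) ^ s"
  have c0: "c > 0" using N by (simp add: c_def)
  define y' where "y' i' = (\<lambda>n. of_real c * v s i' n)" for i'
  define l' where "l' i' = l (K + i' * N ^ s)" for i'
  have blocks': "blocks l' y'"
    unfolding blocks_def
  proof (intro conjI allI impI)
    show "mono l'" unfolding l'_def by (intro monoI monoD[OF ml]) auto
    fix k n assume "y' k n \<noteq> 0"
    then have "v s k n \<noteq> 0" by (auto simp: y'_def)
    then obtain k' where k': "k' \<in> {K + k * N ^ s..<K + (k + 1) * N ^ s}" "y k' n \<noteq> 0"
      unfolding v_def block_sum_def by (meson sum.neutral)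
    then have "l k' \<le> n" "n < l (Suc k')" using y by (auto simp: blocks_def)
    moreover have "l (K + k * N ^ s) \<le> l k'" "l (Suc k') \<le> l (K + Suc k * N ^ s)"
      using k' by (intro monoD[OF ml]; simp)+
    ultimately show "l' k \<le> n" "n < l' (Suc k)" unfolding l'_def by linarith+
  qed
  have vW: "v s i' \<in> W" for s i' unfolding v_def using W by (rule lin_closed_block_sum)
  have up': "norm (act t (y' k)) \<le> 2" if "valid t" for t k
  proof -
    have "norm (act t (y' k)) = c * norm (act t (v s k))" unfolding y'_def act_scale using c0 by (simp add: norm_mult)
    also have "\<dots> \<le> c * (real N / 2) ^ s" using s(1) that c0 by (intro mult_left_mono) (auto simp: B_def)
    also have "\<dots> = 2 * ((2 / real N) * (real N / 2)) ^ s" unfolding c_def power_mult_distrib by simp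
    also have "\<dots> = 2" using N by simp
    finally show ?thesis .
  qed
  define x where "x = (\<lambda>n. of_real (1 / real N) * block_sum y' (i * N) (i * N + N) n)"
  have bs: "block_sum y' (i * N) (i * N + N) = (\<lambda>n. of_real c * v (Suc s) i n)"
  proof
    fix n
    have "block_sum y' (i * N) (i * N + N) n = of_real c * (\<Sum>i'=i * N..<i * N + N. \<Sum>k=K + i' * N ^ s..<K + (i' + 1) * N ^ s. y k n)"
      by (simp add: block_sum_def y'_def v_def sum_distrib_left)
    also have "(\<Sum>i'=i * N..<i * N + N. \<Sum>k=K + i' * N ^ s..<K + (i' + 1) * N ^ s. y k n) = (\<Sum>k=K + (i * N) * N ^ s..<K + (i * N + N) * N ^ s. y k n)"
      by (rule sum_group) auto
    also have "\<dots> = v (Suc s) i n" by (simp add: v_def block_sum_def algebra_simps)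
    finally show "block_sum y' (i * N) (i * N + N) n = of_real c * v (Suc s) i n" .
  qed
  show ?thesis
  proof (intro exI conjI allI impI)
    show "l K \<le> l' (i * N + N)" unfolding l'_def by (intro monoD[OF ml]) auto
    show "x \<in> W" unfolding x_def bs by (rule lin_closed_scale[OF W(1) lin_closed_scale[OF W(1) vW]])
    show "valid t0" by fact
    have "norm (act t0 x) = c / real N * norm (act t0 (v (Suc s) i))"
      unfolding x_def bs act_scale using c0 by (simp add: norm_mult norm_divide)
    also have "\<dots> \<ge> c / real N * (real N / 2) ^ Suc s" using t0 c0 by (intro mult_left_mono) auto
    moreover have "c / real N * (real N / 2) ^ Suc s = ((2 / real N) * (real N / 2)) ^ Suc s"
      unfolding c_def power_mult_distrib by simp
    moreover have "\<dots> = 1" using N by simp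
    ultimately show "1 / 2 \<le> norm (act t0 x)" by simp
    fix n assume "x n \<noteq> 0"
    then have "v (Suc s) i n \<noteq> 0" unfolding x_def bs by auto
    then obtain k where k: "k \<in> {i * N..<i * N + N}" "y' k n \<noteq> 0"
      using bs unfolding block_sum_def by (metis (no_types, lifting) \<open>x n \<noteq> 0\<close> block_sum_def mult_zero_right sum.neutral x_def)
    then have "l' k \<le> n" "n < l' (Suc k)" using blocks' by (auto simp: blocks_def)
    moreover have "l K \<le> l' k" unfolding l'_def by (intro monoD[OF ml]) auto
    moreover have "l' (Suc k) \<le> l' (i * N + N)" using blocks' k by (intro monoD[of l']) (auto simp: blocks_def)
    ultimately show "l K \<le> n" "n < l' (i * N + N)" by linarith+
  next
    fix t assume t: "valid t"
    show "norm (act t x) \<le> 4" unfolding x_def using avg_estimate(1)[OF blocks' up' _ N t, of "i * N"] by simp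
  next
    fix t assume t: "valid t \<and> 1 \<le> weight t \<and> nn (weight t) \<le> N"
    then show "norm (act t x) \<le> 4 / real (mm (weight t))" unfolding x_def using avg_estimate(2)[OF blocks' up' _ N, of t "i * N"] by simp
  qed
qed


text \<open>Far out in \<open>W\<close> there is a normalised block sequence, and
  \<open>ell1_average\<close> turns it into long averages. Their length parameter is N + 1, to be
  positive.\<close>

lemma supplies_subspace:
  assumes W: "lin_closed W" and far: "\<And>s. \<exists>y\<in>W. \<exists>e. (\<forall>i. y i \<noteq> 0 \<longrightarrow> s \<le> i \<and> i < e) \<and> y \<noteq> (\<lambda>i. 0)"
  shows "supplies 4 {x \<in> W. \<exists>t. valid t \<and> norm (act t x) \<ge> 1/2}"
  unfolding supplies_def
proof (intro allI)
  fix s N :: nat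
  define P where "P = (\<lambda>(s, x, e). s \<le> e \<and> x \<in> W \<and> (\<forall>i. x i \<noteq> 0 \<longrightarrow> s \<le> i \<and> i < e) \<and> (\<forall>t. valid t \<longrightarrow> norm (act t x) \<le> 1)
     \<and> (\<exists>t. valid t \<and> norm (act t x) \<ge> 1/2))"
  define R where "R = (\<lambda>(s::nat, x :: nat \<Rightarrow> 'k, e::nat) (s'::nat, x' :: nat \<Rightarrow> 'k, e' :: nat). s' = e)"
  have ex: "\<exists>x e. P (s, x, e)" for s
  proof -
    obtain y e where y: "y \<in> W" "\<forall>i. y i \<noteq> 0 \<longrightarrow> s \<le> i \<and> i < e" "y \<noteq> (\<lambda>i. 0)" using far by blast
    have yX: "y \<in> X0" using y(2) by (intro fin_X0[of e]) force
    have pos: "nm y > 0" using nm_eq_0[OF yX] nm_nonneg[OF yX] y(3) by force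
    define x where "x = (\<lambda>i. of_real (1 / nm y) * y i)"
    have xX: "x \<in> X0" unfolding x_def using yX by (rule X0_scale)
    have nx: "nm x = 1" unfolding x_def nm_scale[OF yX] using pos by (simp add: norm_divide)
    have "x \<in> W" unfolding x_def by (rule lin_closed_scale[OF W y(1)])
    moreover have "\<forall>i. x i \<noteq> 0 \<longrightarrow> s \<le> i \<and> i < e" using y(2) by (auto simp: x_def)
    moreover have "\<forall>t. valid t \<longrightarrow> norm (act t x) \<le> 1" using act_le_nm[OF xX] nx by simp
    moreover have "\<exists>t. valid t \<and> norm (act t x) \<ge> 1/2" using norming_tree[OF xX, of "1/2"] nx by force
    moreover have "s \<le> e" using y(2,3) by (metis ext le_trans less_imp_le)
    ultimately show ?thesis by (auto simp: P_def)
  qed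
  have "\<exists>f. \<forall>n. (P (f n) \<and> (n = 0 \<longrightarrow> fst (f n) = s)) \<and> R (f n) (f (Suc n))"
  proof (rule dependent_nat_choice)
    show "\<exists>z. P z \<and> ((0::nat) = 0 \<longrightarrow> fst z = s)" using ex[of s] by auto
  next
    fix z :: "nat \<times> (nat \<Rightarrow> 'k) \<times> nat" and n :: nat
    obtain s0 x e where Z: "z = (s0, x, e)" by (cases z) auto
    obtain x' e' where "P (e, x', e')" using ex by blast
    then show "\<exists>z'. (P z' \<and> (Suc n = 0 \<longrightarrow> fst z' = s)) \<and> R z z'"
      using Z by (intro exI[of _ "(e, x', e')"]) (auto simp: R_def)
  qed
  then obtain f where f: "\<And>n. P (f n)" "\<And>n. R (f n) (f (Suc n))" "fst (f 0) = s" by blast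
  define l where "l n = fst (f n)" for n
  define y where "y n = fst (snd (f n))" for n
  have e: "f n = (l n, y n, l (Suc n))" for n
    using f(2)[of n] by (auto simp: l_def y_def R_def split: prod.splits)
  have Pn: "l n \<le> l (Suc n)" "y n \<in> W" "\<forall>i. y n i \<noteq> 0 \<longrightarrow> l n \<le> i \<and> i < l (Suc n)" "\<forall>t. valid t \<longrightarrow> norm (act t (y n)) \<le> 1"
     "\<exists>t. valid t \<and> norm (act t (y n)) \<ge> 1/2" for n
    using f(1)[of n] unfolding e P_def by auto
  have "\<forall>k. \<exists>t. valid t \<and> norm (act t (y k)) \<ge> 1/2" using Pn by blast
  from choice[OF this] obtain tt where tt: "\<And>k. valid (tt k) \<and> norm (act (tt k) (y k)) \<ge> 1/2" by blast
  have b: "blocks l y" using Pn by (auto simp: blocks_def incseq_SucI)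
  have l0: "l 0 = s" using f by (simp add: l_def)
  obtain x e where x: "s \<le> e" "x \<in> W" "\<exists>t. valid t \<and> norm (act t x) \<ge> 1/2" "\<forall>i. x i \<noteq> 0 \<longrightarrow> s \<le> i \<and> i < e"
     "\<forall>t. valid t \<longrightarrow> norm (act t x) \<le> 4" "\<forall>t. valid t \<and> 1 \<le> weight t \<and> nn (weight t) \<le> Suc N \<longrightarrow> norm (act t x) \<le> 4 / real (mm (weight t))"
    using ell1_average[OF b W _ _ tt, of "Suc N" 0] Pn l0 by auto
  show "\<exists>x e. s \<le> e \<and> x \<in> {x \<in> W. \<exists>t. valid t \<and> 1 / 2 \<le> norm (act t x)} \<and> (\<forall>i. x i \<noteq> 0 \<longrightarrow> s \<le> i \<and> i < e) \<and> (\<forall>t. valid t \<longrightarrow> norm (act t x) \<le> 4) \<and>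
           (\<forall>t. valid t \<and> 1 \<le> weight t \<and> nn (weight t) \<le> N \<longrightarrow> norm (act t x) \<le> 4 / real (mm (weight t)))"
    using x by (intro exI[of _ x] exI[of _ e]) auto
qed

section \<open>Hereditary indecomposability\<close>

text \<open>120 is 12 times 10: a rapidly increasing sequence with C = 4 gives 3 C = 12, and
  normalising against the lower estimate nn / (10 mm) gives 10. Lighter functionals gain their own
  factor 1/mm and heavier ones are negligible, so only weight j can act substantially.\<close>

definition exact :: "nat \<Rightarrow> (nat \<Rightarrow> 'k) \<Rightarrow> bool" where
  "exact j x \<longleftrightarrow> (\<forall>t. valid t \<longrightarrow> norm (act t x) \<le> 120 \<and>
     (1 \<le> weight t \<and> weight t < j \<longrightarrow> norm (act t x) \<le> 120 / real (mm (weight t))) \<and>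
     (weight t > j \<longrightarrow> norm (act t x) \<le> 120 * real (mm j) / real (nn j)))"

text \<open>The vector is a multiple of the sum of nn j terms of a rapidly increasing sequence in
  \<open>W\<close>. Because j is even, some functional of weight j is at least nn j / (10 mm j) on
  that sum; dividing by its value gives 1.\<close>

lemma exact_pair:
  assumes W: "lin_closed W" and far: "\<And>s. \<exists>y\<in>W. \<exists>e. (\<forall>i. y i \<noteq> 0 \<longrightarrow> s \<le> i \<and> i < e) \<and> y \<noteq> (\<lambda>i. 0)"
    and j: "even j" "j \<ge> 1"
  shows "\<exists>x f e. s \<le> e \<and> x \<in> W \<and> (\<forall>i. x i \<noteq> 0 \<longrightarrow> s \<le> i \<and> i < e) \<and> valid f \<and> weight f = j \<and> supp f \<subseteq> {s..<e} \<and> act f x = 1 \<and> exact j x"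
proof -
  obtain l x js where x: "blocks l x" "l 0 = s" "\<forall>k. x k \<in> {x \<in> W. \<exists>t. valid t \<and> norm (act t x) \<ge> 1/2}" "strict_mono js" "j \<le> js 0"
    "\<forall>t k. valid t \<longrightarrow> norm (act t (x k)) \<le> 4"
    "\<forall>t k. valid t \<longrightarrow> 1 \<le> weight t \<longrightarrow> weight t \<le> js k \<longrightarrow> norm (act t (x k)) \<le> 4 / real (mm (weight t))"
    "\<forall>t k. valid t \<longrightarrow> weight t \<ge> js (Suc k) \<longrightarrow> norm (act t (x k)) \<le> 4 / real (nn j)"
    using ris_exists[OF supplies_subspace[OF W far] _ j(2), of s] by auto
  have "\<forall>k. \<exists>t. valid t \<and> norm (act t (x k)) \<ge> 1/2" using x(3) by blast
  from choice[OF this] obtain tt where tt: "\<And>k. valid (tt k)" "\<And>k. norm (act (tt k) (x k)) \<ge> 1/2" by blast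
  have ml: "mono l" using x by (simp add: blocks_def)
  have m: "real (mm j) \<ge> 2" "real (nn j) \<ge> 2" using mm_ge[of j] nn_ge[of j] by linarith+
  define z where "z = block_sum x 0 (nn j)"
  have est: "norm (act t z) \<le> 3 * 4 * real (nn j) / real (mm j)"
      "1 \<le> weight t \<Longrightarrow> weight t < j \<Longrightarrow> norm (act t z) \<le> 3 * 4 * real (nn j) / (real (mm j) * real (mm (weight t)))"
      "weight t > j \<Longrightarrow> norm (act t z) \<le> 3 * 4" if "valid t" for t
    unfolding z_def using ris_estimate[OF x(1) _ j(2) x(5,4) _ _ _ that, of 4] x by auto
  obtain f where f: "valid f" "weight f = j" "supp f \<subseteq> {l 0..<l (0 + nn j)}"
    "norm (act f (block_sum x 0 (0 + nn j))) \<ge> (\<Sum>k=0..<0 + nn j. norm (act (tt k) (x k))) / (5 * real (mm j))"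
    using even_lower_estimate[OF x(1), where tt = tt, OF tt(1) j order_refl, of 0] by blast
  have "(\<Sum>k=0..<0 + nn j. (1/2::real)) \<le> (\<Sum>k=0..<0 + nn j. norm (act (tt k) (x k)))" using tt by (intro sum_mono) auto
  then have "real (nn j) / 2 / (5 * real (mm j)) \<le> (\<Sum>k=0..<0 + nn j. norm (act (tt k) (x k))) / (5 * real (mm j))"
    by (intro divide_right_mono) auto
  then have fz: "real (nn j) / (10 * real (mm j)) \<le> norm (act f z)" using f(4) by (simp add: z_def)
  have pos: "0 < real (nn j) / (10 * real (mm j))" using m by simp
  then have fz0: "act f z \<noteq> 0" using fz by auto
  define c where "c = 1 / act f z"
  have c: "norm c \<le> 10 * real (mm j) / real (nn j)"
  proof -
    have "norm c = 1 / norm (act f z)" by (simp add: c_def norm_divide)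
    also have "\<dots> \<le> 1 / (real (nn j) / (10 * real (mm j)))" using fz pos fz0 by (intro divide_left_mono mult_pos_pos) auto
    finally show ?thesis by simp
  qed
  have ub: "norm (act t (\<lambda>i. c * z i)) \<le> 10 * real (mm j) / real (nn j) * B" if "norm (act t z) \<le> B" for t B
    unfolding act_scale norm_mult using that c by (intro mult_mono) (auto intro: order_trans[OF norm_ge_zero])
  show ?thesis
  proof (intro exI conjI)
    show "s \<le> l (nn j)" using monoD[OF ml, of 0 "nn j"] x by simp
    have "z \<in> W" unfolding z_def using x(3) by (intro lin_closed_block_sum[OF W]) auto
    then show "(\<lambda>i. c * z i) \<in> W" by (rule lin_closed_scale[OF W])
    show "\<forall>i. c * z i \<noteq> 0 \<longrightarrow> s \<le> i \<and> i < l (nn j)"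
    proof (intro allI impI)
      fix i assume "c * z i \<noteq> 0"
      then have "(\<Sum>k=0..<nn j. x k i) \<noteq> 0" by (auto simp: z_def block_sum_def)
      then obtain k where k: "k \<in> {0..<nn j}" "x k i \<noteq> 0" by (meson sum.neutral)
      then have "l k \<le> i" "i < l (Suc k)" using x by (auto simp: blocks_def)
      then show "s \<le> i \<and> i < l (nn j)" using monoD[OF ml, of 0 k] monoD[OF ml, of "Suc k" "nn j"] k x(2) by auto
    qed
    show "valid f" "weight f = j" using f by auto
    show "supp f \<subseteq> {s..<l (nn j)}" using f x by simp
    show "act f (\<lambda>i. c * z i) = 1" unfolding act_scale c_def using fz0 by simp
    show "exact j (\<lambda>i. c * z i)"
      unfolding exact_def
    proof (intro allI impI conjI)
      fix t assume t: "valid t"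
      show "norm (act t (\<lambda>i. c * z i)) \<le> 120" using ub[OF est(1)[OF t]] m by simp
      show "norm (act t (\<lambda>i. c * z i)) \<le> 120 / real (mm (weight t))" if "1 \<le> weight t \<and> weight t < j"
        using ub[OF est(2)[OF t]] that m by simp
      show "norm (act t (\<lambda>i. c * z i)) \<le> 120 * real (mm j) / real (nn j)" if "j < weight t"
        using ub[OF est(3)[OF t that]] by simp
    qed
  qed
qed

text \<open>A dependent sequence in the sense of hereditarily indecomposable spaces. Entry i is
  taken from \<open>W i\<close> so that two subspaces can alternate, and zero blocks prolong it so
  that \<open>blocks\<close> applies.\<close>

definition dep_seq :: "nat \<Rightarrow> nat \<Rightarrow> (nat \<Rightarrow> (nat \<Rightarrow> 'k) set) \<Rightarrow> tree list \<Rightarrow> (nat \<Rightarrow> nat \<Rightarrow> 'k) \<Rightarrow> (nat \<Rightarrow> nat) \<Rightarrow> bool" where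
  "dep_seq p d W fs x l \<longleftrightarrow> length fs = d \<and> blocks l x \<and> (\<forall>k\<ge>d. x k = (\<lambda>i. 0) \<and> l k = l d) \<and> special p fs \<and>
    (\<forall>i<d. x i \<in> W i \<and> valid (fs ! i) \<and> supp (fs ! i) \<subseteq> {l i..<l (Suc i)} \<and> act (fs ! i) (x i) = 1 \<and> exact (weight (fs ! i)) (x i))"

text \<open>The coding fixes the weight of the next functional from those already chosen, before the
  next vector is picked. All these weights are even, so \<open>exact_pair\<close> can realise them
  in the prescribed subspace.\<close>

lemma dep_seq_exists:
  assumes W: "\<And>i. lin_closed (W i)" and far: "\<And>i s. \<exists>y\<in>W i. \<exists>e. (\<forall>i. y i \<noteq> 0 \<longrightarrow> s \<le> i \<and> i < e) \<and> y \<noteq> (\<lambda>i. 0)"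
  shows "\<exists>fs x l. dep_seq p d W fs x l"
proof (induction d)
  case 0
  have "dep_seq p 0 W [] (\<lambda>k i. 0) (\<lambda>k. 0)" by (simp add: dep_seq_def blocks_def special_def mono_def)
  then show ?case by blast
next
  case (Suc d)
  then obtain fs x l where D: "dep_seq p d W fs x l" by blast
  have len: "length fs = d" using D by (simp add: dep_seq_def)
  \<comment> \<open>The first weight has to be divisible by 4 and larger than
    \<open>p\<close>.\<close>
  define j where "j = (if d = 0 then 4 * (p + 1) else coding p fs)"
  have j: "even j" "j \<ge> 1" using coding_even(1)[of p fs] coding_gt[of p fs] by (auto simp: j_def)
  obtain y f e where y: "l d \<le> e" "y \<in> W d" "\<forall>i. y i \<noteq> 0 \<longrightarrow> l d \<le> i \<and> i < e" "valid f" "weight f = j" "supp f \<subseteq> {l d..<e}" "act f y = 1" "exact j y"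
    using exact_pair[OF W far j, of "l d" d] by blast
  define l' where "l' k = (if k \<le> d then l k else e)" for k
  define x' where "x' = x(d := y)"
  have b: "blocks l' x'"
    unfolding blocks_def
  proof (intro conjI allI impI)
    have "mono l" using D by (simp add: dep_seq_def blocks_def)
    then show "mono l'" unfolding l'_def mono_def using y(1) by (auto intro: order_trans)
    fix k i assume a: "x' k i \<noteq> 0"
    consider "k < d" | "k = d" | "k > d" by linarith
    then have "l' k \<le> i \<and> i < l' (Suc k)"
    proof cases
      case 1
      then show ?thesis using a D by (auto simp: x'_def l'_def dep_seq_def blocks_def)
    next
      case 2
      then show ?thesis using a y by (auto simp: x'_def l'_def)
    next
      case 3
      then show ?thesis using a D by (auto simp: x'_def dep_seq_def)
    qed
    then show "l' k \<le> i" "i < l' (Suc k)" by auto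
  qed
  have sp: "special p (fs @ [f])"
    using D len y(5) unfolding special_def dep_seq_def j_def by (auto simp: nth_append less_Suc_eq)
  have "dep_seq p (Suc d) W (fs @ [f]) x' l'"
    unfolding dep_seq_def
  proof (intro conjI allI impI)
    fix i assume i: "i < Suc d"
    have "x' i \<in> W i \<and> valid ((fs @ [f]) ! i) \<and> supp ((fs @ [f]) ! i) \<subseteq> {l' i..<l' (Suc i)} \<and> act ((fs @ [f]) ! i) (x' i) = 1 \<and> exact (weight ((fs @ [f]) ! i)) (x' i)"
    proof (cases "i < d")
      case True
      then have "(fs @ [f]) ! i = fs ! i" "x' i = x i" "l' i = l i" "l' (Suc i) = l (Suc i)"
        using len by (simp_all add: nth_append x'_def l'_def)
      then show ?thesis using D True by (simp add: dep_seq_def)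
    next
      case False
      then have "i = d" using i by simp
      then have "(fs @ [f]) ! i = f" "x' i = y" "l' i = l d" "l' (Suc i) = e" "i = d"
        using len by (simp_all add: nth_append x'_def l'_def)
      then show ?thesis using y by simp
    qed
    then show "x' i \<in> W i" "valid ((fs @ [f]) ! i)" "supp ((fs @ [f]) ! i) \<subseteq> {l' i..<l' (Suc i)}" "act ((fs @ [f]) ! i) (x' i) = 1"
      "exact (weight ((fs @ [f]) ! i)) (x' i)" by auto
  next
    show "length (fs @ [f]) = Suc d" using len by simp
    show "blocks l' x'" "special p (fs @ [f])" by fact+
    fix k assume "Suc d \<le> k"
    then show "x' k = (\<lambda>i. 0)" "l' k = l' (Suc d)" using D by (auto simp: dep_seq_def x'_def l'_def)
  qed
  then show ?case by blast
qed

lemma alternating_sum_bound: "norm (\<Sum>s=u..<v. (-1) ^ s :: 'k) \<le> 1"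
proof (cases "u \<le> v")
  case True
  then have "(\<Sum>s=u..<v. (-1) ^ s :: 'k) = (if even (u + v) then 0 else (-1) ^ u)"
  proof (induction v rule: dec_induct)
    case (step v)
    then show ?case by (cases "even u"; cases "even v") auto
  qed simp
  then show ?thesis by (auto simp: norm_power)
qed simp

text \<open>The square of nn p is there so that up to (nn p)^2 mismatched pairs add up to at most
  120. For lighter functionals mm of a weight above p is at least (nn p)^2; for heavier ones nn / mm
  is at least mm^2, which is again at least (nn p)^2.\<close>

lemma dep_seq_off_diagonal:
  assumes D: "dep_seq p (nn p) W fs x l" and t: "valid t" "weight t > p" and i: "i < nn p" "weight t \<noteq> weight (fs ! i)"
  shows "norm (act t (x i)) \<le> 120 / (real (nn p))\<^sup>2"
proof -
  let ?j = "weight (fs ! i)"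
  have ex: "exact ?j (x i)" and sp: "special p fs" and len: "length fs = nn p" using D i by (auto simp: dep_seq_def)
  have jp: "?j > p" using special_weight[OF sp, of i] i len by simp
  have n: "real (nn p) \<ge> 2" using nn_ge[of p] by linarith
  consider "weight t < ?j" | "weight t > ?j" using i by linarith
  then show ?thesis
  proof cases
    case 1
    have "(nn p)\<^sup>2 \<le> mm (weight t)" using nn_sq_le_mm[OF t(2)] by linarith
    then have "(real (nn p))\<^sup>2 \<le> real (mm (weight t))" by (metis of_nat_le_iff of_nat_power)
    then have "120 / real (mm (weight t)) \<le> 120 / (real (nn p))\<^sup>2" using n mm_ge[of "weight t"] by (intro divide_left_mono mult_pos_pos) auto
    moreover have "norm (act t (x i)) \<le> 120 / real (mm (weight t))" using ex 1 t by (auto simp: exact_def)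
    ultimately show ?thesis by linarith
  next
    case 2
    have "real (mm ?j) * (real (nn p))\<^sup>2 \<le> real (nn ?j)"
    proof -
      have a: "real (nn ?j) = real (mm ?j) ^ 3 * real (split_bound (nn (?j - 1)) (Suc ((mm ?j)\<^sup>2)))"
        using jp by (intro nn_decomp) auto
      have "1 \<le> split_bound (nn (?j - 1)) (Suc ((mm ?j)\<^sup>2))"
        using split_bound_ge[of "nn (?j - 1)" "Suc ((mm ?j)\<^sup>2)"] nn_ge[of "?j - 1"] by linarith
      then have "1 \<le> real (split_bound (nn (?j - 1)) (Suc ((mm ?j)\<^sup>2)))" by linarith
      then have "real (mm ?j) ^ 3 * 1 \<le> real (nn ?j)" unfolding a by (rule mult_left_mono) simp
      moreover have "(real (nn p))\<^sup>2 \<le> (real (mm ?j))\<^sup>2" using nn_sq_le_mm[OF jp] by (intro power_mono) auto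
      then have "real (mm ?j) * (real (nn p))\<^sup>2 \<le> real (mm ?j) * (real (mm ?j))\<^sup>2" by (intro mult_left_mono) auto
      moreover have "real (mm ?j) * (real (mm ?j))\<^sup>2 = real (mm ?j) ^ 3" by (simp add: power3_eq_cube power2_eq_square)
      ultimately show ?thesis by linarith
    qed
    then have "120 * real (mm ?j) / real (nn ?j) \<le> 120 / (real (nn p))\<^sup>2"
      using n nn_ge[of ?j] by (simp add: field_simps)
    moreover have "norm (act t (x i)) \<le> 120 * real (mm ?j) / real (nn ?j)" using ex 2 t by (auto simp: exact_def)
    ultimately show ?thesis by linarith
  qed
qed

text \<open>Residues mod 4 separate initial weights from codes, and injectivity of the coding
  recovers all predecessors from a common later weight.\<close>

lemma dep_seq_weight_inj:
  assumes D: "dep_seq p n W fs x l" and gs: "special p gs" and si: "s < length gs" "i < n" "weight (gs ! s) = weight (fs ! i)"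
  shows "i = s \<and> take s gs = take s fs"
proof -
  have sp: "special p fs" and len: "length fs = n" using D by (auto simp: dep_seq_def)
  have g: "if s = 0 then weight (gs ! 0) mod 4 = 0 else weight (gs ! s) = coding p (take s gs)" using gs si unfolding special_def by (metis (full_types))
  have f: "if i = 0 then weight (fs ! 0) mod 4 = 0 else weight (fs ! i) = coding p (take i fs)" using sp si len unfolding special_def by (metis (full_types))
  show ?thesis
  proof (cases "s = 0 \<or> i = 0")
    case True
    then show ?thesis using f g si coding_even(2)[of p "take s gs"] coding_even(2)[of p "take i fs"] by (auto split: if_splits)
  next
    case False
    then have "coding p (take s gs) = coding p (take i fs)" using f g si by simp
    then have "take s gs = take i fs" by (rule coding_inj)
    moreover from this have "length (take s gs) = length (take i fs)" by simp
    then have "s = i" using si(1,2) len by simp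
    ultimately show ?thesis by simp
  qed
qed

lemma norm_diff_le: "u = a - b \<Longrightarrow> norm a \<le> K \<Longrightarrow> norm b \<le> K \<Longrightarrow> norm (u :: 'k) \<le> K + K"
  using norm_triangle_ineq4[of a b] by simp

lemma norm_sum3: "u = a + b + c \<Longrightarrow> norm u \<le> norm a + norm b + norm (c :: 'k)"
  using norm_triangle_ineq[of "a + b" c] norm_triangle_ineq[of a b] by simp

text \<open>Special functionals of weight \<open>p\<close> agree with the given sequence up to some index and, by injectivity of the coding, have
  different weights afterwards; on the common part the signs cancel.\<close>

lemma alternating_upper_estimate:
  assumes D: "dep_seq p (nn p) W fs x l" and p: "odd p"
  defines "X \<equiv> (\<lambda>k i. (-1) ^ k * x k i)"
  assumes t: "valid t"
  shows "norm (act t (block_sum X 0 (nn p))) \<le> 240 * real (nn p) / (real (mm p))\<^sup>2"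
proof -
  let ?n = "nn p"
  have n: "real ?n \<ge> 2" using nn_ge[of p] by linarith
  have m: "real (mm p) \<ge> 2" using mm_ge[of p] by linarith
  have bx: "blocks l x" and sp: "special p fs" and len: "length fs = ?n" using D by (auto simp: dep_seq_def)
  have Di: "valid (fs ! i)" "supp (fs ! i) \<subseteq> {l i..<l (Suc i)}" "act (fs ! i) (x i) = 1" "exact (weight (fs ! i)) (x i)" if "i < ?n" for i
    using D that by (auto simp: dep_seq_def)
  have ml: "mono l" using bx by (simp add: blocks_def)
  have bX: "blocks l X" using bx by (auto simp: blocks_def X_def)
  have p1: "p \<ge> 1" using p by (cases p) auto
  have aX: "act t (window c d (X k)) = (-1) ^ k * act t (window c d (x k))" for t c d k
  proof -
    have "window c d (X k) = (\<lambda>i. (-1) ^ k * window c d (x k) i)" by (auto simp: window_def X_def)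
    then show ?thesis by (simp add: act_scale)
  qed
  have nX: "norm (act t (X k)) = norm (act t (x k))" for t k
    unfolding X_def act_scale by (simp add: norm_mult norm_power)
  have up: "norm (act t (x k)) \<le> 120" if "valid t" "k < ?n" for t k
    using Di(4)[OF that(2)] that by (auto simp: exact_def)
  have wtinj: "weight (fs ! i) \<noteq> weight (fs ! k)" if "i < ?n" "k < ?n" "i \<noteq> k" for i k
    using dep_seq_weight_inj[OF D sp, of i k] len that by auto
  \<comment> \<open>The weights in the sequence are distinct, so at most one of them equals the
    weight of \<open>t\<close>; all other terms are off-diagonal. If none matches, \<open>k0\<close>
    is arbitrary and only enlarges the bound.\<close>
  have above: "norm (act t (block_sum X a b)) \<le> 120 * (8 + real (b - a) * 0)" if t: "valid t" "weight t > p" and ab: "b \<le> ?n" for t a b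
  proof -
    define k0 where "k0 = (SOME k. k < ?n \<and> weight t = weight (fs ! k))"
    have each: "norm (act t (X k)) \<le> 120 / (real ?n)\<^sup>2 + (if k = k0 then 120 else 0)" if k: "k < ?n" for k
    proof (cases "weight t = weight (fs ! k)")
      case True
      then have "k < ?n \<and> weight t = weight (fs ! k)" using k by simp
      then have "k0 = k" unfolding k0_def using wtinj by (intro some_equality) auto
      then show ?thesis using up[OF t(1) k] nX by (simp add: add_increasing)
    next
      case False
      then show ?thesis using dep_seq_off_diagonal[OF D t k False] nX[of t k] by auto
    qed
    have "norm (act t (block_sum X a b)) \<le> (\<Sum>k=a..<b. norm (act t (X k)))" unfolding act_block_sum by (rule norm_sum)
    also have "\<dots> \<le> (\<Sum>k=a..<b. 120 / (real ?n)\<^sup>2 + (if k = k0 then 120 else 0))"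
      using ab by (intro sum_mono each) auto
    also have "\<dots> = real (b - a) * (120 / (real ?n)\<^sup>2) + (if k0 \<in> {a..<b} then 120 else 0)"
      by (simp only: sum.distrib sum.delta[OF finite_atLeastLessThan] sum_constant card_atLeastLessThan of_nat_id)
    also have "\<dots> \<le> real ?n * (120 / (real ?n)\<^sup>2) + 120"
      using ab by (intro add_mono mult_right_mono) auto
    also have "real ?n * (120 / (real ?n)\<^sup>2) = 120 / real ?n" using n by (simp add: power2_eq_square)
    also have "120 / real ?n + 120 \<le> 120 * (8 + real (b - a) * 0)" using n by (simp add: field_simps)
    finally show ?thesis .
  qed
  have level: "norm (act t (block_sum X a b)) \<le> 120 * (8 + real (b - a) * 0)" if t: "valid t" "weight t = p" and ab: "a \<le> b" "b \<le> ?n" for t a b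
  proof -
    obtain e c d gs where T: "t = Node e c d p gs" using t p1 by (cases t) auto
    have gs: "special p gs" "\<And>g. g \<in> set gs \<Longrightarrow> valid g" "length gs \<le> ?n" using t p T by auto
    \<comment> \<open>\<open>s0\<close> becomes the first position where \<open>gs\<close> departs
      from \<open>fs\<close> or the lists end. By the coding, weights may still agree at
      \<open>s0\<close> itself but never afterwards.\<close>
    define A where "A s \<longleftrightarrow> s < length gs \<and> s < ?n \<and> take (Suc s) gs = take (Suc s) fs" for s
    define s0 where "s0 = (LEAST s. \<not> A s)"
    have exA: "\<not> A (length gs)" by (simp add: A_def)
    have s0: "\<not> A s0" unfolding s0_def using exA by (rule LeastI)
    have As: "A s" if "s < s0" for s using not_less_Least[of s "\<lambda>s. \<not> A s"] that by (auto simp: s0_def)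
    have same: "gs ! s = fs ! s" "s < length gs" "s < ?n" if "s < s0" for s
    proof -
      show "s < length gs" "s < ?n" using As[OF that] by (auto simp: A_def)
      have "take (Suc s) gs ! s = take (Suc s) fs ! s" using As[OF that] by (simp add: A_def)
      then show "gs ! s = fs ! s" by simp
    qed
    have coll: "i = s \<and> s \<le> s0" if "s < length gs" "i < ?n" "weight (gs ! s) = weight (fs ! i)" for s i
    proof -
      have 1: "i = s" "take s gs = take s fs" using dep_seq_weight_inj[OF D gs(1) that] by auto
      have "s \<le> s0"
      proof (rule ccontr)
        assume "\<not> s \<le> s0"
        then have "s0 < s" by simp
        then have "take (Suc s0) (take s gs) = take (Suc s0) (take s fs)" using 1 by simp
        then have "take (Suc s0) gs = take (Suc s0) fs" using \<open>s0 < s\<close> by simp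
        then have "A s0" using \<open>s0 < s\<close> 1 that by (auto simp: A_def)
        then show False using s0 by simp
      qed
      then show ?thesis using 1 by simp
    qed
    have gw: "weight (gs ! s) > p" "valid (gs ! s)" if "s < length gs" for s
      using special_weight(1)[OF gs(1) that] gs(2) that by auto
    define T' where "T' c s i = act (gs ! s) (window 0 c (X i))" for c s i
    have T'up: "norm (T' c s i) \<le> 120" if "s < length gs" "i < ?n" for c s i
    proof -
      have "norm (T' c s i) = norm (act (restrict_tree 0 c (gs ! s)) (x i))" unfolding T'_def aX act_restrict_tree by (simp add: norm_mult norm_power)
      then show ?thesis using up[OF _ that(2)] gw(2)[OF that(1)] by simp
    qed
    have wrst: "weight (restrict_tree 0 c (gs ! s)) = weight (gs ! s)" if "s < length gs" for c s
      using gw(1)[OF that] by (cases "gs ! s") auto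
    have T'off: "norm (T' c s i) \<le> 120 / (real ?n)\<^sup>2" if "s < length gs" "i < ?n" "\<not> (i = s \<and> s \<le> s0)" for c s i
    proof -
      have "norm (T' c s i) = norm (act (restrict_tree 0 c (gs ! s)) (x i))" unfolding T'_def aX act_restrict_tree by (simp add: norm_mult norm_power)
      also have "\<dots> \<le> 120 / (real ?n)\<^sup>2"
        using gw[OF that(1)] wrst[OF that(1)] coll[OF that(1,2)] that(3) by (intro dep_seq_off_diagonal[OF D _ _ that(2)]) auto
      finally show ?thesis .
    qed
    \<comment> \<open>The end of the window cuts at most one block, \<open>e\<close>. Before it the
      terms are alternating signs, after it they are 0, and the cut term is at most 120; hence 1 +
      120.\<close>
    have diag: "norm (\<Sum>s=a..<min b s0. T' c s s) \<le> 121" for c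
    proof -
      define e where "e = (LEAST e. e \<ge> b \<or> l (Suc e) > c)"
      have e1: "e \<ge> b \<or> l (Suc e) > c" unfolding e_def by (rule LeastI[of _ b]) auto
      have e2: "l (Suc k) \<le> c" if "k < e" for k using not_less_Least[OF that[unfolded e_def]] by auto
      have full: "T' c s s = (-1) ^ s" if s: "s < min b s0" "s < e" for s
      proof -
        have "act (fs ! s) (window 0 c (x s)) = act (fs ! s) (x s)"
          using Di(2)[of s] e2[OF s(2)] same(3)[of s] s by (intro act_cong) (auto simp: window_def)
        then show ?thesis unfolding T'_def aX using same[of s] Di(3)[of s] s by simp
      qed
      have none: "T' c s s = 0" if s: "s < min b s0" "s > e" for s
      proof -
        have "c < l (Suc e)" using e1 s by auto
        also have "l (Suc e) \<le> l s" using s by (intro monoD[OF ml]) auto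
        finally have "act (fs ! s) (window 0 c (x s)) = 0"
          using Di(2)[of s] same(3)[of s] s by (intro act_eq_0) (auto simp: window_def)
        then show ?thesis unfolding T'_def aX using same[of s] s by simp
      qed
      have "(\<Sum>s=a..<min b s0. T' c s s) = (\<Sum>s\<in>{a..<min b s0}. (if s < e then (-1) ^ s else 0) + (if s = e then T' c e e else 0))"
      proof (intro sum.cong refl)
        fix s assume "s \<in> {a..<min b s0}"
        then have s: "s < min b s0" by simp
        consider "s < e" | "s = e" | "s > e" by linarith
        then show "T' c s s = (if s < e then (-1) ^ s else 0) + (if s = e then T' c e e else 0)"
          using full[OF s] none[OF s] by cases auto
      qed
      also have "\<dots> = (\<Sum>s=a..<min (min b s0) e. (-1) ^ s) + (if e \<in> {a..<min b s0} then T' c e e else 0)"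
      proof -
        have "(\<Sum>s\<in>{a..<min b s0}. if s < e then (-1) ^ s else 0 :: 'k) = (\<Sum>s=a..<min (min b s0) e. (-1) ^ s)"
          by (intro sum.mono_neutral_cong_right) auto
        moreover have "(\<Sum>s\<in>{a..<min b s0}. if s = e then T' c e e else 0) = (if e \<in> {a..<min b s0} then T' c e e else 0)"
          by (rule sum.delta) simp
        ultimately show ?thesis by (simp only: sum.distrib)
      qed
      finally have "norm (\<Sum>s=a..<min b s0. T' c s s) \<le> norm (\<Sum>s=a..<min (min b s0) e. (-1) ^ s :: 'k) + norm (if e \<in> {a..<min b s0} then T' c e e else 0)"
        using norm_triangle_ineq by metis
      also have "\<dots> \<le> 1 + 120" using T'up[of e e c] same[of e] by (intro add_mono alternating_sum_bound) auto
      finally show ?thesis by simp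
    qed
    \<comment> \<open>361 = 121 + 120 + 120: the common part, the position \<open>s0\<close>, and
      all mismatched pairs together.\<close>
    have tot: "norm (\<Sum>s<length gs. \<Sum>i=a..<b. T' c s i) \<le> 361" for c
    proof -
      have delta: "(\<Sum>i=a..<b. if i = s \<and> P then v else 0) = (if s \<in> {a..<b} \<and> P then v else 0)" for s P and v :: 'k
        by (cases P) (simp_all add: sum.delta)
      let ?T1 = "\<lambda>s i. if i = s \<and> s < s0 then T' c s s else 0"
      let ?T2 = "\<lambda>s i. if i = s \<and> s = s0 then T' c s s else 0"
      let ?T3 = "\<lambda>s i. if i = s \<and> s \<le> s0 then 0 else T' c s i"
      have "(\<Sum>s<length gs. \<Sum>i=a..<b. T' c s i) = (\<Sum>s<length gs. \<Sum>i=a..<b. ?T1 s i + ?T2 s i + ?T3 s i)"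
        by (intro sum.cong refl) auto
      also have "\<dots> = (\<Sum>s<length gs. \<Sum>i=a..<b. ?T1 s i) + (\<Sum>s<length gs. \<Sum>i=a..<b. ?T2 s i) + (\<Sum>s<length gs. \<Sum>i=a..<b. ?T3 s i)"
        by (simp only: sum.distrib)
      finally have "(\<Sum>s<length gs. \<Sum>i=a..<b. T' c s i) = (\<Sum>s<length gs. \<Sum>i=a..<b. ?T1 s i) + (\<Sum>s<length gs. \<Sum>i=a..<b. ?T2 s i) + (\<Sum>s<length gs. \<Sum>i=a..<b. ?T3 s i)" .
      from norm_sum3[OF this] have split: "norm (\<Sum>s<length gs. \<Sum>i=a..<b. T' c s i) \<le> norm (\<Sum>s<length gs. \<Sum>i=a..<b. ?T1 s i) + norm (\<Sum>s<length gs. \<Sum>i=a..<b. ?T2 s i) + norm (\<Sum>s<length gs. \<Sum>i=a..<b. ?T3 s i)" .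
      have "(\<Sum>s<length gs. \<Sum>i=a..<b. ?T1 s i) = (\<Sum>s<length gs. if s \<in> {a..<b} \<and> s < s0 then T' c s s else 0)"
        by (rule sum.cong[OF refl], rule delta)
      also have "\<dots> = (\<Sum>s=a..<min b s0. T' c s s)"
        using same(2) by (intro sum.mono_neutral_cong_right) auto
      finally have 1: "norm (\<Sum>s<length gs. \<Sum>i=a..<b. ?T1 s i) \<le> 121" using diag by simp
      have "(\<Sum>s<length gs. \<Sum>i=a..<b. ?T2 s i) = (\<Sum>s<length gs. if s \<in> {a..<b} \<and> s = s0 then T' c s s else 0)"
        by (rule sum.cong[OF refl], rule delta)
      also have "\<dots> = (\<Sum>s<length gs. if s = s0 then (if s0 \<in> {a..<b} then T' c s0 s0 else 0) else 0)"
        by (intro sum.cong refl) auto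
      also have "\<dots> = (if s0 < length gs then (if s0 \<in> {a..<b} then T' c s0 s0 else 0) else 0)" by (simp add: sum.delta)
      finally have 2: "norm (\<Sum>s<length gs. \<Sum>i=a..<b. ?T2 s i) \<le> 120" using T'up[of s0 s0 c] ab by auto
      have "norm (\<Sum>s<length gs. \<Sum>i=a..<b. ?T3 s i) \<le> (\<Sum>s<length gs. norm (\<Sum>i=a..<b. ?T3 s i))" by (rule norm_sum)
      also have "\<dots> \<le> (\<Sum>s<length gs. \<Sum>i=a..<b. 120 / (real ?n)\<^sup>2)"
        using T'off ab by (intro sum_mono sum_norm_le) auto
      also have "\<dots> = real (length gs) * (real (b - a) * (120 / (real ?n)\<^sup>2))" by simp
      also have "\<dots> \<le> real ?n * (real ?n * (120 / (real ?n)\<^sup>2))"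
        using gs(3) ab by (intro mult_mono) auto
      also have "\<dots> = 120" using n by (simp add: power2_eq_square)
      finally show ?thesis using split 1 2 by linarith
    qed
    have act_sum_gs: "(\<Sum>g\<leftarrow>gs. act g (window 0 c (block_sum X a b))) = (\<Sum>s<length gs. \<Sum>i=a..<b. T' c s i)" for c
    proof -
      have "window 0 c (block_sum X a b) = block_sum (\<lambda>k. window 0 c (X k)) a b" by (auto simp: window_def block_sum_def)
      then have "(\<Sum>g\<leftarrow>gs. act g (window 0 c (block_sum X a b))) = (\<Sum>g\<leftarrow>gs. \<Sum>i=a..<b. act g (window 0 c (X i)))"
        by (simp only: act_block_sum)
      also have "\<dots> = (\<Sum>s<length gs. \<Sum>i=a..<b. T' c s i)"
        unfolding T'_def sum_list_sum_nth by (simp add: atLeast0LessThan)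
      finally show ?thesis .
    qed
    \<comment> \<open>An interval is the difference of two initial windows, which doubles 361. After
      division by mm p >= 2 the result is below 120 times 8.\<close>
    have "norm (\<Sum>g\<leftarrow>gs. act g (window c d (block_sum X a b))) \<le> 722"
    proof (cases "c \<le> d")
      case True
      have "window c d x = (\<lambda>i. window 0 d x i - window 0 c x i)" for x :: "nat \<Rightarrow> 'k" using True by (auto simp: window_def)
      then have "act g (window c d (block_sum X a b)) = act g (window 0 d (block_sum X a b)) - act g (window 0 c (block_sum X a b))" for g
        unfolding act_minus[symmetric] by simp
      then have "(\<Sum>g\<leftarrow>gs. act g (window c d (block_sum X a b))) = (\<Sum>g\<leftarrow>gs. act g (window 0 d (block_sum X a b))) - (\<Sum>g\<leftarrow>gs. act g (window 0 c (block_sum X a b)))"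
        by (simp add: sum_list_subtractf)
      moreover have "norm (\<Sum>g\<leftarrow>gs. act g (window 0 c (block_sum X a b))) \<le> 361" for c unfolding act_sum_gs by (rule tot)
      ultimately have "norm (\<Sum>g\<leftarrow>gs. act g (window c d (block_sum X a b))) \<le> 361 + 361"
        by (blast intro: norm_diff_le)
      then show ?thesis by simp
    next
      case False
      then have "window c d (block_sum X a b) = (\<lambda>i. 0)" by (intro ext) (auto simp: window_def)
      then show ?thesis by (simp add: sum_list_0)
    qed
    then have "norm (\<Sum>g\<leftarrow>gs. act g (window c d (block_sum X a b))) / real (mm p) \<le> 722 / 2" using m by (intro frac_le) auto
    moreover have "norm (act t (block_sum X a b)) = norm (\<Sum>g\<leftarrow>gs. act g (window c d (block_sum X a b))) / real (mm p)"
      unfolding T by (simp add: norm_mult norm_divide)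
    ultimately show ?thesis by simp
  qed
  \<comment> \<open>With \<theta> = 0, unfolding for mm^2 rounds leaves a bound of order nn / mm^2
    instead of nn / mm.\<close>
  have "norm (act t (block_sum X 0 ?n)) \<le> 120 * (real (split_bound (nn (p - 1)) ((mm p)\<^sup>2)) + real (?n - 0) * (0 + (1/2) ^ ((mm p)\<^sup>2)))"
  proof (rule recursive_estimate(1)[OF bX, of ?n])
    show "norm (act t (block_sum X a b)) \<le> 120 * (8 + real (b - a) * 0)" if "valid t" "p \<le> weight t" "a \<le> b" "b \<le> ?n" for t a b
      using above[OF that(1) _ that(4)] level[OF that(1) _ that(3,4)] that(2) by (cases "weight t = p") auto
  qed (use up nX p1 t in auto)
  also have "\<dots> \<le> 120 * (real ?n / (real (mm p))\<^sup>2 + real ?n * (1 / (real (mm p))\<^sup>2))"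
  proof -
    define sb where "sb = real (split_bound (nn (p - 1)) (Suc ((mm p)\<^sup>2)))"
    have N: "real ?n = real (mm p) ^ 3 * sb" using nn_decomp[OF p1] by (simp add: sb_def)
    have "real ?n / (real (mm p))\<^sup>2 = real (mm p) * sb" unfolding N using m by (simp add: power2_eq_square power3_eq_cube)
    moreover have "1 * sb \<le> real (mm p) * sb" using m by (intro mult_right_mono) (auto simp: sb_def)
    moreover have "real (split_bound (nn (p - 1)) ((mm p)\<^sup>2)) \<le> sb"
      unfolding sb_def using split_bound_Suc_ge[of "nn (p - 1)"] nn_ge[of "p - 1"] by (simp del: split_bound.simps)
    ultimately have 1: "real (split_bound (nn (p - 1)) ((mm p)\<^sup>2)) \<le> real ?n / (real (mm p))\<^sup>2" by linarith
    have 2: "real (?n - 0) * (0 + (1/2) ^ ((mm p)\<^sup>2)) \<le> real ?n * (1 / (real (mm p))\<^sup>2)"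
      unfolding diff_zero add_0 by (rule mult_left_mono[OF half_power_le]) simp
    have "(0::real) \<le> 120" by simp
    from mult_left_mono[OF add_mono[OF 1 2] this] show ?thesis .
  qed
  also have "\<dots> = 240 * real ?n / (real (mm p))\<^sup>2" by simp
  finally show ?thesis .
qed

text \<open>The functionals of a dependent sequence form a special list themselves, so the node of
  odd weight \<open>p\<close> over them is admissible, and each child takes the value 1 on its own
  block.\<close>

lemma dep_seq_lower:
  assumes D: "dep_seq p (nn p) W fs x l" and p: "odd p"
  shows "\<exists>t. valid t \<and> norm (act t (block_sum x 0 (nn p))) = real (nn p) / real (mm p)"
proof -
  let ?n = "nn p"
  have bx: "blocks l x" and sp: "special p fs" and len: "length fs = ?n" using D by (auto simp: dep_seq_def)
  have Di: "valid (fs ! i)" "supp (fs ! i) \<subseteq> {l i..<l (Suc i)}" "act (fs ! i) (x i) = 1" if "i < ?n" for i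
    using D that by (auto simp: dep_seq_def)
  have ml: "mono l" using bx by (simp add: blocks_def)
  define t where "t = Node 0 0 (l ?n) p fs"
  have st: "successive fs"
    unfolding successive_def sorted_wrt_iff_nth_less
  proof (intro allI impI ballI)
    fix a b i j assume "a < b" "b < length fs" "i \<in> supp (fs ! a)" "j \<in> supp (fs ! b)"
    then show "i < j" using Di(2)[of a] Di(2)[of b] len monoD[OF ml, of "Suc a" b] by fastforce
  qed
  have "\<forall>g\<in>set fs. valid g" using Di(1) len by (metis in_set_conv_nth)
  then have v: "valid t" using p sp len st by (cases p) (auto simp: t_def)
  have one: "act (fs ! s) (window 0 (l ?n) (block_sum x 0 ?n)) = 1" if s: "s < ?n" for s
  proof -
    have "act (fs ! s) (window 0 (l ?n) (block_sum x 0 ?n)) = act (fs ! s) (x s)"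
    proof (rule act_cong)
      fix i assume "i \<in> supp (fs ! s)"
      then have i: "l s \<le> i" "i < l (Suc s)" using Di(2)[OF s] by auto
      have "l (Suc s) \<le> l ?n" using s by (intro monoD[OF ml]) auto
      moreover have "x k i = 0" if "k \<noteq> s" for k
      proof (cases "k < s")
        case True
        then have "l (Suc k) \<le> l s" by (intro monoD[OF ml]) auto
        then show ?thesis using bx i by (meson blocks_def leD less_le_trans)
      next
        case False
        then have "l (Suc s) \<le> l k" using that by (intro monoD[OF ml]) auto
        then show ?thesis using bx i by (meson blocks_def leD less_le_trans)
      qed
      then have "block_sum x 0 ?n i = (\<Sum>k\<in>{s}. x k i)" unfolding block_sum_def using s by (intro sum.mono_neutral_right) auto
      ultimately show "window 0 (l ?n) (block_sum x 0 ?n) i = x s i" using i by (simp add: window_def)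
    qed
    then show ?thesis using Di(3)[OF s] by simp
  qed
  have "(\<Sum>g\<leftarrow>fs. act g (window 0 (l ?n) (block_sum x 0 ?n))) = (\<Sum>s<length fs. act (fs ! s) (window 0 (l ?n) (block_sum x 0 ?n)))"
    unfolding sum_list_sum_nth by (simp add: atLeast0LessThan)
  also have "\<dots> = (\<Sum>s<length fs. 1)" using one len by (intro sum.cong) auto
  finally have "norm (act t (block_sum x 0 ?n)) = real ?n / real (mm p)"
    unfolding t_def using len by (simp add: norm_mult norm_divide)
  then show ?thesis using v by blast
qed

text \<open>The even-indexed part of a dependent sequence lies in one subspace, the odd-indexed part
  in the other. Their sum has norm at least nn / mm, their difference at most 240 nn / mm^2.\<close>

theorem hereditarily_indecomposable:
  assumes W: "lin_closed W0" "lin_closed W1"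
    and far: "\<And>s. \<exists>y\<in>W0. \<exists>e. (\<forall>i. y i \<noteq> 0 \<longrightarrow> s \<le> i \<and> i < e) \<and> y \<noteq> (\<lambda>i. 0)"
      "\<And>s. \<exists>y\<in>W1. \<exists>e. (\<forall>i. y i \<noteq> 0 \<longrightarrow> s \<le> i \<and> i < e) \<and> y \<noteq> (\<lambda>i. 0)"
    and eps: "\<epsilon> > 0"
  shows "\<exists>y\<in>W0 \<inter> X0. \<exists>z\<in>W1 \<inter> X0. nm (\<lambda>i. y i - z i) \<le> \<epsilon> * nm (\<lambda>i. y i + z i) \<and> nm (\<lambda>i. y i + z i) > 0"
proof -
  \<comment> \<open>Makes the ratio 240 / mm p at most \<epsilon>; then p = 2 N + 1 is odd, so that
    the coding governs weight p.\<close>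
  obtain N where N: "real N \<ge> 240 / \<epsilon>" using real_arch_simple by blast
  define p where "p = 2 * N + 1"
  have p: "odd p" by (simp add: p_def)
  have mp: "real (mm p) \<ge> 240 / \<epsilon>" using N mm_gt[of p] by (simp add: p_def)
  have m: "real (mm p) \<ge> 2" "real (nn p) \<ge> 2" using mm_ge[of p] nn_ge[of p] by linarith+
  let ?W = "\<lambda>i::nat. if even i then W0 else W1"
  have "lin_closed (?W i)" "\<exists>y\<in>?W i. \<exists>e. (\<forall>i. y i \<noteq> 0 \<longrightarrow> s \<le> i \<and> i < e) \<and> y \<noteq> (\<lambda>i. 0)" for i s
    using W far[of s] by (cases "even i"; simp)+
  then obtain fs x l where D: "dep_seq p (nn p) ?W fs x l" using dep_seq_exists[of ?W p "nn p"] by blast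
  define xe where "xe k = (if even k then x k else (\<lambda>i. 0))" for k
  define xo where "xo k = (if odd k then x k else (\<lambda>i. 0))" for k
  have z: "(\<lambda>i. 0) \<in> W0" "(\<lambda>i. 0) \<in> W1" using W by (auto simp: lin_closed_def)
  have xk: "x k \<in> ?W k" for k using D z by (cases "k < nn p") (auto simp: dep_seq_def)
  have We: "block_sum xe 0 (nn p) \<in> W0"
  proof (rule lin_closed_block_sum[OF W(1)])
    show "xe k \<in> W0" for k using xk[of k] z by (auto simp: xe_def)
  qed
  have Wo: "block_sum xo 0 (nn p) \<in> W1"
  proof (rule lin_closed_block_sum[OF W(2)])
    show "xo k \<in> W1" for k using xk[of k] z by (auto simp: xo_def)
  qed
  have ml: "mono l" using D by (simp add: dep_seq_def blocks_def)
  have bx: "blocks l x" using D by (simp add: dep_seq_def)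
  have x0: "x k i = 0" if "i \<ge> l (nn p)" "k < nn p" for k i
  proof (rule ccontr)
    assume "x k i \<noteq> 0"
    then have "i < l (Suc k)" using bx by (auto simp: blocks_def)
    also have "\<dots> \<le> l (nn p)" using that by (intro monoD[OF ml]) auto
    finally show False using that by simp
  qed
  have X0: "block_sum xe 0 (nn p) \<in> X0" "block_sum xo 0 (nn p) \<in> X0" "block_sum x 0 (nn p) \<in> X0"
    using x0 by (auto intro!: fin_X0[of "l (nn p)"] sum.neutral simp: block_sum_def xe_def xo_def)
  have plus: "(\<lambda>i. block_sum xe 0 (nn p) i + block_sum xo 0 (nn p) i) = block_sum x 0 (nn p)"
    unfolding block_sum_def sum.distrib[symmetric] by (intro ext sum.cong refl) (auto simp: xe_def xo_def)
  have minus: "(\<lambda>i. block_sum xe 0 (nn p) i - block_sum xo 0 (nn p) i) = block_sum (\<lambda>k i. (-1) ^ k * x k i) 0 (nn p)"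
    unfolding block_sum_def sum_subtractf[symmetric] by (intro ext sum.cong refl) (auto simp: xe_def xo_def)
  have up: "nm (block_sum (\<lambda>k i. (-1) ^ k * x k i) 0 (nn p)) \<le> 240 * real (nn p) / (real (mm p))\<^sup>2"
    using alternating_upper_estimate[OF D p] by (intro nm_le) auto
  obtain t where t: "valid t" "norm (act t (block_sum x 0 (nn p))) = real (nn p) / real (mm p)" using dep_seq_lower[OF D p] by blast
  have lo: "real (nn p) / real (mm p) \<le> nm (block_sum x 0 (nn p))" using act_le_nm[OF X0(3) t(1)] t(2) by simp
  have "240 \<le> \<epsilon> * real (mm p)" using mp eps by (simp add: field_simps)
  then have "240 * real (nn p) / (real (mm p))\<^sup>2 \<le> \<epsilon> * real (mm p) * real (nn p) / (real (mm p))\<^sup>2"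
    by (intro divide_right_mono mult_right_mono) auto
  also have "\<dots> = \<epsilon> * (real (nn p) / real (mm p))" using m by (simp add: power2_eq_square)
  also have "\<dots> \<le> \<epsilon> * nm (block_sum x 0 (nn p))" using lo eps by (intro mult_left_mono) auto
  finally have "nm (block_sum (\<lambda>k i. (-1) ^ k * x k i) 0 (nn p)) \<le> \<epsilon> * nm (block_sum x 0 (nn p))" using up by linarith
  moreover have "nm (block_sum x 0 (nn p)) > 0" using lo m by (smt (verit) divide_pos_pos)
  ultimately show ?thesis using We Wo X0 plus minus by (intro bexI[of _ "block_sum xe 0 (nn p)"] bexI[of _ "block_sum xo 0 (nn p)"]) auto
qed

end

section \<open>Duals, reflexivity and adjoints\<close>

context normed_ctx
begin

lemma dual_ctx: "normed_ctx \<omega> (dual Y)"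
  by unfold_locales (rule normed_space_dual[OF ns])

lemma banachI:
  assumes "\<And>s. (\<And>n::nat. s n \<in> C) \<Longrightarrow> (\<And>e. e > 0 \<Longrightarrow> \<exists>M. \<forall>m\<ge>M. \<forall>n\<ge>M. N (s m - s n) < e) \<Longrightarrow> \<exists>l\<in>C. (\<lambda>n. N (s n - l)) \<longlonglongrightarrow> 0"
  shows "banach_space Y"
proof -
  interpret M: Metric_space C "ndist Y" by (rule normed_space_Metric_space[OF ns])
  have "\<exists>l. limitin M.mtopology s l sequentially" if s: "M.MCauchy s" for s :: "nat \<Rightarrow> 'a"
  proof -
    have in_C: "s n \<in> C" for n using s by (auto simp: M.MCauchy_def)
    have "\<exists>M. \<forall>m\<ge>M. \<forall>n\<ge>M. N (s m - s n) < e" if "e > 0" for e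
      using s that in_C by (simp add: M.MCauchy_def ndist_def)
    then obtain l where l: "l \<in> C" "(\<lambda>n. N (s n - l)) \<longlonglongrightarrow> 0" using assms in_C by blast
    moreover have "ndist Y (s n) l = N (s n - l)" for n using in_C l by (simp add: ndist_def)
    ultimately have "limitin M.mtopology s l sequentially" using in_C by (simp add: M.limitin_metric_dist_null)
    then show ?thesis by blast
  qed
  then show ?thesis using ns by (auto simp: banach_space_def M.mcomplete_def)
qed

lemma banach_dual: "banach_space (dual Y)"
proof -
  interpret D: normed_ctx \<omega> "dual Y" by (rule dual_ctx)
  show ?thesis
  proof (rule D.banachI)
    fix s :: "nat \<Rightarrow> 'a \<Rightarrow> 'k" assume s: "\<And>n. s n \<in> D.C" and c: "\<And>e. e > 0 \<Longrightarrow> \<exists>M. \<forall>m\<ge>M. \<forall>n\<ge>M. D.N (s m - s n) < e"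
    have diff: "norm (s m x - s n x) \<le> D.N (s m - s n) * N x" if "x \<in> C" for m n x
      using dual_norm_le[OF D.diff_in[OF s s] that, of m n] by simp
    have "convergent (\<lambda>n. s n x)" for x
    proof (cases "x \<in> C")
      case True
      have "Cauchy (\<lambda>n. s n x)"
      proof (rule metric_CauchyI)
        fix e :: real assume e: "e > 0"
        have pos: "N x + 1 > 0" using True by (simp add: add_nonneg_pos)
        obtain M where M: "\<And>m n. m \<ge> M \<Longrightarrow> n \<ge> M \<Longrightarrow> D.N (s m - s n) < e / (N x + 1)"
          using c[of "e / (N x + 1)"] e pos by auto
        have "dist (s m x) (s n x) < e" if "m \<ge> M" "n \<ge> M" for m n
        proof -
          have "norm (s m x - s n x) \<le> e / (N x + 1) * N x"
            using diff[OF True, of m n] M[OF that] True by (meson N_nonneg less_imp_le mult_right_mono order_trans)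
          also have "\<dots> < e" using e pos by (simp add: field_simps)
          finally show ?thesis by (simp add: dist_norm)
        qed
        then show "\<exists>M. \<forall>m\<ge>M. \<forall>n\<ge>M. dist (s m x) (s n x) < e" by blast
      qed
      then show ?thesis by (rule Cauchy_convergent)
    next
      case False
      then show ?thesis using dualD(3)[OF s] by (simp add: convergent_const)
    qed
    then obtain l where l: "\<And>x. (\<lambda>n. s n x) \<longlonglongrightarrow> l x" unfolding convergent_def by metis
    have near: "norm (s m x - l x) \<le> e * N x" if M: "\<And>m n. m \<ge> M \<Longrightarrow> n \<ge> M \<Longrightarrow> D.N (s m - s n) < e" and "m \<ge> M" "x \<in> C" for M m e x
    proof (rule Lim_norm_ubound[of sequentially])
      show "(\<lambda>n. s m x - s n x) \<longlonglongrightarrow> s m x - l x" by (intro tendsto_intros l)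
      have "norm (s m x - s n x) \<le> e * N x" if n: "n \<ge> M" for n
      proof -
        have "D.N (s m - s n) * N x \<le> e * N x" using M[OF \<open>m \<ge> M\<close> n] \<open>x \<in> C\<close> by (intro mult_right_mono) auto
        then show ?thesis using diff[OF \<open>x \<in> C\<close>, of m n] by simp
      qed
      then show "\<forall>\<^sub>F n in sequentially. norm (s m x - s n x) \<le> e * N x" by (auto simp: eventually_sequentially)
    qed simp
    obtain M1 where M1: "\<And>m n. m \<ge> M1 \<Longrightarrow> n \<ge> M1 \<Longrightarrow> D.N (s m - s n) < 1" using c[of 1] by auto
    have lD: "l \<in> D.C"
    proof (rule dualI)
      show "l (x + y) = l x + l y" if "x \<in> C" "y \<in> C" for x y
      proof (rule LIMSEQ_unique[OF l])
        have "(\<lambda>n. s n x + s n y) \<longlonglongrightarrow> l x + l y" by (intro tendsto_intros l)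
        then show "(\<lambda>n. s n (x + y)) \<longlonglongrightarrow> l x + l y" using dualD(1)[OF s that] by simp
      qed
      show "l (sc a x) = a * l x" if "x \<in> C" for a x
      proof (rule LIMSEQ_unique[OF l])
        have "(\<lambda>n. a * s n x) \<longlonglongrightarrow> a * l x" by (intro tendsto_intros l)
        then show "(\<lambda>n. s n (sc a x)) \<longlonglongrightarrow> a * l x" using dualD(2)[OF s that] by simp
      qed
      show "l x = 0" if "x \<notin> C" for x using LIMSEQ_unique[OF l[of x]] dualD(3)[OF s that] by simp
      show "norm (l x) \<le> (D.N (s M1) + 1) * N x" if "x \<in> C" for x
        using near[of M1 1 M1 x] M1 that dual_norm_le[OF s that, of M1] norm_triangle_sub[of "l x" "s M1 x"]
        by (auto simp: norm_minus_commute distrib_right)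
    qed
    have "(\<lambda>n. D.N (s n - l)) \<longlonglongrightarrow> 0"
    proof (rule LIMSEQ_I)
      fix e :: real assume e: "e > 0"
      obtain M where M: "\<And>m n. m \<ge> M \<Longrightarrow> n \<ge> M \<Longrightarrow> D.N (s m - s n) < e / 2" using c[of "e / 2"] e by auto
      have "D.N (s n - l) \<le> e / 2" if "n \<ge> M" for n
        using near[of M "e / 2" n] M that e by (intro dual_norm_least) auto
      then show "\<exists>M. \<forall>n\<ge>M. norm (D.N (s n - l) - 0) < e"
        using e D.N_nonneg[OF D.diff_in[OF s lD]] by (intro exI[of _ M]) force
    qed
    then show "\<exists>l\<in>D.C. (\<lambda>n. D.N (s n - l)) \<longlonglongrightarrow> 0" using lD by blast
  qed
qed

lemma eq_0_if_functionals_0: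
  assumes "x \<in> C" "\<And>f. f \<in> carr (dual Y) \<Longrightarrow> f x = 0" shows "x = 0"
proof -
  obtain f where "f \<in> carr (dual Y)" "norm (f x) \<ge> N x" using norming_functional[OF assms(1)] by blast
  then show ?thesis using assms(2)[of f] N_eq0[OF assms(1)] N_nonneg[OF assms(1)] by simp
qed

lemma eq_if_functionals_eq:
  assumes "x \<in> C" "y \<in> C" "\<And>f. f \<in> carr (dual Y) \<Longrightarrow> f x = f y" shows "x = y"
proof -
  have "x - y = 0"
  proof (rule eq_0_if_functionals_0)
    show "f (x - y) = 0" if "f \<in> carr (dual Y)" for f using assms(3)[OF that] dual_diff[OF that assms(1,2)] by simp
  qed (use assms(1,2) in simp)
  then show ?thesis by simp
qed

lemma reflexiveD: "reflexive Y \<Longrightarrow> \<Phi> \<in> carr (dual (dual Y)) \<Longrightarrow> \<exists>x\<in>C. \<forall>f\<in>carr (dual Y). \<Phi> f = f x"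
proof -
  assume "reflexive Y" "\<Phi> \<in> carr (dual (dual Y))"
  then obtain x where x: "x \<in> C" "\<Phi> = canonical_embedding Y x" unfolding reflexive_def by blast
  have "\<Phi> f = f x" if "f \<in> carr (dual Y)" for f using that by (simp add: x(2) canonical_embedding_def)
  then show ?thesis using x(1) by blast
qed

lemma embedding_in_bidual: assumes "x \<in> C" shows "canonical_embedding Y x \<in> carr (dual (dual Y))"
proof -
  interpret D: normed_ctx \<omega> "dual Y" by (rule dual_ctx)
  show ?thesis
  proof (rule D.dualI)
    show "norm (canonical_embedding Y x f) \<le> N x * D.N f" if "f \<in> D.C" for f
      using dual_norm_le[OF that assms] that by (simp add: canonical_embedding_def mult.commute)
    show "canonical_embedding Y x (scal (dual Y) c f) = c * canonical_embedding Y x f" if "f \<in> D.C" for c f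
      using D.sc_in[OF that, of c] that by (simp add: canonical_embedding_def) (simp add: dual_def)
  qed (auto simp: canonical_embedding_def)
qed

lemma reflexiveI:
  assumes "\<And>\<Phi>. \<Phi> \<in> carr (dual (dual Y)) \<Longrightarrow> \<exists>x\<in>C. \<forall>f\<in>carr (dual Y). \<Phi> f = f x"
  shows "reflexive Y"
proof -
  interpret D: normed_ctx \<omega> "dual Y" by (rule dual_ctx)
  have "\<Phi> \<in> canonical_embedding Y ` C" if \<Phi>: "\<Phi> \<in> carr (dual (dual Y))" for \<Phi>
  proof -
    obtain x where x: "x \<in> C" "\<And>f. f \<in> D.C \<Longrightarrow> \<Phi> f = f x" using assms[OF \<Phi>] by blast
    have "\<Phi> = canonical_embedding Y x" using x(2) D.dualD(3)[OF \<Phi>] by (auto simp: canonical_embedding_def)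
    then show ?thesis using x by blast
  qed
  then show ?thesis unfolding reflexive_def using embedding_in_bidual by blast
qed

text \<open>A functional on the bidual composed with the canonical embedding is an element of the
  dual; since the embedding is onto, this element represents the given functional.\<close>

lemma reflexive_dual: assumes R: "reflexive Y" shows "reflexive (dual Y)"
proof -
  interpret D: normed_ctx \<omega> "dual Y" by (rule dual_ctx)
  interpret DD: normed_ctx \<omega> "dual (dual Y)" by (rule D.dual_ctx)
  show ?thesis
  proof (rule D.reflexiveI)
    fix \<Psi> assume \<Psi>: "\<Psi> \<in> carr (dual (dual (dual Y)))"
    let ?J = "canonical_embedding Y"
    define f where "f x = (if x \<in> C then \<Psi> (?J x) else 0)" for x
    have J: "?J x \<in> DD.C" if "x \<in> C" for x using embedding_in_bidual[OF that] .
    have f: "f \<in> D.C"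
    proof (rule dualI)
      show "f (x + y) = f x + f y" if "x \<in> C" "y \<in> C" for x y
      proof -
        have "?J (x + y) = ?J x + ?J y" using that by (auto simp: canonical_embedding_def dualD(1))
        then show ?thesis using that D.dualD(1) DD.dualD(1)[OF \<Psi> J J] by (simp add: f_def)
      qed
      show "f (sc c x) = c * f x" if "x \<in> C" for c x
      proof -
        have "?J (sc c x) = scal (dual (dual Y)) c (?J x)"
          using that by (auto simp: canonical_embedding_def dualD(2)) (auto simp: dual_def fun_eq_iff)
        then show ?thesis using that DD.dualD(2)[OF \<Psi> J] by (simp add: f_def)
      qed
      show "norm (f x) \<le> nrm (dual (dual (dual Y))) \<Psi> * N x" if "x \<in> C" for x
      proof -
        have "DD.N (?J x) \<le> N x"
          using dual_norm_le[OF _ that] that by (intro D.dual_norm_least) (auto simp: canonical_embedding_def mult.commute)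
        then have "nrm (dual (dual (dual Y))) \<Psi> * DD.N (?J x) \<le> nrm (dual (dual (dual Y))) \<Psi> * N x"
          using normed_space_nonneg[OF normed_space_dual[OF DD.ns] \<Psi>] by (intro mult_left_mono)
        then show ?thesis using DD.dual_norm_le[OF \<Psi> J[OF that]] that by (simp add: f_def)
      qed
    qed (simp add: f_def)
    moreover have "\<Psi> \<Phi> = \<Phi> f" if \<Phi>: "\<Phi> \<in> DD.C" for \<Phi>
    proof -
      obtain x where x: "x \<in> C" "\<Phi> = ?J x" using R \<Phi> unfolding reflexive_def by blast
      then show ?thesis using f by (simp add: f_def canonical_embedding_def)
    qed
    ultimately show "\<exists>f\<in>D.C. \<forall>\<Phi>\<in>DD.C. \<Psi> \<Phi> = \<Phi> f" by blast
  qed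
qed

text \<open>The bidual is complete, and the embedding distorts norms by a factor of at most 2, so
  Cauchy sequences can be transported there and back.\<close>

lemma banach_of_reflexive: assumes R: "reflexive Y" shows "banach_space Y"
proof (rule banachI)
  interpret D: normed_ctx \<omega> "dual Y" by (rule dual_ctx)
  interpret DD: normed_ctx \<omega> "dual (dual Y)" by (rule D.dual_ctx)
  let ?J = "canonical_embedding Y"
  fix s :: "nat \<Rightarrow> 'a" assume s: "\<And>n. s n \<in> C" and c: "\<And>e. e > 0 \<Longrightarrow> \<exists>M. \<forall>m\<ge>M. \<forall>n\<ge>M. N (s m - s n) < e"
  have J: "?J x \<in> DD.C" if "x \<in> C" for x using embedding_in_bidual[OF that] .
  have Jd: "?J x - ?J y = ?J (x - y)" if "x \<in> C" "y \<in> C" for x y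
    using that by (auto simp: canonical_embedding_def dual_diff)
  have JN: "DD.N (?J x) \<le> N x" if "x \<in> C" for x
    using dual_norm_le[OF _ that] that by (intro D.dual_norm_least) (auto simp: canonical_embedding_def mult.commute)
  have NJ: "N x \<le> 2 * DD.N (?J x)" if x: "x \<in> C" for x
  proof -
    obtain f where f: "f \<in> D.C" "\<And>x. x \<in> C \<Longrightarrow> norm (f x) \<le> 2 * N x" "norm (f x) \<ge> N x" using norming_functional[OF x] by blast
    have "norm (?J x f) \<le> DD.N (?J x) * D.N f" using D.dual_norm_le[OF J[OF x] f(1)] .
    also have "\<dots> \<le> DD.N (?J x) * 2" using f(2) DD.N_nonneg[OF J[OF x]] by (intro mult_left_mono dual_norm_least) auto
    finally show ?thesis using f by (simp add: canonical_embedding_def)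
  qed
  have cauchy: "\<exists>M. \<forall>m\<ge>M. \<forall>n\<ge>M. DD.N (?J (s m) - ?J (s n)) < e" if e: "e > 0" for e
  proof -
    obtain M where "\<forall>m\<ge>M. \<forall>n\<ge>M. N (s m - s n) < e" using c[OF e] by blast
    then show ?thesis
      unfolding Jd[OF s s] using le_less_trans[OF JN[OF diff_in[OF s s]]] by blast
  qed
  obtain \<Phi> where \<Phi>: "\<Phi> \<in> DD.C" "(\<lambda>n. DD.N (?J (s n) - \<Phi>)) \<longlonglongrightarrow> 0"
    using DD.convergent_of_Cauchy[OF D.banach_dual, of "\<lambda>n. ?J (s n)"] J s cauchy by blast
  obtain l where l: "l \<in> C" "\<Phi> = ?J l" using R \<Phi> unfolding reflexive_def by blast
  have "(\<lambda>n. N (s n - l)) \<longlonglongrightarrow> 0"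
  proof (rule Lim_null_comparison)
    show "\<forall>\<^sub>F n in sequentially. norm (N (s n - l)) \<le> 2 * DD.N (?J (s n) - \<Phi>)"
      using NJ[OF diff_in[OF s l(1)]] s l by (simp add: Jd)
    show "(\<lambda>n. 2 * DD.N (?J (s n) - \<Phi>)) \<longlonglongrightarrow> 0" by (intro tendsto_mult_right_zero \<Phi>)
  qed
  then show "\<exists>l\<in>C. (\<lambda>n. N (s n - l)) \<longlonglongrightarrow> 0" using l by blast
qed

lemma preadjoint:
  assumes R: "reflexive Y" and T: "power_bounded_op \<omega> (dual Y) T K"
  shows "\<exists>S. power_bounded_op \<omega> Y S (2 * K) \<and> (\<forall>f\<in>carr (dual Y). \<forall>x\<in>C. T f x = f (S x))"
proof -
  interpret D: power_bounded_op \<omega> "dual Y" T K by (rule T)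
  have "\<exists>z\<in>C. \<forall>f\<in>D.C. T f x = f z" if x: "x \<in> C" for x
  proof -
    define \<Phi> where "\<Phi> f = (if f \<in> D.C then T f x else 0)" for f
    have "\<Phi> \<in> carr (dual (dual Y))"
    proof (rule D.dualI)
      show "\<Phi> (scal (dual Y) c f) = c * \<Phi> f" if "f \<in> D.C" for c f
        using that D.sc_in[OF that, of c] by (simp add: \<Phi>_def D.T_sc) (simp add: dual_def)
      show "norm (\<Phi> f) \<le> (K * N x) * D.N f" if "f \<in> D.C" for f
      proof -
        have "norm (\<Phi> f) \<le> D.N (T f) * N x" using dual_norm_le[OF D.T_in[OF that] x] that by (simp add: \<Phi>_def)
        also have "\<dots> \<le> (K * D.N f) * N x" using D.T_norm[OF that] x by (intro mult_right_mono) auto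
        finally show ?thesis by (simp add: mult_ac)
      qed
    qed (auto simp: \<Phi>_def D.T_add)
    then obtain z where "z \<in> C" "\<forall>f\<in>D.C. \<Phi> f = f z" using reflexiveD[OF R] by blast
    then show ?thesis by (auto simp: \<Phi>_def)
  qed
  then obtain S where S: "\<And>x. x \<in> C \<Longrightarrow> S x \<in> C" "\<And>f x. f \<in> D.C \<Longrightarrow> x \<in> C \<Longrightarrow> T f x = f (S x)" by metis
  have Sn: "(S ^^ n) x \<in> C" if "x \<in> C" for n x using that S(1) by (induction n) auto
  have SnT: "(T ^^ n) f x = f ((S ^^ n) x)" if "f \<in> D.C" "x \<in> C" for f x n
    using that(2)
  proof (induction n arbitrary: x)
    case (Suc n)
    have "(T ^^ Suc n) f x = (T ^^ n) f (S x)" using S(2)[OF D.Tn_in[OF that(1)] Suc.prems] by simp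
    then show ?case using Suc.IH[OF S(1)[OF Suc.prems]] by (simp add: funpow_swap1)
  qed simp
  have "power_bounded_op \<omega> Y S (2 * K)"
  proof unfold_locales
    show "S (x + y) = S x + S y" if "x \<in> C" "y \<in> C" for x y
      using that S by (intro eq_if_functionals_eq) (auto simp: dualD(1) S(2)[symmetric])
    show "S (sc c x) = sc c (S x)" if "x \<in> C" for c x
      using that S by (intro eq_if_functionals_eq) (auto simp: dualD(2) S(2)[symmetric])
    \<comment> \<open>The factor 2 is the norm bound of the norming functional.\<close>
    show "N ((S ^^ n) x) \<le> 2 * K * N x" if x: "x \<in> C" for n x
    proof -
      obtain f where f: "f \<in> D.C" "\<And>x. x \<in> C \<Longrightarrow> norm (f x) \<le> 2 * N x" "norm (f ((S ^^ n) x)) \<ge> N ((S ^^ n) x)"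
        using norming_functional[OF Sn[OF x]] by blast
      have "norm ((T ^^ n) f x) \<le> D.N ((T ^^ n) f) * N x" using dual_norm_le[OF D.Tn_in[OF f(1)] x] .
      also have "\<dots> \<le> (K * D.N f) * N x" using D.T_pow[OF f(1)] x by (intro mult_right_mono) auto
      also have "\<dots> \<le> (K * 2) * N x" using f(2) D.K1 x by (intro mult_right_mono mult_left_mono dual_norm_least) auto
      finally show ?thesis using f(3) SnT[OF f(1) x] by (simp add: mult.commute)
    qed
    show "1 \<le> 2 * K" using D.K1 by simp
  qed (use S in auto)
  then show ?thesis using S by blast
qed

text \<open>The adjoint of \<open>Q\<close> does it. \<open>Q\<close> commutes with the quadratic
  factor V, so transposing V = V Q V gives an identity of the same form.\<close>

lemma regular_at_adjoint:
  assumes S: "power_bounded_op \<omega> Y S K" and T: "power_bounded_op \<omega> (dual Y) T K'"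
    and TS: "\<And>f x. f \<in> carr (dual Y) \<Longrightarrow> x \<in> C \<Longrightarrow> T f x = f (S x)" and reg: "regular_at S c"
  shows "normed_ctx.regular_at (dual Y) T c"
proof -
  interpret S: power_bounded_op \<omega> Y S K by (rule S)
  interpret D: power_bounded_op \<omega> "dual Y" T K' by (rule T)
  obtain Q L where Q: "\<And>x. x \<in> C \<Longrightarrow> Q x \<in> C" "\<And>x. x \<in> C \<Longrightarrow> N (Q x) \<le> L * N x"
      "\<And>x. x \<in> C \<Longrightarrow> S (Q x) = Q (S x)" "\<And>x. x \<in> C \<Longrightarrow> S.qop c (x - S.qop c (Q x)) = 0"
      "\<And>x y. x \<in> C \<Longrightarrow> y \<in> C \<Longrightarrow> Q (x + y) = Q x + Q y" "\<And>a x. x \<in> C \<Longrightarrow> Q (sc a x) = sc a (Q x)"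
    using reg unfolding regular_at_def by blast
  define R where "R f x = (if x \<in> C then f (Q x) else 0)" for f :: "'a \<Rightarrow> 'k" and x
  have sc: "scal (dual Y) = (\<lambda>c f x. c * f x)" by (simp add: dual_def)
  have q: "D.qop c f x = f (S.qop c x)" if "f \<in> D.C" "x \<in> C" for f x
    using that by (simp add: D.qop_def S.qop_def D.rscale_def rscale_def sc dualD(1,2) dual_diff TS)
  have R_in: "R f \<in> D.C" if f: "f \<in> D.C" for f
  proof (rule dualI)
    show "norm (R f x) \<le> (D.N f * L) * N x" if x: "x \<in> C" for x
    proof -
      have "norm (R f x) \<le> D.N f * N (Q x)" using dual_norm_le[OF f Q(1)[OF x]] x by (simp add: R_def)
      also have "\<dots> \<le> D.N f * (L * N x)" using Q(2)[OF x] f by (intro mult_left_mono) auto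
      finally show ?thesis by simp
    qed
  qed (use f Q in \<open>auto simp: R_def dualD\<close>)
  have Q_diff: "Q (x - y) = Q x - Q y" if "x \<in> C" "y \<in> C" for x y
    using Q(5)[of x "sc (-1) y"] Q(6)[of y "-1"] that by simp
  have Qq: "Q (S.qop c x) = S.qop c (Q x)" if "x \<in> C" for x
    using that by (simp add: S.qop_def Q rscale_def Q_diff)
  show ?thesis
    unfolding D.regular_at_def
  proof (intro exI[of _ R] exI[of _ "max L 0"] conjI ballI allI)
    fix f assume f: "f \<in> D.C"
    show "R f \<in> D.C" by (rule R_in[OF f])
    show "D.N (R f) \<le> max L 0 * D.N f"
    proof (rule dual_norm_least)
      show "norm (R f x) \<le> max L 0 * D.N f * N x" if x: "x \<in> C" for x
      proof -
        have "norm (R f x) \<le> D.N f * N (Q x)" using dual_norm_le[OF f Q(1)[OF x]] x by (simp add: R_def)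
        also have "\<dots> \<le> D.N f * (L * N x)" using Q(2)[OF x] f by (intro mult_left_mono) auto
        also have "\<dots> \<le> D.N f * (max L 0 * N x)" using x f by (intro mult_left_mono mult_right_mono) auto
        finally show ?thesis by (simp add: mult_ac)
      qed
    qed (use f in auto)
    show "T (R f) = R (T f)"
    proof
      show "T (R f) x = R (T f) x" for x
        using f R_in[OF f] D.T_in Q(1,3) TS dualD(3) by (cases "x \<in> C") (auto simp: R_def)
    qed
    show "D.qop c (f - D.qop c (R f)) = 0"
    proof
      fix x
      have fR: "f - D.qop c (R f) \<in> D.C" using f R_in by simp
      show "D.qop c (f - D.qop c (R f)) x = 0 x"
      proof (cases "x \<in> C")
        case True
        have "D.qop c (f - D.qop c (R f)) x = f (S.qop c x) - f (S.qop c (S.qop c (Q x)))"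
          unfolding q[OF fR True] using True f R_in[OF f] by (simp add: q Qq[symmetric] R_def)
        also have "\<dots> = f (S.qop c (x - S.qop c (Q x)))" using True f Q(1) by (simp add: S.qop_diff dual_diff)
        also have "\<dots> = 0" using Q(4)[OF True] dualD(2)[OF f zero_in, of 0] by simp
        finally show ?thesis by simp
      next
        case False
        then show ?thesis using dualD(3)[OF D.qop_in[OF fR]] by simp
      qed
    qed
    show "R (f + g) = R f + R g" for g by (auto simp: R_def)
    show "R (scal (dual Y) a f) = scal (dual Y) a (R f)" for a by (auto simp: R_def sc)
  qed
qed

end

section \<open>The quadratic factor on the closure of its range\<close>

context power_bounded_op
begin

text \<open>By the mean ergodic splitting this closed subspace complements the kernel, so it is the
  place where the quadratic factor can be inverted.\<close>

definition qrange :: "real \<Rightarrow> 'a set" where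
  "qrange c = {z\<in>C. \<forall>e>0. \<exists>v\<in>C. N (z - qop c v) < e}"

lemma qrange_in: "z \<in> qrange c \<Longrightarrow> z \<in> C"
  by (simp add: qrange_def)

lemma qrangeD: "z \<in> qrange c \<Longrightarrow> e > 0 \<Longrightarrow> \<exists>v\<in>C. N (z - qop c v) < e"
  by (simp add: qrange_def)

lemma qop_qrange [simp]: "v \<in> C \<Longrightarrow> qop c v \<in> qrange c"
  by (force simp: qrange_def)

lemma qrange_add: assumes "x \<in> qrange c" "y \<in> qrange c" shows "x + y \<in> qrange c"
  unfolding qrange_def
proof (intro CollectI conjI allI impI)
  show "x + y \<in> C" using assms by (simp add: qrange_def)
  fix e :: real assume e: "e > 0"
  obtain v w where vw: "v \<in> C" "N (x - qop c v) < e / 2" "w \<in> C" "N (y - qop c w) < e / 2"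
    using qrangeD[OF assms(1), of "e / 2"] qrangeD[OF assms(2), of "e / 2"] e by auto
  have "x + y - qop c (v + w) = (x - qop c v) + (y - qop c w)" using vw by (simp add: qop_add)
  also have "N \<dots> \<le> N (x - qop c v) + N (y - qop c w)" using vw assms[THEN qrange_in] by (intro N_tri) auto
  finally show "\<exists>v\<in>C. N (x + y - qop c v) < e" using vw by (intro bexI[of _ "v + w"]) auto
qed

lemma qrange_map:
  assumes z: "z \<in> qrange c" and A: "\<And>x. x \<in> C \<Longrightarrow> A x \<in> C" "\<And>x y. x \<in> C \<Longrightarrow> y \<in> C \<Longrightarrow> A (x - y) = A x - A y"
    "\<And>x. x \<in> C \<Longrightarrow> N (A x) \<le> L * N x" "\<And>x. x \<in> C \<Longrightarrow> A (qop c x) = qop c (A x)" and L: "L \<ge> 0"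
  shows "A z \<in> qrange c"
  unfolding qrange_def
proof (intro CollectI conjI allI impI)
  show "A z \<in> C" using z A(1) by (simp add: qrange_def)
  fix e :: real assume e: "e > 0"
  obtain v where v: "v \<in> C" "N (z - qop c v) < e / (L + 1)" using qrangeD[OF z, of "e / (L + 1)"] e L by auto
  have "N (A z - qop c (A v)) \<le> L * N (z - qop c v)" using A(3)[of "z - qop c v"] A(2,4) v z[THEN qrange_in] by simp
  also have "\<dots> \<le> L * (e / (L + 1))" using v L by (intro mult_left_mono) auto
  also have "\<dots> < e" using e L by (simp add: field_simps)
  finally show "\<exists>v\<in>C. N (A z - qop c v) < e" using v A(1) by blast
qed

lemma qrange_T: "z \<in> qrange c \<Longrightarrow> T z \<in> qrange c"
  by (rule qrange_map[of z c T K]) (use K1 in \<open>simp_all add: T_diff qop_T T_norm\<close>)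
lemma qrange_sc: "z \<in> qrange c \<Longrightarrow> sc a z \<in> qrange c"
  by (rule qrange_map[of z c "sc a" "norm a"]) (auto simp: V.scale_right_diff_distrib qop_sc N_sc)
lemma qrange_diff: "x \<in> qrange c \<Longrightarrow> y \<in> qrange c \<Longrightarrow> x - y \<in> qrange c"
  using qrange_add[of x c "sc (-1) y"] qrange_sc[of y c "-1"] by simp

lemma qrange_closed:
  assumes z: "z \<in> C" and lim: "\<And>e. e > 0 \<Longrightarrow> \<exists>y\<in>qrange c. N (z - y) < e" shows "z \<in> qrange c"
  unfolding qrange_def
proof (intro CollectI conjI allI impI z)
  fix e :: real assume e: "e > 0"
  obtain y where y: "y \<in> qrange c" "N (z - y) < e / 2" using lim[of "e / 2"] e by auto
  obtain v where v: "v \<in> C" "N (y - qop c v) < e / 2" using qrangeD[OF y(1), of "e / 2"] e by auto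
  have "N (z - qop c v) \<le> N (z - y) + N (y - qop c v)" using z v y(1)[THEN qrange_in] by (intro N_tri3) auto
  then show "\<exists>v\<in>C. N (z - qop c v) < e" using v y by (intro bexI[of _ v]) auto
qed

text \<open>The operators \<open>F n\<close> are the defects of the truncated formal inverse. They
  fix kernel vectors and are uniformly bounded, while their sums over a range vector telescope to
  something bounded in n. Averaging therefore sends a kernel vector in the closed range both to
  itself and to 0.\<close>

lemma qop_kernel_qrange:
  assumes c: "\<bar>c\<bar> < 1" and z: "z \<in> qrange c" and 0: "qop c z = 0"
  shows "z = 0"
proof -
  let ?u = "chev c"
  define F where "F n x = rscale (?u (Suc n)) ((T ^^ n) x) - rscale (?u n) ((T ^^ Suc n) x)" for n x
  define B where "B = 1 / sin (arccos c)"
  have B: "\<bar>?u n\<bar> \<le> B" "B \<ge> 0" for n using chev_simps(4,5)[OF c] by (auto simp: B_def)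
  define D where "D = 2 * B * K"
  have D: "D \<ge> 0" using B K1 by (simp add: D_def)
  have F_in: "F n x \<in> C" if "x \<in> C" for n x using that by (simp add: F_def del: funpow.simps)
  have F_add: "F n (x + y) = F n x + F n y" if "x \<in> C" "y \<in> C" for n x y
    using that by (simp add: F_def Tn_add rscale_add del: funpow.simps)
  have F_norm: "N (F n x) \<le> D * N x" if x: "x \<in> C" for n x
  proof -
    have "N (F n x) \<le> N (rscale (?u (Suc n)) ((T ^^ n) x)) + N (rscale (?u n) ((T ^^ Suc n) x))" unfolding F_def using x by (intro N_tri_minus) auto
    also have "\<dots> \<le> B * (K * N x) + B * (K * N x)"
      unfolding N_rs[OF Tn_in[OF x]] using B T_pow[OF x] x by (intro add_mono mult_mono) (auto simp del: funpow.simps)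
    finally show ?thesis by (simp add: D_def)
  qed
  have step: "F (Suc n) x = F n x - rscale (?u (Suc n)) ((T ^^ n) (qop c x))" if x: "x \<in> C" for n x
    using x unfolding F_def chev_simps(3)[OF c] qop_def
    by (simp add: rscale_diff rscale_add rscale_diff2 Tn_add Tn_diff Tn_rs T_Tn mult_ac)
  have F0: "F 0 x = x" for x using chev_simps[OF c] by (simp add: F_def)
  have Fz: "F n z = z" for n
    using step[OF qrange_in[OF z]] 0 by (induction n) (auto simp: F0)
  have tel: "(\<Sum>i<Suc n. F i (qop c v)) = (v - F (Suc n) v) - T (T (v - F n v))" if v: "v \<in> C" for n v
  proof (induction n)
    case 0
    then show ?case using step[OF v, of 0] chev_simps[OF c] by (simp add: F0)
  next
    case (Suc n)
    have "F (Suc n) (qop c v) = (F (Suc n) v - F (Suc (Suc n)) v) - T (T (F n v - F (Suc n) v))"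
      unfolding step[OF v, of "Suc n"] step[OF v, of n] unfolding F_def using v by (simp add: T_rs T_Tn)
    moreover have "T (T (v - F (Suc n) v)) = T (T (v - F n v)) + T (T (F n v - F (Suc n) v))"
      using v F_in by (simp add: T_diff)
    moreover have "(\<Sum>i<Suc (Suc n). F i (qop c v)) = (\<Sum>i<Suc n. F i (qop c v)) + F (Suc n) (qop c v)" by (rule sum.lessThan_Suc)
    ultimately show ?case unfolding Suc.IH by (simp del: sum.lessThan_Suc)
  qed
  have tel_norm: "N (\<Sum>i<Suc n. F i (qop c v)) \<le> (1 + D) * (1 + K) * N v" if v: "v \<in> C" for n v
  proof -
    have e: "N (v - F n v) \<le> (1 + D) * N v" for n
      using N_tri_minus[OF v F_in[OF v], of n] F_norm[OF v, of n] by (simp add: distrib_right)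
    have "N (\<Sum>i<Suc n. F i (qop c v)) \<le> N (v - F (Suc n) v) + N (T (T (v - F n v)))"
      unfolding tel[OF v] using v F_in by (intro N_tri_minus) auto
    also have "N (T (T (v - F n v))) \<le> K * N (v - F n v)" using T_pow[of "v - F n v" 2] v F_in by (simp add: numeral_2_eq_2)
    also have "\<dots> \<le> K * ((1 + D) * N v)" using e K1 by (intro mult_left_mono) auto
    finally show ?thesis using e[of "Suc n"] by (simp add: algebra_simps)
  qed
  have zC: "z \<in> C" using z by (rule qrange_in)
  have "N z \<le> 0 + e" if e: "e > 0" for e
  proof -
    \<comment> \<open>The approximation error then contributes D d <= e/2, and enough terms in the
      average make the telescoped part at most e/2.\<close>
    define d where "d = e / (2 * (D + 1))"
    have d: "d > 0" using e D by (simp add: d_def)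
    obtain v where v: "v \<in> C" "N (z - qop c v) < d" using qrangeD[OF z d] by blast
    let ?B = "(1 + D) * (1 + K) * N v"
    obtain n where n: "real n \<ge> 2 * ?B / e" using real_arch_simple by blast
    have "(\<Sum>i<Suc n. z) = (\<Sum>i<Suc n. F i (z - qop c v)) + (\<Sum>i<Suc n. F i (qop c v))"
    proof -
      have "F i (z - qop c v) + F i (qop c v) = z" for i using F_add[of "z - qop c v" "qop c v" i] zC v Fz by simp
      then show ?thesis by (simp add: sum.distrib[symmetric] del: sum.lessThan_Suc)
    qed
    also have "N \<dots> \<le> N (\<Sum>i<Suc n. F i (z - qop c v)) + N (\<Sum>i<Suc n. F i (qop c v))" using zC v F_in by (intro N_tri sum_in) auto
    also have "N (\<Sum>i<Suc n. F i (z - qop c v)) \<le> (\<Sum>i<Suc n. N (F i (z - qop c v)))" using zC v F_in by (intro N_sum) auto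
    also have "\<dots> \<le> (\<Sum>i<Suc n. D * d)"
    proof (rule sum_mono)
      fix i
      have "N (F i (z - qop c v)) \<le> D * N (z - qop c v)" using zC v by (intro F_norm) auto
      also have "\<dots> \<le> D * d" using v D by (intro mult_left_mono) auto
      finally show "N (F i (z - qop c v)) \<le> D * d" .
    qed
    also have "(\<Sum>i<Suc n. D * d) = real (Suc n) * (D * d)" by simp
    finally have "N (\<Sum>i<Suc n. z) \<le> real (Suc n) * (D * d) + ?B" using tel_norm[OF v(1), of n] by linarith
    moreover have "(\<Sum>i<m. z) = rscale (real m) z" for m by (induction m) (auto simp: rscale_add2 add.commute)
    ultimately have a: "real (Suc n) * N z \<le> real (Suc n) * (D * d) + ?B" using zC by (simp add: N_rs del: sum.lessThan_Suc)
    have b: "?B \<le> real (Suc n) * (e / 2)" using n e by (simp add: field_simps)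
    have "real (Suc n) * N z \<le> real (Suc n) * (D * d + e / 2)"
      unfolding distrib_left by (rule order_trans[OF a add_left_mono[OF b]])
    then have "N z \<le> D * d + e / 2" by (subst (asm) mult_le_cancel_left_pos) auto
    also have "D * d \<le> e / 2" using e D by (simp add: d_def field_simps)
    finally show ?thesis by simp
  qed
  then have "N z \<le> 0" by (rule field_le_epsilon)
  then show ?thesis using N_eq0[OF zC] N_nonneg[OF zC] by simp
qed

text \<open>Let V be the quadratic factor and R the closure of its range. V ignores the kernel part
  of a vector, so V maps R onto a dense part of R, and the lower bound closes the image. Thus V is
  bijective on R, and Q x is the unique w in R with V V w = V x. Linearity of Q and commutation with
  T follow from uniqueness.\<close>

lemma regular_of_bounded_below:
  assumes R: "reflexive Y" and Ba: "banach_space Y" and c: "\<bar>c\<bar> < 1"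
    and d: "d > 0" "\<And>z. z \<in> qrange c \<Longrightarrow> d * N z \<le> N (qop c z)"
  shows "regular_at T c"
proof -
  have split: "\<exists>g\<in>C. qop c g = 0 \<and> x - g \<in> qrange c" if x: "x \<in> C" for x
  proof -
    obtain g where g: "g \<in> C" "qop c g = 0" "\<forall>e>0. \<exists>v\<in>C. N (x - g - qop c v) < e"
      using ergodic_qop[OF R c] x unfolding ergodic_for_def by blast
    then have "x - g \<in> qrange c" using x by (simp add: qrange_def)
    then show ?thesis using g by blast
  qed
  \<comment> \<open>Removing the kernel part moves an approximate preimage into R without changing
    its image; the lower bound then makes the approximants Cauchy.\<close>
  have onto: "\<exists>w\<in>qrange c. qop c w = z" if z: "z \<in> qrange c" for z
  proof -
    have "\<exists>w\<in>qrange c. N (z - qop c w) < 1 / real (Suc n)" for n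
    proof -
      obtain v where v: "v \<in> C" "N (z - qop c v) < 1 / real (Suc n)" using qrangeD[OF z, of "1 / real (Suc n)"] by auto
      obtain g where g: "g \<in> C" "qop c g = 0" "v - g \<in> qrange c" using split[OF v(1)] by blast
      then show ?thesis using v by (intro bexI[of _ "v - g"]) (auto simp: qop_diff)
    qed
    then obtain w where w: "\<And>n. w n \<in> qrange c" "\<And>n. N (z - qop c (w n)) < 1 / real (Suc n)" by metis
    have wC: "w n \<in> C" for n using w(1) qrange_in by blast
    have zC: "z \<in> C" using z qrange_in by blast
    have inv: "\<exists>M. \<forall>n\<ge>M. 1 / real (Suc n) < e" if "e > 0" for e
    proof -
      have "(\<lambda>n. 1 / real (Suc n)) \<longlonglongrightarrow> 0" by (rule LIMSEQ_Suc[OF lim_1_over_n])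
      then have "\<forall>\<^sub>F n in sequentially. 1 / real (Suc n) < e" using that by (intro order_tendstoD)
      then show ?thesis by (simp add: eventually_sequentially)
    qed
    have "\<exists>l\<in>C. (\<lambda>n. N (w n - l)) \<longlonglongrightarrow> 0"
    proof (rule convergent_of_Cauchy[OF Ba wC])
      fix e :: real assume e: "e > 0"
      obtain M where M: "\<And>n. n \<ge> M \<Longrightarrow> 1 / real (Suc n) < d * e / 2" using inv[of "d * e / 2"] e d by auto
      have "N (w m - w n) < e" if mn: "m \<ge> M" "n \<ge> M" for m n
      proof -
        have "d * N (w m - w n) \<le> N (qop c (w m) - qop c (w n))" using d(2)[OF qrange_diff[OF w(1) w(1)]] by (simp add: qop_diff wC)
        also have "\<dots> \<le> N (qop c (w m) - z) + N (z - qop c (w n))" using wC zC by (intro N_tri3) auto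
        also have "N (qop c (w m) - z) = N (z - qop c (w m))" using wC zC by (intro N_comm) auto
        finally have "d * N (w m - w n) < d * e" using w(2)[of m] w(2)[of n] M[OF mn(1)] M[OF mn(2)] by simp
        then show ?thesis using d by simp
      qed
      then show "\<exists>M. \<forall>m\<ge>M. \<forall>n\<ge>M. N (w m - w n) < e" by blast
    qed
    then obtain l where l: "l \<in> C" "(\<lambda>n. N (w n - l)) \<longlonglongrightarrow> 0" by blast
    have ev: "\<exists>M. \<forall>n\<ge>M. N (w n - l) < e" if "e > 0" for e
      using order_tendstoD(2)[OF l(2) that] by (simp add: eventually_sequentially)
    have lR: "l \<in> qrange c"
    proof (rule qrange_closed[OF l(1)])
      show "\<exists>y\<in>qrange c. N (l - y) < e" if "e > 0" for e using ev[OF that] w(1) N_comm[OF l(1) wC] by (metis order_refl)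
    qed
    have "N (z - qop c l) \<le> 0 + e" if e: "e > 0" for e
    proof -
      define D where "D = K + 2 * \<bar>c\<bar> * K + 1"
      have D: "D > 0" using K1 by (simp add: D_def add_nonneg_pos)
      obtain M1 where M1: "\<And>n. n \<ge> M1 \<Longrightarrow> 1 / real (Suc n) < e / 2" using inv[of "e / 2"] e by auto
      obtain M2 where M2: "\<And>n. n \<ge> M2 \<Longrightarrow> N (w n - l) < e / (2 * D)" using ev[of "e / (2 * D)"] e D by auto
      define n where "n = max M1 M2"
      have "N (z - qop c l) \<le> N (z - qop c (w n)) + N (qop c (w n) - qop c l)" using wC zC l by (intro N_tri3) auto
      also have "N (qop c (w n) - qop c l) \<le> D * N (w n - l)" using qop_norm[of "w n - l" c] wC l by (simp add: qop_diff D_def)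
      also have "\<dots> \<le> D * (e / (2 * D))" using M2[of n] D by (intro mult_left_mono) (auto simp: n_def)
      also have "\<dots> = e / 2" using D by simp
      finally show ?thesis using w(2)[of n] M1[of n] by (simp add: n_def)
    qed
    then have "N (z - qop c l) \<le> 0" by (rule field_le_epsilon)
    moreover have "N (z - qop c l) \<ge> 0" using zC l by simp
    ultimately have "N (z - qop c l) = 0" by simp
    then have "z = qop c l" using N_eq0[of "z - qop c l"] zC l by simp
    then show ?thesis using lR by blast
  qed
  have ex: "\<exists>w\<in>qrange c. qop c (x - qop c w) = 0" if x: "x \<in> C" for x
  proof -
    obtain g where g: "g \<in> C" "qop c g = 0" "x - g \<in> qrange c" using split[OF x] by blast
    obtain w where w: "w \<in> qrange c" "qop c w = x - g" using onto[OF g(3)] by blast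
    then show ?thesis using g x by (intro bexI[of _ w]) (auto simp: qop_diff)
  qed
  have uniq: "w = w'" if w: "w \<in> qrange c" "qop c (x - qop c w) = 0" "w' \<in> qrange c" "qop c (x - qop c w') = 0" "x \<in> C" for x w w'
  proof -
    have C: "w \<in> C" "w' \<in> C" using w qrange_in by auto
    have "qop c (qop c (w - w')) = 0" using w C by (simp add: qop_diff)
    then have "qop c (w - w') = 0" using qop_kernel_qrange[OF c qop_qrange, of "w - w'"] C by simp
    then have "w - w' = 0" using qop_kernel_qrange[OF c qrange_diff[OF w(1,3)]] by simp
    then show ?thesis by simp
  qed
  define Q where "Q x = (SOME w. w \<in> qrange c \<and> qop c (x - qop c w) = 0)" for x
  have Q: "Q x \<in> qrange c" "qop c (x - qop c (Q x)) = 0" if "x \<in> C" for x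
  proof -
    have "Q x \<in> qrange c \<and> qop c (x - qop c (Q x)) = 0"
      unfolding Q_def by (rule someI_ex) (use ex[OF that] in blast)
    then show "Q x \<in> qrange c" "qop c (x - qop c (Q x)) = 0" by auto
  qed
  have QC: "Q x \<in> C" if "x \<in> C" for x using Q(1)[OF that] by (rule qrange_in)
  have QQ: "qop c (qop c (Q x)) = qop c x" if "x \<in> C" for x using Q(2)[OF that] QC[OF that] that by (simp add: qop_diff)
  show ?thesis
    unfolding regular_at_def
  proof (intro exI[of _ Q] exI[of _ "(K + 2 * \<bar>c\<bar> * K + 1) / (d * d)"] conjI ballI allI)
    fix x assume x: "x \<in> C"
    show "Q x \<in> C" by (rule QC[OF x])
    show "qop c (x - qop c (Q x)) = 0" by (rule Q(2)[OF x])
    show "T (Q x) = Q (T x)"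
      by (rule uniq[where x = "T x"]) (use Q[OF x] Q[OF T_in[OF x]] QC[OF x] x in \<open>auto intro: qrange_T simp: qop_T QQ qop_diff\<close>)
    show "Q (sc a x) = sc a (Q x)" for a
      by (rule uniq[where x = "sc a x"]) (use Q[OF x] Q[OF sc_in[OF x]] QC x in \<open>auto intro: qrange_sc simp: qop_sc QQ qop_diff\<close>)
    show "Q (x + y) = Q x + Q y" if y: "y \<in> C" for y
      by (rule uniq[where x = "x + y"]) (use Q[OF x] Q[OF y] Q[OF add_in[OF x y]] QC x y in \<open>auto intro: qrange_add simp: qop_add QQ qop_diff\<close>)
    \<comment> \<open>The lower bound, used twice, against V V (Q x) = V x.\<close>
    have "d * (d * N (Q x)) \<le> d * N (qop c (Q x))" using d Q(1)[OF x] by (intro mult_left_mono) auto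
    also have "\<dots> \<le> N (qop c (qop c (Q x)))" using QC[OF x] by (intro d(2)) auto
    also have "\<dots> \<le> (K + 2 * \<bar>c\<bar> * K + 1) * N x" unfolding QQ[OF x] by (rule qop_norm[OF x])
    finally show "N (Q x) \<le> (K + 2 * \<bar>c\<bar> * K + 1) / (d * d) * N x" using d by (simp add: field_simps)
  qed
qed

end

section \<open>The space and its dual\<close>

lemma sum_pointwise: "(\<Sum>i\<in>A. f i) x = (\<Sum>i\<in>A. f i x)"
  by (induction A rule: infinite_finite_induct) auto

context normed_ctx
begin

lemma dual_sum:
  assumes f: "f \<in> carr (dual Y)" and A: "finite A" "\<And>i. i \<in> A \<Longrightarrow> g i \<in> C"
  shows "f (\<Sum>i\<in>A. sc (a i) (g i)) = (\<Sum>i\<in>A. a i * f (g i))"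
  using A
proof (induction A rule: finite_induct)
  case empty
  then show ?case using dualD(2)[OF f zero_in, of 0] by simp
next
  case (insert i A)
  then show ?case using dualD(1,2)[OF f] by (simp add: sum_in)
qed

end

locale tree_space = phase_field \<omega> + scalar_field \<omega> for \<omega> :: "'k::{real_normed_field, euclidean_space}"
begin

definition TS :: "('k, nat \<Rightarrow> 'k) nspace" where
  "TS = \<lparr>carr = X0, scal = (\<lambda>c x i. c * x i), nrm = nm\<rparr>"

lemma TS_simps [simp]: "carr TS = X0" "scal TS = (\<lambda>c x i. c * x i)" "nrm TS = nm"
  by (simp_all add: TS_def)

lemma normed_TS: "normed_space TS"
proof -
  interpret V: vector_space "\<lambda>c x i. c * x i :: 'k"
    by standard (auto simp: fun_eq_iff algebra_simps)
  have "V.subspace X0"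
  proof (rule V.subspaceI)
    show "0 \<in> X0" by (rule fin_X0) simp
    show "x + y \<in> X0" if "x \<in> X0" "y \<in> X0" for x y using X0_add[OF that] by (simp add: plus_fun_def)
    show "(\<lambda>i. c * x i) \<in> X0" if "x \<in> X0" for c x using X0_scale[OF that] .
  qed
  then show ?thesis
    using V.vector_space_axioms nm_eq_0 nm_scale nm_add by (simp add: normed_space_def plus_fun_def zero_fun_def)
qed

sublocale X: normed_ctx \<omega> TS
  by unfold_locales (rule normed_TS)

definition tail :: "nat \<Rightarrow> (nat \<Rightarrow> 'k) \<Rightarrow> nat \<Rightarrow> 'k" where
  "tail L x = (\<lambda>i. if L \<le> i then x i else 0)"

lemma tail_eq: "tail L x = x - window 0 L x"
  by (auto simp: tail_def window_def)

text \<open>Trees have finite support, so each of them sees a tail as a long window; this transfers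
  norm facts from windows to tails.\<close>

lemma act_tail: "\<exists>b0. \<forall>b\<ge>b0. act t (tail L x) = act t (window L b x)"
proof -
  obtain b0 where "supp t \<subseteq> {..<b0}" using finite_supp[of t] by (meson finite_nat_bounded)
  then have "act t (tail L x) = act t (window L b x)" if "b \<ge> b0" for b
    using that by (intro act_cong) (force simp: tail_def window_def)
  then show ?thesis by blast
qed

lemma tail_X0: "x \<in> X0 \<Longrightarrow> tail L x \<in> X0"
  and nm_tail: "x \<in> X0 \<Longrightarrow> nm (tail L x) \<le> nm x"
proof -
  assume x: "x \<in> X0"
  have *: "norm (act t (tail L x)) \<le> nm x" if t: "valid t" for t
  proof -
    obtain b where "act t (tail L x) = act t (window L b x)" using act_tail by blast
    then show ?thesis using act_le_nm[OF X0_window[OF x] t, of L b] nm_window[OF x, of L b] by simp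
  qed
  show "tail L x \<in> X0" using * by (rule X0_I)
  show "nm (tail L x) \<le> nm x" using * by (rule nm_le)
qed

lemma nn_ge_mm_sq: assumes "j \<ge> 1" shows "real (nn j) \<ge> real (mm j) * real (mm j)"
proof -
  have m: "real (mm j) \<ge> 1" using mm_ge[of j] by simp
  have "nn (j - 1) \<ge> 1" using nn_ge[of "j - 1"] by simp
  then have s: "1 \<le> real (split_bound (nn (j - 1)) (Suc ((mm j)\<^sup>2)))"
    using split_bound_ge[of "nn (j - 1)" "Suc ((mm j)\<^sup>2)"] by linarith
  have "(real (mm j) * real (mm j)) * (1 * 1) \<le> (real (mm j) * real (mm j)) * (real (mm j) * real (split_bound (nn (j - 1)) (Suc ((mm j)\<^sup>2))))"
    using m s by (intro mult_left_mono mult_mono) auto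
  then show ?thesis unfolding nn_decomp[OF assms] by (simp add: power3_eq_cube mult.assoc del: split_bound.simps)
qed

text \<open>If the tails stayed above e, the vector would contain infinitely many successive blocks
  of norm above e. A functional of even weight j takes at least nn j e / (5 mm j) on nn j of them,
  and nn j >= (mm j)^2 makes this unbounded.\<close>

lemma tail_tendsto_0:
  assumes x: "x \<in> X0" and e: "e > 0" shows "\<exists>L0. \<forall>L\<ge>L0. nm (tail L x) \<le> e"
proof (rule ccontr)
  assume "\<not> ?thesis"
  then have "\<exists>L\<ge>s. nm (tail L x) > e" for s by (auto simp: not_le)
  moreover have "nm (tail L x) \<le> nm (tail s x)" if "L \<ge> s" for L s
  proof -
    have "tail L x = tail L (tail s x)" using that by (auto simp: tail_def fun_eq_iff)
    then show ?thesis using nm_tail[OF tail_X0[OF x]] by metis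
  qed
  ultimately have big: "nm (tail s x) > e" for s by (meson less_le_trans)
  have "\<exists>b t. s \<le> b \<and> valid t \<and> norm (act t (window s b x)) > e" for s
  proof -
    obtain t where t: "valid t" "norm (act t (tail s x)) > e" using norming_tree[OF tail_X0[OF x] big] by blast
    obtain b0 where "\<forall>b\<ge>b0. act t (tail s x) = act t (window s b x)" using act_tail by blast
    then have "act t (tail s x) = act t (window s (max s b0) x)" by simp
    then show ?thesis using t by (intro exI[of _ "max s b0"] exI[of _ t]) simp
  qed
  then obtain B tt where B: "\<And>s. s \<le> B s" "\<And>s. valid (tt s)" "\<And>s. norm (act (tt s) (window s (B s) x)) > e" by metis
  define l where "l n = (B ^^ n) 0" for n
  define y where "y k = window (l k) (l (Suc k)) x" for k
  have lS: "l (Suc n) = B (l n)" and l0: "l 0 = 0" for n by (simp_all add: l_def)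
  have ml: "mono l" by (rule incseq_SucI) (simp add: lS B)
  have blocks: "blocks l y" using ml by (auto simp: blocks_def y_def window_def)
  have sum: "block_sum y 0 d = window 0 (l d) x" for d
  proof (induction d)
    case 0
    then show ?case by (auto simp: block_sum_def window_def l0)
  next
    case (Suc d)
    have "l d \<le> l (Suc d)" using ml by (simp add: mono_def)
    have "block_sum y 0 (Suc d) i = block_sum y 0 d i + y d i" for i by (simp add: block_sum_def)
    then show ?case using \<open>l d \<le> l (Suc d)\<close> unfolding Suc y_def by (auto simp: window_def fun_eq_iff)
  qed
  obtain n where n: "real n > 5 * nm x / e" using reals_Archimedean2 by blast
  define j where "j = 2 * (n + 1)"
  have j: "even j" "j \<ge> 1" by (auto simp: j_def)
  have m: "real (mm j) > 0" "real (mm j) > 5 * nm x / e" using mm_gt[of j] n by (auto simp: j_def)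
  obtain t where t: "valid t" "norm (act t (block_sum y 0 (0 + nn j))) \<ge> (\<Sum>k=0..<0+nn j. norm (act (tt (l k)) (y k))) / (5 * real (mm j))"
    using even_lower_estimate[OF blocks, of "\<lambda>k. tt (l k)" j "nn j" 0] B(2) j by auto
  have "real (nn j) * e = (\<Sum>k=0..<0+nn j. e)" by simp
  also have "\<dots> \<le> (\<Sum>k=0..<0+nn j. norm (act (tt (l k)) (y k)))"
    using B(3) by (intro sum_mono) (simp add: y_def lS less_imp_le)
  finally have "real (nn j) * e / (5 * real (mm j)) \<le> (\<Sum>k=0..<0+nn j. norm (act (tt (l k)) (y k))) / (5 * real (mm j))"
    by (intro divide_right_mono) auto
  also have "\<dots> \<le> nm (window 0 (l (nn j)) x)" using t act_le_nm[OF X0_window[OF x] t(1), of 0 "l (nn j)"] by (simp add: sum)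
  also have "\<dots> \<le> nm x" by (rule nm_window[OF x])
  finally have "real (nn j) * e \<le> 5 * real (mm j) * nm x" using m by (simp add: field_simps)
  moreover have "real (mm j) * real (mm j) * e \<le> real (nn j) * e" using nn_ge_mm_sq[OF j(2)] e by (intro mult_right_mono) auto
  ultimately have "real (mm j) * (real (mm j) * e) \<le> real (mm j) * (5 * nm x)" by (simp add: mult_ac)
  then have "real (mm j) * e \<le> 5 * nm x" using m(1) by (subst (asm) mult_le_cancel_left_pos) auto
  then show False using m e by (simp add: field_simps)
qed

lemma block_sequence:
  assumes ex: "\<And>s k. \<exists>x e. s \<le> e \<and> (\<forall>i. x i \<noteq> 0 \<longrightarrow> s \<le> i \<and> i < e) \<and> P k x"
  shows "\<exists>l x. blocks l (x :: nat \<Rightarrow> nat \<Rightarrow> 'k) \<and> l 0 = s \<and> (\<forall>k. P k (x k))"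
proof -
  obtain x b where xb: "\<And>s k. s \<le> b s k" "\<And>s k i. x s k i \<noteq> 0 \<Longrightarrow> s \<le> i \<and> i < b s k" "\<And>s k. P k (x s k)"
    using ex by metis
  define l where "l = rec_nat s (\<lambda>k m. b m k)"
  have l: "l 0 = s" "l (Suc k) = b (l k) k" for k by (simp_all add: l_def)
  have "mono l" by (rule incseq_SucI) (simp add: l xb)
  then have "blocks l (\<lambda>k. x (l k) k)" using xb(2) by (auto simp: blocks_def l)
  then show ?thesis using l xb(3) by blast
qed

lemma dual_block_sum:
  assumes f: "f \<in> carr (dual TS)" and y: "\<And>k. y k \<in> X0"
  shows "block_sum y a b \<in> X0" "f (block_sum y a b) = (\<Sum>k=a..<b. f (y k))"
proof -
  have e: "block_sum y a b = (\<Sum>k=a..<b. X.sc 1 (y k))" by (auto simp: block_sum_def fun_eq_iff sum_pointwise)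
  have in_C: "X.sc 1 (y k) \<in> X.C" for k using y by simp
  show "block_sum y a b \<in> X0" unfolding e using X.sum_in[OF in_C] by simp
  show "f (block_sum y a b) = (\<Sum>k=a..<b. f (y k))" unfolding e using X.dual_sum[OF f, of "{a..<b}" y "\<lambda>_. 1"] y by simp
qed

text \<open>Otherwise there are rapidly increasing sequences of vectors with \<open>f x = 1\<close>, whose averages have small norm.\<close>

lemma functional_vanishes_at_infinity:
  assumes f: "f \<in> carr (dual TS)" and e: "e > 0"
  shows "\<exists>L. \<forall>x\<in>X0. (\<forall>i<L. x i = 0) \<longrightarrow> norm (f x) \<le> e * nm x"
proof (rule ccontr)
  assume "\<not> ?thesis"
  then have neg: "\<exists>x\<in>X0. (\<forall>i<s. x i = 0) \<and> norm (f x) > e * nm x" for s by (auto simp: not_le)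
  obtain B0 where B0: "B0 \<ge> 0" "\<And>x. x \<in> X0 \<Longrightarrow> norm (f x) \<le> B0 * nm x" using X.dualD(4)[OF f] by auto
  define B where "B = B0 + 1"
  have B: "B > 0" "norm (f x) \<le> B * nm x" if "x \<in> X0" for x
    using B0 B0(2)[OF that] nm_nonneg[OF that] by (auto simp: B_def distrib_right)
  have Bpos: "B > 0" using B0 by (simp add: B_def)
  have y: "\<exists>y b. s \<le> b \<and> (\<forall>i. y i \<noteq> 0 \<longrightarrow> s \<le> i \<and> i < b) \<and> (f y = 1 \<and> nm y \<le> 1 / e \<and> y \<in> X0)" for s :: nat
  proof -
    obtain x where x: "x \<in> X0" "\<forall>i<s. x i = 0" "norm (f x) > e * nm x" using neg by blast
    \<comment> \<open>Cutting the tail at this size costs \<open>f\<close> at most half of its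
      excess over e nm x, so a finitely supported vector still violates the bound.\<close>
    define d where "d = (norm (f x) - e * nm x) / (2 * B)"
    have d: "d > 0" using x Bpos by (simp add: d_def)
    obtain b0 where b0: "\<And>L. L \<ge> b0 \<Longrightarrow> nm (tail L x) \<le> d" using tail_tendsto_0[OF x(1) d] by blast
    define b where "b = max b0 s"
    define z where "z = window 0 b x"
    have zX: "z \<in> X0" unfolding z_def by (rule X0_window[OF x(1)])
    have fz: "f (tail b x) = f x - f z" unfolding tail_eq z_def using X.dual_diff[OF f, of x "window 0 b x"] x(1) X0_window[OF x(1)] by simp
    have "norm (f (tail b x)) \<le> B * nm (tail b x)" by (rule B(2)[OF tail_X0[OF x(1)]])
    also have "\<dots> \<le> B * d" using b0[of b] Bpos by (intro mult_left_mono) (auto simp: b_def)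
    also have "\<dots> = (norm (f x) - e * nm x) / 2" using Bpos by (simp add: d_def)
    finally have "norm (f z) \<ge> norm (f x) - (norm (f x) - e * nm x) / 2"
      unfolding fz using norm_triangle_sub[of "f x" "f z"] by linarith
    then have "norm (f z) > e * nm x" using x(3) by (simp add: field_simps)
    moreover have "e * nm z \<le> e * nm x" unfolding z_def using e nm_window[OF x(1)] by (intro mult_left_mono) auto
    ultimately have fz2: "norm (f z) > e * nm z" by linarith
    then have fz0: "norm (f z) > 0" using e nm_nonneg[OF zX] by (meson le_less_trans mult_nonneg_nonneg less_imp_le)
    define y where "y = (\<lambda>i. (1 / f z) * z i)"
    have yX: "y \<in> X0" unfolding y_def by (rule X0_scale[OF zX])
    have "f y = 1" using X.dualD(2)[OF f, of z "1 / f z"] zX fz0 by (simp add: y_def)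
    moreover have "nm y \<le> 1 / e" unfolding y_def nm_scale[OF zX] using fz0 fz2 e by (simp add: norm_divide field_simps)
    moreover have "\<forall>i. y i \<noteq> 0 \<longrightarrow> s \<le> i \<and> i < b" using x(2) by (auto simp: y_def z_def window_def not_le[symmetric])
    ultimately show ?thesis using yX by (intro exI[of _ y] exI[of _ b]) (auto simp: b_def)
  qed
  \<comment> \<open>The condition f x = 1 survives averaging, so long averages of such vectors can
    feed a rapidly increasing sequence.\<close>
  have sup: "supplies (2 / e) {x. f x = 1 \<and> x \<in> X0}"
    unfolding supplies_def
  proof (intro allI)
    fix s N :: nat
    obtain l y where y: "blocks l y" "l 0 = s" "\<And>k. f (y k) = 1 \<and> nm (y k) \<le> 1 / e \<and> y k \<in> X0"
      using block_sequence[of "\<lambda>k y. f y = 1 \<and> nm y \<le> 1 / e \<and> y \<in> X0" s, OF y] by metis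
    define x where "x = (\<lambda>i. of_real (1 / real (Suc N)) * block_sum y 0 (0 + Suc N) i)"
    have bX: "block_sum y 0 (0 + Suc N) \<in> X0" "f (block_sum y 0 (0 + Suc N)) = of_nat (Suc N)" using dual_block_sum[OF f, of y 0 "0 + Suc N"] y(3) by auto
    have xX: "x \<in> X0" unfolding x_def by (rule X0_scale[OF bX(1)])
    have fx: "f x = 1"
    proof -
      have "f x = of_real (1 / real (Suc N)) * of_nat (Suc N)" using X.dualD(2)[OF f, of "block_sum y 0 (0 + Suc N)" "of_real (1 / real (Suc N))"] bX by (simp add: x_def)
      also have "\<dots> = of_real (1 / real (Suc N) * real (Suc N))" by (simp only: of_real_mult of_real_of_nat_eq)
      finally show ?thesis by simp
    qed
    have up: "norm (act t (y k)) \<le> 1 / e" if "valid t" for t k using act_le_nm[OF _ that, of "y k"] y(3)[of k] by simp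
    have e0: "0 \<le> 1 / e" using e by simp
    have est: "norm (act t x) \<le> 1 / e" "1 \<le> weight t \<Longrightarrow> nn (weight t) \<le> Suc N \<Longrightarrow> norm (act t x) \<le> 2 * (1 / e) / real (mm (weight t))" if "valid t" for t
      unfolding x_def using avg_estimate[OF y(1) up e0 _ that, of "Suc N" 0] by auto
    have ml: "mono l" using y(1) by (simp add: blocks_def)
    have "s \<le> l (Suc N)" using ml y(2) by (metis le0 monoD)
    moreover have "s \<le> i \<and> i < l (Suc N)" if "x i \<noteq> 0" for i
    proof -
      have "\<exists>k\<in>{0..<Suc N}. y k i \<noteq> 0" using that by (auto simp: x_def block_sum_def intro: ccontr)
      then obtain k where k: "k < Suc N" "y k i \<noteq> 0" by auto
      then have "l k \<le> i" "i < l (Suc k)" using y(1) by (auto simp: blocks_def)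
      then show ?thesis using monoD[OF ml, of 0 k] monoD[OF ml, of "Suc k" "Suc N"] k y(2) by auto
    qed
    moreover have "norm (act t x) \<le> 2 / e" if "valid t" for t using est(1)[OF that] e by (smt (verit) divide_right_mono)
    moreover have "norm (act t x) \<le> 2 / e / real (mm (weight t))" if "valid t" "1 \<le> weight t" "nn (weight t) \<le> N" for t
      using est(2)[OF that(1,2)] that(3) by simp
    ultimately show "\<exists>x ea. s \<le> ea \<and> x \<in> {x. f x = 1 \<and> x \<in> X0} \<and> (\<forall>i. x i \<noteq> 0 \<longrightarrow> s \<le> i \<and> i < ea) \<and> (\<forall>t. valid t \<longrightarrow> norm (act t x) \<le> 2 / e) \<and>
           (\<forall>t. valid t \<and> 1 \<le> weight t \<and> nn (weight t) \<le> N \<longrightarrow> norm (act t x) \<le> 2 / e / real (mm (weight t)))"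
      using xX fx by (intro exI[of _ x] exI[of _ "l (Suc N)"]) auto
  qed
  \<comment> \<open>On the sum of nn j terms \<open>f\<close> takes the value nn j, while the norm
    is at most (6 / e) nn j / mm j. This \<open>n\<close> makes mm j too large for the bound
    \<open>B\<close> of \<open>f\<close>.\<close>
  obtain n where n: "real n > B * (3 * (2 / e))" using reals_Archimedean2 by blast
  define j where "j = n + 1"
  have j: "j \<ge> 1" by (simp add: j_def)
  have C: "2 / e > 0" using e by simp
  obtain l x js where R: "blocks l x" "\<And>k. f (x k) = 1 \<and> x k \<in> X0" "strict_mono js" "j \<le> js 0"
    "\<And>t k. valid t \<Longrightarrow> norm (act t (x k)) \<le> 2 / e"
    "\<And>t k. valid t \<Longrightarrow> 1 \<le> weight t \<Longrightarrow> weight t \<le> js k \<Longrightarrow> norm (act t (x k)) \<le> 2 / e / real (mm (weight t))"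
    "\<And>t k. valid t \<Longrightarrow> weight t \<ge> js (Suc k) \<Longrightarrow> norm (act t (x k)) \<le> 2 / e / real (nn j)"
    using ris_exists[OF sup C j, of 0] by blast
  have fx: "block_sum x 0 (nn j) \<in> X0" "f (block_sum x 0 (nn j)) = of_nat (nn j)" using dual_block_sum[OF f, of x 0 "nn j"] R(2) by auto
  have "nm (block_sum x 0 (nn j)) \<le> 3 * (2 / e) * real (nn j) / real (mm j)"
    using ris_estimate(1)[OF R(1) less_imp_le[OF C] j R(4,3,5,6,7)] by (intro nm_le) auto
  then have "B * nm (block_sum x 0 (nn j)) \<le> B * (3 * (2 / e) * real (nn j) / real (mm j))" using Bpos by (intro mult_left_mono) auto
  then have "real (nn j) \<le> B * (3 * (2 / e) * real (nn j) / real (mm j))" using B(2)[OF fx(1)] fx(2) by simp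
  moreover have pos: "real (nn j) > 0" "real (mm j) > 0" using nn_ge[of j] mm_ge[of j] by linarith+
  ultimately have "real (nn j) * real (mm j) \<le> (B * (3 * (2 / e) * real (nn j) / real (mm j))) * real (mm j)" by (intro mult_right_mono) auto
  also have "\<dots> = real (nn j) * (B * (3 * (2 / e)))" using pos by simp
  finally have "real (nn j) * real (mm j) \<le> real (nn j) * (B * (3 * (2 / e)))" .
  then have "real (mm j) \<le> B * (3 * (2 / e))" using pos by (subst (asm) mult_le_cancel_left_pos) auto
  then show False using mm_gt[of j] n by (simp add: j_def)
qed

definition unit :: "nat \<Rightarrow> nat \<Rightarrow> 'k" where
  "unit i = (\<lambda>k. if k = i then 1 else 0)"

definition coord :: "nat \<Rightarrow> (nat \<Rightarrow> 'k) \<Rightarrow> 'k" where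
  "coord i x = (if x \<in> X0 then x i else 0)"

lemma unit_X0 [simp]: "unit i \<in> X0"
  by (rule fin_X0[of "Suc i"]) (auto simp: unit_def)

lemma coord_dual: "coord i \<in> carr (dual TS)"
  by (rule X.dualI[where B = 1]) (auto simp: coord_def coord_le_nm X0_scale X.add_in[simplified])

lemma window_expand: "window 0 L x = (\<Sum>i<L. (\<lambda>k. x i * unit i k))"
proof
  fix k
  have "(\<Sum>i<L. x i * unit i k) = (\<Sum>i<L. if k = i then x i else 0)" by (rule sum.cong) (auto simp: unit_def)
  then show "window 0 L x k = (\<Sum>i<L. (\<lambda>k. x i * unit i k)) k" by (simp add: sum_pointwise window_def)
qed

lemma act_expand: "act t z = (\<Sum>i\<in>supp t. act t (unit i) * z i)"
proof -
  have "act t z = act t (\<lambda>k. \<Sum>i\<in>supp t. z i * unit i k)"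
  proof (rule act_cong)
    fix k assume "k \<in> supp t"
    then have "(\<Sum>i\<in>supp t. if k = i then z i else 0) = z k" by (simp add: sum.delta)
    moreover have "(\<Sum>i\<in>supp t. z i * unit i k) = (\<Sum>i\<in>supp t. if k = i then z i else 0)" by (rule sum.cong) (auto simp: unit_def)
    ultimately show "z k = (\<Sum>i\<in>supp t. z i * unit i k)" by simp
  qed
  also have "\<dots> = (\<Sum>i\<in>supp t. act t (\<lambda>k. z i * unit i k))" by (rule act_sum) simp
  finally show ?thesis by (simp add: act_scale mult.commute)
qed

text \<open>The two halves of James's criterion. Tree functionals are finite combinations of
  coordinates of norm at most 1, so the values of \<Phi> at the coordinates form a vector of
  \<open>X0\<close>. Since functionals are small far out, finite combinations of coordinates are
  norm dense in the dual, which forces \<Phi> f = f x.\<close>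

lemma reflexive_TS: "reflexive TS"
proof (rule X.reflexiveI)
  interpret D: normed_ctx \<omega> "dual TS" by (rule X.dual_ctx)
  have scD: "D.sc = (\<lambda>c f x. c * f x)" by (simp add: dual_def)
  fix \<Phi> assume \<Phi>: "\<Phi> \<in> carr (dual (dual TS))"
  define B where "B = nrm (dual (dual TS)) \<Phi>"
  have B: "norm (\<Phi> f) \<le> B * D.N f" if "f \<in> D.C" for f unfolding B_def using D.dual_norm_le[OF \<Phi> that] .
  have B0: "B \<ge> 0" unfolding B_def using normed_space_nonneg[OF normed_space_dual[OF D.ns] \<Phi>] .
  define x where "x i = \<Phi> (coord i)" for i
  have \<Phi>sum: "\<Phi> (\<Sum>i\<in>A. D.sc (a i) (coord i)) = (\<Sum>i\<in>A. a i * x i)" if "finite A" for a A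
    unfolding x_def by (rule D.dual_sum[OF \<Phi> that coord_dual])
  have sum_in: "(\<Sum>i\<in>A. D.sc (a i) (coord i)) \<in> D.C" for a and A :: "nat set" by (intro D.sum_in D.sc_in coord_dual)
  have sum_val: "(\<Sum>i\<in>A. D.sc (a i) (coord i)) z = (\<Sum>i\<in>A. a i * z i)" if "z \<in> X0" for a A z
    using that by (simp add: scD sum_pointwise coord_def)
  have x: "x \<in> X0"
  proof (rule X0_I)
    fix t assume t: "valid t"
    let ?A = "\<Sum>i\<in>supp t. D.sc (act t (unit i)) (coord i)"
    have "norm (\<Phi> ?A) \<le> B * D.N ?A" by (rule B[OF sum_in])
    also have "\<dots> \<le> B * 1"
      using B0 act_le_nm[OF _ t] by (intro mult_left_mono X.dual_norm_least) (auto simp: sum_val act_expand[symmetric])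
    finally show "norm (act t x) \<le> B" by (simp add: \<Phi>sum act_expand[of t x])
  qed
  moreover have "\<Phi> f = f x" if f: "f \<in> D.C" for f
  proof -
    have le: "norm (\<Phi> f - f x) \<le> (B + nm x) * e" if e: "e > 0" for e
    proof -
      obtain L where L: "\<And>z. z \<in> X0 \<Longrightarrow> \<forall>i<L. z i = 0 \<Longrightarrow> norm (f z) \<le> e * nm z" using functional_vanishes_at_infinity[OF f e] by blast
      have Lt: "norm (f (tail L z)) \<le> e * nm z" if "z \<in> X0" for z
      proof -
        have "norm (f (tail L z)) \<le> e * nm (tail L z)" by (rule L[OF tail_X0[OF that]]) (simp add: tail_def)
        also have "\<dots> \<le> e * nm z" using e nm_tail[OF that] by (intro mult_left_mono) auto
        finally show ?thesis .
      qed
      have ftail: "f (tail L z) = f z - f (window 0 L z)" if "z \<in> X0" for z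
        unfolding tail_eq using X.dual_diff[OF f, of z "window 0 L z"] that X0_window[OF that] by simp
      let ?g = "\<Sum>i<L. D.sc (f (unit i)) (coord i)"
      have frs: "f (window 0 L z) = (\<Sum>i<L. f (unit i) * z i)" for z
        unfolding window_expand using X.dual_sum[OF f, of "{..<L}" unit z] by (simp add: mult.commute)
      have fg: "(f - ?g) z = f (tail L z)" if "z \<in> X0" for z
        using ftail[OF that] by (simp add: sum_val[OF that] frs)
      have "norm (\<Phi> (f - ?g)) \<le> B * D.N (f - ?g)" by (intro B D.diff_in f sum_in)
      also have "\<dots> \<le> B * e" using B0 e Lt by (intro mult_left_mono X.dual_norm_least) (auto simp: fg simp del: minus_apply)
      finally have 1: "norm (\<Phi> f - f (window 0 L x)) \<le> B * e" using D.dual_diff[OF \<Phi> f sum_in] by (simp add: \<Phi>sum frs)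
      have "\<Phi> f - f x = (\<Phi> f - f (window 0 L x)) - f (tail L x)" using ftail[OF x] by simp
      then have "norm (\<Phi> f - f x) \<le> norm (\<Phi> f - f (window 0 L x)) + norm (f (tail L x))" using norm_triangle_ineq4 by metis
      also have "\<dots> \<le> B * e + e * nm x" using 1 Lt[OF x] by simp
      finally show ?thesis by (simp add: algebra_simps)
    qed
    have S: "B + nm x + 1 > 0" using B0 nm_nonneg[OF x] by simp
    have "norm (\<Phi> f - f x) \<le> 0 + e" if e: "e > 0" for e
    proof -
      have "norm (\<Phi> f - f x) \<le> (B + nm x) * (e / (B + nm x + 1))" using e S by (intro le) auto
      also have "\<dots> \<le> (B + nm x + 1) * (e / (B + nm x + 1))" using e S by (intro mult_right_mono) auto
      finally show ?thesis using S by simp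
    qed
    then have "norm (\<Phi> f - f x) \<le> 0" by (rule field_le_epsilon)
    then show ?thesis by simp
  qed
  ultimately show "\<exists>x\<in>X.C. \<forall>f\<in>D.C. \<Phi> f = f x" by auto
qed

lemma banach_TS: "banach_space TS"
  using X.banach_of_reflexive[OF reflexive_TS] .

section \<open>Dimension and separability\<close>

lemma inj_unit: "inj unit"
  by (rule injI) (metis unit_def zero_neq_one)

lemma infinite_dimensional_TS: "\<not> finite_dimensional TS"
proof
  assume "finite_dimensional TS"
  then obtain B where B: "finite B" "B \<subseteq> X0" "X.V.span B = X0" by (auto simp: finite_dimensional_def)
  have "X.V.independent (range unit)"
  proof (rule ccontr)
    assume "\<not> ?thesis"
    then obtain A u v where A: "finite A" "A \<subseteq> range unit" "(\<Sum>v\<in>A. X.sc (u v) v) = 0" "v \<in> A" "u v \<noteq> 0"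
      unfolding X.V.dependent_explicit by blast
    obtain i where i: "v = unit i" using A by blast
    have "0 = (\<Sum>w\<in>A. u w * w i)" using fun_cong[OF A(3), of i] by (simp add: sum_pointwise)
    also have "\<dots> = (\<Sum>w\<in>A. if w = v then u w else 0)"
    proof (rule sum.cong[OF refl])
      fix w assume "w \<in> A"
      then obtain k where "w = unit k" using A by blast
      moreover from this have "w = v \<longleftrightarrow> k = i" using inj_unit i by (auto simp: inj_eq)
      ultimately show "u w * w i = (if w = v then u w else 0)" by (auto simp: unit_def)
    qed
    also have "\<dots> = u v" using A by (simp add: sum.delta)
    finally show False using A by simp
  qed
  moreover have "range unit \<subseteq> X.V.span B" using B by auto
  ultimately have "finite (range unit)" using X.V.independent_span_bound[OF B(1)] by blast
  then show False using finite_imageD[OF _ inj_unit] by simp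
qed

lemma nm_window_le_l1: "nm (window 0 L w) \<le> (\<Sum>i<L. norm (w i))"
proof (rule nm_le)
  fix t assume t: "valid t"
  have "norm (act t (window 0 L w)) \<le> (\<Sum>i\<in>{..<L} \<inter> supp t. norm (window 0 L w i))"
    by (rule norm_act_l1(1)[OF t]) (auto simp: window_def)
  also have "\<dots> \<le> (\<Sum>i<L. norm (window 0 L w i))" by (rule sum_mono2) auto
  also have "\<dots> = (\<Sum>i<L. norm (w i))" by (intro sum.cong) (auto simp: window_def)
  finally show "norm (act t (window 0 L w)) \<le> (\<Sum>i<L. norm (w i))" .
qed

text \<open>Finite lists over a countable dense subset of the field suffice: the tail of a vector is
  small, and on the head the norm is below the l1 norm.\<close>

lemma separable_TS: "separable_space (ntop TS)"
proof -
  interpret M: Metric_space X0 "ndist TS" using normed_space_Metric_space[OF normed_TS] by simp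
  obtain D :: "'k set" where D: "countable D" "\<And>U. open U \<Longrightarrow> U \<noteq> {} \<Longrightarrow> \<exists>d\<in>D. d \<in> U"
    using countable_dense_exists by metis
  define vec :: "'k list \<Rightarrow> nat \<Rightarrow> 'k" where "vec ds = (\<lambda>i. if i < length ds then ds ! i else 0)" for ds
  have vecX: "vec ds \<in> X0" for ds by (rule fin_X0[of "length ds"]) (simp add: vec_def)
  have near: "\<exists>ds\<in>lists D. nm (x - vec ds) < e" if x: "x \<in> X0" and e: "e > 0" for x e
  proof -
    obtain L where L: "nm (tail L x) \<le> e / 3" using tail_tendsto_0[OF x, of "e / 3"] e by auto
    have "\<exists>d\<in>D. norm (x i - d) < e / (3 * (real L + 1))" for i
    proof -
      have "e / (3 * (real L + 1)) > 0" using e by (intro divide_pos_pos) auto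
      then have "\<exists>d\<in>D. d \<in> ball (x i) (e / (3 * (real L + 1)))" by (intro D(2)) (auto simp del: zero_less_divide_iff)
      then show ?thesis by (simp add: dist_norm)
    qed
    then obtain d where d: "\<And>i. d i \<in> D" "\<And>i. norm (x i - d i) < e / (3 * (real L + 1))" by metis
    let ?v = "vec (map d [0..<L])"
    have vi: "?v i = (if i < L then d i else 0)" for i by (simp add: vec_def)
    have "nm (window 0 L (x - ?v)) \<le> (\<Sum>i<L. norm ((x - ?v) i))" by (rule nm_window_le_l1)
    also have "\<dots> \<le> (\<Sum>i<L. e / (3 * (real L + 1)))"
      using less_imp_le[OF d(2)] by (intro sum_mono) (auto simp: vi)
    also have "\<dots> \<le> e / 3" using e by (simp add: field_simps)
    finally have "nm (window 0 L (x - ?v)) \<le> e / 3" .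
    moreover have "x - ?v = window 0 L (x - ?v) + tail L x" by (auto simp: window_def tail_def vi)
    ultimately have "nm (x - ?v) \<le> e / 3 + e / 3"
      using X.N_tri[of "window 0 L (x - ?v)" "tail L x"] L x vecX X.diff_in[of x ?v] X0_window tail_X0 by simp
    then show ?thesis using d(1) e by (intro bexI[of _ "map d [0..<L]"]) auto
  qed
  have cl: "M.mtopology closure_of (vec ` lists D) = X0"
  proof
    show "M.mtopology closure_of (vec ` lists D) \<subseteq> X0" using closure_of_subset_topspace[of M.mtopology] by simp
    show "X0 \<subseteq> M.mtopology closure_of (vec ` lists D)"
    proof
      fix x assume x: "x \<in> X0"
      have "\<exists>y\<in>vec ` lists D. y \<in> M.mball x r" if r: "r > 0" for r
      proof -
        obtain ds where "ds \<in> lists D" "nm (x - vec ds) < r" using near[OF x r] by blast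
        then show ?thesis using x vecX by (auto simp: ndist_def)
      qed
      then show "x \<in> M.mtopology closure_of (vec ` lists D)" using x by (auto simp: M.metric_closure_of)
    qed
  qed
  have "countable (vec ` lists D)" using D(1) by simp
  moreover have "vec ` lists D \<subseteq> topspace M.mtopology" using vecX by auto
  ultimately show ?thesis unfolding separable_space_def ntop_def TS_simps using cl by auto
qed

end

section \<open>Operators on the space\<close>

lemma bounded_coordinates_subsequence:
  fixes u :: "nat \<Rightarrow> nat \<Rightarrow> 'k::euclidean_space"
  assumes B: "\<And>n i. norm (u n i) \<le> B"
  shows "\<exists>r v. strict_mono (r :: nat \<Rightarrow> nat) \<and> (\<forall>i<L. (\<lambda>n. u (r n) i) \<longlonglongrightarrow> v i)"
proof (induction L)
  case 0
  then show ?case by (auto intro: exI[of _ id] simp: strict_mono_id)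
next
  case (Suc L)
  then obtain r v where r: "strict_mono r" "\<And>i. i < L \<Longrightarrow> (\<lambda>n. u (r n) i) \<longlonglongrightarrow> v i" by blast
  have "bounded (range (\<lambda>n. u (r n) L))" using B by (auto intro: boundedI)
  then obtain l r' where r': "strict_mono r'" "((\<lambda>n. u (r n) L) \<circ> r') \<longlonglongrightarrow> l"
    using bounded_imp_convergent_subsequence by blast
  have "(\<lambda>n. u ((r \<circ> r') n) i) \<longlonglongrightarrow> (if i < L then v i else l)" if "i < Suc L" for i
  proof (cases "i < L")
    case True
    then show ?thesis using LIMSEQ_subseq_LIMSEQ[OF r(2) r'(1)] by (simp add: o_def)
  next
    case False
    then have "i = L" using that by simp
    then show ?thesis using r'(2) by (simp add: o_def)
  qed
  then show ?case using strict_mono_o[OF r(1) r'(1)] by (intro exI[of _ "r \<circ> r'"] exI[of _ "\<lambda>i. if i < L then v i else l"]) blast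
qed

context power_bounded_op
begin

lemma qop_sum_norm:
  fixes y :: "nat \<Rightarrow> 'a"
  assumes "\<And>k. y k \<in> C"
  shows "N (qop c (\<Sum>k<n. sc (a k) (y k))) \<le> (\<Sum>k<n. norm (a k) * N (qop c (y k)))"
proof (induction n)
  case (Suc n)
  have "(\<Sum>k<n. sc (a k) (y k)) \<in> C" using assms by (intro sum_in) auto
  then show ?case using Suc assms[of n] N_tri[of "qop c (\<Sum>k<n. sc (a k) (y k))" "sc (a n) (qop c (y n))"]
    by (simp add: qop_add qop_sc N_sc)
qed simp

end

section \<open>Lower bounds far out and the exceptional parameter\<close>

context tree_space
begin

lemma window_plus_tail: "window 0 L w + tail L w = w"
  by (auto simp: window_def tail_def)

definition bounded_below_far :: "((nat \<Rightarrow> 'k) \<Rightarrow> nat \<Rightarrow> 'k) \<Rightarrow> bool" where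
  "bounded_below_far V \<longleftrightarrow> (\<exists>L \<delta>. \<delta> > 0 \<and> (\<forall>w\<in>X0. (\<forall>i<L. w i = 0) \<longrightarrow> \<delta> * nm w \<le> nm (V w)))"

text \<open>A lower bound on a tail leaves finitely many coordinates uncontrolled. A normalised
  sequence in the closed range with V u tending to 0 has a subsequence converging in these
  coordinates; it is then Cauchy, and its limit would be a unit vector of the closed range killed by
  V, which \<open>qop_kernel_qrange\<close> excludes. So V is bounded below on the whole closed
  range.\<close>

lemma regular_at_TS:
  assumes P: "power_bounded_op \<omega> TS S K" and c: "\<bar>c\<bar> < 1"
    and far: "bounded_below_far (power_bounded_op.qop TS S c)"
  shows "X.regular_at S c"
proof -
  interpret P: power_bounded_op \<omega> TS S K by (rule P)
  let ?V = "P.qop c"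
  obtain L \<delta> where \<delta>: "\<delta> > 0" "\<And>w. w \<in> X0 \<Longrightarrow> \<forall>i<L. w i = 0 \<Longrightarrow> \<delta> * nm w \<le> nm (?V w)"
    using far unfolding bounded_below_far_def by blast
  define D where "D = K + 2 * \<bar>c\<bar> * K + 1"
  have D: "D > 0" "nm (?V x) \<le> D * nm x" if "x \<in> X0" for x
    using P.K1 P.qop_norm[of x c] that by (auto simp: D_def add_nonneg_pos)
  have D0: "D > 0" using P.K1 by (simp add: D_def add_nonneg_pos)
  have Vin: "?V x \<in> X0" if "x \<in> X0" for x using P.qop_in[of x c] that by simp
  define A where "A = 1 + D / \<delta>"
  have A: "A > 0" using D0 \<delta> by (simp add: A_def add_pos_pos)
  \<comment> \<open>The first L coordinates and V w together control the norm of w, by splitting w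
    into head and tail.\<close>
  have head: "nm w \<le> A * (\<Sum>i<L. norm (w i)) + nm (?V w) / \<delta>" if w: "w \<in> X0" for w
  proof -
    let ?h = "\<Sum>i<L. norm (w i)"
    have in0: "window 0 L w \<in> X0" "tail L w \<in> X0" using X0_window[OF w] tail_X0[OF w] by auto
    have "\<delta> * nm (tail L w) \<le> nm (?V (tail L w))" by (rule \<delta>(2)[OF in0(2)]) (simp add: tail_def)
    also have "?V (tail L w) = ?V w - ?V (window 0 L w)" unfolding tail_eq using P.qop_diff[of w "window 0 L w" c] w in0 by simp
    also have "nm \<dots> \<le> nm (?V w) + nm (?V (window 0 L w))" using X.N_tri_minus[of "?V w" "?V (window 0 L w)"] Vin w in0 by simp
    also have "\<dots> \<le> nm (?V w) + D * ?h" using D(2)[OF in0(1)] mult_left_mono[OF nm_window_le_l1[of L w], of D] D0 by linarith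
    finally have "nm (tail L w) \<le> (nm (?V w) + D * ?h) / \<delta>" using \<delta>(1) by (simp add: field_simps)
    moreover have "nm w \<le> nm (window 0 L w) + nm (tail L w)" using X.N_tri[of "window 0 L w" "tail L w"] in0 by (simp add: window_plus_tail)
    ultimately have "nm w \<le> ?h + (nm (?V w) + D * ?h) / \<delta>" using nm_window_le_l1[of L w] by linarith
    then show ?thesis by (simp add: A_def algebra_simps add_divide_distrib)
  qed
  have "\<exists>d>0. \<forall>z\<in>P.qrange c. d * nm z \<le> nm (?V z)"
  proof (rule ccontr)
    assume "\<not> ?thesis"
    then have bad: "\<exists>z\<in>P.qrange c. nm (?V z) < d * nm z" if "d > 0" for d using that by (auto simp: not_le)
    have "\<exists>u\<in>P.qrange c. nm u = 1 \<and> nm (?V u) < 1 / real (Suc n)" for n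
    proof -
      obtain z where z: "z \<in> P.qrange c" "nm (?V z) < 1 / real (Suc n) * nm z" using bad[of "1 / real (Suc n)"] by auto
      have zX: "z \<in> X0" using P.qrange_in[OF z(1)] by simp
      have pos: "nm z > 0" using zero_less_mult_pos[OF le_less_trans[OF nm_nonneg[OF Vin[OF zX]] z(2)]] by simp
      let ?u = "\<lambda>i. of_real (1 / nm z) * z i"
      have "?u \<in> P.qrange c" using P.qrange_sc[OF z(1), of "of_real (1 / nm z)"] by simp
      moreover have "nm ?u = 1" unfolding nm_scale[OF zX] using pos by (simp add: norm_divide)
      moreover have "nm (?V ?u) < 1 / real (Suc n)"
      proof -
        have "?V ?u = (\<lambda>i. of_real (1 / nm z) * ?V z i)" using P.qop_sc[of z c "of_real (1 / nm z)"] zX by simp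
        then have "nm (?V ?u) = norm (of_real (1 / nm z) :: 'k) * nm (?V z)" using nm_scale[OF Vin[OF zX]] by (simp only:)
        also have "\<dots> = 1 / nm z * nm (?V z)" using pos by (simp add: norm_divide)
        also have "\<dots> < 1 / nm z * (1 / real (Suc n) * nm z)" using z(2) pos by (intro mult_strict_left_mono) auto
        finally show ?thesis using pos by simp
      qed
      ultimately show ?thesis by blast
    qed
    then obtain u where u: "\<And>n. u n \<in> P.qrange c" "\<And>n. nm (u n) = 1" "\<And>n. nm (?V (u n)) < 1 / real (Suc n)" by metis
    have uX: "u n \<in> X0" for n using P.qrange_in[OF u(1)] by simp
    have "norm (u n i) \<le> 1" for n i using coord_le_nm[OF uX, of n i] u(2) by simp
    then obtain r v where r: "strict_mono (r :: nat \<Rightarrow> nat)" "\<forall>i<L. (\<lambda>n. u (r n) i) \<longlonglongrightarrow> v i"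
      using bounded_coordinates_subsequence[of u 1 L] by blast
    define h where "h n = (\<Sum>i<L. norm (u (r n) i - v i))" for n
    have "h \<longlonglongrightarrow> (\<Sum>i<L. 0)" unfolding h_def using r(2) by (intro tendsto_sum) (auto simp: tendsto_norm_zero_iff Lim_null[symmetric])
    then have h: "h \<longlonglongrightarrow> 0" by simp
    have inv: "(\<lambda>n. 1 / real (Suc n)) \<longlonglongrightarrow> 0" by (rule LIMSEQ_Suc[OF lim_1_over_n])
    have Vr: "nm (?V (u (r n))) \<le> 1 / real (Suc n)" for n
    proof -
      have "1 / real (Suc (r n)) \<le> 1 / real (Suc n)" using seq_suble[OF r(1), of n] by (intro divide_left_mono) auto
      then show ?thesis using u(3)[of "r n"] by linarith
    qed
    have "\<exists>l\<in>X.C. (\<lambda>n. X.N (u (r n) - l)) \<longlonglongrightarrow> 0"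
    proof (rule X.convergent_of_Cauchy[OF banach_TS])
      show "u (r n) \<in> X.C" for n using uX by simp
      fix e :: real assume e: "e > 0"
      have "(\<lambda>n. A * h n + 1 / real (Suc n) / \<delta>) \<longlonglongrightarrow> A * 0 + 0 / \<delta>" using \<delta>(1) by (intro tendsto_intros h inv) auto
      then have "\<forall>\<^sub>F n in sequentially. A * h n + 1 / real (Suc n) / \<delta> < e / 2" using e by (intro order_tendstoD) auto
      then obtain M where M: "\<And>n. n \<ge> M \<Longrightarrow> A * h n + 1 / real (Suc n) / \<delta> < e / 2" by (auto simp: eventually_sequentially)
      have "nm (u (r m) - u (r n)) < e" if mn: "m \<ge> M" "n \<ge> M" for m n
      proof -
        let ?w = "u (r m) - u (r n)"
        have w: "?w \<in> X0" using X.diff_in[of "u (r m)" "u (r n)"] uX by simp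
        have "(\<Sum>i<L. norm (?w i)) \<le> (\<Sum>i<L. norm (u (r m) i - v i) + norm (u (r n) i - v i))"
          using norm_triangle_ineq4[of "u (r m) i - v i" "u (r n) i - v i" for i] by (intro sum_mono) simp
        then have "(\<Sum>i<L. norm (?w i)) \<le> h m + h n" by (simp add: h_def sum.distrib)
        then have "A * (\<Sum>i<L. norm (?w i)) \<le> A * h m + A * h n" using A by (metis distrib_left less_imp_le mult_left_mono)
        moreover have "nm (?V ?w) \<le> nm (?V (u (r m))) + nm (?V (u (r n)))"
          using X.N_tri_minus[of "?V (u (r m))" "?V (u (r n))"] P.qop_diff[of "u (r m)" "u (r n)" c] uX Vin by simp
        then have "nm (?V ?w) / \<delta> \<le> (1 / real (Suc m) + 1 / real (Suc n)) / \<delta>"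
          using Vr[of m] Vr[of n] \<delta>(1) by (intro divide_right_mono) auto
        ultimately show ?thesis using head[OF w] M[OF mn(1)] M[OF mn(2)] by (simp only: add_divide_distrib)
      qed
      then show "\<exists>M. \<forall>m\<ge>M. \<forall>n\<ge>M. X.N (u (r m) - u (r n)) < e" by (simp only: TS_simps) blast
    qed
    then obtain l where l: "l \<in> X0" "(\<lambda>n. nm (u (r n) - l)) \<longlonglongrightarrow> 0" by auto
    have lR: "l \<in> P.qrange c"
    proof (rule P.qrange_closed)
      fix e :: real assume "e > 0"
      then have "\<forall>\<^sub>F n in sequentially. nm (u (r n) - l) < e" using l(2) by (intro order_tendstoD) auto
      then obtain n where "nm (u (r n) - l) < e" by (auto simp: eventually_sequentially)
      then show "\<exists>y\<in>P.qrange c. X.N (l - y) < e" using X.N_comm[of l "u (r n)"] l(1) uX u(1) by (intro bexI[of _ "u (r n)"]) auto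
    qed (use l in simp)
    have "nm (?V l) \<le> 0"
    proof (rule tendsto_lowerbound[of _ _ sequentially])
      show "(\<lambda>n. D * nm (u (r n) - l) + 1 / real (Suc n)) \<longlonglongrightarrow> 0"
        using tendsto_add[OF tendsto_mult_right_zero[OF l(2), of D] inv] by simp
      have "nm (?V l) \<le> D * nm (u (r n) - l) + 1 / real (Suc n)" for n
      proof -
        have dX: "u (r n) - l \<in> X0" using X.diff_in[of "u (r n)" l] uX l by simp
        have "?V l = ?V (u (r n)) - ?V (u (r n) - l)" using P.qop_diff[of "u (r n)" l c] uX l by simp
        then have "nm (?V l) \<le> nm (?V (u (r n))) + nm (?V (u (r n) - l))" using X.N_tri_minus[of "?V (u (r n))" "?V (u (r n) - l)"] Vin uX dX by simp
        then show ?thesis using Vr[of n] D(2)[OF dX] by linarith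
      qed
      then show "\<forall>\<^sub>F n in sequentially. nm (?V l) \<le> D * nm (u (r n) - l) + 1 / real (Suc n)" by simp
    qed simp
    then have "?V l = 0" using nm_eq_0[OF Vin[OF l(1)]] nm_nonneg[OF Vin[OF l(1)]] by (simp add: zero_fun_def)
    then have "l = 0" by (rule P.qop_kernel_qrange[OF c lR])
    then have "(\<lambda>n. 1) \<longlonglongrightarrow> (0::real)" using l(2) u(2) by simp
    then show False by (simp add: LIMSEQ_const_iff)
  qed
  then obtain d where "d > 0" "\<And>z. z \<in> P.qrange c \<Longrightarrow> d * X.N z \<le> X.N (?V z)" by auto
  then show ?thesis by (rule P.regular_of_bounded_below[OF reflexive_TS banach_TS c])
qed

text \<open>The subspace is spanned by successive normalised vectors with V-values at most \<eta> /
  2^(k+1). Windows do not increase the norm, so each coefficient of a combination is at most the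
  norm of the combination, and the geometric series gives \<eta>.\<close>

lemma small_block_subspace:
  assumes P: "power_bounded_op \<omega> TS S K" and bad: "\<not> bounded_below_far (power_bounded_op.qop TS S c)" and \<eta>: "\<eta> > 0"
  shows "\<exists>W. lin_closed W \<and> (\<forall>s. \<exists>y\<in>W. \<exists>e. (\<forall>i. y i \<noteq> 0 \<longrightarrow> s \<le> i \<and> i < e) \<and> y \<noteq> (\<lambda>i. 0))
    \<and> (\<forall>y\<in>W. nm (power_bounded_op.qop TS S c y) \<le> \<eta> * nm y)"
proof -
  interpret P: power_bounded_op \<omega> TS S K by (rule P)
  let ?V = "P.qop c"
  define D where "D = K + 2 * \<bar>c\<bar> * K + 1"
  have D: "nm (?V x) \<le> D * nm x" if "x \<in> X0" for x using P.qop_norm[of x c] that by (simp add: D_def)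
  have D0: "D > 0" using P.K1 by (simp add: D_def add_nonneg_pos)
  have Vin: "?V x \<in> X0" if "x \<in> X0" for x using P.qop_in[of x c] that by simp
  have ex: "\<exists>y b. s \<le> b \<and> (\<forall>i. y i \<noteq> 0 \<longrightarrow> s \<le> i \<and> i < b) \<and> (y \<in> X0 \<and> nm y = 1 \<and> nm (?V y) \<le> \<eta> / 2 ^ Suc k)" for s k :: nat
  proof -
    define d where "d = \<eta> / 2 ^ Suc k"
    have d: "d > 0" using \<eta> by (simp add: d_def)
    have "\<exists>w\<in>X0. (\<forall>i<s. w i = 0) \<and> nm (?V w) < \<delta> * nm w" if "\<delta> > 0" for \<delta>
      using bad that by (auto simp: bounded_below_far_def not_le)
    then obtain w where w: "w \<in> X0" "\<forall>i<s. w i = 0" "nm (?V w) < d / 2 * nm w"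
      using d half_gt_zero by metis
    have wpos: "nm w > 0" using w(3) nm_nonneg[OF Vin[OF w(1)]] d by (meson le_less_trans zero_less_mult_pos half_gt_zero)
    \<comment> \<open>Cutting the tail must neither shrink the vector much nor spoil the smallness
      of V; the choice (D + d) \<tau> = d/2 balances the two losses.\<close>
    define \<tau> where "\<tau> = d / (2 * (D + d))"
    have \<tau>: "\<tau> > 0" "\<tau> < 1" "(D + d) * \<tau> = d / 2" using d D0 by (auto simp: \<tau>_def field_simps)
    obtain b0 where b0: "\<And>L. L \<ge> b0 \<Longrightarrow> nm (tail L w) \<le> \<tau> * nm w" using tail_tendsto_0[OF w(1), of "\<tau> * nm w"] \<tau> wpos by auto
    define b where "b = max b0 s"
    have tb: "nm (tail b w) \<le> \<tau> * nm w" by (rule b0) (simp add: b_def)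
    define y0 where "y0 = window 0 b w"
    have y0X: "y0 \<in> X0" unfolding y0_def by (rule X0_window[OF w(1)])
    have tX: "tail b w \<in> X0" by (rule tail_X0[OF w(1)])
    have "nm w \<le> nm y0 + nm (tail b w)" using X.N_tri[of y0 "tail b w"] y0X tX by (simp add: y0_def window_plus_tail)
    then have ny0: "(1 - \<tau>) * nm w \<le> nm y0" using tb by (simp add: algebra_simps)
    then have y0pos: "nm y0 > 0" using \<tau> wpos by (meson diff_gt_0_iff_gt less_le_trans mult_pos_pos)
    have "?V y0 = ?V w - ?V (tail b w)" using P.qop_add[of y0 "tail b w" c] y0X tX by (simp add: y0_def window_plus_tail)
    then have "nm (?V y0) \<le> nm (?V w) + nm (?V (tail b w))" using X.N_tri_minus[of "?V w" "?V (tail b w)"] Vin w(1) tX by simp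
    also have "\<dots> \<le> d / 2 * nm w + D * (\<tau> * nm w)" using w(3) D[OF tX] mult_left_mono[OF tb, of D] D0 by linarith
    also have "\<dots> = (d / 2 + D * \<tau>) * nm w" by (simp add: algebra_simps)
    also have "d / 2 + D * \<tau> = d * (1 - \<tau>)" using \<tau>(3) by (simp add: algebra_simps)
    also have "d * (1 - \<tau>) * nm w \<le> d * nm y0" using ny0 d by (simp add: mult.assoc)
    finally have Vy0: "nm (?V y0) \<le> d * nm y0" .
    define y where "y = (\<lambda>i. of_real (1 / nm y0) * y0 i)"
    have "?V y = (\<lambda>i. of_real (1 / nm y0) * ?V y0 i)" using P.qop_sc[of y0 c "of_real (1 / nm y0)"] y0X by (simp add: y_def)
    then have "nm (?V y) = norm (of_real (1 / nm y0) :: 'k) * nm (?V y0)" using nm_scale[OF Vin[OF y0X]] by (simp only:)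
    also have "\<dots> = 1 / nm y0 * nm (?V y0)" using y0pos by (simp add: norm_divide)
    also have "\<dots> \<le> 1 / nm y0 * (d * nm y0)" using Vy0 y0pos by (intro mult_left_mono) auto
    also have "\<dots> = d" using y0pos by simp
    finally have "nm (?V y) \<le> \<eta> / 2 ^ Suc k" by (simp add: d_def)
    moreover have "nm y = 1" unfolding y_def nm_scale[OF y0X] using y0pos by (simp add: norm_divide)
    moreover have "y \<in> X0" unfolding y_def by (rule X0_scale[OF y0X])
    moreover have "\<forall>i. y i \<noteq> 0 \<longrightarrow> s \<le> i \<and> i < b" using w(2) by (auto simp: y_def y0_def window_def not_le[symmetric])
    ultimately show ?thesis by (intro exI[of _ y] exI[of _ b]) (auto simp: b_def)
  qed
  obtain l y where y: "blocks l y" "\<And>k. y k \<in> X0 \<and> nm (y k) = 1 \<and> nm (?V (y k)) \<le> \<eta> / 2 ^ Suc k"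
    using block_sequence[of "\<lambda>k y. y \<in> X0 \<and> nm y = 1 \<and> nm (?V y) \<le> \<eta> / 2 ^ Suc k", OF ex] by metis
  have ml: "mono l" and supp: "\<And>k i. y k i \<noteq> 0 \<Longrightarrow> l k \<le> i \<and> i < l (Suc k)" using y(1) by (auto simp: blocks_def)
  define comb where "comb a n = (\<Sum>k<n. (\<lambda>i. a k * y k i))" for a n
  define W where "W = {comb a n |a n. \<forall>k\<ge>n. a k = 0}"
  have comb_ext: "comb a n = comb a n'" if "\<forall>k\<ge>n. a k = 0" "n \<le> n'" for a n n'
    unfolding comb_def using that by (intro sum.mono_neutral_left) (auto simp: zero_fun_def)
  have comb_at: "comb a n i = (\<Sum>k<n. a k * y k i)" for a n i by (simp add: comb_def sum_pointwise)
  have W: "lin_closed W"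
    unfolding lin_closed_def
  proof (intro conjI ballI allI)
    show "(\<lambda>i. 0) \<in> W" unfolding W_def by (intro CollectI exI[of _ "\<lambda>_. 0"] exI[of _ 0]) (auto simp: comb_def zero_fun_def)
    show "(\<lambda>i. x i + z i) \<in> W" if xz: "x \<in> W" "z \<in> W" for x z
    proof -
      obtain a n where a: "x = comb a n" "\<forall>k\<ge>n. a k = 0" using xz by (auto simp: W_def)
      obtain b n' where b: "z = comb b n'" "\<forall>k\<ge>n'. b k = 0" using xz by (auto simp: W_def)
      have "x = comb a (max n n')" "z = comb b (max n n')" using comb_ext[OF a(2)] comb_ext[OF b(2)] a(1) b(1) by auto
      then have "(\<lambda>i. x i + z i) = comb (\<lambda>k. a k + b k) (max n n')" by (auto simp: comb_at distrib_right sum.distrib)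
      then show ?thesis using a(2) b(2) unfolding W_def by (intro CollectI exI[of _ "\<lambda>k. a k + b k"] exI[of _ "max n n'"]) auto
    qed
    show "(\<lambda>i. c * x i) \<in> W" if x: "x \<in> W" for c x
    proof -
      obtain a n where a: "x = comb a n" "\<forall>k\<ge>n. a k = 0" using x by (auto simp: W_def)
      then have "(\<lambda>i. c * x i) = comb (\<lambda>k. c * a k) n" by (auto simp: comb_at sum_distrib_left mult.assoc)
      then show ?thesis using a(2) unfolding W_def by (intro CollectI exI[of _ "\<lambda>k. c * a k"] exI[of _ n]) auto
    qed
  qed
  have far: "\<exists>x\<in>W. \<exists>e. (\<forall>i. x i \<noteq> 0 \<longrightarrow> s \<le> i \<and> i < e) \<and> x \<noteq> (\<lambda>i. 0)" for s
  proof -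
    have y0: "y k \<noteq> (\<lambda>i. 0)" for k using y(2)[of k] nm_eq_0[of "y k"] by auto
    have "l k < l (Suc k)" for k
    proof -
      obtain i where "y k i \<noteq> 0" using y0[of k] by auto
      then show ?thesis using supp[of k i] by linarith
    qed
    then have "strict_mono l" by (rule strict_monoI_Suc)
    then have "s \<le> l s" by (rule seq_suble)
    moreover have "y s = comb (\<lambda>k. if k = s then 1 else 0) (Suc s)"
    proof
      fix i
      have "comb (\<lambda>k. if k = s then 1 else 0) (Suc s) i = (\<Sum>k<Suc s. if k = s then y k i else 0)"
        unfolding comb_at by (rule sum.cong) auto
      then show "y s i = comb (\<lambda>k. if k = s then 1 else 0) (Suc s) i" by (simp add: sum.delta)
    qed
    then have "y s \<in> W" unfolding W_def by (intro CollectI exI[of _ "\<lambda>k. if k = s then 1 else 0"] exI[of _ "Suc s"]) auto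
    ultimately show ?thesis using y0[of s] supp[of s] by (intro bexI[of _ "y s"] exI[of _ "l (Suc s)"]) (auto intro: order_trans)
  qed
  have "nm (?V x) \<le> \<eta> * nm x" if "x \<in> W" for x
  proof -
    obtain a n where a: "x = comb a n" using \<open>x \<in> W\<close> by (auto simp: W_def)
    have xX: "x \<in> X0" using X.sum_in[of "{..<n}" "\<lambda>k i. a k * y k i"] y(2) by (simp add: a comb_def X0_scale)
    have ak: "norm (a k) \<le> nm x" if k: "k < n" for k
    proof -
      have "window (l k) (l (Suc k)) x = (\<lambda>i. a k * y k i)"
      proof
        fix i
        show "window (l k) (l (Suc k)) x i = a k * y k i"
        proof (cases "l k \<le> i \<and> i < l (Suc k)")
          case True
          have term_eq: "a m * y m i = (if m = k then a k * y k i else 0)" for m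
          proof (cases "m = k")
            case False
            have "y m i = 0"
            proof (rule ccontr)
              assume "y m i \<noteq> 0"
              then have m: "l m \<le> i" "i < l (Suc m)" using supp by auto
              show False
              proof (cases "m < k")
                case True
                then have "l (Suc m) \<le> l k" using ml by (simp add: mono_def)
                then show False using m \<open>l k \<le> i \<and> i < l (Suc k)\<close> by linarith
              next
                case False
                then have "l (Suc k) \<le> l m" using \<open>m \<noteq> k\<close> ml by (simp add: mono_def)
                then show False using m \<open>l k \<le> i \<and> i < l (Suc k)\<close> by linarith
              qed
            qed
            then show ?thesis using False by simp
          qed simp
          have "x i = (\<Sum>m<n. if m = k then a k * y k i else 0)" unfolding a comb_at by (rule sum.cong[OF refl term_eq])
          then show ?thesis using True k by (simp add: window_def sum.delta)
        next
          case False
          then show ?thesis using supp[of k i] by (auto simp: window_def)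
        qed
      qed
      then have "nm (\<lambda>i. a k * y k i) \<le> nm x" using nm_window[OF xX] by metis
      then show ?thesis using nm_scale[of "y k" "a k"] y(2)[of k] by simp
    qed
    have "nm (?V x) \<le> (\<Sum>k<n. norm (a k) * nm (?V (y k)))" using P.qop_sum_norm[of y c a n] y(2) by (simp add: a comb_def)
    also have "\<dots> \<le> (\<Sum>k<n. nm x * (\<eta> / 2 ^ Suc k))"
      using ak y(2) nm_nonneg[OF xX] Vin by (intro sum_mono mult_mono) (auto intro: nm_nonneg)
    also have "\<dots> = nm x * \<eta> * (\<Sum>k<n. (1/2) ^ Suc k)" by (simp add: sum_distrib_left power_divide mult.assoc)
    also have "(\<Sum>k<n. (1/2) ^ Suc k) = 1 - (1/2::real) ^ n" by (induction n) auto
    also have "nm x * \<eta> * (1 - (1/2) ^ n) \<le> nm x * \<eta> * 1" using \<eta> nm_nonneg[OF xX] by (intro mult_left_mono) auto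
    finally show ?thesis by (simp add: mult.commute)
  qed
  then show ?thesis using W far by blast
qed

lemma bounded_below_far_unless_one:
  assumes P: "power_bounded_op \<omega> TS S K" and cc: "c \<noteq> c'"
    and bad: "\<not> bounded_below_far (power_bounded_op.qop TS S c)"
  shows "bounded_below_far (power_bounded_op.qop TS S c')"
proof (rule ccontr)
  assume bad': "\<not> bounded_below_far (power_bounded_op.qop TS S c')"
  interpret P: power_bounded_op \<omega> TS S K by (rule P)
  define D where "D = K + 2 * \<bar>c\<bar> * K + 1"
  have D: "nm (P.qop c x) \<le> D * nm x" if "x \<in> X0" for x using P.qop_norm[of x c] that by (simp add: D_def)
  have D0: "D > 0" using P.K1 by (simp add: D_def add_nonneg_pos)
  define g where "g = \<bar>2 * (c - c')\<bar>"
  have g: "g > 0" using cc by (simp add: g_def)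
  \<comment> \<open>Collects the constants in the bound nm z <= E \<epsilon> s obtained below. It
    leads to s <= (2 E + 1) \<epsilon> s, which \<epsilon> = 1 / (2 E + 2) excludes.\<close>
  define E where "E = (1 + D) + (K + 2 * \<bar>c\<bar>) * ((2 + D) / g)"
  have E: "E > 0" using D0 g P.K1 by (simp add: E_def add_pos_nonneg)
  define \<epsilon> where "\<epsilon> = 1 / (2 * E + 2)"
  have \<epsilon>: "\<epsilon> > 0" "\<epsilon> < 1" using E by (auto simp: \<epsilon>_def)
  obtain W0 where W0: "lin_closed W0" "\<forall>s. \<exists>y\<in>W0. \<exists>e. (\<forall>i. y i \<noteq> 0 \<longrightarrow> s \<le> i \<and> i < e) \<and> y \<noteq> (\<lambda>i. 0)" "\<forall>y\<in>W0. nm (P.qop c y) \<le> \<epsilon> * nm y"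
    using small_block_subspace[OF P bad \<epsilon>(1)] by blast
  obtain W1 where W1: "lin_closed W1" "\<forall>s. \<exists>y\<in>W1. \<exists>e. (\<forall>i. y i \<noteq> 0 \<longrightarrow> s \<le> i \<and> i < e) \<and> y \<noteq> (\<lambda>i. 0)" "\<forall>y\<in>W1. nm (P.qop c' y) \<le> \<epsilon> * nm y"
    using small_block_subspace[OF P bad' \<epsilon>(1)] by blast
  obtain y z where yz: "y \<in> W0" "y \<in> X0" "z \<in> W1" "z \<in> X0" "nm (y - z) \<le> \<epsilon> * nm (y + z)" "nm (y + z) > 0"
    using hereditarily_indecomposable[OF W0(1) W1(1) W0(2)[THEN spec] W1(2)[THEN spec] \<epsilon>(1)] unfolding plus_fun_def fun_diff_def by blast
  define s where "s = nm (y + z)"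
  have s: "s > 0" "nm (y - z) \<le> \<epsilon> * s" using yz by (auto simp: s_def)
  have yzX: "y + z \<in> X0" "y - z \<in> X0" using X.add_in[of y z] X.diff_in[of y z] yz by auto
  have es: "\<epsilon> * s \<le> s" using \<epsilon> s by simp
  have two: "X.rscale 2 y = (y + z) + (y - z)" "X.rscale 2 z = (y + z) - (y - z)" "y + z = X.rscale 2 z + (y - z)"
    by (auto simp: X.rscale_def)
  have n2: "nm (X.rscale 2 y) = 2 * nm y" "nm (X.rscale 2 z) = 2 * nm z" "X.rscale 2 z \<in> X0"
    using X.N_rs[of y 2] X.N_rs[of z 2] X.rscale_in[of z 2] yz by auto
  have "nm (X.rscale 2 y) \<le> nm (y + z) + nm (y - z)" unfolding two(1) using X.N_tri[of "y + z" "y - z"] yzX by (simp only: TS_simps)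
  then have y2: "2 * nm y \<le> 2 * s" using n2 s es by (simp only: s_def)
  have "nm (X.rscale 2 z) \<le> nm (y + z) + nm (y - z)" unfolding two(2) using X.N_tri_minus[of "y + z" "y - z"] yzX by (simp only: TS_simps)
  then have z2: "2 * nm z \<le> 2 * s" using n2 s es by (simp only: s_def)
  have "nm (y + z) \<le> nm (X.rscale 2 z) + nm (y - z)" unfolding two(3) using X.N_tri[of "X.rscale 2 z" "y - z"] n2(3) yzX by (simp only: TS_simps)
  then have zl: "s \<le> 2 * nm z + \<epsilon> * s" using n2 s by (simp only: s_def)
  have in0: "P.qop c x \<in> X0" "P.qop c' x \<in> X0" "S x \<in> X0" if "x \<in> X0" for x using P.qop_in[of x] P.T_in[of x] that by auto
  have "P.qop c z = P.qop c y - P.qop c (y - z)" using P.qop_diff[of y z c] yz by simp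
  then have "nm (P.qop c z) \<le> nm (P.qop c y) + nm (P.qop c (y - z))" using X.N_tri_minus[of "P.qop c y" "P.qop c (y - z)"] in0 yz yzX by simp
  also have "\<dots> \<le> \<epsilon> * s + D * (\<epsilon> * s)"
    using W0(3)[THEN bspec, OF yz(1)] D[OF yzX(2)] mult_left_mono[of "nm y" s \<epsilon>] mult_left_mono[OF s(2), of D] y2 \<epsilon> D0 by linarith
  finally have Vz: "nm (P.qop c z) \<le> (1 + D) * (\<epsilon> * s)" by (simp add: algebra_simps)
  have V'z: "nm (P.qop c' z) \<le> \<epsilon> * s" using W1(3)[THEN bspec, OF yz(3)] mult_left_mono[of "nm z" s \<epsilon>] z2 \<epsilon> by linarith
  have "X.rscale (2 * (c - c')) (S z) = P.qop c' z - P.qop c z"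
    by (simp add: P.qop_def X.rscale_diff2[symmetric] algebra_simps)
  then have "g * nm (S z) \<le> nm (P.qop c' z) + nm (P.qop c z)"
    using X.N_tri_minus[of "P.qop c' z" "P.qop c z"] X.N_rs[of "S z" "2 * (c - c')"] in0 yz by (simp add: g_def)
  also have "\<dots> \<le> (2 + D) * (\<epsilon> * s)" using Vz V'z by (simp add: algebra_simps)
  finally have Sz: "nm (S z) \<le> (2 + D) / g * (\<epsilon> * s)" using g by (simp add: field_simps)
  \<comment> \<open>Smallness of S z passes to S (S z), and together with smallness of q(c) z it
    makes z itself small, against the norm of z being about s/2.\<close>
  have "z = (P.qop c z - S (S z)) + X.rscale (2 * c) (S z)" by (simp add: P.qop_def)
  then have "nm z \<le> nm (P.qop c z - S (S z)) + nm (X.rscale (2 * c) (S z))"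
    using X.N_tri[of "P.qop c z - S (S z)" "X.rscale (2 * c) (S z)"] X.diff_in[of "P.qop c z" "S (S z)"] X.rscale_in[of "S z" "2 * c"] in0 yz by simp
  also have "nm (P.qop c z - S (S z)) \<le> nm (P.qop c z) + nm (S (S z))" using X.N_tri_minus[of "P.qop c z" "S (S z)"] in0 yz by simp
  also have "nm (S (S z)) \<le> K * nm (S z)" using P.T_norm[of "S z"] in0 yz by simp
  also have "nm (X.rscale (2 * c) (S z)) = 2 * \<bar>c\<bar> * nm (S z)" using X.N_rs[of "S z" "2 * c"] in0 yz by (simp add: abs_mult)
  finally have "nm z \<le> nm (P.qop c z) + (K + 2 * \<bar>c\<bar>) * nm (S z)" by (simp add: algebra_simps)
  also have "\<dots> \<le> (1 + D) * (\<epsilon> * s) + (K + 2 * \<bar>c\<bar>) * ((2 + D) / g * (\<epsilon> * s))"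
    using Vz Sz P.K1 by (intro add_mono mult_left_mono) auto
  also have "\<dots> = E * (\<epsilon> * s)" unfolding E_def distrib_right by (simp only: mult.assoc distrib_right)
  finally have "s \<le> (2 * E + 1) * \<epsilon> * s" using zl by (simp add: algebra_simps)
  then have "1 \<le> (2 * E + 1) * \<epsilon>" using s by simp
  then show False using E by (simp add: \<epsilon>_def field_simps)
qed

lemma regular_TS:
  assumes P: "power_bounded_op \<omega> TS S K"
  shows "\<exists>c0. \<bar>c0\<bar> < 1 \<and> (\<forall>c. \<bar>c\<bar> < 1 \<longrightarrow> c \<noteq> c0 \<longrightarrow> X.regular_at S c)"
proof (cases "\<exists>c0. \<bar>c0\<bar> < 1 \<and> \<not> bounded_below_far (power_bounded_op.qop TS S c0)")
  case True
  then show ?thesis using bounded_below_far_unless_one[OF P] regular_at_TS[OF P] by metis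
next
  case False
  \<comment> \<open>Without a bad parameter any exception will do.\<close>
  then show ?thesis using regular_at_TS[OF P] by (intro exI[of _ 0]) auto
qed

theorem TS_properties:
  "banach_space TS \<and> \<not> finite_dimensional TS \<and> separable_space (ntop TS) \<and> reflexive TS
    \<and> (\<forall>T. power_bounded TS T \<longrightarrow> almost_periodic TS T)
    \<and> (\<forall>T. power_bounded TS T \<and> weakly_mixing TS T \<longrightarrow> stable_operator TS T)
    \<and> (\<forall>T. power_bounded (dual TS) T \<longrightarrow> almost_periodic (dual TS) T)
    \<and> (\<forall>T. power_bounded (dual TS) T \<and> weakly_mixing (dual TS) T \<longrightarrow> stable_operator (dual TS) T)"
proof -
  interpret D: normed_ctx \<omega> "dual TS" by (rule X.dual_ctx)
  have R: "reflexive (dual TS)" by (rule X.reflexive_dual[OF reflexive_TS])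
  have "\<exists>c0. \<bar>c0\<bar> < 1 \<and> (\<forall>c. \<bar>c\<bar> < 1 \<longrightarrow> c \<noteq> c0 \<longrightarrow> D.regular_at T c)" if T: "power_bounded_op \<omega> (dual TS) T K" for T K
  proof -
    obtain S where S: "power_bounded_op \<omega> TS S (2 * K)" "\<And>f x. f \<in> D.C \<Longrightarrow> x \<in> X.C \<Longrightarrow> T f x = f (S x)"
      using X.preadjoint[OF reflexive_TS T] by blast
    show ?thesis using regular_TS[OF S(1)] X.regular_at_adjoint[OF S(1) T S(2)] by blast
  qed
  note D = D.regular_power_bounded[OF R X.banach_dual _ this]
  note X = X.regular_power_bounded[OF reflexive_TS banach_TS _ regular_TS]
  show ?thesis
    by (intro conjI allI impI; (elim conjE)?)
      (rule banach_TS infinite_dimensional_TS separable_TS reflexive_TS | (rule X D; assumption))+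
qed

end

section \<open>The real and the complex space\<close>

interpretation R: tree_space "-1 :: real"
proof unfold_locales
  show "\<exists>e. norm ((- 1) ^ e * z - of_real (norm z)) \<le> 4 / 5 * norm z" for z :: real
    by (cases "z \<ge> 0") (auto intro: exI[of _ 0] exI[of _ 1])
  show "\<exists>a b. z = of_real a + of_real b * -1" for z :: real by (auto intro: exI[of _ z] exI[of _ 0])
qed auto

text \<open>Within 45 degrees of the positive axis Re w is at least |w| / sqrt 2, which is above
  17/25 |w|. The number 17/25 is chosen so that 2 (1 - 17/25) is the square of 4/5.\<close>

lemma sector_estimate:
  assumes "Re w \<ge> \<bar>Im w\<bar>" shows "norm (w - of_real (norm w)) \<le> 4 / 5 * norm w"
proof (rule power2_le_imp_le)
  let ?n = "norm w"
  have n2: "?n\<^sup>2 = (Re w)\<^sup>2 + (Im w)\<^sup>2" by (rule cmod_power2)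
  have "(Im w)\<^sup>2 \<le> (Re w)\<^sup>2" using assms by (simp add: abs_le_square_iff[symmetric])
  then have "?n\<^sup>2 \<le> 2 * (Re w)\<^sup>2" using n2 by simp
  moreover have "(17 / 25 * ?n)\<^sup>2 = 289 / 625 * ?n\<^sup>2" by (simp add: power2_eq_square)
  moreover have "0 \<le> (Re w)\<^sup>2" by simp
  ultimately have "(17 / 25 * ?n)\<^sup>2 \<le> (Re w)\<^sup>2" by linarith
  then have re: "17 / 25 * ?n \<le> Re w" using power2_le_imp_le[of "17 / 25 * ?n" "Re w"] assms by linarith
  have "(norm (w - of_real ?n))\<^sup>2 = (Re w - ?n)\<^sup>2 + (Im w)\<^sup>2" unfolding cmod_power2 by simp
  also have "\<dots> = 2 * ?n\<^sup>2 - 2 * ?n * Re w" using n2 by (simp add: power2_eq_square algebra_simps)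
  also have "\<dots> \<le> 2 * ?n\<^sup>2 - 2 * ?n * (17 / 25 * ?n)" using re by (intro diff_left_mono mult_left_mono) auto
  also have "\<dots> = (4 / 5 * ?n)\<^sup>2" by (simp add: power2_eq_square)
  finally show "(norm (w - of_real ?n))\<^sup>2 \<le> (4 / 5 * ?n)\<^sup>2" .
qed simp

interpretation C: tree_space "\<i>"
proof unfold_locales
  show "\<exists>e. norm (\<i> ^ e * z - of_real (norm z)) \<le> 4 / 5 * norm z" for z :: complex
  proof -
    \<comment> \<open>Quarter turns bring every number into the sector around the positive
      axis.\<close>
    have "\<exists>e. Re (\<i> ^ e * z) \<ge> \<bar>Im (\<i> ^ e * z)\<bar>"
    proof -
      have "Re z \<ge> \<bar>Im z\<bar> \<or> - Im z \<ge> \<bar>Re z\<bar> \<or> - Re z \<ge> \<bar>Im z\<bar> \<or> Im z \<ge> \<bar>Re z\<bar>" by linarith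
      then show ?thesis
      proof (elim disjE)
        show ?thesis if "Re z \<ge> \<bar>Im z\<bar>" using that by (intro exI[of _ 0]) simp
        show ?thesis if "- Im z \<ge> \<bar>Re z\<bar>" using that by (intro exI[of _ 1]) simp
        show ?thesis if "- Re z \<ge> \<bar>Im z\<bar>" using that by (intro exI[of _ 2]) simp
        show ?thesis if "Im z \<ge> \<bar>Re z\<bar>" using that by (intro exI[of _ 3]) (simp add: power3_eq_cube)
      qed
    qed
    then obtain e where "Re (\<i> ^ e * z) \<ge> \<bar>Im (\<i> ^ e * z)\<bar>" by blast
    then have "norm (\<i> ^ e * z - of_real (norm (\<i> ^ e * z))) \<le> 4 / 5 * norm (\<i> ^ e * z)" by (rule sector_estimate)
    then show ?thesis by (intro exI[of _ e]) (simp add: norm_mult norm_power)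
  qed
  show "\<exists>a b. z = of_real a + of_real b * \<i>" for z
    by (intro exI[of _ "Re z"] exI[of _ "Im z"]) (simp add: complex_eq_iff)
  show "\<i> = - 1 \<or> \<i> * \<i> = - 1 \<and> 1 \<bullet> \<i> = 0" by (simp add: inner_complex_def)
qed simp

theorem theorem2p9:
  shows "(\<exists>X :: (real, nat \<Rightarrow> real) nspace.
            banach_space X \<and> \<not> finite_dimensional X \<and> separable_space (ntop X) \<and> reflexive X
            \<and> (\<forall>T. power_bounded X T \<longrightarrow> almost_periodic X T)
            \<and> (\<forall>T. power_bounded X T \<and> weakly_mixing X T \<longrightarrow> stable_operator X T)
            \<and> (\<forall>T. power_bounded (dual X) T \<longrightarrow> almost_periodic (dual X) T)
            \<and> (\<forall>T. power_bounded (dual X) T \<and> weakly_mixing (dual X) T \<longrightarrow> stable_operator (dual X) T))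
       \<and> (\<exists>X :: (complex, nat \<Rightarrow> complex) nspace.
            banach_space X \<and> \<not> finite_dimensional X \<and> separable_space (ntop X) \<and> reflexive X
            \<and> (\<forall>T. power_bounded X T \<longrightarrow> almost_periodic X T)
            \<and> (\<forall>T. power_bounded X T \<and> weakly_mixing X T \<longrightarrow> stable_operator X T)
            \<and> (\<forall>T. power_bounded (dual X) T \<longrightarrow> almost_periodic (dual X) T)
            \<and> (\<forall>T. power_bounded (dual X) T \<and> weakly_mixing (dual X) T \<longrightarrow> stable_operator (dual X) T))"
  by (rule conjI; rule exI, rule R.TS_properties C.TS_properties)

end
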